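(* Let $k$ be an algebraically closed field of characteristic zero and let $\mathrm{Cr}_1=\mathrm{Bir}(\mathbf P^1)=\mathrm{Aut}(\mathbf P^1)=\mathrm{PSL}_2(k)$ be the Cremona group of rank $1$ over $k$. (i) Every finite subgroup of $\mathrm{Cr}_1$ is nontrivially self-compressible. (ii) Every compression of a finite subgroup of $\mathrm{Cr}_1$ is a compression $\mathbf P^1\to\mathbf P^1$ into a conjugate subgroup.
   Context: Varieties are algebraic varieties over $k$, and $\mathrm{Bir}(X)$ is the group of birational self-maps of an irreducible variety $X$. A rational action of a finite group $H$ on $X$ is an injective homomorphism $\varrho\colon H\hookrightarrow\mathrm{Bir}(X)$. A compression of a rational action $\varrho_1\colon H\hookrightarrow\mathrm{Bir}(X_1)$ into a rational action $\varrho_2\colon H\hookrightarrow\mathrm{Bir}(X_2)$ is an $H$-equivariant dominant rational map $\varphi\colon X_1\dashrightarrow X_2$; it is nontrivial if it is not a birational isomorphism. A finite subgroup $G_1\subseteq\mathrm{Bir}(X_1)$ is compressible into a finite subgroup $G_2\subseteq\mathrm{Bir}(X_2)$ isomorphic to it if there are rational actions $\varrho_1,\varrho_2$ of the same finite group on $X_1,X_2$ with images $G_1,G_2$ and a compression $\varphi$ of $\varrho_1$ into $\varrho_2$ (a compression of $G_1$ into $G_2$). When $X_1=X_2$ and $\varrho_1=\varrho_2$, one speaks of self-compressions; a finite subgroup $G\subset\mathrm{Bir}(X)$ is nontrivially self-compressible if it has a nontrivial self-compression, i.e., there is a dominant rational map $\varphi\colon X\dashrightarrow X$ that is not a birational isomorphism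 and satisfies $\varphi\circ g=g\circ\varphi$ for all $g\in G$.
   Formalization: In (ii) the target variety of the compression is assumed not to be a single point; otherwise the constant map from P^1 to a point, a compression of the trivial group, contradicts the claim as printed. *)

theory Defs
  imports
    "HOL-Analysis.Abstract_Topology"
    "HOL-Computational_Algebra.Polynomial"
    "HOL-Algebra.Coset"
begin

section \<open>Spaces with functions\<close>

text \<open>
  Varieties are treated in the classical (Serre, Kempf, Milne) way: a topological space together
  with a sheaf of functions with values in the field. \<open>regular X U\<close> is meaningful only for open
  \<open>U\<close>; its elements are total functions whose values outside \<open>U\<close> are irrelevant.
\<close>

record ('a, 'k) fspace =
  top_of :: "'a topology"
  regular :: "'a set \<Rightarrow> ('a \<Rightarrow> 'k) set"

abbreviation points :: "('a, 'k, 'm) fspace_scheme \<Rightarrow> 'a set"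
  where "points X \<equiv> topspace (top_of X)"

definition sheaf_of_functions :: "('a, 'k) fspace \<Rightarrow> bool" where
  "sheaf_of_functions X \<longleftrightarrow>
     (\<forall>U f g. openin (top_of X) U \<longrightarrow> f \<in> regular X U \<longrightarrow> (\<forall>x\<in>U. f x = g x) \<longrightarrow> g \<in> regular X U) \<and>
     (\<forall>U V f. openin (top_of X) U \<longrightarrow> openin (top_of X) V \<longrightarrow> V \<subseteq> U \<longrightarrow>
        f \<in> regular X U \<longrightarrow> f \<in> regular X V) \<and>
     (\<forall>U f. openin (top_of X) U \<longrightarrow>
        (\<forall>x\<in>U. \<exists>V. openin (top_of X) V \<and> x \<in> V \<and> V \<subseteq> U \<and> f \<in> regular X V) \<longrightarrow> f \<in> regular X U)"

definition open_subspace :: "('a, 'k) fspace \<Rightarrow> 'a set \<Rightarrow> ('a, 'k) fspace" where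
  "open_subspace X U = \<lparr>top_of = subtopology (top_of X) U, regular = regular X\<rparr>"

definition morphism :: "('a, 'k) fspace \<Rightarrow> ('b, 'k) fspace \<Rightarrow> ('a \<Rightarrow> 'b) \<Rightarrow> bool" where
  "morphism X Y f \<longleftrightarrow>
     continuous_map (top_of X) (top_of Y) f \<and>
     (\<forall>V h. openin (top_of Y) V \<longrightarrow> h \<in> regular Y V \<longrightarrow> h \<circ> f \<in> regular X {x \<in> points X. f x \<in> V})"

definition isomorphic :: "('a, 'k) fspace \<Rightarrow> ('b, 'k) fspace \<Rightarrow> bool" where
  "isomorphic X Y \<longleftrightarrow>
     (\<exists>f g. morphism X Y f \<and> morphism Y X g \<and>
        (\<forall>x\<in>points X. g (f x) = x) \<and> (\<forall>y\<in>points Y. f (g y) = y))"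


section \<open>Affine varieties\<close>

text \<open>Affine \<open>n\<close>-space is the set of sequences vanishing from index \<open>n\<close> on.\<close>

definition affine_points :: "nat \<Rightarrow> (nat \<Rightarrow> 'k::field) set" where
  "affine_points n = {x. \<forall>i\<ge>n. x i = 0}"

inductive_set poly_functions :: "nat \<Rightarrow> ((nat \<Rightarrow> 'k::field) \<Rightarrow> 'k) set" for n where
  const: "(\<lambda>x. c) \<in> poly_functions n"
| coord: "i < n \<Longrightarrow> (\<lambda>x. x i) \<in> poly_functions n"
| add: "p \<in> poly_functions n \<Longrightarrow> q \<in> poly_functions n \<Longrightarrow> (\<lambda>x. p x + q x) \<in> poly_functions n"
| mult: "p \<in> poly_functions n \<Longrightarrow> q \<in> poly_functions n \<Longrightarrow> (\<lambda>x. p x * q x) \<in> poly_functions n"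

definition algebraic_set :: "nat \<Rightarrow> (nat \<Rightarrow> 'k::field) set \<Rightarrow> bool" where
  "algebraic_set n Z \<longleftrightarrow> (\<exists>S \<subseteq> poly_functions n. Z = {x \<in> affine_points n. \<forall>p\<in>S. p x = 0})"

text \<open>
  The principal open sets form a basis of the Zariski topology: its closed sets are exactly the
  algebraic sets.
\<close>

definition zariski_topology :: "nat \<Rightarrow> (nat \<Rightarrow> 'k::field) topology" where
  "zariski_topology n =
     topology_generated_by {{x \<in> affine_points n. p x \<noteq> 0} | p. p \<in> poly_functions n}"

definition affine_variety :: "nat \<Rightarrow> (nat \<Rightarrow> 'k::field) set \<Rightarrow> (nat \<Rightarrow> 'k, 'k) fspace" where
  "affine_variety n Z =
     \<lparr>top_of = subtopology (zariski_topology n) Z,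
      regular = (\<lambda>U. {f. \<forall>x\<in>U. \<exists>V. openin (subtopology (zariski_topology n) Z) V \<and> x \<in> V \<and> V \<subseteq> U \<and>
        (\<exists>p \<in> poly_functions n. \<exists>q \<in> poly_functions n. \<forall>y\<in>V. q y \<noteq> 0 \<and> f y = p y / q y)})\<rparr>"


section \<open>Varieties\<close>

definition prevariety :: "('a, 'k::field) fspace \<Rightarrow> bool" where
  "prevariety X \<longleftrightarrow> sheaf_of_functions X \<and>
     (\<exists>\<U>. finite \<U> \<and> \<Union>\<U> = points X \<and>
        (\<forall>U\<in>\<U>. openin (top_of X) U \<and>
           (\<exists>n Z. algebraic_set n Z \<and> isomorphic (open_subspace X U) (affine_variety n Z))))"

text \<open>
  Separatedness: the locus where two morphisms coincide is closed. As closedness is local, it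
  suffices to test this on affine varieties.
\<close>

definition separated :: "('a, 'k::field) fspace \<Rightarrow> bool" where
  "separated X \<longleftrightarrow>
     (\<forall>n Z f g. algebraic_set n Z \<longrightarrow> morphism (affine_variety n Z) X f \<longrightarrow>
        morphism (affine_variety n Z) X g \<longrightarrow>
        closedin (top_of (affine_variety n Z)) {z \<in> Z. f z = g z})"

definition irreducible_space :: "'a topology \<Rightarrow> bool" where
  "irreducible_space T \<longleftrightarrow> topspace T \<noteq> {} \<and>
     (\<forall>A B. closedin T A \<longrightarrow> closedin T B \<longrightarrow> A \<union> B = topspace T \<longrightarrow>
        A = topspace T \<or> B = topspace T)"

definition irreducible_variety :: "('a, 'k::field) fspace \<Rightarrow> bool" where
  "irreducible_variety X \<longleftrightarrow> prevariety X \<and> separated X \<and> irreducible_space (top_of X)"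


section \<open>Projective space\<close>

type_synonym 'k proj_point = "(nat \<Rightarrow> 'k) set"

definition homogeneous_coords :: "nat \<Rightarrow> (nat \<Rightarrow> 'k::field) set" where
  "homogeneous_coords n = affine_points (Suc n) - {\<lambda>i. 0}"

definition proj_class :: "(nat \<Rightarrow> 'k::field) \<Rightarrow> 'k proj_point" where
  "proj_class x = {(\<lambda>i. c * x i) | c. c \<noteq> 0}"

text \<open>
  Over an infinite field this scaling property characterises the functions of homogeneous
  polynomials of degree \<open>d\<close> (including the zero polynomial).
\<close>

definition homogeneous :: "nat \<Rightarrow> nat \<Rightarrow> ((nat \<Rightarrow> 'k::field) \<Rightarrow> 'k) set" where
  "homogeneous m d = {p \<in> poly_functions m. \<forall>c x. p (\<lambda>i. c * x i) = c ^ d * p x}"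

definition projective_topology :: "nat \<Rightarrow> 'k::field proj_point topology" where
  "projective_topology n =
     topology_generated_by
       {proj_class ` {x \<in> homogeneous_coords n. p x \<noteq> 0} | p d. p \<in> homogeneous (Suc n) d}"

definition projective_space :: "nat \<Rightarrow> ('k::field proj_point, 'k) fspace" where
  "projective_space n =
     \<lparr>top_of = projective_topology n,
      regular = (\<lambda>U. {f. \<forall>P\<in>U. \<exists>V. openin (projective_topology n) V \<and> P \<in> V \<and> V \<subseteq> U \<and>
        (\<exists>d. \<exists>p \<in> homogeneous (Suc n) d. \<exists>q \<in> homogeneous (Suc n) d.
           \<forall>x \<in> homogeneous_coords n. proj_class x \<in> V \<longrightarrow>
             q x \<noteq> 0 \<and> f (proj_class x) = p x / q x)})\<rparr>"


section \<open>Rational maps\<close>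

text \<open>
  A rational map between irreducible varieties is a class of pairs \<open>(U, f)\<close>, where \<open>f\<close> is a morphism
  on the nonempty (hence dense) open set \<open>U\<close>. The values of \<open>f\<close> outside \<open>U\<close> are irrelevant.
\<close>

type_synonym ('a, 'b) rational_map = "('a set \<times> ('a \<Rightarrow> 'b)) set"

definition partial_morphisms ::
  "('a, 'k) fspace \<Rightarrow> ('b, 'k) fspace \<Rightarrow> ('a set \<times> ('a \<Rightarrow> 'b)) set" where
  "partial_morphisms X Y =
     {(U, f). openin (top_of X) U \<and> U \<noteq> {} \<and> morphism (open_subspace X U) Y f}"

definition rational_rel ::
  "('a, 'k) fspace \<Rightarrow> ('b, 'k) fspace \<Rightarrow> (('a set \<times> ('a \<Rightarrow> 'b)) \<times> ('a set \<times> ('a \<Rightarrow> 'b))) set" where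
  "rational_rel X Y =
     {((U, f), (V, g)). (U, f) \<in> partial_morphisms X Y \<and> (V, g) \<in> partial_morphisms X Y \<and>
        (\<forall>x \<in> U \<inter> V. f x = g x)}"

definition rational_maps :: "('a, 'k) fspace \<Rightarrow> ('b, 'k) fspace \<Rightarrow> ('a, 'b) rational_map set" where
  "rational_maps X Y = partial_morphisms X Y // rational_rel X Y"

definition dominant :: "('b, 'k) fspace \<Rightarrow> ('a, 'b) rational_map \<Rightarrow> bool" where
  "dominant Y \<phi> \<longleftrightarrow> (\<exists>(U, f) \<in> \<phi>. top_of Y closure_of (f ` U) = points Y)"

definition rational_id :: "('a, 'k) fspace \<Rightarrow> ('a, 'a) rational_map" where
  "rational_id X = rational_rel X X `` {(points X, \<lambda>x. x)}"

text \<open>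
  \<open>rational_comp X Z \<psi> \<phi>\<close> is the composite \<open>\<psi> \<circ> \<phi>\<close> from \<open>X\<close> to \<open>Z\<close>, for dominant \<open>\<phi>\<close>. The classes in
  the union all coincide.
\<close>

definition rational_comp ::
  "('a, 'k) fspace \<Rightarrow> ('c, 'k) fspace \<Rightarrow> ('b, 'c) rational_map \<Rightarrow> ('a, 'b) rational_map \<Rightarrow>
     ('a, 'c) rational_map" where
  "rational_comp X Z \<psi> \<phi> =
     (\<Union>(U, f) \<in> \<phi>. \<Union>(V, g) \<in> \<psi>. rational_rel X Z `` {({x \<in> U. f x \<in> V}, g \<circ> f)})"

definition everywhere_defined :: "('a, 'k) fspace \<Rightarrow> ('a, 'b) rational_map \<Rightarrow> bool" where
  "everywhere_defined X \<phi> \<longleftrightarrow> (\<exists>f. (points X, f) \<in> \<phi>)"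

definition mutually_inverse ::
  "('a, 'k) fspace \<Rightarrow> ('b, 'k) fspace \<Rightarrow> ('a, 'b) rational_map \<Rightarrow> ('b, 'a) rational_map \<Rightarrow> bool" where
  "mutually_inverse X Y \<phi> \<psi> \<longleftrightarrow>
     \<phi> \<in> rational_maps X Y \<and> dominant Y \<phi> \<and> \<psi> \<in> rational_maps Y X \<and> dominant X \<psi> \<and>
     rational_comp X X \<psi> \<phi> = rational_id X \<and> rational_comp Y Y \<phi> \<psi> = rational_id Y"

definition birational :: "('a, 'k) fspace \<Rightarrow> ('b, 'k) fspace \<Rightarrow> ('a, 'b) rational_map \<Rightarrow> bool" where
  "birational X Y \<phi> \<longleftrightarrow> (\<exists>\<psi>. mutually_inverse X Y \<phi> \<psi>)"

definition Bir :: "('a, 'k) fspace \<Rightarrow> ('a, 'a) rational_map monoid" where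
  "Bir X = \<lparr>carrier = {\<phi>. birational X X \<phi>}, mult = rational_comp X X, one = rational_id X\<rparr>"

definition Cremona :: "nat \<Rightarrow> ('k::field proj_point, 'k proj_point) rational_map monoid" where
  "Cremona n = Bir (projective_space n :: ('k proj_point, 'k) fspace)"


section \<open>Rational actions and compressions\<close>

definition rational_action ::
  "('h, 'm) monoid_scheme \<Rightarrow> ('a, 'k) fspace \<Rightarrow> ('h \<Rightarrow> ('a, 'a) rational_map) \<Rightarrow> bool" where
  "rational_action H X \<rho> \<longleftrightarrow> group H \<and> finite (carrier H) \<and> \<rho> \<in> mon H (Bir X)"

definition compression ::
  "('h, 'm) monoid_scheme \<Rightarrow> ('a, 'k) fspace \<Rightarrow> ('h \<Rightarrow> ('a, 'a) rational_map) \<Rightarrow>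
     ('b, 'k) fspace \<Rightarrow> ('h \<Rightarrow> ('b, 'b) rational_map) \<Rightarrow> ('a, 'b) rational_map \<Rightarrow> bool" where
  "compression H X\<^sub>1 \<rho>\<^sub>1 X\<^sub>2 \<rho>\<^sub>2 \<phi> \<longleftrightarrow>
     rational_action H X\<^sub>1 \<rho>\<^sub>1 \<and> rational_action H X\<^sub>2 \<rho>\<^sub>2 \<and>
     \<phi> \<in> rational_maps X\<^sub>1 X\<^sub>2 \<and> dominant X\<^sub>2 \<phi> \<and>
     (\<forall>h \<in> carrier H. rational_comp X\<^sub>1 X\<^sub>2 \<phi> (\<rho>\<^sub>1 h) = rational_comp X\<^sub>1 X\<^sub>2 (\<rho>\<^sub>2 h) \<phi>)"

definition nontrivially_self_compressible ::
  "('a, 'k) fspace \<Rightarrow> ('a, 'a) rational_map set \<Rightarrow> bool" where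
  "nontrivially_self_compressible X G \<longleftrightarrow>
     (\<exists>\<phi>. compression (Bir X\<lparr>carrier := G\<rparr>) X (\<lambda>g. g) X (\<lambda>g. g) \<phi> \<and> \<not> birational X X \<phi>)"

definition conjugate_subgroups :: "('g, 'm) monoid_scheme \<Rightarrow> 'g set \<Rightarrow> 'g set \<Rightarrow> bool" where
  "conjugate_subgroups G A B \<longleftrightarrow>
     (\<exists>g \<in> carrier G. B = (\<lambda>a. g \<otimes>\<^bsub>G\<^esub> a \<otimes>\<^bsub>G\<^esub> inv\<^bsub>G\<^esub> g) ` A)"

end

theory Submission
  imports Defs "HOL-Number_Theory.Totient" "HOL-Algebra.Sylow" "HOL-Algebra.Multiplicative_Group"
    "HOL-Computational_Algebra.Fraction_Field"
begin

hide_const (open) Module.smult UnivPoly.coeff UnivPoly.monom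

text \<open>
  A finite group of Moebius transformations has a finite invariant set of at least 3 points.
  Mapping a point to its polar with respect to this set (the barycentre of the set, in an affine
  coordinate that puts the point at infinity) is an equivariant self-map of the line of degree
  greater than 1, hence a nontrivial self-compression.

  A variety dominated by the line and not a point is rational by Lueroth's theorem, so every
  compression becomes an equivariant rational self-map of the line, defined everywhere because
  fractions can be put in lowest terms. Its target is isomorphic to the source, and isomorphic
  finite subgroups are conjugate: counting points with nontrivial stabilizers leaves Klein's list,
  in which the order of the group and the largest order of an element determine generators up to
  conjugation.
\<close>

section \<open>Spaces with functions\<close>

text \<open>The polar construction needs no list of groups: the union of the translates of three
  points serves as invariant set, and the polar of n points has degree exactly n - 1 because its two
  coordinate forms have no common zero (characteristic zero enters through the factor n in
  \<open>polar_bracket\<close>). Conjugacy uses nothing of the compression except that both images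
  are copies of one abstract group. The link between geometry and group theory is the largest order
  r of a point stabilizer: in suitable coordinates a stabilizer is a group of roots of unity, so r
  is also the largest order of an element. Tetrahedral, octahedral and icosahedral groups are pinned
  down by a rotation of order r and an involution whose product has order 3. The obstacle is r = 5:
  for a prescribed fifth root of unity z the involution found may fit z^2 instead, and an explicit
  word in the group has to produce a suitable one. Rational maps are classes of morphisms on open
  sets, so even composing them rests on an identity theorem for separated irreducible
  varieties.\<close>

lemma sheaf_cong:
  assumes "sheaf_of_functions X" "openin (top_of X) U" "f \<in> regular X U" "\<And>x. x \<in> U \<Longrightarrow> f x = g x"
  shows "g \<in> regular X U"
  using assms(1)[unfolded sheaf_of_functions_def, THEN conjunct1, rule_format, OF assms(2,3)] assms(4) by simp

lemma sheaf_restrict: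
  assumes "sheaf_of_functions X" "openin (top_of X) U" "openin (top_of X) V" "V \<subseteq> U" "f \<in> regular X U"
  shows "f \<in> regular X V"
  using assms unfolding sheaf_of_functions_def by blast

lemma sheaf_glue:
  assumes "sheaf_of_functions X" "openin (top_of X) U"
    and "\<And>x. x \<in> U \<Longrightarrow> \<exists>V. openin (top_of X) V \<and> x \<in> V \<and> V \<subseteq> U \<and> f \<in> regular X V"
  shows "f \<in> regular X U"
  using assms(1)[unfolded sheaf_of_functions_def, THEN conjunct2, THEN conjunct2, rule_format, OF assms(2)] assms(3)
  by simp

lemma top_of_open_subspace [simp]: "top_of (open_subspace X U) = subtopology (top_of X) U"
  by (simp add: open_subspace_def)

lemma regular_open_subspace [simp]: "regular (open_subspace X U) = regular X"
  by (simp add: open_subspace_def)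

lemma points_open_subspace [simp]: "points (open_subspace X U) = points X \<inter> U"
  by (simp add: open_subspace_def)

lemma openin_open_subspace_iff:
  assumes "openin (top_of X) U"
  shows "openin (top_of (open_subspace X U)) V \<longleftrightarrow> openin (top_of X) V \<and> V \<subseteq> U"
  using assms by (simp add: openin_open_subtopology)

lemma open_subspace_subspace:
  "open_subspace (open_subspace X U) V = open_subspace X (U \<inter> V)"
  by (simp add: open_subspace_def subtopology_subtopology)

lemma sheaf_open_subspace:
  assumes "sheaf_of_functions X" "openin (top_of X) U"
  shows "sheaf_of_functions (open_subspace X U)"
  unfolding sheaf_of_functions_def openin_open_subspace_iff[OF assms(2)] regular_open_subspace
proof (intro conjI allI impI, goal_cases)
  case (1 W f g)
  then show ?case using sheaf_cong[OF assms(1), of W f g] by auto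
next
  case (2 W V f)
  then show ?case using sheaf_restrict[OF assms(1), of W V f] by auto
next
  case (3 W f)
  have "\<exists>V. openin (top_of X) V \<and> x \<in> V \<and> V \<subseteq> W \<and> f \<in> regular X V" if "x \<in> W" for x
    using 3(2) that by blast
  then show ?case using sheaf_glue[OF assms(1), of W f] 3(1) by simp
qed

section \<open>Morphisms: composition, restriction and gluing\<close>

lemma morphismD:
  assumes "morphism X Y f"
  shows "\<And>x. x \<in> points X \<Longrightarrow> f x \<in> points Y"
    and "\<And>V. openin (top_of Y) V \<Longrightarrow> openin (top_of X) {x \<in> points X. f x \<in> V}"
    and "\<And>V h. openin (top_of Y) V \<Longrightarrow> h \<in> regular Y V \<Longrightarrow> (\<lambda>x. h (f x)) \<in> regular X {x \<in> points X. f x \<in> V}"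
  using assms unfolding morphism_def continuous_map_def by (auto simp: o_def Pi_iff)

lemma morphismI:
  assumes "\<And>x. x \<in> points X \<Longrightarrow> f x \<in> points Y"
    and "\<And>V. openin (top_of Y) V \<Longrightarrow> openin (top_of X) {x \<in> points X. f x \<in> V}"
    and "\<And>V h. openin (top_of Y) V \<Longrightarrow> h \<in> regular Y V \<Longrightarrow> (\<lambda>x. h (f x)) \<in> regular X {x \<in> points X. f x \<in> V}"
  shows "morphism X Y f"
  using assms unfolding morphism_def continuous_map_def by (auto simp: o_def Pi_iff)

lemma morphism_comp:
  assumes f: "morphism X Y f" and g: "morphism Y Z g"
  shows "morphism X Z (g \<circ> f)"
proof (rule morphismI)
  fix V h assume V: "openin (top_of Z) V"
  have eq: "{x \<in> points X. (g \<circ> f) x \<in> V} = {x \<in> points X. f x \<in> {y \<in> points Y. g y \<in> V}}"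
    using morphismD(1)[OF f] by auto
  show "openin (top_of X) {x \<in> points X. (g \<circ> f) x \<in> V}"
    unfolding eq by (intro morphismD(2)[OF f] morphismD(2)[OF g] V)
  assume h: "h \<in> regular Z V"
  show "(\<lambda>x. h ((g \<circ> f) x)) \<in> regular X {x \<in> points X. (g \<circ> f) x \<in> V}"
    unfolding eq using morphismD(3)[OF f morphismD(2)[OF g V] morphismD(3)[OF g V h]] by simp
qed (use morphismD(1)[OF f] morphismD(1)[OF g] in auto)

lemma morphism_cong:
  assumes X: "sheaf_of_functions X" and f: "morphism X Y f" and eq: "\<And>x. x \<in> points X \<Longrightarrow> f x = g x"
  shows "morphism X Y g"
proof (rule morphismI)
  fix V h assume V: "openin (top_of Y) V"
  have eq': "{x \<in> points X. g x \<in> V} = {x \<in> points X. f x \<in> V}"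
    using eq by auto
  show op: "openin (top_of X) {x \<in> points X. g x \<in> V}"
    unfolding eq' by (rule morphismD(2)[OF f V])
  assume h: "h \<in> regular Y V"
  show "(\<lambda>x. h (g x)) \<in> regular X {x \<in> points X. g x \<in> V}"
    by (rule sheaf_cong[OF X op, of "\<lambda>x. h (f x)"]) (use eq' morphismD(3)[OF f V h] eq in auto)
qed (use morphismD(1)[OF f] eq in auto)

lemma morphism_id: "sheaf_of_functions X \<Longrightarrow> morphism X X (\<lambda>x. x)"
proof (rule morphismI)
  fix V h assume X: "sheaf_of_functions X" and V: "openin (top_of X) V"
  have eq: "{x \<in> points X. x \<in> V} = V" using openin_subset[OF V] by auto
  show "openin (top_of X) {x \<in> points X. x \<in> V}" using V eq by simp
  assume "h \<in> regular X V"
  then show "(\<lambda>x. h x) \<in> regular X {x \<in> points X. x \<in> V}" using eq by simp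
qed

lemma morphism_restrict:
  assumes X: "sheaf_of_functions X" and U: "openin (top_of X) U" and f: "morphism X Y f"
  shows "morphism (open_subspace X U) Y f"
proof (rule morphismI)
  fix V h assume V: "openin (top_of Y) V"
  have eq: "{x \<in> points (open_subspace X U). f x \<in> V} = {x \<in> points X. f x \<in> V} \<inter> U" by auto
  have op: "openin (top_of X) ({x \<in> points X. f x \<in> V} \<inter> U)"
    by (intro openin_Int morphismD(2)[OF f V] U)
  show "openin (top_of (open_subspace X U)) {x \<in> points (open_subspace X U). f x \<in> V}"
    unfolding openin_open_subspace_iff[OF U] eq using op by auto
  assume h: "h \<in> regular Y V"
  show "(\<lambda>x. h (f x)) \<in> regular (open_subspace X U) {x \<in> points (open_subspace X U). f x \<in> V}"
    unfolding eq using sheaf_restrict[OF X morphismD(2)[OF f V] op _ morphismD(3)[OF f V h]] by simp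
qed (use morphismD(1)[OF f] in auto)

lemma morphism_restrict':
  assumes X: "sheaf_of_functions X" and U: "openin (top_of X) U" and V: "openin (top_of X) V" "V \<subseteq> U"
    and f: "morphism (open_subspace X U) Y f"
  shows "morphism (open_subspace X V) Y f"
proof -
  have "morphism (open_subspace (open_subspace X U) V) Y f"
    using V by (intro morphism_restrict sheaf_open_subspace X U f) (auto simp: openin_open_subtopology[OF U])
  moreover have "U \<inter> V = V" using V by auto
  ultimately show ?thesis by (simp add: open_subspace_subspace)
qed

text \<open>Maps between projective lines have coordinate formulas only chart by chart; this lemma
  allows them to be recognized as morphisms there.\<close>

lemma morphism_local:
  assumes X: "sheaf_of_functions X"
    and loc: "\<And>x. x \<in> points X \<Longrightarrow> \<exists>U. openin (top_of X) U \<and> x \<in> U \<and> morphism (open_subspace X U) Y f"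
  shows "morphism X Y f"
proof (rule morphismI)
  fix x assume "x \<in> points X"
  then obtain U where "openin (top_of X) U" "x \<in> U" "morphism (open_subspace X U) Y f"
    using loc by blast
  then show "f x \<in> points Y" using morphismD(1)[of "open_subspace X U" Y f x] \<open>x \<in> points X\<close> by auto
next
  fix V h assume V: "openin (top_of Y) V"
  have loc': "\<exists>W. openin (top_of X) W \<and> x \<in> W \<and> W \<subseteq> {x \<in> points X. f x \<in> V} \<and>
     (\<forall>h\<in>regular Y V. (\<lambda>x. h (f x)) \<in> regular X W)" if x: "x \<in> points X" "f x \<in> V" for x
  proof -
    obtain U where U: "openin (top_of X) U" "x \<in> U" and f: "morphism (open_subspace X U) Y f"
      using loc x by blast
    show ?thesis
      using morphismD(2,3)[OF f V] x U openin_subset[OF U(1)]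
      by (intro exI[of _ "{x \<in> points (open_subspace X U). f x \<in> V}"])
         (auto simp: openin_open_subtopology[OF U(1)])
  qed
  show op: "openin (top_of X) {x \<in> points X. f x \<in> V}"
    by (subst openin_subopen) (use loc' in blast)
  assume h: "h \<in> regular Y V"
  show "(\<lambda>x. h (f x)) \<in> regular X {x \<in> points X. f x \<in> V}"
    by (rule sheaf_glue[OF X op]) (use loc' h in blast)
qed

lemma morphism_into_open_subspace:
  assumes f: "morphism X Y f" and V: "openin (top_of Y) V" and im: "\<And>x. x \<in> points X \<Longrightarrow> f x \<in> V"
  shows "morphism X (open_subspace Y V) f"
proof (rule morphismI)
  fix W h assume W: "openin (top_of (open_subspace Y V)) W"
  then have W': "openin (top_of Y) W" by (simp add: openin_open_subtopology[OF V])
  show "openin (top_of X) {x \<in> points X. f x \<in> W}" by (rule morphismD(2)[OF f W'])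
  assume "h \<in> regular (open_subspace Y V) W"
  then show "(\<lambda>x. h (f x)) \<in> regular X {x \<in> points X. f x \<in> W}" using morphismD(3)[OF f W'] by simp
qed (use morphismD(1)[OF f] im in auto)

lemma morphism_from_open_subspace_target:
  assumes Y: "sheaf_of_functions Y" and f: "morphism X (open_subspace Y V) f" and V: "openin (top_of Y) V"
  shows "morphism X Y f"
proof -
  have "morphism (open_subspace Y V) Y (\<lambda>x. x)"
    by (rule morphism_restrict[OF Y V morphism_id[OF Y]])
  from morphism_comp[OF f this] show ?thesis by (simp add: o_def)
qed

text \<open>
  The regular functions form rings in which a function is invertible exactly where it does not
  vanish; this is what makes a map with regular coordinates a morphism.
\<close>

definition function_space :: "('a, 'k::field) fspace \<Rightarrow> bool" where
  "function_space X \<longleftrightarrow> sheaf_of_functions X \<and>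
     (\<forall>U c. openin (top_of X) U \<longrightarrow> (\<lambda>x. c) \<in> regular X U) \<and>
     (\<forall>U f g. openin (top_of X) U \<longrightarrow> f \<in> regular X U \<longrightarrow> g \<in> regular X U \<longrightarrow>
        (\<lambda>x. f x + g x) \<in> regular X U \<and> (\<lambda>x. f x * g x) \<in> regular X U) \<and>
     (\<forall>U f. openin (top_of X) U \<longrightarrow> f \<in> regular X U \<longrightarrow>
        openin (top_of X) {x \<in> U. f x \<noteq> 0} \<and> (\<lambda>x. inverse (f x)) \<in> regular X {x \<in> U. f x \<noteq> 0})"

lemma function_spaceD:
  assumes "function_space X"
  shows "sheaf_of_functions X"
    and "openin (top_of X) U \<Longrightarrow> (\<lambda>x. c) \<in> regular X U"
    and "openin (top_of X) U \<Longrightarrow> f \<in> regular X U \<Longrightarrow> g \<in> regular X U \<Longrightarrow> (\<lambda>x. f x + g x) \<in> regular X U"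
    and "openin (top_of X) U \<Longrightarrow> f \<in> regular X U \<Longrightarrow> g \<in> regular X U \<Longrightarrow> (\<lambda>x. f x * g x) \<in> regular X U"
    and "openin (top_of X) U \<Longrightarrow> f \<in> regular X U \<Longrightarrow> openin (top_of X) {x \<in> U. f x \<noteq> 0}"
    and "openin (top_of X) U \<Longrightarrow> f \<in> regular X U \<Longrightarrow> (\<lambda>x. inverse (f x)) \<in> regular X {x \<in> U. f x \<noteq> 0}"
  using assms unfolding function_space_def by blast+

lemma function_space_diff:
  assumes X: "function_space X" and "openin (top_of X) U" "f \<in> regular X U" "g \<in> regular X U"
  shows "(\<lambda>x. f x - g x) \<in> regular X U"
  using function_spaceD(3)[OF X assms(2,3) function_spaceD(4)[OF X assms(2) function_spaceD(2)[OF X assms(2), of "-1"] assms(4)]]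
  by simp

lemma function_space_divide:
  assumes X: "function_space X" and U: "openin (top_of X) U" and f: "f \<in> regular X U" and g: "g \<in> regular X U"
    and nz: "\<And>x. x \<in> U \<Longrightarrow> g x \<noteq> 0"
  shows "(\<lambda>x. f x / g x) \<in> regular X U"
proof -
  have "{x \<in> U. g x \<noteq> 0} = U" using nz by auto
  then have "(\<lambda>x. inverse (g x)) \<in> regular X U" using function_spaceD(6)[OF X U g] by simp
  from function_spaceD(4)[OF X U f this] show ?thesis by (simp add: field_simps)
qed

lemma function_space_open_subspace:
  assumes X: "function_space X" and U: "openin (top_of X) U"
  shows "function_space (open_subspace X U)"
  unfolding function_space_def openin_open_subspace_iff[OF U] regular_open_subspace
  using sheaf_open_subspace[OF function_spaceD(1)[OF X] U] function_spaceD(2-6)[OF X] by auto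

text \<open>All clauses of \<open>function_space\<close> are local, so they pass from affine charts
  to arbitrary prevarieties.\<close>

lemma function_space_local:
  assumes X: "sheaf_of_functions X"
    and loc: "\<And>x. x \<in> points X \<Longrightarrow> \<exists>U. openin (top_of X) U \<and> x \<in> U \<and> function_space (open_subspace X U)"
  shows "function_space X"
proof -
  \<comment> \<open>Intersecting a neighbourhood that carries the property with U keeps the
    property, since open subspaces inherit it, and makes the neighbourhood lie in U.\<close>
  have cover: "\<exists>W. openin (top_of X) W \<and> x \<in> W \<and> W \<subseteq> U \<and>
      openin (top_of (open_subspace X W)) W \<and> function_space (open_subspace X W)"
    if U: "openin (top_of X) U" "x \<in> U" for x U
  proof -
    obtain W where W: "openin (top_of X) W" "x \<in> W" and fs: "function_space (open_subspace X W)"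
      using loc U openin_subset[OF U(1)] by blast
    have "openin (top_of (open_subspace X W)) (U \<inter> W)"
      using U W by (simp add: openin_open_subtopology[OF W(1)] openin_Int)
    from function_space_open_subspace[OF fs this]
    have "function_space (open_subspace X (U \<inter> W))"
      by (simp add: open_subspace_subspace Int_absorb1 Int_commute Int_left_absorb)
    moreover have "openin (top_of X) (U \<inter> W)" using U W by (simp add: openin_Int)
    ultimately show ?thesis using U W
      by (intro exI[of _ "U \<inter> W"]) (auto simp: openin_open_subtopology)
  qed
  have sh: "f \<in> regular X W" if "openin (top_of X) U" "openin (top_of X) W" "W \<subseteq> U" "f \<in> regular X U" for f W U
    using sheaf_restrict[OF X that] .
  show ?thesis unfolding function_space_def
  proof (intro conjI allI impI X)
    fix U c assume U: "openin (top_of X) U"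
    show "(\<lambda>x. c) \<in> regular X U"
      by (rule sheaf_glue[OF X U]) (use cover[OF U] function_spaceD(2) in fastforce)
  next
    fix U f g assume U: "openin (top_of X) U" and f: "f \<in> regular X U" and g: "g \<in> regular X U"
    show "(\<lambda>x. f x + g x) \<in> regular X U"
    proof (rule sheaf_glue[OF X U])
      fix x assume "x \<in> U"
      then obtain W where W: "openin (top_of X) W" "x \<in> W" "W \<subseteq> U" "openin (top_of (open_subspace X W)) W"
          "function_space (open_subspace X W)"
        using cover[OF U] by blast
      then show "\<exists>V. openin (top_of X) V \<and> x \<in> V \<and> V \<subseteq> U \<and> (\<lambda>x. f x + g x) \<in> regular X V"
        using function_spaceD(3)[OF W(5,4), of f g] sh[OF U W(1,3) f] sh[OF U W(1,3) g] by auto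
    qed
    show "(\<lambda>x. f x * g x) \<in> regular X U"
    proof (rule sheaf_glue[OF X U])
      fix x assume "x \<in> U"
      then obtain W where W: "openin (top_of X) W" "x \<in> W" "W \<subseteq> U" "openin (top_of (open_subspace X W)) W"
          "function_space (open_subspace X W)"
        using cover[OF U] by blast
      then show "\<exists>V. openin (top_of X) V \<and> x \<in> V \<and> V \<subseteq> U \<and> (\<lambda>x. f x * g x) \<in> regular X V"
        using function_spaceD(4)[OF W(5,4), of f g] sh[OF U W(1,3) f] sh[OF U W(1,3) g] by auto
    qed
  next
    fix U f assume U: "openin (top_of X) U" and f: "f \<in> regular X U"
    have nv: "\<exists>V. openin (top_of X) V \<and> x \<in> V \<and> V \<subseteq> {x \<in> U. f x \<noteq> 0} \<and> (\<lambda>x. inverse (f x)) \<in> regular X V"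
      if x: "x \<in> {x \<in> U. f x \<noteq> 0}" for x
    proof -
      obtain W where W: "openin (top_of X) W" "x \<in> W" "W \<subseteq> U" "openin (top_of (open_subspace X W)) W"
          "function_space (open_subspace X W)"
        using cover[OF U] x by blast
      have "openin (top_of (open_subspace X W)) {x \<in> W. f x \<noteq> 0}"
        "(\<lambda>x. inverse (f x)) \<in> regular X {x \<in> W. f x \<noteq> 0}"
        using function_spaceD(5,6)[OF W(5,4), of f] sh[OF U W(1,3) f] by auto
      then show ?thesis using W x by (intro exI[of _ "{x \<in> W. f x \<noteq> 0}"])
         (auto simp: openin_open_subtopology[OF W(1)])
    qed
    show op: "openin (top_of X) {x \<in> U. f x \<noteq> 0}"
      by (subst openin_subopen) (use nv in blast)
    show "(\<lambda>x. inverse (f x)) \<in> regular X {x \<in> U. f x \<noteq> 0}"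
      by (rule sheaf_glue[OF X op]) (use nv in blast)
  qed
qed

lemma function_space_isomorphic:
  assumes X: "sheaf_of_functions X" and Y: "function_space Y" and iso: "isomorphic X Y"
  shows "function_space X"
proof -
  obtain a b where a: "morphism X Y a" and b: "morphism Y X b" and ba: "\<And>x. x \<in> points X \<Longrightarrow> b (a x) = x"
    and ab: "\<And>y. y \<in> points Y \<Longrightarrow> a (b y) = y"
    using iso unfolding isomorphic_def by blast
  \<comment> \<open>\<open>T U\<close> is the image of U under \<open>a\<close>, written as a
    preimage under \<open>b\<close> so that continuity of \<open>b\<close> makes it open.\<close>
  define T where "T U = {y \<in> points Y. b y \<in> U}" for U
  have T: "openin (top_of Y) (T U)" if "openin (top_of X) U" for U
    unfolding T_def using morphismD(2)[OF b that] .
  have aT: "{x \<in> points X. a x \<in> T U} = U" if "openin (top_of X) U" for U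
    using openin_subset[OF that] ba morphismD(1)[OF a] by (auto simp: T_def)
  have push: "(\<lambda>y. f (b y)) \<in> regular Y (T U)" if "openin (top_of X) U" "f \<in> regular X U" for U f
    unfolding T_def using morphismD(3)[OF b that] .
  have pull: "f \<in> regular X U" if U: "openin (top_of X) U" and f: "f' \<in> regular Y (T U)" and
    eq: "\<And>x. x \<in> U \<Longrightarrow> f x = f' (a x)" for U f f'
    by (rule sheaf_cong[OF X U, of "\<lambda>x. f' (a x)"]) (use morphismD(3)[OF a T[OF U] f] aT[OF U] eq in auto)
  have baU: "b (a x) = x" if "openin (top_of X) U" "x \<in> U" for x U
    using ba openin_subset[OF that(1)] that(2) by auto
  show ?thesis unfolding function_space_def
  proof (intro conjI allI impI X)
    fix U c assume U: "openin (top_of X) U"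
    show "(\<lambda>x. c) \<in> regular X U" by (rule pull[OF U function_spaceD(2)[OF Y T[OF U]]]) auto
  next
    fix U f g assume U: "openin (top_of X) U" and f: "f \<in> regular X U" and g: "g \<in> regular X U"
    show "(\<lambda>x. f x + g x) \<in> regular X U"
      by (rule pull[OF U function_spaceD(3)[OF Y T[OF U] push[OF U f] push[OF U g]]]) (use baU[OF U] in auto)
    show "(\<lambda>x. f x * g x) \<in> regular X U"
      by (rule pull[OF U function_spaceD(4)[OF Y T[OF U] push[OF U f] push[OF U g]]]) (use baU[OF U] in auto)
  next
    fix U f assume U: "openin (top_of X) U" and f: "f \<in> regular X U"
    let ?W = "{y \<in> T U. f (b y) \<noteq> 0}"
    have eq: "{x \<in> points X. a x \<in> ?W} = {x \<in> U. f x \<noteq> 0}"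
    proof (rule Set.set_eqI)
      fix x
      have "x \<in> points X \<and> a x \<in> T U \<longleftrightarrow> x \<in> U" using aT[OF U] by blast
      then show "x \<in> {x \<in> points X. a x \<in> ?W} \<longleftrightarrow> x \<in> {x \<in> U. f x \<noteq> 0}"
        using baU[OF U, of x] by auto
    qed
    show op: "openin (top_of X) {x \<in> U. f x \<noteq> 0}"
      using morphismD(2)[OF a function_spaceD(5)[OF Y T[OF U] push[OF U f]]] unfolding eq .
    have "T {x \<in> U. f x \<noteq> 0} = ?W" unfolding T_def by auto
    then show "(\<lambda>x. inverse (f x)) \<in> regular X {x \<in> U. f x \<noteq> 0}"
      using function_spaceD(6)[OF Y T[OF U] push[OF U f]]
      by (intro pull[OF op]) (use baU[OF U] in auto)
  qed
qed

text \<open>The structure sheaves of affine varieties and of projective space are both built from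
  functions that are locally fractions. The predicate \<open>frac\<close> abstracts from the kind of
  fraction, so the closure properties are verified once; two functions are compared on the
  intersection of their neighbourhoods.\<close>

lemma function_space_of_fractions:
  fixes T :: "'a topology" and frac :: "'a set \<Rightarrow> ('a \<Rightarrow> 'k::field) \<Rightarrow> bool"
  assumes cong: "\<And>V f g. openin T V \<Longrightarrow> frac V f \<Longrightarrow> (\<And>x. x \<in> V \<Longrightarrow> f x = g x) \<Longrightarrow> frac V g"
    and sub: "\<And>V W f. frac V f \<Longrightarrow> W \<subseteq> V \<Longrightarrow> frac W f"
    and const: "\<And>V c. frac V (\<lambda>x. c)"
    and add: "\<And>V f g. frac V f \<Longrightarrow> frac V g \<Longrightarrow> frac V (\<lambda>x. f x + g x)"
    and mult: "\<And>V f g. frac V f \<Longrightarrow> frac V g \<Longrightarrow> frac V (\<lambda>x. f x * g x)"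
    and inv: "\<And>V f. openin T V \<Longrightarrow> frac V f \<Longrightarrow>
        openin T {x \<in> V. f x \<noteq> 0} \<and> frac {x \<in> V. f x \<noteq> 0} (\<lambda>x. inverse (f x))"
  shows "function_space \<lparr>top_of = T, regular = (\<lambda>U. {f. \<forall>x\<in>U. \<exists>V. openin T V \<and> x \<in> V \<and> V \<subseteq> U \<and> frac V f})\<rparr>"
    (is "function_space ?X")
proof -
  have R: "f \<in> regular ?X U \<longleftrightarrow> (\<forall>x\<in>U. \<exists>V. openin T V \<and> x \<in> V \<and> V \<subseteq> U \<and> frac V f)" for f U
    by simp
  have two: "\<exists>V. openin T V \<and> x \<in> V \<and> V \<subseteq> U \<and> frac V f \<and> frac V g"
    if f: "f \<in> regular ?X U" and g: "g \<in> regular ?X U" and x: "x \<in> U" for f g U x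
  proof -
    obtain V where V: "openin T V" "x \<in> V" "V \<subseteq> U" "frac V f" using f x unfolding R by blast
    obtain W where W: "openin T W" "x \<in> W" "W \<subseteq> U" "frac W g" using g x unfolding R by blast
    show ?thesis using V W sub[of V f "V \<inter> W"] sub[of W g "V \<inter> W"]
      by (intro exI[of _ "V \<inter> W"]) auto
  qed
  have nonvanishing: "\<exists>W. openin T W \<and> x \<in> W \<and> W \<subseteq> {x \<in> U. f x \<noteq> 0} \<and> frac W (\<lambda>x. inverse (f x))"
    if f: "f \<in> regular ?X U" and x: "x \<in> {x \<in> U. f x \<noteq> 0}" for f U x
  proof -
    obtain V where V: "openin T V" "x \<in> V" "V \<subseteq> U" "frac V f" using f x unfolding R by blast
    show ?thesis using inv[OF V(1,4)] V x by (intro exI[of _ "{x \<in> V. f x \<noteq> 0}"]) auto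
  qed
  show ?thesis unfolding function_space_def sheaf_of_functions_def fspace.simps(1)
  proof (intro conjI allI impI, goal_cases)
    case (1 U f g)
    show ?case unfolding R
    proof
      fix x assume "x \<in> U"
      then obtain V where V: "openin T V" "x \<in> V" "V \<subseteq> U" "frac V f" using 1(2) unfolding R by blast
      then have "frac V g" using cong[OF V(1,4)] 1(3) by blast
      then show "\<exists>V. openin T V \<and> x \<in> V \<and> V \<subseteq> U \<and> frac V g" using V by blast
    qed
  next
    case (2 U V f)
    show ?case unfolding R
    proof
      fix x assume x: "x \<in> V"
      then obtain W where "openin T W" "x \<in> W" "frac W f" using 2(3,4) unfolding R by blast
      then show "\<exists>W. openin T W \<and> x \<in> W \<and> W \<subseteq> V \<and> frac W f"
        using x 2(2) sub[of W f "W \<inter> V"] by (intro exI[of _ "W \<inter> V"]) auto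
    qed
  next
    case (3 U f)
    show ?case unfolding R
    proof
      fix x assume "x \<in> U"
      then obtain V where V: "x \<in> V" "V \<subseteq> U" "f \<in> regular ?X V" using 3(2) by blast
      then obtain W where "openin T W" "x \<in> W" "W \<subseteq> V" "frac W f" unfolding R by blast
      then show "\<exists>W. openin T W \<and> x \<in> W \<and> W \<subseteq> U \<and> frac W f" using V by blast
    qed
  next
    case (4 U c)
    then show ?case unfolding R using const by blast
  next
    case (5 U f g)
    then show ?case unfolding R[of "\<lambda>x. f x + g x"] using two[OF 5(2,3)] add by meson
  next
    case (6 U f g)
    then show ?case unfolding R[of "\<lambda>x. f x * g x"] using two[OF 6(2,3)] mult by meson
  next
    case (7 U f)
    show ?case by (subst openin_subopen) (use nonvanishing[OF 7(2)] in blast)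
  next
    case (8 U f)
    show ?case unfolding R using nonvanishing[OF 8(2)] by blast
  qed
qed

section \<open>Affine and projective spaces\<close>

lemma topspace_zariski [simp]: "topspace (zariski_topology n) = (affine_points n :: (nat \<Rightarrow> 'a::field) set)"
proof -
  have "affine_points n \<in> {{x \<in> affine_points n. p x \<noteq> (0::'a)} |p. p \<in> poly_functions n}"
    by (intro CollectI exI[of _ "\<lambda>x. 1"] conjI poly_functions.const) simp
  then show ?thesis unfolding zariski_topology_def topology_generated_by_topspace
    by (intro equalityI Union_least Union_upper) auto
qed

lemma top_of_affine_variety [simp]: "top_of (affine_variety n Z) = subtopology (zariski_topology n) Z"
  by (simp add: affine_variety_def)

lemma points_affine_variety [simp]: "points (affine_variety n Z) = affine_points n \<inter> Z"
  by (simp add: affine_variety_def)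

lemma regular_affine_variety:
  "f \<in> regular (affine_variety n Z) U \<longleftrightarrow>
    (\<forall>x\<in>U. \<exists>V. openin (subtopology (zariski_topology n) Z) V \<and> x \<in> V \<and> V \<subseteq> U \<and>
        (\<exists>p \<in> poly_functions n. \<exists>q \<in> poly_functions n. \<forall>y\<in>V. q y \<noteq> 0 \<and> f y = p y / q y))"
  by (simp add: affine_variety_def)

lemma algebraic_set_subset: "algebraic_set n Z \<Longrightarrow> Z \<subseteq> affine_points n"
  unfolding algebraic_set_def by auto

lemma openin_zariski_basic:
  "p \<in> poly_functions n \<Longrightarrow> openin (zariski_topology n) {x \<in> affine_points n. p x \<noteq> 0}"
  unfolding zariski_topology_def by (rule topology_generated_by_Basis) blast

lemma openin_affine_variety_basic:
  assumes "p \<in> poly_functions n" "openin (subtopology (zariski_topology n) Z) V"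
  shows "openin (subtopology (zariski_topology n) Z) {x \<in> V. p x \<noteq> 0}"
proof -
  have "{x \<in> V. p x \<noteq> 0} = V \<inter> ({x \<in> affine_points n. p x \<noteq> 0} \<inter> Z)"
    using openin_subset[OF assms(2)] by auto
  moreover have "openin (subtopology (zariski_topology n) Z) ({x \<in> affine_points n. p x \<noteq> 0} \<inter> Z)"
    unfolding openin_subtopology using openin_zariski_basic[OF assms(1)] by blast
  ultimately show ?thesis using assms(2) by (simp add: openin_Int)
qed

lemma function_space_affine_variety: "function_space (affine_variety n Z :: (nat \<Rightarrow> 'k::field, 'k) fspace)"
proof -
  let ?T = "subtopology (zariski_topology n) Z"
  define frac where "frac V f \<longleftrightarrow>
     (\<exists>p \<in> poly_functions n. \<exists>q \<in> poly_functions n. \<forall>y\<in>V. q y \<noteq> 0 \<and> f y = p y / q y)"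
    for V and f :: "_ \<Rightarrow> 'k"
  have fracI: "frac V f" if "p \<in> poly_functions n" "q \<in> poly_functions n" "\<And>y. y \<in> V \<Longrightarrow> q y \<noteq> 0 \<and> f y = p y / q y"
    for p q V f using that unfolding frac_def by blast
  have fracE: "\<exists>p q. p \<in> poly_functions n \<and> q \<in> poly_functions n \<and> (\<forall>y\<in>V. q y \<noteq> 0 \<and> f y = p y / q y)"
    if "frac V f" for V f using that unfolding frac_def by blast
  have "function_space \<lparr>top_of = ?T, regular = (\<lambda>U. {f. \<forall>x\<in>U. \<exists>V. openin ?T V \<and> x \<in> V \<and> V \<subseteq> U \<and> frac V f})\<rparr>"
  proof (rule function_space_of_fractions, goal_cases)
    case (1 V f g)
    then show ?case using fracE[OF 1(2)] by (metis fracI)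
  next
    case (2 V W f)
    then show ?case using fracE[OF 2(1)] by (metis fracI subsetD)
  next
    case (3 V c)
    show ?case by (rule fracI[OF poly_functions.const[of c] poly_functions.const[of 1]]) auto
  next
    case (4 V f g)
    obtain p q p' q' where pq: "p \<in> poly_functions n" "q \<in> poly_functions n" "p' \<in> poly_functions n" "q' \<in> poly_functions n"
      and "\<forall>y\<in>V. q y \<noteq> 0 \<and> f y = p y / q y" "\<forall>y\<in>V. q' y \<noteq> 0 \<and> g y = p' y / q' y"
      using fracE[OF 4(1)] fracE[OF 4(2)] by blast
    then show ?case
      by (intro fracI[of "\<lambda>y. p y * q' y + q y * p' y" "\<lambda>y. q y * q' y"] poly_functions.intros) (auto simp: field_simps)
  next
    case (5 V f g)
    obtain p q p' q' where pq: "p \<in> poly_functions n" "q \<in> poly_functions n" "p' \<in> poly_functions n" "q' \<in> poly_functions n"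
      and "\<forall>y\<in>V. q y \<noteq> 0 \<and> f y = p y / q y" "\<forall>y\<in>V. q' y \<noteq> 0 \<and> g y = p' y / q' y"
      using fracE[OF 5(1)] fracE[OF 5(2)] by blast
    then show ?case
      by (intro fracI[of "\<lambda>y. p y * p' y" "\<lambda>y. q y * q' y"] poly_functions.intros) auto
  next
    case (6 V f)
    obtain p q where pq: "p \<in> poly_functions n" "q \<in> poly_functions n"
      and eq: "\<forall>y\<in>V. q y \<noteq> 0 \<and> f y = p y / q y"
      using fracE[OF 6(2)] by blast
    have "{x \<in> V. f x \<noteq> 0} = {x \<in> V. p x \<noteq> 0}" using eq by auto
    then show ?case using openin_affine_variety_basic[OF pq(1) 6(1)] eq
      by (auto intro!: fracI[OF pq(2,1)])
  qed
  then show ?thesis unfolding affine_variety_def frac_def .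
qed

lemma poly_function_regular:
  assumes "p \<in> poly_functions n" "openin (top_of (affine_variety n Z)) U"
  shows "p \<in> regular (affine_variety n Z) U"
proof -
  have "\<exists>p' \<in> poly_functions n. \<exists>q \<in> poly_functions n. \<forall>y\<in>U. q y \<noteq> 0 \<and> p y = p' y / q y"
    by (intro bexI[OF _ assms(1)] bexI[of _ "\<lambda>x. 1"] poly_functions.const) auto
  then show ?thesis using assms(2) unfolding regular_affine_variety by auto
qed

lemma poly_function_comp_regular:
  assumes S: "function_space S" and U: "openin (top_of S) U"
    and p: "p \<in> poly_functions n" and w: "\<And>i. i < n \<Longrightarrow> (\<lambda>x. w x i) \<in> regular S U"
  shows "(\<lambda>x. p (w x)) \<in> regular S U"
  using p by induction (use w function_spaceD(2-4)[OF S U] in auto)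

text \<open>Polynomials in regular functions are regular, so principal open sets pull back to
  nonvanishing loci, which gives continuity on a generating family. Fractions pull back to fractions
  because regular functions are invertible where they do not vanish.\<close>

lemma morphism_to_affine:
  fixes S :: "('a, 'k::field) fspace"
  assumes S: "function_space S" and w: "\<And>i. i < n \<Longrightarrow> (\<lambda>x. w x i) \<in> regular S (points S)"
    and im: "\<And>x. x \<in> points S \<Longrightarrow> w x \<in> affine_points n \<and> w x \<in> Z"
  shows "morphism S (affine_variety n Z) w"
proof -
  have P: "openin (top_of S) (points S)" by simp
  have pw: "(\<lambda>x. p (w x)) \<in> regular S (points S)" if "p \<in> poly_functions n" for p
    by (rule poly_function_comp_regular[OF S P that w])
  have basic: "openin (top_of S) (w -` {x \<in> affine_points n. p x \<noteq> 0} \<inter> points S)" if "p \<in> poly_functions n" for p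
  proof -
    have "w -` {x \<in> affine_points n. p x \<noteq> 0} \<inter> points S = {x \<in> points S. p (w x) \<noteq> 0}" using im by auto
    then show ?thesis using function_spaceD(5)[OF S P pw[OF that]] by simp
  qed
  have "w ` points S \<subseteq> topspace (zariski_topology n)" using im by auto
  then have "continuous_map (top_of S) (zariski_topology n) w"
    unfolding zariski_topology_def topology_generated_by_topspace
    by (rule continuous_on_generated_topo[rotated]) (use basic in blast)
  then have cont: "continuous_map (top_of S) (top_of (affine_variety n Z)) w"
    using im by (auto simp: continuous_map_in_subtopology)
  show ?thesis
  proof (rule morphismI)
    fix x assume "x \<in> points S" then show "w x \<in> points (affine_variety n Z)" using im by simp
  next
    fix V h assume V: "openin (top_of (affine_variety n Z)) V"
    show op: "openin (top_of S) {x \<in> points S. w x \<in> V}" using cont V by (rule openin_continuous_map_preimage)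
    assume h: "h \<in> regular (affine_variety n Z) V"
    show "(\<lambda>x. h (w x)) \<in> regular S {x \<in> points S. w x \<in> V}"
    proof (rule sheaf_glue[OF function_spaceD(1)[OF S] op])
      fix x assume x: "x \<in> {x \<in> points S. w x \<in> V}"
      then obtain W p q where W: "openin (top_of (affine_variety n Z)) W" "w x \<in> W" "W \<subseteq> V"
         and pq: "p \<in> poly_functions n" "q \<in> poly_functions n" and eq: "\<forall>y\<in>W. q y \<noteq> 0 \<and> h y = p y / q y"
        using h[unfolded regular_affine_variety, rule_format, of "w x"] unfolding top_of_affine_variety by auto
      let ?W = "{x \<in> points S. w x \<in> W}"
      have opW: "openin (top_of S) ?W" using cont W(1) by (rule openin_continuous_map_preimage)
      have "(\<lambda>x. p (w x)) \<in> regular S ?W" "(\<lambda>x. q (w x)) \<in> regular S ?W"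
        by (rule sheaf_restrict[OF function_spaceD(1)[OF S] P opW _ pw]; use pq in auto)+
      then have "(\<lambda>x. p (w x) / q (w x)) \<in> regular S ?W"
        by (rule function_space_divide[OF S opW]) (use eq in auto)
      then have "(\<lambda>x. h (w x)) \<in> regular S ?W"
        by (rule sheaf_cong[OF function_spaceD(1)[OF S] opW]) (use eq in auto)
      then show "\<exists>V'. openin (top_of S) V' \<and> x \<in> V' \<and> V' \<subseteq> {x \<in> points S. w x \<in> V} \<and> (\<lambda>x. h (w x)) \<in> regular S V'"
        using x W opW by (intro exI[of _ ?W]) auto
    qed
  qed
qed

section \<open>Projective space and its structure sheaf\<close>

lemma homogeneous_mult:
  "p \<in> homogeneous m d \<Longrightarrow> q \<in> homogeneous m e \<Longrightarrow> (\<lambda>x. p x * q x) \<in> homogeneous m (d + e)"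
  unfolding homogeneous_def by (auto intro: poly_functions.mult simp: power_add algebra_simps)

lemma homogeneous_add:
  "p \<in> homogeneous m d \<Longrightarrow> q \<in> homogeneous m d \<Longrightarrow> (\<lambda>x. p x + q x) \<in> homogeneous m d"
  unfolding homogeneous_def by (auto intro: poly_functions.add simp: algebra_simps)

lemma homogeneous_const: "(\<lambda>x. c) \<in> homogeneous m 0"
  unfolding homogeneous_def by (auto intro: poly_functions.const)

lemma homogeneous_coord: "i < m \<Longrightarrow> (\<lambda>x. x i) \<in> homogeneous m (Suc 0)"
  unfolding homogeneous_def by (auto intro: poly_functions.coord)

lemma proj_class_eqD:
  assumes "proj_class x = proj_class y"
  shows "\<exists>c. c \<noteq> 0 \<and> y = (\<lambda>i. c * x i)"
proof -
  have "y \<in> proj_class y" unfolding proj_class_def by (auto intro!: exI[of _ 1])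
  then show ?thesis using assms unfolding proj_class_def by auto
qed

lemma proj_class_scale: "c \<noteq> 0 \<Longrightarrow> proj_class (\<lambda>i. c * x i) = proj_class x"
proof -
  assume c: "c \<noteq> 0"
  have "\<exists>c'. (\<lambda>i. b * x i) = (\<lambda>i. c' * (c * x i)) \<and> c' \<noteq> 0" if "b \<noteq> 0" for b
    using c that by (intro exI[of _ "b / c"]) (auto simp: fun_eq_iff)
  then show ?thesis unfolding proj_class_def using c
    by (auto simp: mult.assoc[symmetric] intro: exI[of _ "_ * c"])
qed

lemma homogeneous_zero_proj_class:
  assumes "p \<in> homogeneous m d" "proj_class x = proj_class y"
  shows "p x = 0 \<longleftrightarrow> p y = 0"
  using proj_class_eqD[OF assms(2)] assms(1) unfolding homogeneous_def by auto

lemma projective_basic_mem: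
  assumes "p \<in> homogeneous (Suc n) d" "x \<in> homogeneous_coords n"
  shows "proj_class x \<in> proj_class ` {x \<in> homogeneous_coords n. p x \<noteq> 0} \<longleftrightarrow> p x \<noteq> 0"
  using homogeneous_zero_proj_class[OF assms(1)] assms(2) by blast

lemma openin_projective_basic:
  "p \<in> homogeneous (Suc n) d \<Longrightarrow> openin (projective_topology n) (proj_class ` {x \<in> homogeneous_coords n. p x \<noteq> 0})"
  unfolding projective_topology_def by (rule topology_generated_by_Basis) blast

lemma topspace_projective [simp]:
  "topspace (projective_topology n) = (proj_class ` homogeneous_coords n :: 'a::field proj_point set)"
proof -
  have "proj_class ` homogeneous_coords n \<in>
      {proj_class ` {x \<in> homogeneous_coords n. p x \<noteq> (0::'a)} |p d. p \<in> homogeneous (Suc n) d}"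
    by (intro CollectI exI[of _ "\<lambda>x. 1"] exI[of _ 0] conjI homogeneous_const) simp
  then show ?thesis unfolding projective_topology_def topology_generated_by_topspace
    by (intro equalityI Union_least Union_upper) auto
qed

lemma top_of_projective_space [simp]: "top_of (projective_space n) = projective_topology n"
  by (simp add: projective_space_def)

lemma regular_projective_space:
  "f \<in> regular (projective_space n) U \<longleftrightarrow>
    (\<forall>P\<in>U. \<exists>V. openin (projective_topology n) V \<and> P \<in> V \<and> V \<subseteq> U \<and>
        (\<exists>d. \<exists>p \<in> homogeneous (Suc n) d. \<exists>q \<in> homogeneous (Suc n) d.
           \<forall>x \<in> homogeneous_coords n. proj_class x \<in> V \<longrightarrow>
             q x \<noteq> 0 \<and> f (proj_class x) = p x / q x))"
  by (simp add: projective_space_def)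

lemma openin_projective_basic_Int:
  assumes "p \<in> homogeneous (Suc n) d" "openin (projective_topology n) V"
  shows "openin (projective_topology n) (V \<inter> proj_class ` {x \<in> homogeneous_coords n. p x \<noteq> 0})"
  using assms by (intro openin_Int openin_projective_basic)

lemma function_space_projective: "function_space (projective_space n :: ('k::field proj_point, 'k) fspace)"
proof -
  let ?T = "projective_topology n :: 'k proj_point topology"
  let ?H = "\<lambda>d. homogeneous (Suc n) d :: ((nat \<Rightarrow> 'k) \<Rightarrow> 'k) set"
  define frac where "frac V f \<longleftrightarrow> (\<exists>d. \<exists>p \<in> ?H d. \<exists>q \<in> ?H d.
           \<forall>x \<in> homogeneous_coords n. proj_class x \<in> V \<longrightarrow> q x \<noteq> 0 \<and> f (proj_class x) = p x / q x)"
    for V :: "'k proj_point set" and f :: "_ \<Rightarrow> 'k"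
  have fracI: "frac V f" if "p \<in> ?H d" "q \<in> ?H d"
     "\<And>x. x \<in> homogeneous_coords n \<Longrightarrow> proj_class x \<in> V \<Longrightarrow> q x \<noteq> 0 \<and> f (proj_class x) = p x / q x"
    for p q d V f using that unfolding frac_def by (intro exI[of _ d] bexI[of _ p] bexI[of _ q]) auto
  have fracE: "\<exists>d p q. p \<in> ?H d \<and> q \<in> ?H d \<and>
     (\<forall>x \<in> homogeneous_coords n. proj_class x \<in> V \<longrightarrow> q x \<noteq> 0 \<and> f (proj_class x) = p x / q x)"
    if "frac V f" for V f using that unfolding frac_def by blast
  have "function_space \<lparr>top_of = ?T, regular = (\<lambda>U. {f. \<forall>x\<in>U. \<exists>V. openin ?T V \<and> x \<in> V \<and> V \<subseteq> U \<and> frac V f})\<rparr>"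
  proof (rule function_space_of_fractions, goal_cases)
    case (1 V f g)
    obtain d p q where "p \<in> ?H d" "q \<in> ?H d"
      "\<forall>x \<in> homogeneous_coords n. proj_class x \<in> V \<longrightarrow> q x \<noteq> 0 \<and> f (proj_class x) = p x / q x"
      using fracE[OF 1(2)] by blast
    then show ?case using 1(3) by (intro fracI[of p d q]) auto
  next
    case (2 V W f)
    obtain d p q where "p \<in> ?H d" "q \<in> ?H d"
      "\<forall>x \<in> homogeneous_coords n. proj_class x \<in> V \<longrightarrow> q x \<noteq> 0 \<and> f (proj_class x) = p x / q x"
      using fracE[OF 2(1)] by blast
    then show ?case using 2(2) by (intro fracI[of p d q]) auto
  next
    case (3 V c)
    show ?case by (rule fracI[OF homogeneous_const[of c] homogeneous_const[of 1]]) auto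
  next
    case (4 V f g)
    obtain d p q where pq: "p \<in> ?H d" "q \<in> ?H d" and
      eq: "\<forall>x \<in> homogeneous_coords n. proj_class x \<in> V \<longrightarrow> q x \<noteq> 0 \<and> f (proj_class x) = p x / q x"
      using fracE[OF 4(1)] by blast
    obtain d' p' q' where pq': "p' \<in> ?H d'" "q' \<in> ?H d'" and
      eq': "\<forall>x \<in> homogeneous_coords n. proj_class x \<in> V \<longrightarrow> q' x \<noteq> 0 \<and> g (proj_class x) = p' x / q' x"
      using fracE[OF 4(2)] by blast
    show ?case using eq eq'
      by (intro fracI[of "\<lambda>y. p y * q' y + q y * p' y" "d + d'" "\<lambda>y. q y * q' y"] homogeneous_add homogeneous_mult pq pq')
         (auto simp: field_simps)
  next
    case (5 V f g)
    obtain d p q where pq: "p \<in> ?H d" "q \<in> ?H d" and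
      eq: "\<forall>x \<in> homogeneous_coords n. proj_class x \<in> V \<longrightarrow> q x \<noteq> 0 \<and> f (proj_class x) = p x / q x"
      using fracE[OF 5(1)] by blast
    obtain d' p' q' where pq': "p' \<in> ?H d'" "q' \<in> ?H d'" and
      eq': "\<forall>x \<in> homogeneous_coords n. proj_class x \<in> V \<longrightarrow> q' x \<noteq> 0 \<and> g (proj_class x) = p' x / q' x"
      using fracE[OF 5(2)] by blast
    show ?case using eq eq'
      by (intro fracI[of "\<lambda>y. p y * p' y" "d + d'" "\<lambda>y. q y * q' y"] homogeneous_mult pq pq') auto
  next
    case (6 V f)
    obtain d p q where pq: "p \<in> ?H d" "q \<in> ?H d" and
      eq: "\<forall>x \<in> homogeneous_coords n. proj_class x \<in> V \<longrightarrow> q x \<noteq> 0 \<and> f (proj_class x) = p x / q x"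
      using fracE[OF 6(2)] by blast
    let ?W = "V \<inter> proj_class ` {x \<in> homogeneous_coords n. p x \<noteq> 0}"
    have W: "proj_class y \<in> ?W \<longleftrightarrow> proj_class y \<in> V \<and> p y \<noteq> 0" if "y \<in> homogeneous_coords n" for y
      using projective_basic_mem[OF pq(1) that] by auto
    have "P \<in> {P \<in> V. f P \<noteq> 0} \<longleftrightarrow> P \<in> ?W" if P: "P \<in> V" for P
    proof -
      obtain x where x: "x \<in> homogeneous_coords n" "P = proj_class x"
        using P openin_subset[OF 6(1)] by auto
      then show ?thesis using W[OF x(1)] eq P by auto
    qed
    then have "{P \<in> V. f P \<noteq> 0} = ?W" by blast
    then show ?case using openin_projective_basic_Int[OF pq(1) 6(1)] W eq
      by (auto intro!: fracI[OF pq(2,1)])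
  qed
  then show ?thesis unfolding projective_space_def frac_def .
qed

text \<open>The projective analogue of \<open>morphism_to_affine\<close>: forms of a fixed degree
  are evaluated at the coordinate functions, and \<open>im\<close> says that these have no common
  zero.\<close>

lemma morphism_to_projective:
  fixes S :: "('a, 'k::field) fspace"
  assumes S: "function_space S" and w: "\<And>i. i < Suc n \<Longrightarrow> (\<lambda>x. w x i) \<in> regular S (points S)"
    and im: "\<And>x. x \<in> points S \<Longrightarrow> w x \<in> homogeneous_coords n"
  shows "morphism S (projective_space n) (\<lambda>x. proj_class (w x))"
proof -
  have P: "openin (top_of S) (points S)" by simp
  have pw: "(\<lambda>x. p (w x)) \<in> regular S (points S)" if "p \<in> homogeneous (Suc n) d" for p d
    by (rule poly_function_comp_regular[OF S P _ w]) (use that in \<open>auto simp: homogeneous_def\<close>)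
  have basic: "openin (top_of S) ((\<lambda>x. proj_class (w x)) -` proj_class ` {x \<in> homogeneous_coords n. p x \<noteq> 0} \<inter> points S)"
    if p: "p \<in> homogeneous (Suc n) d" for p d
  proof -
    have "(\<lambda>x. proj_class (w x)) -` proj_class ` {x \<in> homogeneous_coords n. p x \<noteq> 0} \<inter> points S = {x \<in> points S. p (w x) \<noteq> 0}"
      using im projective_basic_mem[OF p] by blast
    then show ?thesis using function_spaceD(5)[OF S P pw[OF that]] by simp
  qed
  have "(\<lambda>x. proj_class (w x)) ` points S \<subseteq> topspace (projective_topology n)" using im by auto
  then have cont: "continuous_map (top_of S) (top_of (projective_space n)) (\<lambda>x. proj_class (w x))"
    unfolding top_of_projective_space projective_topology_def topology_generated_by_topspace
    by (rule continuous_on_generated_topo[rotated]) (use basic in blast)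
  show ?thesis
  proof (rule morphismI)
    fix x assume "x \<in> points S" then show "proj_class (w x) \<in> points (projective_space n)" using im by simp
  next
    fix V :: "'k proj_point set" and h
    assume V: "openin (top_of (projective_space n)) V"
    show op: "openin (top_of S) {x \<in> points S. proj_class (w x) \<in> V}" using cont V by (rule openin_continuous_map_preimage)
    assume h: "h \<in> regular (projective_space n) V"
    show "(\<lambda>x. h (proj_class (w x))) \<in> regular S {x \<in> points S. proj_class (w x) \<in> V}"
    proof (rule sheaf_glue[OF function_spaceD(1)[OF S] op])
      fix x assume x: "x \<in> {x \<in> points S. proj_class (w x) \<in> V}"
      then obtain W d p q where W: "openin (top_of (projective_space n)) W" "proj_class (w x) \<in> W" "W \<subseteq> V"
         and pq: "p \<in> homogeneous (Suc n) d" "q \<in> homogeneous (Suc n) d"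
         and eq: "\<forall>x \<in> homogeneous_coords n. proj_class x \<in> W \<longrightarrow> q x \<noteq> 0 \<and> h (proj_class x) = p x / q x"
        using h[unfolded regular_projective_space, rule_format, of "proj_class (w x)"]
        unfolding top_of_projective_space by auto
      let ?W = "{x \<in> points S. proj_class (w x) \<in> W}"
      have opW: "openin (top_of S) ?W" using cont W(1) by (rule openin_continuous_map_preimage)
      have "(\<lambda>x. p (w x)) \<in> regular S ?W" "(\<lambda>x. q (w x)) \<in> regular S ?W"
        by (rule sheaf_restrict[OF function_spaceD(1)[OF S] P opW _ pw]; use pq in auto)+
      then have "(\<lambda>x. p (w x) / q (w x)) \<in> regular S ?W"
        by (rule function_space_divide[OF S opW]) (use eq im in auto)
      then have "(\<lambda>x. h (proj_class (w x))) \<in> regular S ?W"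
        by (rule sheaf_cong[OF function_spaceD(1)[OF S] opW]) (use eq im in auto)
      then show "\<exists>V'. openin (top_of S) V' \<and> x \<in> V' \<and> V' \<subseteq> {x \<in> points S. proj_class (w x) \<in> V} \<and> (\<lambda>x. h (proj_class (w x))) \<in> regular S V'"
        using x W opW by (intro exI[of _ ?W]) auto
    qed
  qed
qed

section \<open>Affine open sets and separatedness\<close>

lemma isomorphic_trans:
  assumes "isomorphic X Y" "isomorphic Y Z"
  shows "isomorphic X Z"
proof -
  obtain a b where a: "morphism X Y a" and b: "morphism Y X b"
    and ba: "\<And>x. x \<in> points X \<Longrightarrow> b (a x) = x" and ab: "\<And>y. y \<in> points Y \<Longrightarrow> a (b y) = y"
    using assms(1) unfolding isomorphic_def by blast
  obtain c d where c: "morphism Y Z c" and d: "morphism Z Y d"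
    and dc: "\<And>x. x \<in> points Y \<Longrightarrow> d (c x) = x" and cd: "\<And>y. y \<in> points Z \<Longrightarrow> c (d y) = y"
    using assms(2) unfolding isomorphic_def by blast
  show ?thesis unfolding isomorphic_def
    using morphism_comp[OF a c] morphism_comp[OF d b] morphismD(1)[OF a] morphismD(1)[OF d] ba ab dc cd
    by (intro exI[of _ "c \<circ> a"] exI[of _ "b \<circ> d"]) simp
qed

lemma isomorphic_open_subspace:
  assumes X: "sheaf_of_functions X" and Y: "sheaf_of_functions Y"
    and a: "morphism X Y a" and b: "morphism Y X b"
    and ba: "\<And>x. x \<in> points X \<Longrightarrow> b (a x) = x" and ab: "\<And>y. y \<in> points Y \<Longrightarrow> a (b y) = y"
    and V: "openin (top_of Y) V"
  shows "isomorphic (open_subspace X {x \<in> points X. a x \<in> V}) (open_subspace Y V)"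
proof -
  let ?U = "{x \<in> points X. a x \<in> V}"
  have U: "openin (top_of X) ?U" by (rule morphismD(2)[OF a V])
  have "morphism (open_subspace X ?U) (open_subspace Y V) a"
    by (intro morphism_into_open_subspace morphism_restrict X U a V) auto
  moreover have "morphism (open_subspace Y V) (open_subspace X ?U) b"
    by (intro morphism_into_open_subspace morphism_restrict Y U b V)
       (use ab morphismD(1)[OF b] in auto)
  ultimately show ?thesis unfolding isomorphic_def
    using ab ba by (intro exI[of _ a] exI[of _ b]) auto
qed

lemma prevarietyD:
  assumes "prevariety X"
  shows "sheaf_of_functions X"
    and "x \<in> points X \<Longrightarrow> \<exists>U n Z. openin (top_of X) U \<and> x \<in> U \<and> algebraic_set n Z \<and>
       isomorphic (open_subspace X U) (affine_variety n Z)"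
proof -
  show "sheaf_of_functions X" using assms unfolding prevariety_def by blast
  assume "x \<in> points X"
  then show "\<exists>U n Z. openin (top_of X) U \<and> x \<in> U \<and> algebraic_set n Z \<and>
       isomorphic (open_subspace X U) (affine_variety n Z)"
    using assms unfolding prevariety_def by (metis UnionE)
qed

lemma function_space_prevariety:
  assumes "prevariety X"
  shows "function_space X"
proof (rule function_space_local[OF prevarietyD(1)[OF assms]])
  fix x assume "x \<in> points X"
  then obtain U n Z where U: "openin (top_of X) U" "x \<in> U" "isomorphic (open_subspace X U) (affine_variety n Z)"
    using prevarietyD(2)[OF assms] by blast
  then show "\<exists>U. openin (top_of X) U \<and> x \<in> U \<and> function_space (open_subspace X U)"
    using function_space_isomorphic[OF sheaf_open_subspace[OF prevarietyD(1)[OF assms] U(1)] function_space_affine_variety U(3)]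
    by blast
qed

section \<open>Principal open sets as affine varieties\<close>

lemma poly_functions_cong:
  "p \<in> poly_functions n \<Longrightarrow> (\<And>i. i < n \<Longrightarrow> x i = y i) \<Longrightarrow> p x = p y"
  by (induction rule: poly_functions.induct) auto

lemma poly_functions_Suc: "p \<in> poly_functions n \<Longrightarrow> p \<in> poly_functions (Suc n)"
  by (induction rule: poly_functions.induct) (auto intro: poly_functions.intros)

text \<open>A product is nonzero exactly where both factors are, so the generating sets are closed
  under binary intersections and already form a basis.\<close>

lemma zariski_basis:
  assumes "openin (zariski_topology n) U" "x \<in> U"
  shows "\<exists>p \<in> poly_functions n. p x \<noteq> 0 \<and> {y \<in> affine_points n. p y \<noteq> 0} \<subseteq> U"
proof -
  have "generate_topology_on {{x \<in> affine_points n. p x \<noteq> 0} | p. p \<in> poly_functions n} U"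
    using assms(1) unfolding zariski_topology_def by (rule openin_topology_generated_by)
  then show ?thesis using assms(2)
  proof (induction)
    case (Int a b)
    then obtain p q where p: "p \<in> poly_functions n" "p x \<noteq> 0" "{y \<in> affine_points n. p y \<noteq> 0} \<subseteq> a"
      and q: "q \<in> poly_functions n" "q x \<noteq> 0" "{y \<in> affine_points n. q y \<noteq> 0} \<subseteq> b" by blast
    show ?case
      by (rule bexI[OF _ poly_functions.mult[OF p(1) q(1)]]) (use p q in auto)
  next
    case (UN K)
    then obtain k where k: "k \<in> K" "x \<in> k" by blast
    from UN.IH[OF this] k show ?case by blast
  qed auto
qed

text \<open>The Rabinowitsch trick: \<open>1/p\<close> serves as an additional coordinate.\<close>

lemma principal_open_affine:
  fixes Z :: "(nat \<Rightarrow> 'k::field) set"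
  assumes Z: "algebraic_set n Z" and p: "p \<in> poly_functions n"
  shows "\<exists>Z'. algebraic_set (Suc n) Z' \<and>
    isomorphic (open_subspace (affine_variety n Z) {x \<in> Z. p x \<noteq> 0}) (affine_variety (Suc n) Z')"
proof -
  obtain S where S: "S \<subseteq> poly_functions n" and ZS: "Z = {x \<in> affine_points n. \<forall>p\<in>S. p x = 0}"
    using Z unfolding algebraic_set_def by blast
  define r where "r = (\<lambda>x::nat \<Rightarrow> 'k. x n * p x + (-1))"
  define Z' where "Z' = {x \<in> affine_points (Suc n). \<forall>p\<in>insert r S. p x = 0}"
  have r: "r \<in> poly_functions (Suc n)" unfolding r_def
    by (intro poly_functions.intros poly_functions_Suc p) auto
  have Z': "algebraic_set (Suc n) Z'" unfolding algebraic_set_def Z'_def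
    using r S poly_functions_Suc by (intro exI[of _ "insert r S"]) auto
  let ?D = "{x \<in> Z. p x \<noteq> 0}" and ?A = "affine_variety n Z" and ?A' = "affine_variety (Suc n) Z'"
  define a where "a x = (\<lambda>i. if i = n then inverse (p x) else x i)" for x
  \<comment> \<open>Points of affine n-space are sequences that vanish from index n on, so
    forgetting the last coordinate means setting it to 0.\<close>
  define b where "b x = (\<lambda>i. if i = n then 0 else x i)" for x :: "nat \<Rightarrow> 'k"
  have Zaff: "Z \<subseteq> affine_points n" using algebraic_set_subset[OF Z] .
  have D: "openin (top_of ?A) ?D"
  proof -
    have "openin (top_of ?A) (points ?A)" by blast
    from openin_affine_variety_basic[OF p this[unfolded top_of_affine_variety]]
    have "openin (top_of ?A) {x \<in> points ?A. p x \<noteq> 0}" by simp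
    moreover have "{x \<in> points ?A. p x \<noteq> 0} = ?D" using Zaff by auto
    ultimately show ?thesis by simp
  qed
  have cong: "q (a x) = q x" "q (b x) = q x" if "q \<in> poly_functions n" for q x
    by (rule poly_functions_cong[OF that]; simp add: a_def b_def)+
  have pts: "points (open_subspace ?A ?D) = ?D" using Zaff by auto
  have pts': "points ?A' = Z'" unfolding Z'_def by auto
  have fsD: "function_space (open_subspace ?A ?D)"
    by (intro function_space_open_subspace function_space_affine_variety D)
  have aZ': "a x \<in> Z'" if "x \<in> ?D" for x
  proof -
    have "a x \<in> affine_points (Suc n)" using that ZS unfolding affine_points_def a_def by auto
    moreover have "r (a x) = 0" using that cong(1)[OF p] by (simp add: r_def) (simp add: a_def)
    moreover have "q (a x) = 0" if "q \<in> S" for q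
      using cong(1)[of q x] \<open>x \<in> ?D\<close> that S ZS by auto
    ultimately show ?thesis unfolding Z'_def by auto
  qed
  have bD: "b x \<in> ?D" if "x \<in> Z'" for x
  proof -
    have "b x \<in> affine_points n" using that unfolding Z'_def affine_points_def b_def by auto
    moreover have "p x \<noteq> 0" using that unfolding Z'_def r_def by auto
    moreover have "q (b x) = 0" if "q \<in> S" for q
      using cong(2)[of q x] \<open>x \<in> Z'\<close> that S unfolding Z'_def by auto
    ultimately show ?thesis using cong(2)[OF p] ZS by auto
  qed
  have reg: "q \<in> regular ?A ?D" if "q \<in> poly_functions n" for q
    by (rule poly_function_regular[OF that D])
  have invp: "(\<lambda>x. inverse (p x)) \<in> regular ?A ?D"
    using function_spaceD(6)[OF function_space_affine_variety D reg[OF p]]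
    by (simp add: conj_assoc)
  have ma: "morphism (open_subspace ?A ?D) ?A' a"
  proof (rule morphism_to_affine[OF fsD])
    fix i assume "i < Suc n"
    then consider "i < n" | "i = n" by linarith
    then show "(\<lambda>x. a x i) \<in> regular (open_subspace ?A ?D) (points (open_subspace ?A ?D))"
      unfolding pts regular_open_subspace
    proof cases
      case 1
      then have "(\<lambda>x. a x i) = (\<lambda>x. x i)" by (auto simp: a_def)
      then show "(\<lambda>x. a x i) \<in> regular ?A ?D" using reg[OF poly_functions.coord[OF 1]] by simp
    next
      case 2
      then have "(\<lambda>x. a x i) = (\<lambda>x. inverse (p x))" by (auto simp: a_def)
      then show "(\<lambda>x. a x i) \<in> regular ?A ?D" using invp by simp
    qed
  next
    fix x assume "x \<in> points (open_subspace ?A ?D)"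
    then have "a x \<in> Z'" unfolding pts by (rule aZ')
    then show "a x \<in> affine_points (Suc n) \<and> a x \<in> Z'" using algebraic_set_subset[OF Z'] by auto
  qed
  have "morphism ?A' ?A b"
  proof (rule morphism_to_affine[OF function_space_affine_variety])
    fix i assume i: "i < n"
    then have bi: "(\<lambda>x. b x i) = (\<lambda>x. x i)" by (auto simp: b_def)
    then show "(\<lambda>x. b x i) \<in> regular ?A' (points ?A')"
      unfolding bi
      by (intro poly_function_regular poly_functions.coord openin_topspace) (use i in simp)
  next
    fix x assume "x \<in> points ?A'"
    then have "b x \<in> ?D" unfolding pts' by (rule bD)
    then show "b x \<in> affine_points n \<and> b x \<in> Z" using Zaff by auto
  qed
  then have mb: "morphism ?A' (open_subspace ?A ?D) b"
    by (rule morphism_into_open_subspace[OF _ D]) (use pts' bD in blast)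
  have "b (a x) = x" if "x \<in> ?D" for x
    using that ZS unfolding a_def b_def affine_points_def by auto
  moreover have "a (b x) = x" if "x \<in> Z'" for x
  proof -
    have "p x * x n = 1" using that unfolding Z'_def r_def by (auto simp: mult.commute)
    then have "inverse (p x) = x n" by (rule inverse_unique)
    then show ?thesis using cong(2)[OF p] unfolding a_def by (auto simp: b_def)
  qed
  ultimately have "isomorphic (open_subspace ?A ?D) ?A'"
    unfolding isomorphic_def pts pts' using ma mb by (intro exI[of _ a] exI[of _ b]) auto
  then show ?thesis using Z' by blast
qed

text \<open>A neighbourhood is carried into an affine chart, shrunk there to a principal open set,
  and the latter is affine by the Rabinowitsch trick. Such small affine pieces are required because
  \<open>separated\<close> tests morphisms from affine varieties only.\<close>

lemma affine_open_basis:
  assumes S: "prevariety S" and U: "openin (top_of S) U" and u: "u \<in> U"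
  shows "\<exists>W n Z. openin (top_of S) W \<and> u \<in> W \<and> W \<subseteq> U \<and> algebraic_set n Z \<and>
     isomorphic (open_subspace S W) (affine_variety n Z)"
proof -
  note sS = prevarietyD(1)[OF S]
  have "u \<in> points S" using u openin_subset[OF U] by auto
  then obtain V n Z where V: "openin (top_of S) V" "u \<in> V" and Z: "algebraic_set n Z"
    and iso: "isomorphic (open_subspace S V) (affine_variety n Z)"
    using prevarietyD(2)[OF S] by blast
  let ?A = "affine_variety n Z" and ?SV = "open_subspace S V"
  obtain a b where a: "morphism ?SV ?A a" and b: "morphism ?A ?SV b"
    and ba: "\<And>x. x \<in> points ?SV \<Longrightarrow> b (a x) = x" and ab: "\<And>y. y \<in> points ?A \<Longrightarrow> a (b y) = y"
    using iso unfolding isomorphic_def by blast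
  have Zaff: "Z \<subseteq> affine_points n" using algebraic_set_subset[OF Z] .
  have ptsV: "points ?SV = V" using openin_subset[OF V(1)] by auto
  have "openin (top_of ?SV) (U \<inter> V)" using U V by (auto simp: openin_open_subtopology)
  from morphismD(2)[OF b this] have "openin (top_of ?A) {y \<in> points ?A. b y \<in> U \<inter> V}" .
  then obtain T where T: "openin (zariski_topology n) T" "{y \<in> points ?A. b y \<in> U \<inter> V} = T \<inter> Z"
    unfolding top_of_affine_variety openin_subtopology by blast
  have au: "a u \<in> points ?A" using morphismD(1)[OF a, of u] V ptsV by auto
  moreover have "b (a u) = u" by (rule ba) (use ptsV V in blast)
  ultimately have "a u \<in> T \<inter> Z" unfolding T(2)[symmetric] using u V by auto
  then obtain p where p: "p \<in> poly_functions n" "p (a u) \<noteq> 0" "{y \<in> affine_points n. p y \<noteq> 0} \<subseteq> T"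
    using zariski_basis[OF T(1)] by blast
  let ?D = "{x \<in> Z. p x \<noteq> 0}" let ?W = "{x \<in> points ?SV. a x \<in> ?D}"
  have DT: "?D \<subseteq> T \<inter> Z" using p(3) Zaff by auto
  have D: "openin (top_of ?A) ?D"
  proof -
    have "openin (top_of ?A) (points ?A)" by blast
    from openin_affine_variety_basic[OF p(1) this[unfolded top_of_affine_variety]]
    have "openin (top_of ?A) {x \<in> points ?A. p x \<noteq> 0}" by simp
    moreover have "{x \<in> points ?A. p x \<noteq> 0} = ?D" using Zaff by auto
    ultimately show ?thesis by simp
  qed
  have iso': "isomorphic (open_subspace ?SV ?W) (open_subspace ?A ?D)"
    by (rule isomorphic_open_subspace[OF sheaf_open_subspace[OF sS V(1)] function_spaceD(1)[OF function_space_affine_variety] a b ba ab D])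
  have "openin (top_of ?SV) ?W" by (rule morphismD(2)[OF a D])
  then have W: "openin (top_of S) ?W" "?W \<subseteq> V" using V(1) by (auto simp: openin_open_subtopology)
  have eq: "open_subspace ?SV ?W = open_subspace S ?W"
    using W(2) by (simp add: open_subspace_subspace Int_absorb1)
  have "?W \<subseteq> U"
  proof
    fix x assume x: "x \<in> ?W"
    then have "a x \<in> T \<inter> Z" using DT by blast
    then have "b (a x) \<in> U" unfolding T(2)[symmetric] by blast
    then show "x \<in> U" using ba x by simp
  qed
  moreover have "u \<in> ?W" using V(2) ptsV p(2) au by simp
  moreover obtain Z' where "algebraic_set (Suc n) Z'" "isomorphic (open_subspace ?A ?D) (affine_variety (Suc n) Z')"
    using principal_open_affine[OF Z p(1)] by blast
  ultimately show ?thesis using W(1) isomorphic_trans[OF iso'] unfolding eq by blast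
qed

text \<open>Openness is local, so the source may be replaced by affine open pieces, on which
  separatedness of the target applies directly.\<close>

lemma neq_locus_open:
  assumes S: "prevariety S" and Y: "separated Y" and U: "openin (top_of S) U"
    and f: "morphism (open_subspace S U) Y f" and g: "morphism (open_subspace S U) Y g"
  shows "openin (top_of S) {x \<in> U. f x \<noteq> g x}"
proof (subst openin_subopen, intro ballI)
  fix u assume u: "u \<in> {x \<in> U. f x \<noteq> g x}"
  note sS = prevarietyD(1)[OF S]
  obtain W n Z where W: "openin (top_of S) W" "u \<in> W" "W \<subseteq> U" and Z: "algebraic_set n Z"
    and iso: "isomorphic (open_subspace S W) (affine_variety n Z)"
    using affine_open_basis[OF S U, of u] u by blast
  let ?A = "affine_variety n Z" and ?S = "open_subspace S W"
  obtain a b where a: "morphism ?S ?A a" and b: "morphism ?A ?S b"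
    and ba: "\<And>x. x \<in> points ?S \<Longrightarrow> b (a x) = x"
    using iso unfolding isomorphic_def by blast
  have ptsW: "points ?S = W" using openin_subset[OF W(1)] by auto
  have "morphism ?A Y (f \<circ> b)" "morphism ?A Y (g \<circ> b)"
    by (rule morphism_comp[OF b morphism_restrict'[OF sS U W(1,3)]], fact)+
  then have cl: "closedin (top_of ?A) {z \<in> Z. (f \<circ> b) z = (g \<circ> b) z}"
    using Y Z unfolding separated_def by blast
  have "closedin (top_of ?S) {x \<in> topspace (top_of ?S). a x \<in> {z \<in> Z. (f \<circ> b) z = (g \<circ> b) z}}"
    by (rule closedin_continuous_map_preimage[OF _ cl]) (use a in \<open>simp add: morphism_def\<close>)
  moreover have "{x \<in> topspace (top_of ?S). a x \<in> {z \<in> Z. (f \<circ> b) z = (g \<circ> b) z}} = {x \<in> W. f x = g x}"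
    using ptsW ba morphismD(1)[OF a] by auto
  ultimately have "openin (top_of ?S) (topspace (top_of ?S) - {x \<in> W. f x = g x})"
    unfolding closedin_def by simp
  moreover have "topspace (top_of ?S) - {x \<in> W. f x = g x} = {x \<in> W. f x \<noteq> g x}"
    using ptsW by auto
  ultimately have "openin (top_of S) {x \<in> W. f x \<noteq> g x}"
    using W(1) by (auto simp: openin_open_subtopology)
  then show "\<exists>T. openin (top_of S) T \<and> u \<in> T \<and> T \<subseteq> {x \<in> U. f x \<noteq> g x}"
    using W u by (intro exI[of _ "{x \<in> W. f x \<noteq> g x}"]) auto
qed

lemma irreducible_space_Int:
  assumes T: "irreducible_space T" and U: "openin T U" "U \<noteq> {}" and V: "openin T V" "V \<noteq> {}"
  shows "U \<inter> V \<noteq> {}"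
proof
  assume UV: "U \<inter> V = {}"
  have "closedin T (topspace T - U)" "closedin T (topspace T - V)"
    using U(1) V(1) by (auto intro: openin_closedin_eq[THEN iffD1, THEN conjunct2])
  moreover have "(topspace T - U) \<union> (topspace T - V) = topspace T" using UV by auto
  ultimately have "topspace T - U = topspace T \<or> topspace T - V = topspace T"
    using T unfolding irreducible_space_def by blast
  then show False using U V openin_subset[of T U] openin_subset[of T V] by blast
qed

lemma irreducible_varietyD:
  assumes "irreducible_variety X"
  shows "prevariety X" "separated X" "irreducible_space (top_of X)" "sheaf_of_functions X" "function_space X"
    "points X \<noteq> {}"
  using assms prevarietyD(1) function_space_prevariety unfolding irreducible_variety_def irreducible_space_def by auto

section \<open>The category of dominant rational maps\<close>

lemma partial_morphismsD:
  assumes "(U, f) \<in> partial_morphisms X Y"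
  shows "openin (top_of X) U" "U \<noteq> {}" "morphism (open_subspace X U) Y f"
  using assms unfolding partial_morphisms_def by auto

lemma partial_morphismsI:
  "openin (top_of X) U \<Longrightarrow> U \<noteq> {} \<Longrightarrow> morphism (open_subspace X U) Y f \<Longrightarrow> (U, f) \<in> partial_morphisms X Y"
  unfolding partial_morphisms_def by auto

lemma partial_morphism_image:
  assumes "(U, f) \<in> partial_morphisms X Y" "x \<in> U"
  shows "f x \<in> points Y"
  using morphismD(1)[OF partial_morphismsD(3)[OF assms(1)], of x] openin_subset[OF partial_morphismsD(1)[OF assms(1)]] assms(2)
  by auto

lemma partial_morphism_preimage:
  assumes "(U, f) \<in> partial_morphisms X Y" "openin (top_of Y) V"
  shows "openin (top_of X) {x \<in> U. f x \<in> V}"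
proof -
  note U = partial_morphismsD(1)[OF assms(1)]
  have "openin (top_of (open_subspace X U)) {x \<in> points (open_subspace X U). f x \<in> V}"
    by (rule morphismD(2)[OF partial_morphismsD(3)[OF assms(1)] assms(2)])
  moreover have "{x \<in> points (open_subspace X U). f x \<in> V} = {x \<in> U. f x \<in> V}"
    using openin_subset[OF U] by auto
  ultimately show ?thesis by (simp add: openin_open_subtopology[OF U])
qed

lemma partial_morphism_restrict:
  assumes "sheaf_of_functions X" "(U, f) \<in> partial_morphisms X Y" "openin (top_of X) V" "V \<subseteq> U" "V \<noteq> {}"
  shows "(V, f) \<in> partial_morphisms X Y"
  using morphism_restrict'[OF assms(1) partial_morphismsD(1)[OF assms(2)] assms(3,4) partial_morphismsD(3)[OF assms(2)]] assms
  by (intro partial_morphismsI) auto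

lemma partial_morphism_comp:
  assumes X: "sheaf_of_functions X"
    and f: "(U, f) \<in> partial_morphisms X Y" and g: "(V, g) \<in> partial_morphisms Y Z" and ne: "{x \<in> U. f x \<in> V} \<noteq> {}"
  shows "({x \<in> U. f x \<in> V}, g \<circ> f) \<in> partial_morphisms X Z"
proof -
  let ?W = "{x \<in> U. f x \<in> V}"
  note U = partial_morphismsD(1)[OF f] and V = partial_morphismsD(1)[OF g]
  have W: "openin (top_of X) ?W" by (rule partial_morphism_preimage[OF f V])
  have "morphism (open_subspace X ?W) (open_subspace Y V) f"
    by (intro morphism_into_open_subspace morphism_restrict'[OF X U W] partial_morphismsD(3)[OF f] V) auto
  from morphism_comp[OF this partial_morphismsD(3)[OF g]] show ?thesis
    using W ne by (intro partial_morphismsI)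
qed

text \<open>The identity theorem: the locus of disagreement is open by separatedness, and if it were
  nonempty, \<open>dense\<close> would provide a point of agreement in it.\<close>

lemma partial_morphisms_agree:
  assumes X: "irreducible_variety X" and Y: "irreducible_variety Y"
    and f: "(U, f) \<in> partial_morphisms X Y" and g: "(V, g) \<in> partial_morphisms X Y"
    and dense: "\<And>W. openin (top_of X) W \<Longrightarrow> W \<noteq> {} \<Longrightarrow> W \<subseteq> U \<inter> V \<Longrightarrow> \<exists>x\<in>W. f x = g x"
    and x: "x \<in> U \<inter> V"
  shows "f x = g x"
proof (rule ccontr)
  note sX = irreducible_varietyD(4)[OF X]
  have op: "openin (top_of X) (U \<inter> V)" using partial_morphismsD(1) f g by blast
  have ne: "U \<inter> V \<noteq> {}" using x by blast
  have "openin (top_of X) {x \<in> U \<inter> V. f x \<noteq> g x}"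
    by (intro neq_locus_open[OF irreducible_varietyD(1)[OF X] irreducible_varietyD(2)[OF Y] op]
        partial_morphismsD(3)[OF partial_morphism_restrict[OF sX f op _ ne]]
        partial_morphismsD(3)[OF partial_morphism_restrict[OF sX g op _ ne]]) auto
  moreover assume "f x \<noteq> g x"
  ultimately show False using dense[of "{x \<in> U \<inter> V. f x \<noteq> g x}"] x by blast
qed

text \<open>By irreducibility W meets every nonempty open set, so agreement on W is agreement on a
  dense set.\<close>

lemma partial_morphisms_agree_open:
  assumes X: "irreducible_variety X" and Y: "irreducible_variety Y"
    and f: "(U, f) \<in> partial_morphisms X Y" and g: "(V, g) \<in> partial_morphisms X Y"
    and W: "openin (top_of X) W" "W \<noteq> {}" and eq: "\<And>x. x \<in> W \<Longrightarrow> x \<in> U \<Longrightarrow> x \<in> V \<Longrightarrow> f x = g x"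
    and x: "x \<in> U \<inter> V"
  shows "f x = g x"
proof (rule partial_morphisms_agree[OF X Y f g _ x])
  fix O' assume "openin (top_of X) O'" "O' \<noteq> {}" "O' \<subseteq> U \<inter> V"
  then show "\<exists>x\<in>O'. f x = g x"
    using irreducible_space_Int[OF irreducible_varietyD(3)[OF X], of W O'] W eq by blast
qed

section \<open>Rational maps as classes; dominance and composition\<close>

definition rational_class :: "('a, 'k) fspace \<Rightarrow> ('b, 'k) fspace \<Rightarrow> 'a set \<Rightarrow> ('a \<Rightarrow> 'b) \<Rightarrow> ('a, 'b) rational_map" where
  "rational_class X Y U f = rational_rel X Y `` {(U, f)}"

lemma mem_rational_class:
  "(V, g) \<in> rational_class X Y U f \<longleftrightarrow>
     (U, f) \<in> partial_morphisms X Y \<and> (V, g) \<in> partial_morphisms X Y \<and> (\<forall>x \<in> U \<inter> V. f x = g x)"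
  unfolding rational_class_def rational_rel_def by auto

lemma rational_class_self: "(U, f) \<in> partial_morphisms X Y \<Longrightarrow> (U, f) \<in> rational_class X Y U f"
  by (simp add: mem_rational_class)

lemma rational_class_eqI:
  fixes X :: "('a, 'k::field) fspace" and Y :: "('b, 'k) fspace"
  assumes X: "irreducible_variety X" and Y: "irreducible_variety Y"
    and f: "(U, f) \<in> partial_morphisms X Y" and g: "(V, g) \<in> partial_morphisms X Y"
    and W: "openin (top_of X) W" "W \<noteq> {}" and eq: "\<And>x. x \<in> W \<Longrightarrow> x \<in> U \<Longrightarrow> x \<in> V \<Longrightarrow> f x = g x"
  shows "rational_class X Y U f = rational_class X Y V g"
proof -
  \<comment> \<open>Transitivity of \<open>rational_rel\<close>. Comparison through f covers only
    the points of U, and the identity theorem extends the agreement to all of V \<inter> T.\<close>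
  have *: "\<forall>x \<in> V \<inter> T. g x = h x"
    if f: "(U, f) \<in> partial_morphisms X Y" and g: "(V, g) \<in> partial_morphisms X Y"
      and h: "(T, h) \<in> partial_morphisms X Y" and fg: "\<forall>x \<in> U \<inter> V. f x = g x"
      and fh: "\<forall>x \<in> U \<inter> T. f x = h x" for U f V g T h
  proof
    fix x assume "x \<in> V \<inter> T"
    then show "g x = h x"
      by (rule partial_morphisms_agree_open[OF X Y g h partial_morphismsD(1,2)[OF f], rotated]) (use fg fh in \<open>metis IntI\<close>)
  qed
  have fg: "\<forall>x \<in> U \<inter> V. f x = g x"
  proof
    fix x assume "x \<in> U \<inter> V"
    then show "f x = g x" by (rule partial_morphisms_agree_open[OF X Y f g W, rotated]) (rule eq)
  qed
  then have gf: "\<forall>x \<in> V \<inter> U. g x = f x" by auto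
  show ?thesis
  proof (rule Set.set_eqI)
    fix p :: "'a set \<times> ('a \<Rightarrow> 'b)"
    obtain T h where p: "p = (T, h)" by fastforce
    show "p \<in> rational_class X Y U f \<longleftrightarrow> p \<in> rational_class X Y V g"
      unfolding p mem_rational_class using *[OF f g _ fg] *[OF g f _ gf] f g by blast
  qed
qed

lemma rational_class_eq_iff:
  assumes X: "irreducible_variety X" and Y: "irreducible_variety Y"
    and f: "(U, f) \<in> partial_morphisms X Y" and g: "(V, g) \<in> partial_morphisms X Y"
  shows "rational_class X Y U f = rational_class X Y V g \<longleftrightarrow> (\<forall>x \<in> U \<inter> V. f x = g x)"
proof
  assume "rational_class X Y U f = rational_class X Y V g"
  then have "(V, g) \<in> rational_class X Y U f" using rational_class_self[OF g] by simp
  then show "\<forall>x \<in> U \<inter> V. f x = g x" by (simp add: mem_rational_class)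
next
  assume "\<forall>x \<in> U \<inter> V. f x = g x"
  then show "rational_class X Y U f = rational_class X Y V g"
    by (intro rational_class_eqI[OF X Y f g partial_morphismsD(1,2)[OF f]]) auto
qed

lemma rational_maps_iff:
  "\<phi> \<in> rational_maps X Y \<longleftrightarrow> (\<exists>U f. (U, f) \<in> partial_morphisms X Y \<and> \<phi> = rational_class X Y U f)"
  unfolding rational_maps_def rational_class_def quotient_def by auto

lemma closure_of_eq_points_iff:
  "A \<subseteq> topspace T \<Longrightarrow> T closure_of A = topspace T \<longleftrightarrow> (\<forall>V. openin T V \<longrightarrow> V \<noteq> {} \<longrightarrow> A \<inter> V \<noteq> {})"
  unfolding closure_of_def using openin_subset by fastforce

text \<open>Dominance in a form that composes directly, without closures.\<close>

definition dense_image :: "('b, 'k) fspace \<Rightarrow> 'a set \<Rightarrow> ('a \<Rightarrow> 'b) \<Rightarrow> bool" where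
  "dense_image Y U f \<longleftrightarrow> (\<forall>V. openin (top_of Y) V \<longrightarrow> V \<noteq> {} \<longrightarrow> (\<exists>x\<in>U. f x \<in> V))"

lemma dense_imageD: "dense_image Y U f \<Longrightarrow> openin (top_of Y) V \<Longrightarrow> V \<noteq> {} \<Longrightarrow> \<exists>x\<in>U. f x \<in> V"
  unfolding dense_image_def by blast

lemma dense_imageI:
  "(\<And>V. openin (top_of Y) V \<Longrightarrow> V \<noteq> {} \<Longrightarrow> \<exists>x\<in>U. f x \<in> V) \<Longrightarrow> dense_image Y U f"
  unfolding dense_image_def by blast

text \<open>The definition asks for one representative with dense image. Any two representatives
  agree on the overlap of their domains, which meets every nonempty open set by irreducibility, so
  all representatives have dense image together.\<close>

lemma dominant_rational_class:
  assumes X: "irreducible_variety X" and Y: "irreducible_variety Y"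
    and f: "(U, f) \<in> partial_morphisms X Y"
  shows "dominant Y (rational_class X Y U f) \<longleftrightarrow> dense_image Y U f"
    (is "?L \<longleftrightarrow> ?R")
proof -
  have D: "top_of Y closure_of (g ` V) = points Y \<longleftrightarrow> dense_image Y V g"
    if g: "(V, g) \<in> partial_morphisms X Y" for V g
    using partial_morphism_image[OF g] unfolding dense_image_def by (subst closure_of_eq_points_iff) auto
  show ?thesis
  proof
    assume ?L
    then obtain V g where g: "(V, g) \<in> rational_class X Y U f" and cl: "top_of Y closure_of (g ` V) = points Y"
      unfolding dominant_def by blast
    then have gp: "(V, g) \<in> partial_morphisms X Y" and fg: "\<forall>x \<in> U \<inter> V. f x = g x"
      by (auto simp: mem_rational_class)
    show ?R
    proof (rule dense_imageI)
      fix W assume W: "openin (top_of Y) W" "W \<noteq> {}"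
      then have "{x \<in> V. g x \<in> W} \<noteq> {}" using dense_imageD[OF D[OF gp, THEN iffD1, OF cl] W] by blast
      then have "{x \<in> V. g x \<in> W} \<inter> U \<noteq> {}"
        by (intro irreducible_space_Int[OF irreducible_varietyD(3)[OF X]] partial_morphism_preimage[OF gp W(1)]
            partial_morphismsD[OF f])
      then show "\<exists>x\<in>U. f x \<in> W" using fg by force
    qed
  next
    assume ?R
    then have "top_of Y closure_of (f ` U) = points Y" using D[OF f] by blast
    then show ?L unfolding dominant_def using rational_class_self[OF f] by blast
  qed
qed

definition dominant_maps :: "('a, 'k) fspace \<Rightarrow> ('b, 'k) fspace \<Rightarrow> ('a, 'b) rational_map set" where
  "dominant_maps X Y = {\<phi> \<in> rational_maps X Y. dominant Y \<phi>}"

lemma dominant_mapsE: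
  assumes X: "irreducible_variety X" and Y: "irreducible_variety Y" and \<phi>: "\<phi> \<in> dominant_maps X Y"
  obtains U f where "(U, f) \<in> partial_morphisms X Y" "\<phi> = rational_class X Y U f"
    "dense_image Y U f"
proof -
  obtain U f where f: "(U, f) \<in> partial_morphisms X Y" and eq: "\<phi> = rational_class X Y U f"
    using \<phi> unfolding dominant_maps_def rational_maps_iff by blast
  have "dominant Y (rational_class X Y U f)" using \<phi> eq unfolding dominant_maps_def by blast
  then have "dense_image Y U f"
    unfolding dominant_rational_class[OF X Y f] .
  then show ?thesis using that[OF f eq] by blast
qed

lemma dominant_mapsI:
  assumes X: "irreducible_variety X" and Y: "irreducible_variety Y" and f: "(U, f) \<in> partial_morphisms X Y"
    and "dense_image Y U f"
  shows "rational_class X Y U f \<in> dominant_maps X Y"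
  unfolding dominant_maps_def rational_maps_iff mem_Collect_eq dominant_rational_class[OF X Y f]
  using f assms(4) by blast

lemma dense_image_comp:
  assumes g: "(V, g) \<in> partial_morphisms Y Z" and "dense_image Y U f" "dense_image Z V g"
  shows "dense_image Z {x \<in> U. f x \<in> V} (g \<circ> f)"
proof (rule dense_imageI)
  fix W assume "openin (top_of Z) W" "W \<noteq> {}"
  then have "openin (top_of Y) {y \<in> V. g y \<in> W}" "{y \<in> V. g y \<in> W} \<noteq> {}"
    using partial_morphism_preimage[OF g] dense_imageD[OF assms(3)] by auto
  from dense_imageD[OF assms(2) this] show "\<exists>x\<in>{x \<in> U. f x \<in> V}. (g \<circ> f) x \<in> W" by auto
qed

text \<open>The composite is defined as a union over all pairs of representatives. Density of the
  image keeps every composite domain nonempty, and the overlaps then force all these classes to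
  coincide, so one pair of representatives suffices for computing.\<close>

lemma rational_comp_class:
  assumes X: "irreducible_variety X" and Y: "irreducible_variety Y" and Z: "irreducible_variety Z"
    and f: "(U, f) \<in> partial_morphisms X Y" and fd: "dense_image Y U f"
    and g: "(V, g) \<in> partial_morphisms Y Z"
  shows "({x \<in> U. f x \<in> V}, g \<circ> f) \<in> partial_morphisms X Z"
    and "rational_comp X Z (rational_class Y Z V g) (rational_class X Y U f) =
       rational_class X Z {x \<in> U. f x \<in> V} (g \<circ> f)"
proof -
  note sX = irreducible_varietyD(4)[OF X]
  have comp: "({x \<in> U'. f' x \<in> V'}, g' \<circ> f') \<in> partial_morphisms X Z"
    if f': "(U', f') \<in> rational_class X Y U f" and g': "(V', g') \<in> rational_class Y Z V g" for U' f' V' g'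
  proof -
    have p: "(U', f') \<in> partial_morphisms X Y" "(V', g') \<in> partial_morphisms Y Z" and ff: "\<forall>x \<in> U \<inter> U'. f x = f' x"
      using f' g' by (auto simp: mem_rational_class)
    have "{x \<in> U. f x \<in> V'} \<noteq> {}" using dense_imageD[OF fd partial_morphismsD(1,2)[OF p(2)]] by blast
    then have "{x \<in> U. f x \<in> V'} \<inter> U' \<noteq> {}"
      by (intro irreducible_space_Int[OF irreducible_varietyD(3)[OF X]] partial_morphism_preimage[OF f]
            partial_morphismsD[OF p(1)] partial_morphismsD[OF p(2)])
    then have "{x \<in> U'. f' x \<in> V'} \<noteq> {}" using ff by force
    then show ?thesis by (rule partial_morphism_comp[OF sX p])
  qed
  show *: "({x \<in> U. f x \<in> V}, g \<circ> f) \<in> partial_morphisms X Z"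
    by (rule comp[OF rational_class_self[OF f] rational_class_self[OF g]])
  have same: "rational_class X Z {x \<in> U'. f' x \<in> V'} (g' \<circ> f') = rational_class X Z {x \<in> U. f x \<in> V} (g \<circ> f)"
    if f': "(U', f') \<in> rational_class X Y U f" and g': "(V', g') \<in> rational_class Y Z V g" for U' f' V' g'
  proof -
    have "\<forall>x \<in> U \<inter> U'. f x = f' x" "\<forall>x \<in> V \<inter> V'. g x = g' x"
      using f' g' by (auto simp: mem_rational_class)
    then show ?thesis by (subst rational_class_eq_iff[OF X Z comp[OF f' g'] *]) auto
  qed
  have "rational_comp X Z (rational_class Y Z V g) (rational_class X Y U f) =
     (\<Union>(U', f') \<in> rational_class X Y U f. \<Union>(V', g') \<in> rational_class Y Z V g. rational_class X Z {x \<in> U'. f' x \<in> V'} (g' \<circ> f'))"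
    unfolding rational_comp_def rational_class_def ..
  also have "\<dots> = (\<Union>(U', f') \<in> rational_class X Y U f. \<Union>(V', g') \<in> rational_class Y Z V g. rational_class X Z {x \<in> U. f x \<in> V} (g \<circ> f))"
    using same by fastforce
  also have "\<dots> = rational_class X Z {x \<in> U. f x \<in> V} (g \<circ> f)"
    using rational_class_self[OF f] rational_class_self[OF g] by auto
  finally show "rational_comp X Z (rational_class Y Z V g) (rational_class X Y U f) =
       rational_class X Z {x \<in> U. f x \<in> V} (g \<circ> f)" .
qed

lemma rational_comp_dominant_maps:
  assumes X: "irreducible_variety X" and Y: "irreducible_variety Y" and Z: "irreducible_variety Z"
    and \<phi>: "\<phi> \<in> dominant_maps X Y" and \<psi>: "\<psi> \<in> dominant_maps Y Z"
  shows "rational_comp X Z \<psi> \<phi> \<in> dominant_maps X Z"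
proof -
  obtain U f where f: "(U, f) \<in> partial_morphisms X Y" "\<phi> = rational_class X Y U f"
    and fd: "dense_image Y U f"
    using dominant_mapsE[OF X Y \<phi>] by metis
  obtain V g where g: "(V, g) \<in> partial_morphisms Y Z" "\<psi> = rational_class Y Z V g"
    and gd: "dense_image Z V g"
    using dominant_mapsE[OF Y Z \<psi>] by metis
  show ?thesis unfolding f(2) g(2) rational_comp_class(2)[OF X Y Z f(1) fd g(1)]
    by (rule dominant_mapsI[OF X Z rational_comp_class(1)[OF X Y Z f(1) fd g(1)] dense_image_comp[OF g(1) fd gd]])
qed

lemma rational_comp_assoc:
  assumes X: "irreducible_variety X" and Y: "irreducible_variety Y" and Z: "irreducible_variety Z"
    and T: "irreducible_variety T"
    and \<phi>: "\<phi> \<in> dominant_maps X Y" and \<psi>: "\<psi> \<in> dominant_maps Y Z" and \<chi>: "\<chi> \<in> dominant_maps Z T"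
  shows "rational_comp X T (rational_comp Y T \<chi> \<psi>) \<phi> = rational_comp X T \<chi> (rational_comp X Z \<psi> \<phi>)"
proof -
  obtain U f where f: "(U, f) \<in> partial_morphisms X Y" "\<phi> = rational_class X Y U f"
    and fd: "dense_image Y U f"
    using dominant_mapsE[OF X Y \<phi>] by metis
  obtain V g where g: "(V, g) \<in> partial_morphisms Y Z" "\<psi> = rational_class Y Z V g"
    and gd: "dense_image Z V g"
    using dominant_mapsE[OF Y Z \<psi>] by metis
  obtain W h where h: "(W, h) \<in> partial_morphisms Z T" "\<chi> = rational_class Z T W h"
    using dominant_mapsE[OF Z T \<chi>] by metis
  note gf = rational_comp_class[OF X Y Z f(1) fd g(1)] and hg = rational_comp_class[OF Y Z T g(1) gd h(1)]
  note gfd = dense_image_comp[OF g(1) fd gd]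
  have "{x \<in> U. f x \<in> {y \<in> V. g y \<in> W}} = {x \<in> {x \<in> U. f x \<in> V}. (g \<circ> f) x \<in> W}" by auto
  then show ?thesis
    unfolding f(2) g(2) h(2) gf(2) hg(2) rational_comp_class(2)[OF X Y T f(1) fd hg(1)] rational_comp_class(2)[OF X Z T gf(1) gfd h(1)]
    by (simp add: o_assoc)
qed

lemma partial_morphism_id:
  assumes "irreducible_variety X"
  shows "(points X, \<lambda>x. x) \<in> partial_morphisms X X"
  using irreducible_varietyD(6)[OF assms]
  by (intro partial_morphismsI morphism_restrict morphism_id irreducible_varietyD(4) assms) auto

lemma rational_id_class: "rational_id X = rational_class X X (points X) (\<lambda>x. x)"
  unfolding rational_id_def rational_class_def ..

lemma dense_image_id: "dense_image X (points X) (\<lambda>x. x)"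
  by (rule dense_imageI) (use openin_subset in blast)

lemma rational_id_dominant:
  assumes X: "irreducible_variety X"
  shows "rational_id X \<in> dominant_maps X X"
  unfolding rational_id_class
  by (rule dominant_mapsI[OF X X partial_morphism_id[OF X] dense_image_id])

lemma rational_comp_id:
  assumes X: "irreducible_variety X" and Y: "irreducible_variety Y" and \<phi>: "\<phi> \<in> dominant_maps X Y"
  shows "rational_comp X Y \<phi> (rational_id X) = \<phi>" "rational_comp X Y (rational_id Y) \<phi> = \<phi>"
proof -
  obtain U f where f: "(U, f) \<in> partial_morphisms X Y" "\<phi> = rational_class X Y U f"
    and fd: "dense_image Y U f"
    using dominant_mapsE[OF X Y \<phi>] by metis
  have "{x \<in> points X. x \<in> U} = U" using openin_subset[OF partial_morphismsD(1)[OF f(1)]] by auto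
  then show "rational_comp X Y \<phi> (rational_id X) = \<phi>"
    unfolding f(2) rational_id_class rational_comp_class(2)[OF X X Y partial_morphism_id[OF X] dense_image_id f(1)]
    by (simp add: o_def)
  have "{x \<in> U. f x \<in> points Y} = U" using partial_morphism_image[OF f(1)] by auto
  then show "rational_comp X Y (rational_id Y) \<phi> = \<phi>"
    unfolding f(2) rational_id_class rational_comp_class(2)[OF X Y Y f(1) fd partial_morphism_id[OF Y]]
    by (simp add: o_def)
qed

section \<open>Birational maps, the group Bir, and transport of actions\<close>

lemma mutually_inverse_iff:
  "mutually_inverse X Y \<phi> \<psi> \<longleftrightarrow> \<phi> \<in> dominant_maps X Y \<and> \<psi> \<in> dominant_maps Y X \<and>
     rational_comp X X \<psi> \<phi> = rational_id X \<and> rational_comp Y Y \<phi> \<psi> = rational_id Y"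
  unfolding mutually_inverse_def dominant_maps_def by auto

lemma mutually_inverse_sym: "mutually_inverse X Y \<phi> \<psi> \<Longrightarrow> mutually_inverse Y X \<psi> \<phi>"
  unfolding mutually_inverse_iff by blast

lemma mutually_inverse_comp:
  assumes X: "irreducible_variety X" and Y: "irreducible_variety Y" and Z: "irreducible_variety Z"
    and \<phi>: "mutually_inverse X Y \<phi> \<phi>'" and \<psi>: "mutually_inverse Y Z \<psi> \<psi>'"
  shows "mutually_inverse X Z (rational_comp X Z \<psi> \<phi>) (rational_comp Z X \<phi>' \<psi>')"
proof -
  note a = \<phi>[unfolded mutually_inverse_iff] and b = \<psi>[unfolded mutually_inverse_iff]
  note comp = rational_comp_dominant_maps
  have "rational_comp X X (rational_comp Z X \<phi>' \<psi>') (rational_comp X Z \<psi> \<phi>) =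
        rational_comp X X \<phi>' (rational_comp X Y \<psi>' (rational_comp X Z \<psi> \<phi>))"
    using a b comp[OF X Y Z] by (intro rational_comp_assoc[OF X Z Y X]) auto
  also have "rational_comp X Y \<psi>' (rational_comp X Z \<psi> \<phi>) = rational_comp X Y (rational_comp Y Y \<psi>' \<psi>) \<phi>"
    using a b by (intro rational_comp_assoc[OF X Y Z Y, symmetric]) auto
  finally have 1: "rational_comp X X (rational_comp Z X \<phi>' \<psi>') (rational_comp X Z \<psi> \<phi>) = rational_id X"
    using a b rational_comp_id[OF X Y] by simp
  have "rational_comp Z Z (rational_comp X Z \<psi> \<phi>) (rational_comp Z X \<phi>' \<psi>') =
        rational_comp Z Z \<psi> (rational_comp Z Y \<phi> (rational_comp Z X \<phi>' \<psi>'))"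
    using a b comp[OF Z Y X] by (intro rational_comp_assoc[OF Z X Y Z]) auto
  also have "rational_comp Z Y \<phi> (rational_comp Z X \<phi>' \<psi>') = rational_comp Z Y (rational_comp Y Y \<phi> \<phi>') \<psi>'"
    using a b by (intro rational_comp_assoc[OF Z Y X Y, symmetric]) auto
  finally have 2: "rational_comp Z Z (rational_comp X Z \<psi> \<phi>) (rational_comp Z X \<phi>' \<psi>') = rational_id Z"
    using a b rational_comp_id[OF Z Y] by simp
  show ?thesis unfolding mutually_inverse_iff using 1 2 a b comp[OF X Y Z] comp[OF Z Y X] by auto
qed

lemma carrier_Bir: "\<phi> \<in> carrier (Bir X) \<longleftrightarrow> birational X X \<phi>"
  by (simp add: Bir_def)

lemma mult_Bir: "\<phi> \<otimes>\<^bsub>Bir X\<^esub> \<psi> = rational_comp X X \<phi> \<psi>"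
  by (simp add: Bir_def)

lemma one_Bir: "\<one>\<^bsub>Bir X\<^esub> = rational_id X"
  by (simp add: Bir_def)

lemma birational_dominant: "birational X Y \<phi> \<Longrightarrow> \<phi> \<in> dominant_maps X Y"
  unfolding birational_def mutually_inverse_iff by blast

lemma group_Bir:
  assumes X: "irreducible_variety X"
  shows "group (Bir X)"
proof (rule groupI)
  fix \<phi> \<psi> assume "\<phi> \<in> carrier (Bir X)" "\<psi> \<in> carrier (Bir X)"
  then show "\<phi> \<otimes>\<^bsub>Bir X\<^esub> \<psi> \<in> carrier (Bir X)"
    unfolding carrier_Bir birational_def mult_Bir using mutually_inverse_comp[OF X X X] by blast
next
  have "mutually_inverse X X (rational_id X) (rational_id X)"
    unfolding mutually_inverse_iff using rational_comp_id[OF X X rational_id_dominant[OF X]] rational_id_dominant[OF X] by blast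
  then show "\<one>\<^bsub>Bir X\<^esub> \<in> carrier (Bir X)" unfolding carrier_Bir one_Bir birational_def by blast
next
  fix \<phi> \<psi> \<chi> assume "\<phi> \<in> carrier (Bir X)" "\<psi> \<in> carrier (Bir X)" "\<chi> \<in> carrier (Bir X)"
  then show "\<phi> \<otimes>\<^bsub>Bir X\<^esub> \<psi> \<otimes>\<^bsub>Bir X\<^esub> \<chi> = \<phi> \<otimes>\<^bsub>Bir X\<^esub> (\<psi> \<otimes>\<^bsub>Bir X\<^esub> \<chi>)"
    unfolding carrier_Bir mult_Bir by (intro rational_comp_assoc[OF X X X X] birational_dominant)
next
  fix \<phi> assume "\<phi> \<in> carrier (Bir X)"
  then have \<phi>: "birational X X \<phi>" unfolding carrier_Bir .
  show "\<one>\<^bsub>Bir X\<^esub> \<otimes>\<^bsub>Bir X\<^esub> \<phi> = \<phi>"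
    unfolding mult_Bir one_Bir by (rule rational_comp_id(2)[OF X X birational_dominant[OF \<phi>]])
  show "\<exists>\<psi>\<in>carrier (Bir X). \<psi> \<otimes>\<^bsub>Bir X\<^esub> \<phi> = \<one>\<^bsub>Bir X\<^esub>"
  proof -
    obtain \<psi> where \<psi>: "mutually_inverse X X \<phi> \<psi>" using \<phi> unfolding birational_def by blast
    then have "birational X X \<psi>" using mutually_inverse_sym unfolding birational_def by blast
    then show ?thesis using \<psi> unfolding carrier_Bir[symmetric] mult_Bir one_Bir mutually_inverse_iff by blast
  qed
qed

text \<open>Conjugation by a birational map. Associativity is available only for dominant maps, so
  every regrouping has to carry the dominance of its factors.\<close>

lemma transport_hom:
  assumes X: "irreducible_variety X" and Y: "irreducible_variety Y" and inv: "mutually_inverse X Y \<psi> \<psi>'"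
    and \<rho>: "\<rho> \<in> mon H (Bir X)" and H: "group H"
  shows "(\<lambda>h. rational_comp Y Y \<psi> (rational_comp Y X (\<rho> h) \<psi>')) \<in> mon H (Bir Y)"
proof -
  note a = inv[unfolded mutually_inverse_iff]
  note compXX = rational_comp_dominant_maps
  let ?r = "\<lambda>h. rational_comp Y Y \<psi> (rational_comp Y X (\<rho> h) \<psi>')"
  have hom: "\<rho> \<in> hom H (Bir X)" and inj: "inj_on \<rho> (carrier H)" using \<rho> by (auto simp: mon_def)
  have bir: "birational X X (\<rho> h)" if "h \<in> carrier H" for h
    using hom that carrier_Bir by (auto simp: hom_def)
  have dom: "\<rho> h \<in> dominant_maps X X" if "h \<in> carrier H" for h using birational_dominant[OF bir[OF that]] .
  have domr: "rational_comp Y X (\<rho> h) \<psi>' \<in> dominant_maps Y X" if "h \<in> carrier H" for h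
    using a dom[OF that] by (intro rational_comp_dominant_maps[OF Y X X]) auto
  have carr: "?r h \<in> carrier (Bir Y)" if h: "h \<in> carrier H" for h
  proof -
    obtain \<chi> where "mutually_inverse X X (\<rho> h) \<chi>" using bir[OF h] unfolding birational_def by blast
    from mutually_inverse_comp[OF Y X Y mutually_inverse_comp[OF Y X X mutually_inverse_sym[OF inv] this] inv]
    show ?thesis unfolding carrier_Bir birational_def by blast
  qed
  \<comment> \<open>This relation between the two actions is what makes the multiplication law and
    injectivity follow without expanding the conjugates.\<close>
  have intertwine: "rational_comp X Y (?r h) \<psi> = rational_comp X Y \<psi> (\<rho> h)" if h: "h \<in> carrier H" for h
  proof -
    have "rational_comp X Y (?r h) \<psi> = rational_comp X Y \<psi> (rational_comp X X (rational_comp Y X (\<rho> h) \<psi>') \<psi>)"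
      using a domr[OF h] by (intro rational_comp_assoc[OF X Y X Y]) auto
    also have "rational_comp X X (rational_comp Y X (\<rho> h) \<psi>') \<psi> = rational_comp X X (\<rho> h) (rational_comp X X \<psi>' \<psi>)"
      using a dom[OF h] by (intro rational_comp_assoc[OF X Y X X]) auto
    also have "\<dots> = \<rho> h" using a rational_comp_id[OF X X dom[OF h]] by simp
    finally show ?thesis .
  qed
  have cancel: "rational_comp X X \<psi>' (rational_comp X Y \<psi> (\<rho> h)) = \<rho> h" if h: "h \<in> carrier H" for h
  proof -
    have "rational_comp X X \<psi>' (rational_comp X Y \<psi> (\<rho> h)) = rational_comp X X (rational_comp X X \<psi>' \<psi>) (\<rho> h)"
      using a dom[OF h] by (intro rational_comp_assoc[OF X X Y X, symmetric]) auto
    then show ?thesis using a rational_comp_id[OF X X dom[OF h]] by simp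
  qed
  have "inj_on ?r (carrier H)"
  proof (rule inj_onI)
    fix h k assume h: "h \<in> carrier H" and k: "k \<in> carrier H" and "?r h = ?r k"
    then have "rational_comp X Y \<psi> (\<rho> h) = rational_comp X Y \<psi> (\<rho> k)"
      by (metis intertwine[OF h] intertwine[OF k])
    then have "\<rho> h = \<rho> k" by (metis cancel[OF h] cancel[OF k])
    then show "h = k" by (rule inj_onD[OF inj _ h k])
  qed
  moreover have "?r (h \<otimes>\<^bsub>H\<^esub> k) = ?r h \<otimes>\<^bsub>Bir Y\<^esub> ?r k" if h: "h \<in> carrier H" and k: "k \<in> carrier H" for h k
  proof -
    have hk: "\<rho> (h \<otimes>\<^bsub>H\<^esub> k) = rational_comp X X (\<rho> h) (\<rho> k)"
      using hom h k by (auto simp: hom_def mult_Bir)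
    have hr: "?r h \<in> dominant_maps Y Y" using carr[OF h] birational_dominant unfolding carrier_Bir by blast
    have "rational_comp Y Y (?r h) (?r k) = rational_comp Y Y (rational_comp X Y (?r h) \<psi>) (rational_comp Y X (\<rho> k) \<psi>')"
      using a domr[OF k] hr by (intro rational_comp_assoc[OF Y X Y Y, symmetric]) auto
    also have "\<dots> = rational_comp Y Y \<psi> (rational_comp Y X (\<rho> h) (rational_comp Y X (\<rho> k) \<psi>'))"
      unfolding intertwine[OF h] using a domr[OF k] dom[OF h] by (intro rational_comp_assoc[OF Y X X Y]) auto
    also have "rational_comp Y X (\<rho> h) (rational_comp Y X (\<rho> k) \<psi>') = rational_comp Y X (\<rho> (h \<otimes>\<^bsub>H\<^esub> k)) \<psi>'"
      unfolding hk using a dom h k by (intro rational_comp_assoc[OF Y X X X, symmetric]) auto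
    finally show ?thesis by (simp add: mult_Bir)
  qed
  ultimately show ?thesis using carr unfolding mon_def hom_def by auto
qed

lemma transport_compression:
  assumes W: "irreducible_variety W" and X: "irreducible_variety X" and Y: "irreducible_variety Y"
    and inv: "mutually_inverse X Y \<psi> \<psi>'" and comp: "compression H W \<rho>\<^sub>1 X \<rho>\<^sub>2 \<phi>"
  shows "compression H W \<rho>\<^sub>1 Y (\<lambda>h. rational_comp Y Y \<psi> (rational_comp Y X (\<rho>\<^sub>2 h) \<psi>')) (rational_comp W Y \<psi> \<phi>)"
proof -
  note a = inv[unfolded mutually_inverse_iff]
  have H: "group H" "finite (carrier H)" and r1: "rational_action H W \<rho>\<^sub>1" and r1m: "\<rho>\<^sub>1 \<in> mon H (Bir W)" and r2: "\<rho>\<^sub>2 \<in> mon H (Bir X)"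
    and \<phi>: "\<phi> \<in> dominant_maps W X"
    and eqv: "\<And>h. h \<in> carrier H \<Longrightarrow> rational_comp W X \<phi> (\<rho>\<^sub>1 h) = rational_comp W X (\<rho>\<^sub>2 h) \<phi>"
    using comp unfolding compression_def rational_action_def dominant_maps_def by auto
  let ?r = "\<lambda>h. rational_comp Y Y \<psi> (rational_comp Y X (\<rho>\<^sub>2 h) \<psi>')"
  have r: "?r \<in> mon H (Bir Y)" by (rule transport_hom[OF X Y inv r2 H(1)])
  have d: "\<rho>\<^sub>1 h \<in> dominant_maps W W" "\<rho>\<^sub>2 h \<in> dominant_maps X X" if "h \<in> carrier H" for h
    using that r1m r2 birational_dominant[of W W "\<rho>\<^sub>1 h"] birational_dominant[of X X "\<rho>\<^sub>2 h"]
      carrier_Bir[of "\<rho>\<^sub>1 h" W] carrier_Bir[of "\<rho>\<^sub>2 h" X] by (auto simp: mon_def hom_def)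
  have d2: "rational_comp W Y \<psi> \<phi> \<in> dominant_maps W Y" using a \<phi> by (intro rational_comp_dominant_maps[OF W X Y]) auto
  have "rational_comp W Y (rational_comp W Y \<psi> \<phi>) (\<rho>\<^sub>1 h) = rational_comp W Y (?r h) (rational_comp W Y \<psi> \<phi>)"
    if h: "h \<in> carrier H" for h
  proof -
    have dY: "rational_comp Y X (\<rho>\<^sub>2 h) \<psi>' \<in> dominant_maps Y X"
      using a d[OF h] by (intro rational_comp_dominant_maps[OF Y X X]) auto
    have "rational_comp W Y (?r h) (rational_comp W Y \<psi> \<phi>) = rational_comp W Y \<psi> (rational_comp W X (rational_comp Y X (\<rho>\<^sub>2 h) \<psi>') (rational_comp W Y \<psi> \<phi>))"
      using a dY d2 by (intro rational_comp_assoc[OF W Y X Y]) auto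
    also have "rational_comp W X (rational_comp Y X (\<rho>\<^sub>2 h) \<psi>') (rational_comp W Y \<psi> \<phi>) =
        rational_comp W X (\<rho>\<^sub>2 h) (rational_comp W X \<psi>' (rational_comp W Y \<psi> \<phi>))"
      using a d[OF h] d2 by (intro rational_comp_assoc[OF W Y X X]) auto
    also have "rational_comp W X \<psi>' (rational_comp W Y \<psi> \<phi>) = rational_comp W X (rational_comp X X \<psi>' \<psi>) \<phi>"
      using a \<phi> by (intro rational_comp_assoc[OF W X Y X, symmetric]) auto
    also have "\<dots> = \<phi>" using a rational_comp_id[OF W X \<phi>] by simp
    also have "rational_comp W X (\<rho>\<^sub>2 h) \<phi> = rational_comp W X \<phi> (\<rho>\<^sub>1 h)" using eqv[OF h] by simp
    also have "rational_comp W Y \<psi> (rational_comp W X \<phi> (\<rho>\<^sub>1 h)) = rational_comp W Y (rational_comp W Y \<psi> \<phi>) (\<rho>\<^sub>1 h)"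
      using a \<phi> d[OF h] by (intro rational_comp_assoc[OF W W X Y, symmetric]) auto
    finally show ?thesis by simp
  qed
  then show ?thesis unfolding compression_def rational_action_def
    using H r1m r d2 unfolding dominant_maps_def by auto
qed

section \<open>The projective line\<close>

declare One_nat_def [simp del]

definition vec2 :: "'k \<Rightarrow> 'k \<Rightarrow> nat \<Rightarrow> 'k::field" where
  "vec2 a b = (\<lambda>i. if i = 0 then a else if i = 1 then b else 0)"

abbreviation pt :: "'k::field \<Rightarrow> 'k \<Rightarrow> 'k proj_point" where
  "pt a b \<equiv> proj_class (vec2 a b)"

lemma vec2_simps [simp]: "vec2 a b 0 = a" "vec2 a b (Suc 0) = b" "vec2 a b 1 = b"
  by (simp_all add: vec2_def One_nat_def)

lemma vec2_eq_iff [simp]: "vec2 a b = vec2 c d \<longleftrightarrow> a = c \<and> b = d"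
  by (metis vec2_simps)

lemma scale_vec2: "(\<lambda>i. c * vec2 a b i) = vec2 (c * a) (c * b)"
  by (auto simp: vec2_def)

lemma homogeneous_coords_1_iff: "x \<in> homogeneous_coords 1 \<longleftrightarrow> (\<exists>a b. x = vec2 a b \<and> (a \<noteq> 0 \<or> b \<noteq> 0))"
proof
  assume x: "x \<in> homogeneous_coords 1"
  have "x i = vec2 (x 0) (x 1) i" for i
    using x by (cases "i = 0"; cases "i = 1") (auto simp: vec2_def homogeneous_coords_def affine_points_def)
  then have eq: "x = vec2 (x 0) (x 1)" by (rule ext)
  have "vec2 0 0 = (\<lambda>i. 0 :: 'a)" by (auto simp: vec2_def)
  then have "x 0 \<noteq> 0 \<or> x 1 \<noteq> 0" using eq x by (auto simp: homogeneous_coords_def)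
  then show "\<exists>a b. x = vec2 a b \<and> (a \<noteq> 0 \<or> b \<noteq> 0)" using eq by blast
next
  assume "\<exists>a b. x = vec2 a b \<and> (a \<noteq> 0 \<or> b \<noteq> 0)"
  then obtain a b where x: "x = vec2 a b" "a \<noteq> 0 \<or> b \<noteq> 0" by blast
  then have "x \<in> affine_points (Suc 1)" by (auto simp: affine_points_def vec2_def)
  moreover have "x \<noteq> (\<lambda>i. 0)" using x by (metis vec2_simps)
  ultimately show "x \<in> homogeneous_coords 1" by (simp add: homogeneous_coords_def)
qed

lemma vec2_coords: "a \<noteq> 0 \<or> b \<noteq> 0 \<Longrightarrow> vec2 a b \<in> homogeneous_coords 1"
  using homogeneous_coords_1_iff by blast

lemma points_P1: "points (projective_space 1) = {pt a b | a b. a \<noteq> 0 \<or> b \<noteq> 0}"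
  using homogeneous_coords_1_iff by (auto simp: image_iff) metis+

lemma P1_pointE:
  assumes "p \<in> points (projective_space 1)"
  obtains a b where "p = pt a b" "a \<noteq> 0 \<or> b \<noteq> 0"
  using assms unfolding points_P1 by blast

lemma openin_points_P1 [simp]: "openin (projective_topology n) (proj_class ` homogeneous_coords n)"
  using openin_topspace[of "projective_topology n"] unfolding topspace_projective .

lemma pt_mem: "a \<noteq> 0 \<or> b \<noteq> 0 \<Longrightarrow> pt a b \<in> points (projective_space 1)"
  unfolding points_P1 by blast

lemma pt_eq_iff:
  assumes "a \<noteq> 0 \<or> b \<noteq> 0" "c \<noteq> 0 \<or> d \<noteq> 0"
  shows "pt a b = pt c d \<longleftrightarrow> a * d = b * c"
proof
  assume "pt a b = pt c d"
  then obtain e where "vec2 c d = vec2 (e * a) (e * b)"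
    using proj_class_eqD[of "vec2 a b" "vec2 c d"] unfolding scale_vec2 by blast
  then show "a * d = b * c" by simp
next
  assume eq: "a * d = b * c"
  show "pt a b = pt c d"
  proof (cases "a = 0")
    case True
    then have "c = 0" "b \<noteq> 0" "d \<noteq> 0" using eq assms by auto
    then show ?thesis using True proj_class_scale[of "d / b" "vec2 a b"] unfolding scale_vec2 by simp
  next
    case False
    then have "c \<noteq> 0" "d = c / a * b" using eq assms by (auto simp: field_simps)
    then show ?thesis using False proj_class_scale[of "c / a" "vec2 a b"] unfolding scale_vec2 by simp
  qed
qed

lemma pt_scale: "c \<noteq> 0 \<Longrightarrow> pt (c * a) (c * b) = pt a b"
  using proj_class_scale[of c "vec2 a b"] unfolding scale_vec2 .

section \<open>Binary forms and univariate polynomials\<close>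

lemma homogeneous_scale: "p \<in> homogeneous m d \<Longrightarrow> p (vec2 (c * a) (c * b)) = c ^ d * p (vec2 a b)"
  unfolding homogeneous_def scale_vec2[symmetric] by blast

text \<open>Applied to the lines (x, 1) and (1, y), this turns a binary form into two univariate
  polynomials, one for each chart.\<close>

lemma poly_function_curve:
  assumes "p \<in> poly_functions 2"
  shows "\<exists>A. \<forall>x. p (vec2 (poly e x) (poly f x)) = poly A x"
  using assms
proof induction
  case (const c)
  show ?case by (intro exI[of _ "[:c:]"]) simp
next
  case (coord i)
  then have "i = 0 \<or> i = 1" by auto
  then show ?case by (auto intro: exI[of _ e] exI[of _ f])
next
  case (add p q)
  then obtain A B where "\<forall>x. p (vec2 (poly e x) (poly f x)) = poly A x" "\<forall>x. q (vec2 (poly e x) (poly f x)) = poly B x"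
    by blast
  then show ?case by (intro exI[of _ "A + B"]) simp
next
  case (mult p q)
  then obtain A B where "\<forall>x. p (vec2 (poly e x) (poly f x)) = poly A x" "\<forall>x. q (vec2 (poly e x) (poly f x)) = poly B x"
    by blast
  then show ?case by (intro exI[of _ "A * B"]) simp
qed

lemma poly_eq_0_of_cofinite:
  fixes A :: "'k::field_char_0 poly"
  assumes "finite {x. poly A x \<noteq> 0}"
  shows "A = 0"
proof (rule ccontr)
  assume "A \<noteq> 0"
  then have "finite ({x. poly A x = 0} \<union> {x. poly A x \<noteq> 0})" using poly_roots_finite assms by auto
  moreover have "{x. poly A x = 0} \<union> {x. poly A x \<noteq> 0} = UNIV" by auto
  ultimately show False using infinite_UNIV_char_0[where 'a = 'k] by simp
qed

text \<open>Forms are known only through their scaling law, so the degree bound has to be extracted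
  from it. The restrictions A(x) = p(x, 1) and B(y) = p(1, y) satisfy y^d A(1/y) = B(y); comparing
  this with the reflected polynomial of A at y = 0 bounds the degree and identifies the value at
  infinity.\<close>

lemma homogeneous_dehomogenize:
  fixes p :: "(nat \<Rightarrow> 'k::field_char_0) \<Rightarrow> 'k"
  assumes p: "p \<in> homogeneous 2 d"
  obtains A where "degree A \<le> d" "\<And>x. p (vec2 x 1) = poly A x" "p (vec2 1 0) = coeff A d"
    "\<And>a b. b \<noteq> 0 \<Longrightarrow> p (vec2 a b) = b ^ d * poly A (a / b)" "\<And>a. p (vec2 a 0) = a ^ d * coeff A d"
proof -
  have pf: "p \<in> poly_functions 2" using p by (simp add: homogeneous_def)
  obtain A where A: "\<And>x. p (vec2 x 1) = poly A x"
    using poly_function_curve[OF pf, of "[:0, 1:]" "[:1:]"] by auto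
  obtain B where B: "\<And>y. p (vec2 1 y) = poly B y"
    using poly_function_curve[OF pf, of "[:1:]" "[:0, 1:]"] by auto
  have sc: "p (vec2 a b) = b ^ d * poly A (a / b)" if "b \<noteq> 0" for a b
    using homogeneous_scale[OF p, of b "a / b" 1] A that by simp
  have AB: "y ^ d * poly A (1 / y) = poly B y" if "y \<noteq> 0" for y
    using sc[OF that, of 1] B by simp
  define n where "n = degree A"
  have refl: "poly (reflect_poly A) y = y ^ n * poly A (1 / y)" if "y \<noteq> 0" for y
    using poly_reflect_poly_nz[OF that, of A] by (simp add: n_def inverse_eq_divide)
  \<comment> \<open>If n > d, the reflected polynomial would be y^(n - d) B(y) and vanish at 0, but
    its constant term is the leading coefficient of A.\<close>
  have deg: "n \<le> d"
  proof (rule ccontr)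
    assume nd: "\<not> n \<le> d"
    have "poly (reflect_poly A - monom 1 (n - d) * B) y = 0" if "y \<noteq> 0" for y
    proof -
      have "y ^ n = y ^ (n - d) * y ^ d" using nd by (simp add: power_add[symmetric])
      then show ?thesis using refl[OF that] AB[OF that] by (simp add: poly_monom algebra_simps)
    qed
    then have "{y. poly (reflect_poly A - monom 1 (n - d) * B) y \<noteq> 0} \<subseteq> {0}" by blast
    then have "reflect_poly A - monom 1 (n - d) * B = 0"
      by (intro poly_eq_0_of_cofinite finite_subset[OF _ finite.insertI[OF finite.emptyI]])
    then have "poly (reflect_poly A) 0 = poly (monom 1 (n - d) * B) 0" by simp
    then have "lead_coeff A = 0" using nd by (simp add: poly_monom)
    then show False using nd n_def by simp
  qed
  have "poly (B - monom 1 (d - n) * reflect_poly A) y = 0" if "y \<noteq> 0" for y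
  proof -
    have "y ^ d = y ^ (d - n) * y ^ n" using deg by (simp add: power_add[symmetric])
    then show ?thesis using refl[OF that] AB[OF that] by (simp add: poly_monom algebra_simps)
  qed
  then have "{y. poly (B - monom 1 (d - n) * reflect_poly A) y \<noteq> 0} \<subseteq> {0}" by blast
  then have "B - monom 1 (d - n) * reflect_poly A = 0"
    by (intro poly_eq_0_of_cofinite finite_subset[OF _ finite.insertI[OF finite.emptyI]])
  then have "poly B 0 = poly (monom 1 (d - n) * reflect_poly A) 0" by simp
  also have "\<dots> = coeff A d"
  proof (cases "d = n")
    case True then show ?thesis by (simp add: n_def)
  next
    case False
    then have "n < d" using deg by simp
    then show ?thesis using coeff_eq_0[of A d] by (simp add: n_def poly_monom)
  qed
  finally have c: "p (vec2 1 0) = coeff A d" using B by simp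
  have "p (vec2 a 0) = a ^ d * coeff A d" for a
    using homogeneous_scale[OF p, of a 1 0] c by simp
  then show thesis using that[of A] deg A c sc unfolding n_def by blast
qed

lemma homogeneous_sum:
  assumes "\<And>i. i \<in> I \<Longrightarrow> p i \<in> homogeneous m d" "finite I"
  shows "(\<lambda>x. \<Sum>i\<in>I. p i x) \<in> homogeneous m d"
  using assms(2,1)
proof (induction I)
  case empty
  have "(\<lambda>x. 0) \<in> homogeneous m d" unfolding homogeneous_def by (auto intro: poly_functions.const)
  then show ?case by simp
next
  case (insert i I)
  then have "(\<lambda>x. p i x + (\<Sum>i\<in>I. p i x)) \<in> homogeneous m d" by (intro homogeneous_add) auto
  then show ?case using insert by simp
qed

lemma homogeneous_power: "p \<in> homogeneous m d \<Longrightarrow> (\<lambda>x. p x ^ n) \<in> homogeneous m (n * d)"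
proof (induction n)
  case 0 show ?case using homogeneous_const[of 1 m] by simp
next
  case (Suc n) then show ?case using homogeneous_mult[of p m d "\<lambda>x. p x ^ n" "n * d"] by simp
qed

lemma homogeneous_cmult: "p \<in> homogeneous m d \<Longrightarrow> (\<lambda>x. c * p x) \<in> homogeneous m d"
  using homogeneous_mult[OF homogeneous_const[of c m], of p d] by simp

lemma homogeneous_linear: "(\<lambda>x. a * x 0 + b * x (Suc 0)) \<in> homogeneous 2 (Suc 0)"
  by (intro homogeneous_add homogeneous_cmult homogeneous_coord) auto

definition homogenize :: "nat \<Rightarrow> 'k::field poly \<Rightarrow> (nat \<Rightarrow> 'k) \<Rightarrow> 'k" where
  "homogenize d A x = (\<Sum>i\<le>d. coeff A i * (x 0 ^ i * x (Suc 0) ^ (d - i)))"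

lemma homogenize_homogeneous: "homogenize d A \<in> homogeneous 2 d"
proof -
  have "(\<lambda>x. coeff A i * (x 0 ^ i * x (Suc 0) ^ (d - i))) \<in> homogeneous 2 d" if "i \<le> d" for i
  proof -
    have "(\<lambda>x. coeff A i * (x 0 ^ i * x (Suc 0) ^ (d - i))) \<in> homogeneous 2 (i * Suc 0 + (d - i) * Suc 0)"
      by (intro homogeneous_cmult homogeneous_mult homogeneous_power homogeneous_coord) auto
    then show ?thesis using that by simp
  qed
  then show ?thesis unfolding homogenize_def[abs_def] by (intro homogeneous_sum) auto
qed

lemma homogenize_affine: "degree A \<le> d \<Longrightarrow> homogenize d A (vec2 x 1) = poly A x"
  unfolding homogenize_def poly_altdef by (auto intro!: sum.mono_neutral_right coeff_eq_0 simp: not_le mult.commute)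

lemma homogenize_infinity: "homogenize d A (vec2 1 0) = coeff A d"
proof -
  have "homogenize d A (vec2 1 0) = (\<Sum>i\<le>d. if i = d then coeff A i else 0)"
    unfolding homogenize_def by (intro sum.cong) auto
  then show ?thesis by simp
qed

text \<open>A form that is not identically zero has finitely many zeros on the line, counting
  infinity; conversely a product of linear forms vanishes exactly on a prescribed finite set. The
  Zariski topology is therefore the cofinite one.\<close>

lemma openin_P1_iff:
  fixes U :: "'k::field_char_0 proj_point set"
  shows "openin (projective_topology 1) U \<longleftrightarrow>
    U = {} \<or> (U \<subseteq> points (projective_space 1 :: ('k proj_point, 'k) fspace) \<and> finite (points (projective_space 1 :: ('k proj_point, 'k) fspace) - U))"
    (is "_ \<longleftrightarrow> ?C U")
proof
  let ?P = "points (projective_space 1 :: ('k proj_point, 'k) fspace)"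
  assume "openin (projective_topology 1) U"
  then have "generate_topology_on {proj_class ` {x \<in> homogeneous_coords 1. p x \<noteq> 0} | p d. p \<in> homogeneous (Suc 1) d} U"
    unfolding projective_topology_def by (rule openin_topology_generated_by)
  then show "?C U"
  proof induction
    case (Int a b)
    then show ?case by (auto simp: Diff_Int)
  next
    case (UN K)
    show ?case
    proof (cases "\<exists>k\<in>K. k \<noteq> {}")
      case True
      then obtain k where k: "k \<in> K" "k \<noteq> {}" by blast
      have "finite (?P - \<Union>K)" by (rule finite_subset[of _ "?P - k"]) (use UN[OF k(1)] k in auto)
      then show ?thesis using UN by blast
    qed auto
  next
    case (Basis s)
    then obtain p d where s: "s = proj_class ` {x \<in> homogeneous_coords 1. p x \<noteq> 0}" and p: "p \<in> homogeneous 2 d"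
      by auto
    obtain A where A: "\<And>x. p (vec2 x 1) = poly A x" "\<And>a b. b \<noteq> 0 \<Longrightarrow> p (vec2 a b) = b ^ d * poly A (a / b)"
      "\<And>a. p (vec2 a 0) = a ^ d * coeff A d"
      using homogeneous_dehomogenize[OF p] by metis
    show ?case
    proof (cases "A = 0")
      case True
      then have "p (vec2 a b) = 0" for a b using A(2)[of b a] A(3)[of a] by (cases "b = 0") auto
      then have "s = {}" unfolding s homogeneous_coords_1_iff by auto
      then show ?thesis by blast
    next
      case False
      have "?P - s \<subseteq> insert (pt 1 0) ((\<lambda>x. pt x 1) ` {x. poly A x = 0})"
      proof
        fix P assume P: "P \<in> ?P - s"
        then obtain a b where ab: "P = pt a b" "a \<noteq> 0 \<or> b \<noteq> 0" using points_P1 by blast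
        show "P \<in> insert (pt 1 0) ((\<lambda>x. pt x 1) ` {x. poly A x = 0})"
        proof (cases "b = 0")
          case True then show ?thesis using ab pt_eq_iff[of a b 1 0] by simp
        next
          case b: False
          have eq: "P = pt (a / b) 1" using ab b pt_eq_iff[of a b "a / b" 1] by simp
          have "p (vec2 (a / b) 1) = 0"
            using P vec2_coords[of "a / b" 1] unfolding s eq by auto
          then show ?thesis using eq A(1) by auto
        qed
      qed
      moreover have "finite (insert (pt 1 0) ((\<lambda>x. pt x 1) ` {x. poly A x = 0}))"
        using poly_roots_finite[OF False] by simp
      ultimately show ?thesis using s by (auto intro: finite_subset)
    qed
  qed auto
next
  let ?P = "points (projective_space 1 :: ('k proj_point, 'k) fspace)"
  assume U: "?C U"
  have ex: "\<exists>p d. p \<in> homogeneous 2 d \<and> (\<forall>x \<in> homogeneous_coords 1. p x = 0 \<longleftrightarrow> proj_class x \<in> F)"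
    if "finite F" "F \<subseteq> ?P" for F :: "'k proj_point set"
    using that
  proof induction
    case empty
    show ?case using homogeneous_const[of 1 2] by (intro exI[of _ "\<lambda>x. 1"]) auto
  next
    case (insert P F)
    then obtain p d where p: "p \<in> homogeneous 2 d" "\<And>x. x \<in> homogeneous_coords 1 \<Longrightarrow> p x = 0 \<longleftrightarrow> proj_class x \<in> F"
      by auto
    obtain a b where ab: "P = pt a b" "a \<noteq> 0 \<or> b \<noteq> 0" using insert.prems points_P1 by blast
    let ?l = "\<lambda>x. b * x 0 + (- a) * x (Suc 0)"
    have "?l x = 0 \<longleftrightarrow> proj_class x = P" if x: "x \<in> homogeneous_coords 1" for x
    proof -
      obtain c d where "x = vec2 c d" "c \<noteq> 0 \<or> d \<noteq> 0" using x homogeneous_coords_1_iff by blast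
      then show ?thesis using ab pt_eq_iff[of c d a b] by (auto simp: algebra_simps)
    qed
    then show ?case using p homogeneous_mult[OF homogeneous_linear p(1), of b "- a"]
      by (intro exI[of _ "\<lambda>x. ?l x * p x"] exI[of _ "Suc 0 + d"]) auto
  qed
  show "openin (projective_topology 1) U"
  proof (cases "U = {}")
    case False
    then have U: "U \<subseteq> ?P" "finite (?P - U)" using U by auto
    then obtain p d where p: "p \<in> homogeneous 2 d" "\<forall>x \<in> homogeneous_coords 1. p x = 0 \<longleftrightarrow> proj_class x \<in> ?P - U"
      using ex[of "?P - U"] by auto
    have "proj_class ` {x \<in> homogeneous_coords 1. p x \<noteq> 0} = U"
      using p(2) U(1) by auto
    then show ?thesis using openin_projective_basic[of p 1 d] p(1) by simp
  qed simp
qed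

section \<open>Charts, separatedness and irreducibility of the line\<close>

lemma inj_affine_chart: "inj (\<lambda>x::'k::field. pt x 1)"
  by (rule injI) (simp add: pt_eq_iff)

lemma infinite_points_P1: "infinite (points (projective_space 1 :: ('k::field_char_0 proj_point, 'k) fspace))"
proof
  assume "finite (points (projective_space 1 :: ('k proj_point, 'k) fspace))"
  moreover have "range (\<lambda>x::'k. pt x 1) \<subseteq> points (projective_space 1 :: ('k proj_point, 'k) fspace)"
    by (intro image_subsetI pt_mem) simp
  ultimately have "finite (range (\<lambda>x::'k. pt x 1))" by (rule rev_finite_subset)
  then show False using finite_imageD[OF _ inj_affine_chart] infinite_UNIV_char_0 by blast
qed

text \<open>A function on projective points must choose a representative vector; equal degrees of m
  and l make the choice harmless. With x / 0 = 0 the formula persists where l vanishes.\<close>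

lemma ratio_regular:
  fixes m l :: "(nat \<Rightarrow> 'k::field) \<Rightarrow> 'k"
  assumes m: "m \<in> homogeneous (Suc n) d" and l: "l \<in> homogeneous (Suc n) d"
  shows "\<exists>h \<in> regular (projective_space n) (proj_class ` {x \<in> homogeneous_coords n. l x \<noteq> 0}).
    \<forall>x \<in> homogeneous_coords n. h (proj_class x) = m x / l x"
proof -
  define h where "h P = (let x = (SOME x. x \<in> homogeneous_coords n \<and> proj_class x = P) in m x / l x)" for P
  have h: "h (proj_class x) = m x / l x" if x: "x \<in> homogeneous_coords n" for x
  proof -
    define y where "y = (SOME y. y \<in> homogeneous_coords n \<and> proj_class y = proj_class x)"
    have "y \<in> homogeneous_coords n \<and> proj_class y = proj_class x"
      unfolding y_def by (rule someI[of _ x]) (use x in simp)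
    then obtain c where "c \<noteq> 0" "x = (\<lambda>i. c * y i)" using proj_class_eqD[of y x] by auto
    then have "m x / l x = m y / l y" using m l by (auto simp: homogeneous_def)
    then show ?thesis unfolding h_def y_def[symmetric] Let_def by simp
  qed
  let ?D = "proj_class ` {x \<in> homogeneous_coords n. l x \<noteq> 0}"
  have "h \<in> regular (projective_space n) ?D"
    unfolding regular_projective_space
  proof
    fix P assume "P \<in> ?D"
    moreover have "\<forall>x \<in> homogeneous_coords n. proj_class x \<in> ?D \<longrightarrow> l x \<noteq> 0 \<and> h (proj_class x) = m x / l x"
      using h projective_basic_mem[OF l] by blast
    ultimately show "\<exists>V. openin (projective_topology n) V \<and> P \<in> V \<and> V \<subseteq> ?D \<and>
        (\<exists>d. \<exists>p \<in> homogeneous (Suc n) d. \<exists>q \<in> homogeneous (Suc n) d.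
           \<forall>x \<in> homogeneous_coords n. proj_class x \<in> V \<longrightarrow> q x \<noteq> 0 \<and> h (proj_class x) = p x / q x)"
      using openin_projective_basic[OF l] m l by blast
  qed
  then show ?thesis using h by blast
qed

text \<open>The Boolean selects one of the two standard charts, so arguments on charts are made
  once; \<open>True\<close> is the chart that omits infinity.\<close>

definition chart_coords :: "bool \<Rightarrow> 'k::field \<Rightarrow> nat \<Rightarrow> 'k" where
  "chart_coords s t = (if s then vec2 t 1 else vec2 1 t)"

definition chart_domain :: "bool \<Rightarrow> 'k::field proj_point set" where
  "chart_domain s = proj_class ` {x \<in> homogeneous_coords 1. x (if s then Suc 0 else 0) \<noteq> 0}"

lemma chart_coords_mem: "chart_coords s t \<in> homogeneous_coords 1"
  unfolding chart_coords_def by (auto intro: vec2_coords)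

lemma chart_coords_domain: "proj_class (chart_coords s t) \<in> chart_domain s"
  unfolding chart_domain_def using chart_coords_mem[of s t] by (auto simp: chart_coords_def)

lemma openin_chart_domain: "openin (projective_topology 1) (chart_domain s)"
  unfolding chart_domain_def by (rule openin_projective_basic[OF homogeneous_coord]) auto

lemma chart_domain_cover: "chart_domain True \<union> chart_domain False = points (projective_space 1 :: ('k::field proj_point, 'k) fspace)"
proof -
  have "x (Suc 0) \<noteq> 0 \<or> x 0 \<noteq> 0" if "x \<in> homogeneous_coords 1" for x :: "nat \<Rightarrow> 'k"
    using that unfolding homogeneous_coords_1_iff by auto
  then show ?thesis unfolding chart_domain_def by auto
qed

lemma chart_coordinate:
  obtains h :: "'k::field proj_point \<Rightarrow> 'k" where "h \<in> regular (projective_space 1) (chart_domain s)"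
    "\<And>t. h (proj_class (chart_coords s t)) = t"
    "\<And>P. P \<in> chart_domain s \<Longrightarrow> P = proj_class (chart_coords s (h P))"
proof -
  let ?j = "if s then Suc 0 else 0" and ?i = "if s then 0 else Suc 0"
  have "(\<lambda>x :: nat \<Rightarrow> 'k. x ?i) \<in> homogeneous (Suc 1) (Suc 0)" "(\<lambda>x :: nat \<Rightarrow> 'k. x ?j) \<in> homogeneous (Suc 1) (Suc 0)"
    by (rule homogeneous_coord; simp)+
  from ratio_regular[OF this]
  obtain h :: "'k proj_point \<Rightarrow> 'k" where h: "h \<in> regular (projective_space 1) (chart_domain s)"
    and eq: "\<And>x. x \<in> homogeneous_coords 1 \<Longrightarrow> h (proj_class x) = x ?i / x ?j"
    unfolding chart_domain_def by blast
  have "h (proj_class (chart_coords s t)) = t" for t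
    using eq[OF chart_coords_mem, of s t] by (auto simp: chart_coords_def)
  moreover have "P = proj_class (chart_coords s (h P))" if P: "P \<in> chart_domain s" for P
  proof -
    obtain x where x: "x \<in> homogeneous_coords 1" "P = proj_class x" "x ?j \<noteq> 0" using P unfolding chart_domain_def by blast
    then obtain a b where ab: "x = vec2 a b" "a \<noteq> 0 \<or> b \<noteq> 0" using homogeneous_coords_1_iff by blast
    show ?thesis using x eq[OF x(1)] ab by (cases s) (auto simp: chart_coords_def pt_eq_iff)
  qed
  ultimately show thesis using that h by blast
qed

lemma chart_isomorphic:
  "isomorphic (open_subspace (projective_space 1) (chart_domain s)) (affine_variety 1 (affine_points 1 :: (nat \<Rightarrow> 'k::field) set))"
proof -
  let ?P = "projective_space 1 :: ('k proj_point, 'k) fspace" and ?A = "affine_variety 1 (affine_points 1 :: (nat \<Rightarrow> 'k) set)"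
  obtain h :: "'k proj_point \<Rightarrow> 'k" where h: "h \<in> regular ?P (chart_domain s)"
    "\<And>t. h (proj_class (chart_coords s t)) = t" "\<And>P. P \<in> chart_domain s \<Longrightarrow> P = proj_class (chart_coords s (h P))"
    using chart_coordinate[of s] by metis
  have D: "openin (top_of ?P) (chart_domain s)" using openin_chart_domain by simp
  have pts: "points (open_subspace ?P (chart_domain s)) = chart_domain s"
    using openin_subset[OF D] by auto
  define a where "a P = (\<lambda>i::nat. if i = 0 then h P else 0)" for P
  define b where "b z = proj_class (chart_coords s (z 0))" for z :: "nat \<Rightarrow> 'k"
  have "morphism (open_subspace ?P (chart_domain s)) ?A a"
  proof (rule morphism_to_affine)
    show "function_space (open_subspace ?P (chart_domain s))"
      by (rule function_space_open_subspace[OF function_space_projective D])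
    fix i :: nat assume "i < 1"
    then show "(\<lambda>x. a x i) \<in> regular (open_subspace ?P (chart_domain s)) (points (open_subspace ?P (chart_domain s)))"
      unfolding pts using h(1) by (simp add: a_def)
  qed (auto simp: a_def affine_points_def)
  moreover have "morphism ?A ?P b" unfolding b_def
  proof (rule morphism_to_projective[OF function_space_affine_variety])
    fix i :: nat assume "i < Suc 1"
    have "(\<lambda>z. z 0) \<in> poly_functions 1" "(\<lambda>z. 1) \<in> poly_functions 1" by (intro poly_functions.intros; simp)+
    then have "(\<lambda>z. chart_coords s (z 0) i) \<in> poly_functions 1"
      using \<open>i < Suc 1\<close> by (cases "i = 0"; cases s) (auto simp: chart_coords_def vec2_def)
    then show "(\<lambda>z. chart_coords s (z 0) i) \<in> regular ?A (points ?A)"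
      by (rule poly_function_regular) (rule openin_topspace)
  qed (rule chart_coords_mem)
  then have "morphism ?A (open_subspace ?P (chart_domain s)) b"
    by (rule morphism_into_open_subspace[OF _ D]) (simp add: b_def chart_coords_domain)
  moreover have "b (a P) = P" if "P \<in> chart_domain s" for P using h(3)[OF that] by (simp add: a_def b_def)
  moreover have "a (b z) = z" if "z \<in> points ?A" for z
    using that by (auto simp: a_def b_def h(2) affine_points_def)
  ultimately show ?thesis unfolding isomorphic_def pts by blast
qed

text \<open>Two distinct points of the line lie in a common affine chart, the complement of the zero
  of a linear form nonvanishing at both. A coordinate on this chart separates them, and the
  difference of its pullbacks is a regular function that is nonzero near u.\<close>

lemma neq_locus_open_P1:
  fixes S :: "('a, 'k::field) fspace"
  assumes S: "function_space S" and f: "morphism S (projective_space 1) f" and g: "morphism S (projective_space 1) g"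
  shows "openin (top_of S) {x \<in> points S. f x \<noteq> g x}"
proof (subst openin_subopen, intro ballI)
  let ?P = "projective_space 1 :: ('k proj_point, 'k) fspace"
  fix u assume "u \<in> {x \<in> points S. f x \<noteq> g x}"
  then have u: "u \<in> points S" "f u \<noteq> g u" by auto
  obtain a b where ab: "f u = pt a b" "a \<noteq> 0 \<or> b \<noteq> 0" using morphismD(1)[OF f u(1)] points_P1 by blast
  obtain c d where cd: "g u = pt c d" "c \<noteq> 0 \<or> d \<noteq> 0" using morphismD(1)[OF g u(1)] points_P1 by blast
  define D where "D = a * d - b * c"
  have D: "D \<noteq> 0" using u(2) ab cd pt_eq_iff[of a b c d] by (simp add: D_def)
  \<comment> \<open>By Cramer's rule \<open>?l\<close> takes the value 1 at both (a, b) and (c, d),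
    while \<open>?m\<close> is 0 at the first and - D at the second.\<close>
  let ?l = "\<lambda>x. (d - b) / D * x 0 + (a - c) / D * x (Suc 0)" and ?m = "\<lambda>x. b * x 0 + (- a) * x (Suc 0)"
  have l: "?l \<in> homogeneous (Suc 1) (Suc 0)" and m: "?m \<in> homogeneous (Suc 1) (Suc 0)"
    using homogeneous_linear[of "(d - b) / D" "(a - c) / D"] homogeneous_linear[of b "- a"] by (simp_all only: Suc_1)
  let ?D = "proj_class ` {x \<in> homogeneous_coords 1. ?l x \<noteq> 0}"
  obtain h where h: "h \<in> regular ?P ?D" "\<And>x. x \<in> homogeneous_coords 1 \<Longrightarrow> h (proj_class x) = ?m x / ?l x"
    using ratio_regular[OF m l] by blast
  have "openin (top_of ?P) ?D" using openin_projective_basic[OF l] by simp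
  note fD = morphismD(2,3)[OF f this] and gD = morphismD(2,3)[OF g this]
  let ?W = "{x \<in> points S. f x \<in> ?D} \<inter> {x \<in> points S. g x \<in> ?D}"
  have W: "openin (top_of S) ?W" using fD(1) gD(1) by (rule openin_Int)
  have "(\<lambda>x. h (f x)) \<in> regular S ?W" "(\<lambda>x. h (g x)) \<in> regular S ?W"
    by (rule sheaf_restrict[OF function_spaceD(1)[OF S] fD(1) W _ fD(2)[OF h(1)]]; blast)
       (rule sheaf_restrict[OF function_spaceD(1)[OF S] gD(1) W _ gD(2)[OF h(1)]]; blast)
  then have "(\<lambda>x. h (f x) - h (g x)) \<in> regular S ?W" by (rule function_space_diff[OF S W])
  then have "openin (top_of S) {x \<in> ?W. h (f x) - h (g x) \<noteq> 0}" by (rule function_spaceD(5)[OF S W])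
  moreover have "{x \<in> ?W. h (f x) - h (g x) \<noteq> 0} \<subseteq> {x \<in> points S. f x \<noteq> g x}" by auto
  moreover have "u \<in> {x \<in> ?W. h (f x) - h (g x) \<noteq> 0}"
  proof -
    have l1: "?l (vec2 a b) = 1" "?l (vec2 c d) = 1" using D by (simp_all add: D_def divide_simps) (simp_all add: algebra_simps)
    have "h (f u) = 0" using h(2)[OF vec2_coords[OF ab(2)]] ab(1) by simp
    moreover have "h (g u) = - D" using h(2)[OF vec2_coords[OF cd(2)]] unfolding cd(1) l1(2) by (simp add: D_def)
    moreover have "f u \<in> ?D" "g u \<in> ?D" using l1 ab cd vec2_coords by (metis (mono_tags, lifting) image_eqI mem_Collect_eq zero_neq_one)+
    ultimately show ?thesis using u(1) D by simp
  qed
  ultimately show "\<exists>T. openin (top_of S) T \<and> u \<in> T \<and> T \<subseteq> {x \<in> points S. f x \<noteq> g x}" by blast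
qed

text \<open>The two charts give the affine cover. Irreducibility holds because proper closed sets
  are finite and the line is infinite.\<close>

lemma irreducible_variety_P1: "irreducible_variety (projective_space 1 :: ('k::field_char_0 proj_point, 'k) fspace)"
  unfolding irreducible_variety_def
proof (intro conjI)
  let ?P = "projective_space 1 :: ('k proj_point, 'k) fspace"
  have alg: "algebraic_set 1 (affine_points 1 :: (nat \<Rightarrow> 'k) set)" unfolding algebraic_set_def by auto
  show "prevariety ?P" unfolding prevariety_def
  proof (intro conjI exI[of _ "{chart_domain True, chart_domain False}"] ballI)
    fix U assume "U \<in> {chart_domain True, chart_domain False :: 'k proj_point set}"
    then obtain s where U: "U = chart_domain s" by blast
    show "openin (top_of ?P) U" using openin_chart_domain U by simp
    show "\<exists>n Z. algebraic_set n Z \<and> isomorphic (open_subspace ?P U) (affine_variety n Z)"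
      using alg chart_isomorphic[of s] U by blast
  qed (use function_spaceD(1)[OF function_space_projective] chart_domain_cover in auto)
  show "separated ?P" unfolding separated_def
  proof (intro allI impI)
    fix n and Z :: "(nat \<Rightarrow> 'k) set" and f g
    assume Z: "algebraic_set n Z" and f: "morphism (affine_variety n Z) ?P f" and g: "morphism (affine_variety n Z) ?P g"
    let ?A = "affine_variety n Z"
    have pts: "points ?A = Z" using algebraic_set_subset[OF Z] by auto
    have "openin (top_of ?A) {x \<in> points ?A. f x \<noteq> g x}"
      by (rule neq_locus_open_P1[OF function_space_affine_variety f g])
    moreover have "{x \<in> points ?A. f x \<noteq> g x} = points ?A - {z \<in> Z. f z = g z}" unfolding pts by auto
    ultimately show "closedin (top_of ?A) {z \<in> Z. f z = g z}"
      unfolding closedin_def using pts by auto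
  qed
  show "irreducible_space (top_of ?P)" unfolding irreducible_space_def
  proof (intro conjI allI impI)
    show "points ?P \<noteq> {}" using infinite_points_P1 by (metis finite.emptyI)
    fix A B assume A: "closedin (top_of ?P) A" and B: "closedin (top_of ?P) B" and AB: "A \<union> B = points ?P"
    have fin: "finite C \<or> C = points ?P" if "closedin (top_of ?P) C" for C
    proof -
      have "C \<subseteq> points ?P" and "openin (projective_topology 1) (points ?P - C)" using that unfolding closedin_def by auto
      then show ?thesis unfolding openin_P1_iff by (auto simp: double_diff)
    qed
    show "A = points ?P \<or> B = points ?P"
      using fin[OF A] fin[OF B] AB infinite_points_P1[where 'k = 'k] by (metis finite_UnI)
  qed
qed

section \<open>Rational self-maps of the projective line\<close>

text \<open>Coordinates of a self-map of the line. Excluding common zeros makes d the true degree of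
  the map and not just a bound, which the degree arguments below rely on.\<close>

definition homogeneous_pair :: "nat \<Rightarrow> ((nat \<Rightarrow> 'k::field) \<Rightarrow> 'k) \<Rightarrow> ((nat \<Rightarrow> 'k) \<Rightarrow> 'k) \<Rightarrow> bool" where
  "homogeneous_pair d P Q \<longleftrightarrow> P \<in> homogeneous 2 d \<and> Q \<in> homogeneous 2 d \<and>
     (\<forall>a b. a \<noteq> 0 \<or> b \<noteq> 0 \<longrightarrow> P (vec2 a b) \<noteq> 0 \<or> Q (vec2 a b) \<noteq> 0)"

definition pair_map :: "((nat \<Rightarrow> 'k::field) \<Rightarrow> 'k) \<Rightarrow> ((nat \<Rightarrow> 'k) \<Rightarrow> 'k) \<Rightarrow> 'k proj_point \<Rightarrow> 'k proj_point" where
  "pair_map P Q p = (let x = (SOME x. x \<in> homogeneous_coords 1 \<and> proj_class x = p) in pt (P x) (Q x))"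

abbreviation PL :: "('k::field proj_point, 'k) fspace" where "PL \<equiv> projective_space 1"

lemma pair_map_pt:
  assumes PQ: "homogeneous_pair d P Q" and ab: "a \<noteq> 0 \<or> b \<noteq> 0"
  shows "pair_map P Q (pt a b) = pt (P (vec2 a b)) (Q (vec2 a b))"
proof -
  define y where "y = (SOME y. y \<in> homogeneous_coords 1 \<and> proj_class y = pt a b)"
  have "y \<in> homogeneous_coords 1 \<and> proj_class y = pt a b"
    unfolding y_def by (rule someI[of _ "vec2 a b"]) (use vec2_coords[OF ab] in simp)
  then obtain c where c: "c \<noteq> 0" "y = (\<lambda>i. c * vec2 a b i)" using proj_class_eqD[of "vec2 a b" y] by auto
  then have y: "y = vec2 (c * a) (c * b)" by (simp add: scale_vec2)
  have "P y = c ^ d * P (vec2 a b)" "Q y = c ^ d * Q (vec2 a b)"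
    using PQ homogeneous_scale[of P 2 d c a b] homogeneous_scale[of Q 2 d c a b] unfolding homogeneous_pair_def y by auto
  then have "pt (P y) (Q y) = pt (P (vec2 a b)) (Q (vec2 a b))" using pt_scale[of "c ^ d"] c(1) by simp
  then show ?thesis unfolding pair_map_def y_def[symmetric] Let_def .
qed

text \<open>On a chart both forms are divided by the d-th power of the coordinate that does not
  vanish there; this makes them regular functions without changing the point they describe.\<close>

lemma pair_map_morphism:
  fixes P Q :: "(nat \<Rightarrow> 'k::field) \<Rightarrow> 'k"
  assumes PQ: "homogeneous_pair d P Q"
  shows "morphism PL PL (pair_map P Q)"
proof (rule morphism_local[OF function_spaceD(1)[OF function_space_projective]])
  let ?P = "PL :: ('k proj_point, 'k) fspace"
  fix p :: "'k proj_point" assume "p \<in> points PL"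
  then obtain s where s: "p \<in> chart_domain s" using chart_domain_cover by blast
  let ?j = "if s then Suc 0 else 0"
  have D: "openin (top_of ?P) (chart_domain s)" using openin_chart_domain by simp
  have pts: "points (open_subspace ?P (chart_domain s)) = chart_domain s"
    using openin_subset[OF D] by auto
  have fs: "function_space (open_subspace ?P (chart_domain s))"
    by (rule function_space_open_subspace[OF function_space_projective D])
  have hP: "P \<in> homogeneous (Suc 1) d" "Q \<in> homogeneous (Suc 1) d" using PQ by (auto simp: homogeneous_pair_def)
  have "(\<lambda>x. x ?j) \<in> homogeneous (Suc 1) (Suc 0)" by (rule homogeneous_coord) simp
  from homogeneous_power[OF this, of d] have l: "(\<lambda>x. x ?j ^ d) \<in> homogeneous (Suc 1) d" by simp
  have sub: "chart_domain s \<subseteq> proj_class ` {x \<in> homogeneous_coords 1. x ?j ^ d \<noteq> 0}"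
    unfolding chart_domain_def by auto
  have ratio: "\<exists>h \<in> regular ?P (chart_domain s). \<forall>x \<in> homogeneous_coords 1. h (proj_class x) = m x / x ?j ^ d"
    if m: "m \<in> homogeneous (Suc 1) d" for m
  proof -
    obtain h where h: "h \<in> regular ?P (proj_class ` {x \<in> homogeneous_coords 1. x ?j ^ d \<noteq> 0})"
      "\<forall>x \<in> homogeneous_coords 1. h (proj_class x) = m x / x ?j ^ d"
      using ratio_regular[OF m l] by blast
    have "h \<in> regular ?P (chart_domain s)"
      by (rule sheaf_restrict[OF function_spaceD(1)[OF function_space_projective] _ D sub h(1)])
         (use openin_projective_basic[OF l] in simp)
    then show ?thesis using h(2) by blast
  qed
  obtain u where u: "u \<in> regular ?P (chart_domain s)" "\<And>x. x \<in> homogeneous_coords 1 \<Longrightarrow> u (proj_class x) = P x / x ?j ^ d"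
    using ratio[OF hP(1)] by blast
  obtain v where v: "v \<in> regular ?P (chart_domain s)" "\<And>x. x \<in> homogeneous_coords 1 \<Longrightarrow> v (proj_class x) = Q x / x ?j ^ d"
    using ratio[OF hP(2)] by blast
  have val: "(u p \<noteq> 0 \<or> v p \<noteq> 0) \<and> pt (u p) (v p) = pair_map P Q p" if p: "p \<in> chart_domain s" for p
  proof -
    obtain x where x: "x \<in> homogeneous_coords 1" "p = proj_class x" "x ?j \<noteq> 0" using p unfolding chart_domain_def by blast
    then obtain a b where ab: "x = vec2 a b" "a \<noteq> 0 \<or> b \<noteq> 0" using homogeneous_coords_1_iff by blast
    let ?c = "inverse (x ?j ^ d)"
    have eq: "u p = ?c * P x" "v p = ?c * Q x" using u(2)[OF x(1)] v(2)[OF x(1)] x(2) by (simp_all add: field_simps)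
    have c: "?c \<noteq> 0" using x(3) by simp
    have "P x \<noteq> 0 \<or> Q x \<noteq> 0" using PQ ab unfolding homogeneous_pair_def by auto
    moreover have "pair_map P Q p = pt (P x) (Q x)" unfolding x(2) ab(1) by (rule pair_map_pt[OF PQ ab(2)])
    ultimately show ?thesis using c pt_scale[OF c, of "P x" "Q x"] unfolding eq by auto
  qed
  have "morphism (open_subspace ?P (chart_domain s)) ?P (\<lambda>p. pt (u p) (v p))"
  proof (rule morphism_to_projective[OF fs])
    fix i :: nat assume "i < Suc 1"
    then have "i = 0 \<or> i = 1" by auto
    then show "(\<lambda>p. vec2 (u p) (v p) i) \<in> regular (open_subspace ?P (chart_domain s)) (points (open_subspace ?P (chart_domain s)))"
      unfolding pts using u(1) v(1) by auto
  qed (unfold pts, use val vec2_coords in blast)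
  then have "morphism (open_subspace ?P (chart_domain s)) ?P (pair_map P Q)"
    by (rule morphism_cong[OF function_spaceD(1)[OF fs]]) (unfold pts, use val in blast)
  then show "\<exists>U. openin (top_of ?P) U \<and> p \<in> U \<and> morphism (open_subspace ?P U) ?P (pair_map P Q)"
    using D s by blast
qed

lemma pair_map_partial_morphism:
  fixes P Q :: "(nat \<Rightarrow> 'k::field_char_0) \<Rightarrow> 'k"
  assumes "homogeneous_pair d P Q"
  shows "(points PL, pair_map P Q) \<in> partial_morphisms PL PL"
proof (rule partial_morphismsI)
  show "points (PL :: ('k proj_point, 'k) fspace) \<noteq> {}" by (rule irreducible_varietyD(6)[OF irreducible_variety_P1])
  show "morphism (open_subspace PL (points PL)) PL (pair_map P Q)"
    by (rule morphism_restrict[OF function_spaceD(1)[OF function_space_projective] _ pair_map_morphism[OF assms]]) simp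
qed simp

abbreviation pair_class :: "((nat \<Rightarrow> 'k::field) \<Rightarrow> 'k) \<Rightarrow> ((nat \<Rightarrow> 'k) \<Rightarrow> 'k) \<Rightarrow> ('k proj_point, 'k proj_point) rational_map" where
  "pair_class P Q \<equiv> rational_class PL PL (points PL) (pair_map P Q)"

lemma finite_not_in_open_P1:
  fixes U :: "'k::field_char_0 proj_point set"
  assumes "openin (top_of PL) U" "U \<noteq> {}"
  shows "finite {x. pt x 1 \<notin> U}"
proof -
  have "finite (points (PL :: ('k proj_point, 'k) fspace) - U)" using assms unfolding top_of_projective_space openin_P1_iff by blast
  moreover have "(\<lambda>x. pt x 1) ` {x. pt x 1 \<notin> U} \<subseteq> points (PL :: ('k proj_point, 'k) fspace) - U"
    using pt_mem[of _ 1] by auto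
  ultimately have "finite ((\<lambda>x. pt x 1) ` {x. pt x 1 \<notin> U})" by (rule rev_finite_subset)
  then show ?thesis by (rule finite_imageD) (rule inj_on_subset[OF inj_affine_chart], simp)
qed

lemma cofinite_affine_open:
  fixes E :: "'k::field_char_0 set"
  assumes "finite (- E)"
  shows "openin (top_of PL) ((\<lambda>x. pt x 1) ` E)" "(\<lambda>x. pt x 1) ` E \<noteq> {}"
proof -
  let ?P = "points (PL :: ('k proj_point, 'k) fspace)"
  have "?P - (\<lambda>x. pt x 1) ` E \<subseteq> insert (pt 1 0) ((\<lambda>x. pt x 1) ` (- E))"
  proof
    fix P assume P: "P \<in> ?P - (\<lambda>x. pt x 1) ` E"
    then obtain a b where ab: "P = pt a b" "a \<noteq> 0 \<or> b \<noteq> 0" using P1_pointE[of P] by blast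
    show "P \<in> insert (pt 1 0) ((\<lambda>x. pt x 1) ` (- E))"
    proof (cases "b = 0")
      case True then show ?thesis using ab pt_eq_iff[of a b 1 0] by simp
    next
      case b: False
      have eq: "P = pt (a / b) 1" using ab b pt_eq_iff[of a b "a / b" 1] by simp
      then show ?thesis using P by auto
    qed
  qed
  then have "finite (?P - (\<lambda>x. pt x 1) ` E)" using assms by (auto intro: finite_subset)
  moreover have "(\<lambda>x. pt x 1) ` E \<subseteq> ?P" by (intro image_subsetI pt_mem) simp
  ultimately show "openin (top_of PL) ((\<lambda>x. pt x 1) ` E)" unfolding top_of_projective_space openin_P1_iff by blast
  have "E \<noteq> {}" using assms infinite_UNIV_char_0[where 'a = 'k] by auto
  then show "(\<lambda>x. pt x 1) ` E \<noteq> {}" by blast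
qed

lemma homogeneous_pair_homogenize:
  fixes A B :: "'k::field poly"
  assumes deg: "degree A \<le> e" "degree B \<le> e" and root: "\<And>x. poly A x \<noteq> 0 \<or> poly B x \<noteq> 0"
    and inf: "coeff A e \<noteq> 0 \<or> coeff B e \<noteq> 0"
  shows "homogeneous_pair e (homogenize e A) (homogenize e B)"
  unfolding homogeneous_pair_def
proof (intro conjI allI impI homogenize_homogeneous)
  fix a b :: 'k assume ab: "a \<noteq> 0 \<or> b \<noteq> 0"
  show "homogenize e A (vec2 a b) \<noteq> 0 \<or> homogenize e B (vec2 a b) \<noteq> 0"
  proof (cases "b = 0")
    case True
    then have "homogenize e C (vec2 a b) = a ^ e * coeff C e" for C
      using homogeneous_scale[OF homogenize_homogeneous[of e C], of a 1 0] homogenize_infinity[of e C] by simp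
    then show ?thesis using inf ab True by simp
  next
    case False
    then have "homogenize e C (vec2 a b) = b ^ e * poly C (a / b)" if "degree C \<le> e" for C
      using homogeneous_scale[OF homogenize_homogeneous[of e C], of b "a / b" 1] homogenize_affine[OF that] by simp
    then show ?thesis using root[of "a / b"] False deg by simp
  qed
qed

text \<open>
  In lowest terms a fraction of polynomials extends to all of the projective line, so rational
  maps of the line are everywhere defined.
\<close>

lemma pair_class_of_fraction:
  fixes f :: "'k::field_char_0 proj_point \<Rightarrow> 'k proj_point"
  assumes f: "(U, f) \<in> partial_morphisms PL PL"
    and frac: "finite {x. \<not> ((poly A x \<noteq> 0 \<or> poly B x \<noteq> 0) \<and> f (pt x 1) = pt (poly A x) (poly B x))}"
  shows "\<exists>d P Q. homogeneous_pair d P Q \<and> rational_class PL PL U f = pair_class P Q"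
proof -
  \<comment> \<open>A fraction is allowed to be wrong at finitely many points, so factors can be
    cancelled freely. Minimality of e then excludes common zeros, both at finite points and at
    infinity.\<close>
  define R where "R e A B \<longleftrightarrow> degree A \<le> e \<and> degree B \<le> e \<and>
     finite {x. \<not> ((poly A x \<noteq> 0 \<or> poly B x \<noteq> 0) \<and> f (pt x 1) = pt (poly A x) (poly B x))}" for e :: nat and A B
  have "R (max (degree A) (degree B)) A B" using frac unfolding R_def by auto
  then obtain e where e: "\<exists>A B. R e A B" and min: "\<And>e' A B. e' < e \<Longrightarrow> \<not> R e' A B"
    using exists_least_iff[of "\<lambda>e. \<exists>A B. R e A B"] by auto
  then obtain A B where AB: "R e A B" by blast
  then have deg: "degree A \<le> e" "degree B \<le> e"
    and fin: "finite {x. \<not> ((poly A x \<noteq> 0 \<or> poly B x \<noteq> 0) \<and> f (pt x 1) = pt (poly A x) (poly B x))}"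
    (is "finite ?N") unfolding R_def by auto
  have nz: "A \<noteq> 0 \<or> B \<noteq> 0"
  proof (rule ccontr)
    assume "\<not> (A \<noteq> 0 \<or> B \<noteq> 0)"
    then have "?N = UNIV" by auto
    then show False using fin infinite_UNIV_char_0[where 'a = 'k] by simp
  qed
  \<comment> \<open>Two vanishing coefficients in degree e would be a common zero at infinity, and e
    could be lowered.\<close>
  have inf: "coeff A e \<noteq> 0 \<or> coeff B e \<noteq> 0"
  proof (rule ccontr)
    assume c: "\<not> (coeff A e \<noteq> 0 \<or> coeff B e \<noteq> 0)"
    then have dA: "A = 0 \<or> degree A < e" "B = 0 \<or> degree B < e"
      using deg le_neq_implies_less leading_coeff_0_iff by metis+
    have "e \<noteq> 0" using nz dA by auto
    then have "degree A \<le> e - 1" "degree B \<le> e - 1" using dA by auto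
    then have "R (e - 1) A B" using fin unfolding R_def by blast
    then show False using min[of "e - 1"] \<open>e \<noteq> 0\<close> by simp
  qed
  have root: "poly A r \<noteq> 0 \<or> poly B r \<noteq> 0" for r
  proof (rule ccontr)
    assume "\<not> (poly A r \<noteq> 0 \<or> poly B r \<noteq> 0)"
    then obtain A' B' where A': "A = [:-r, 1:] * A'" and B': "B = [:-r, 1:] * B'"
      by (metis dvdE poly_eq_0_iff_dvd)
    have dC: "C = 0 \<or> degree ([:-r, 1:] * C) = Suc (degree C)" for C
    proof -
      have "degree ([:-r, 1:] * C) = degree [:-r, 1:] + degree C" if "C \<noteq> 0"
        by (rule degree_mult_eq) (use that in auto)
      moreover have "degree [:-r, 1:] = Suc 0" by simp
      ultimately show ?thesis by (metis plus_1_eq_Suc One_nat_def)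
    qed
    have dA: "A' = 0 \<or> degree A = Suc (degree A')" "B' = 0 \<or> degree B = Suc (degree B')"
      unfolding A' B' by (rule dC)+
    then have "e \<noteq> 0" using nz deg A' B' by auto
    then have dAe: "degree A' \<le> e - 1" "degree B' \<le> e - 1" using dA deg by auto
    have "{x. \<not> ((poly A' x \<noteq> 0 \<or> poly B' x \<noteq> 0) \<and> f (pt x 1) = pt (poly A' x) (poly B' x))} \<subseteq> insert r ?N"
    proof
      fix x assume x: "x \<in> {x. \<not> ((poly A' x \<noteq> 0 \<or> poly B' x \<noteq> 0) \<and> f (pt x 1) = pt (poly A' x) (poly B' x))}"
      have "poly A x = (x - r) * poly A' x" "poly B x = (x - r) * poly B' x"
        by (simp_all add: A' B' algebra_simps)
      then have "pt (poly A x) (poly B x) = pt (poly A' x) (poly B' x)" if "x \<noteq> r"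
        using pt_scale[of "x - r" "poly A' x" "poly B' x"] that by simp
      then show "x \<in> insert r ?N" using x by (auto simp: A' B')
    qed
    then have "finite {x. \<not> ((poly A' x \<noteq> 0 \<or> poly B' x \<noteq> 0) \<and> f (pt x 1) = pt (poly A' x) (poly B' x))}"
      by (rule finite_subset) (use fin in simp)
    then have "R (e - 1) A' B'" unfolding R_def using dAe by blast
    then show False using min[of "e - 1"] \<open>e \<noteq> 0\<close> by simp
  qed
  have hp: "homogeneous_pair e (homogenize e A) (homogenize e B)"
    by (rule homogeneous_pair_homogenize[OF deg root inf])
  have "finite (- (- ?N))" using fin by simp
  note W = cofinite_affine_open[OF this]
  have "rational_class PL PL U f = pair_class (homogenize e A) (homogenize e B)"
  proof (rule rational_class_eqI[OF irreducible_variety_P1 irreducible_variety_P1 f pair_map_partial_morphism[OF hp] W])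
    fix p assume "p \<in> (\<lambda>x. pt x 1) ` (- ?N)"
    then obtain x where "p = pt x 1" "f (pt x 1) = pt (poly A x) (poly B x)" by auto
    then show "f p = pair_map (homogenize e A) (homogenize e B) p"
      using pair_map_pt[OF hp, of x 1] deg by (simp add: homogenize_affine)
  qed
  then show ?thesis using hp by blast
qed

text \<open>Near one point of its domain the map is a fraction in a chart coordinate of the target.
  This fraction is valid off a finite set, and \<open>pair_class_of_fraction\<close> extends it to
  the whole line.\<close>

lemma rational_map_P1_pair:
  assumes \<phi>: "\<phi> \<in> rational_maps PL (PL :: ('k::field_char_0 proj_point, 'k) fspace)"
  shows "\<exists>d P Q. homogeneous_pair d P Q \<and> \<phi> = pair_class P Q"
proof -
  let ?P = "PL :: ('k proj_point, 'k) fspace"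
  obtain U f where f: "(U, f) \<in> partial_morphisms ?P ?P" and \<phi>: "\<phi> = rational_class PL PL U f"
    using \<phi> rational_maps_iff by blast
  obtain u where u: "u \<in> U" using partial_morphismsD(2)[OF f] by blast
  obtain s where s: "f u \<in> chart_domain s" using partial_morphism_image[OF f u] chart_domain_cover by blast
  obtain h :: "'k proj_point \<Rightarrow> 'k" where h: "h \<in> regular ?P (chart_domain s)"
    "\<And>P. P \<in> chart_domain s \<Longrightarrow> P = proj_class (chart_coords s (h P))"
    using chart_coordinate[of s] by metis
  have U: "openin (top_of ?P) U" using partial_morphismsD(1)[OF f] .
  have D: "openin (top_of ?P) (chart_domain s)" using openin_chart_domain by simp
  have pts: "{x \<in> points (open_subspace ?P U). f x \<in> chart_domain s} = {x \<in> U. f x \<in> chart_domain s}"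
    using openin_subset[OF U] by auto
  have "(\<lambda>x. h (f x)) \<in> regular ?P {x \<in> U. f x \<in> chart_domain s}"
    using morphismD(3)[OF partial_morphismsD(3)[OF f] D h(1)] unfolding pts by simp
  then obtain V d p q where V: "openin (top_of ?P) V" "u \<in> V" "V \<subseteq> {x \<in> U. f x \<in> chart_domain s}"
    and pq: "p \<in> homogeneous 2 d" "q \<in> homogeneous 2 d"
    and eq: "\<And>x. x \<in> homogeneous_coords 1 \<Longrightarrow> proj_class x \<in> V \<Longrightarrow> q x \<noteq> 0 \<and> h (f (proj_class x)) = p x / q x"
    unfolding regular_projective_space top_of_projective_space using u s by (auto simp: Suc_1)
  obtain A where A: "\<And>x. p (vec2 x 1) = poly A x" using homogeneous_dehomogenize[OF pq(1)] by metis
  obtain B where B: "\<And>x. q (vec2 x 1) = poly B x" using homogeneous_dehomogenize[OF pq(2)] by metis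
  \<comment> \<open>The value p / q of the coordinate stands for [p : q] in one chart and for
    [q : p] in the other.\<close>
  define A' B' where "A' = (if s then A else B)" and "B' = (if s then B else A)"
  have "(poly A' x \<noteq> 0 \<or> poly B' x \<noteq> 0) \<and> f (pt x 1) = pt (poly A' x) (poly B' x)" if x: "pt x 1 \<in> V" for x
  proof -
    have e: "poly B x \<noteq> 0" "h (f (pt x 1)) = poly A x / poly B x" using eq[OF vec2_coords x] A B by auto
    have "f (pt x 1) = proj_class (chart_coords s (poly A x / poly B x))"
      using h(2)[of "f (pt x 1)"] V(3) x e(2) by auto
    also have "\<dots> = pt (poly A' x) (poly B' x)"
      using pt_scale[OF e(1), of "poly A x / poly B x" 1] pt_scale[OF e(1), of 1 "poly A x / poly B x"] e(1)
      by (simp add: chart_coords_def A'_def B'_def)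
    finally show ?thesis using e(1) by (auto simp: A'_def B'_def)
  qed
  then have "{x. \<not> ((poly A' x \<noteq> 0 \<or> poly B' x \<noteq> 0) \<and> f (pt x 1) = pt (poly A' x) (poly B' x))} \<subseteq> {x. pt x 1 \<notin> V}" by blast
  moreover have "finite {x. pt x 1 \<notin> V}" using finite_not_in_open_P1[OF V(1)] V(2) by blast
  ultimately have "finite {x. \<not> ((poly A' x \<noteq> 0 \<or> poly B' x \<noteq> 0) \<and> f (pt x 1) = pt (poly A' x) (poly B' x))}"
    by (rule finite_subset)
  then show ?thesis using pair_class_of_fraction[OF f] \<phi> by blast
qed

text \<open>A nonempty open set is cofinite, so a map missing it has finitely many values and takes
  one of them, [a : b], infinitely often. The form b P - a Q then has infinitely many zeros, hence
  is zero, and the map is constant.\<close>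

lemma pair_map_dense_image:
  fixes P Q :: "(nat \<Rightarrow> 'k::field_char_0) \<Rightarrow> 'k"
  assumes PQ: "homogeneous_pair d P Q"
    and ne: "p \<in> points PL" "q \<in> points PL" "pair_map P Q p \<noteq> pair_map P Q q"
  shows "dense_image PL (points PL) (pair_map P Q)"
proof (rule dense_imageI, rule ccontr)
  let ?P = "points (PL :: ('k proj_point, 'k) fspace)"
  fix V :: "'k proj_point set" assume V: "openin (top_of PL) V" "V \<noteq> {}" and no: "\<not> (\<exists>x\<in>?P. pair_map P Q x \<in> V)"
  have hP: "P \<in> homogeneous 2 d" "Q \<in> homogeneous 2 d" using PQ by (auto simp: homogeneous_pair_def)
  have im: "pair_map P Q x \<in> ?P" if "x \<in> ?P" for x using morphismD(1)[OF pair_map_morphism[OF PQ] that] .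
  have ptm: "pt x 1 \<in> ?P" for x :: 'k by (rule pt_mem) simp
  have "finite (?P - V)" using V unfolding top_of_projective_space openin_P1_iff by blast
  moreover have "range (\<lambda>x. pair_map P Q (pt x 1)) \<subseteq> ?P - V" using no im ptm by blast
  ultimately have "finite (range (\<lambda>x. pair_map P Q (pt x 1)))" by (rule rev_finite_subset)
  then obtain x0 where "infinite {x. pair_map P Q (pt x 1) = pair_map P Q (pt x0 1)}"
    using pigeonhole_infinite[OF infinite_UNIV_char_0[where 'a = 'k]] by auto
  moreover define a b where "a = P (vec2 x0 1)" and "b = Q (vec2 x0 1)"
  have ab: "a \<noteq> 0 \<or> b \<noteq> 0" using PQ unfolding homogeneous_pair_def a_def b_def by auto
  ultimately have inf: "infinite {x. b * P (vec2 x 1) = a * Q (vec2 x 1)}"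
  proof -
    assume inf: "infinite {x. pair_map P Q (pt x 1) = pair_map P Q (pt x0 1)}"
    have "{x. pair_map P Q (pt x 1) = pair_map P Q (pt x0 1)} \<subseteq> {x. b * P (vec2 x 1) = a * Q (vec2 x 1)}"
    proof
      fix x assume "x \<in> {x. pair_map P Q (pt x 1) = pair_map P Q (pt x0 1)}"
      then have "pt (P (vec2 x 1)) (Q (vec2 x 1)) = pt a b" by (simp add: pair_map_pt[OF PQ] a_def b_def)
      moreover have "P (vec2 x 1) \<noteq> 0 \<or> Q (vec2 x 1) \<noteq> 0" using PQ unfolding homogeneous_pair_def by auto
      ultimately show "x \<in> {x. b * P (vec2 x 1) = a * Q (vec2 x 1)}" using ab by (simp add: pt_eq_iff algebra_simps)
    qed
    then show ?thesis using inf finite_subset by blast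
  qed
  have L: "(\<lambda>x. b * P x + (- a) * Q x) \<in> homogeneous 2 d" by (intro homogeneous_add homogeneous_cmult hP)
  obtain A where A: "\<And>x. b * P (vec2 x 1) + (- a) * Q (vec2 x 1) = poly A x"
    "\<And>u v. v \<noteq> 0 \<Longrightarrow> b * P (vec2 u v) + (- a) * Q (vec2 u v) = v ^ d * poly A (u / v)"
    "\<And>u. b * P (vec2 u 0) + (- a) * Q (vec2 u 0) = u ^ d * coeff A d"
    using homogeneous_dehomogenize[OF L] by metis
  have "{x. b * P (vec2 x 1) = a * Q (vec2 x 1)} = {x. poly A x = 0}" by (auto simp: A(1)[symmetric])
  then have "A = 0" using inf poly_roots_finite by metis
  then have "b * P (vec2 u v) = a * Q (vec2 u v)" for u v using A(2)[of v u] A(3)[of u] by (cases "v = 0") auto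
  then have "pair_map P Q r = pt a b" if r: "r \<in> ?P" for r
  proof -
    obtain u v where uv: "r = pt u v" "u \<noteq> 0 \<or> v \<noteq> 0" by (rule P1_pointE[OF r])
    have "P (vec2 u v) \<noteq> 0 \<or> Q (vec2 u v) \<noteq> 0" using PQ uv(2) unfolding homogeneous_pair_def by auto
    then show ?thesis unfolding uv(1) pair_map_pt[OF PQ uv(2)] using ab \<open>b * P (vec2 u v) = a * Q (vec2 u v)\<close>
      by (simp add: pt_eq_iff algebra_simps)
  qed
  then show False using ne by simp
qed

section \<open>Composition and degree of self-maps\<close>

lemma poly_function_substitute:
  assumes "p \<in> poly_functions 2" "P \<in> poly_functions m" "Q \<in> poly_functions m"
  shows "(\<lambda>x. p (vec2 (P x) (Q x))) \<in> poly_functions m"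
  using assms(1)
proof induction
  case (coord i)
  then have "i = 0 \<or> i = 1" by auto
  then show ?case using assms(2,3) by auto
qed (intro poly_functions.intros; assumption)+

lemma homogeneous_pair_comp:
  assumes PQ: "homogeneous_pair d P Q" and RS: "homogeneous_pair e R S"
  shows "homogeneous_pair (e * d) (\<lambda>x. R (vec2 (P x) (Q x))) (\<lambda>x. S (vec2 (P x) (Q x)))" (is ?A)
    and "p \<in> points PL \<Longrightarrow> pair_map R S (pair_map P Q p) = pair_map (\<lambda>x. R (vec2 (P x) (Q x))) (\<lambda>x. S (vec2 (P x) (Q x))) p"
proof -
  have PQ': "P (vec2 a b) \<noteq> 0 \<or> Q (vec2 a b) \<noteq> 0" if "a \<noteq> 0 \<or> b \<noteq> 0" for a b
    using that PQ unfolding homogeneous_pair_def by auto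
  have hom: "(\<lambda>x. T (vec2 (P x) (Q x))) \<in> homogeneous 2 (e * d)" if T: "T \<in> homogeneous 2 e" for T
  proof -
    have "T (vec2 (P (\<lambda>i. c * x i)) (Q (\<lambda>i. c * x i))) = c ^ (e * d) * T (vec2 (P x) (Q x))" for c x
    proof -
      have "P (\<lambda>i. c * x i) = c ^ d * P x" "Q (\<lambda>i. c * x i) = c ^ d * Q x"
        using PQ unfolding homogeneous_pair_def homogeneous_def by auto
      then show ?thesis using homogeneous_scale[OF T, of "c ^ d"] by (simp add: power_mult[symmetric] mult.commute)
    qed
    moreover have "(\<lambda>x. T (vec2 (P x) (Q x))) \<in> poly_functions 2"
      by (rule poly_function_substitute) (use T PQ in \<open>auto simp: homogeneous_def homogeneous_pair_def\<close>)
    ultimately show ?thesis unfolding homogeneous_def by blast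
  qed
  show ?A unfolding homogeneous_pair_def
  proof (intro conjI hom allI impI)
    fix a b :: 'a assume "a \<noteq> 0 \<or> b \<noteq> 0"
    then show "R (vec2 (P (vec2 a b)) (Q (vec2 a b))) \<noteq> 0 \<or> S (vec2 (P (vec2 a b)) (Q (vec2 a b))) \<noteq> 0"
      using PQ'[of a b] RS unfolding homogeneous_pair_def by blast
  qed (use RS in \<open>auto simp: homogeneous_pair_def\<close>)
  then show "pair_map R S (pair_map P Q p) = pair_map (\<lambda>x. R (vec2 (P x) (Q x))) (\<lambda>x. S (vec2 (P x) (Q x))) p"
    if pP: "p \<in> points PL"
  proof -
    obtain a b where p: "p = pt a b" "a \<noteq> 0 \<or> b \<noteq> 0" by (rule P1_pointE[OF pP])
    show ?thesis unfolding p(1) pair_map_pt[OF PQ p(2)] pair_map_pt[OF RS PQ'[OF p(2)]] pair_map_pt[OF \<open>?A\<close> p(2)] ..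
  qed
qed

lemma pair_class_comp:
  fixes P Q R S :: "(nat \<Rightarrow> 'k::field_char_0) \<Rightarrow> 'k"
  assumes PQ: "homogeneous_pair d P Q" and RS: "homogeneous_pair e R S" and dom: "dominant PL (pair_class P Q)"
  shows "rational_comp PL PL (pair_class R S) (pair_class P Q) =
     pair_class (\<lambda>x. R (vec2 (P x) (Q x))) (\<lambda>x. S (vec2 (P x) (Q x)))"
proof -
  note irr = irreducible_variety_P1[where 'k = 'k]
  note pm = pair_map_partial_morphism[OF PQ] pair_map_partial_morphism[OF RS]
  have di: "dense_image PL (points PL) (pair_map P Q)" using dom dominant_rational_class[OF irr irr pm(1)] by blast
  note c = rational_comp_class[OF irr irr irr pm(1) di pm(2)]
  show ?thesis unfolding c(2)
    by (rule rational_class_eqI[OF irr irr c(1) pair_map_partial_morphism[OF homogeneous_pair_comp(1)[OF PQ RS]] _ irreducible_varietyD(6)[OF irr]])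
       (use homogeneous_pair_comp(2)[OF PQ RS] in auto)
qed

lemma pair_class_eq_iff:
  fixes P Q R S :: "(nat \<Rightarrow> 'k::field_char_0) \<Rightarrow> 'k"
  assumes PQ: "homogeneous_pair d P Q" and RS: "homogeneous_pair e R S"
  shows "pair_class P Q = pair_class R S \<longleftrightarrow> (\<forall>p\<in>points PL. pair_map P Q p = pair_map R S p)"
  using rational_class_eq_iff[OF irreducible_variety_P1 irreducible_variety_P1 pair_map_partial_morphism[OF PQ] pair_map_partial_morphism[OF RS]]
  by simp

lemma homogeneous_pair_id: "homogeneous_pair 1 (\<lambda>x. x 0) (\<lambda>x. x (Suc 0))"
  unfolding homogeneous_pair_def using homogeneous_coord[of 0 2] homogeneous_coord[of "Suc 0" 2] by (auto simp: One_nat_def)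

lemma rational_id_pair_class: "rational_id PL = pair_class (\<lambda>x. x 0) (\<lambda>x :: nat \<Rightarrow> 'k::field_char_0. x (Suc 0))"
  unfolding rational_id_class
proof (rule rational_class_eqI[OF irreducible_variety_P1 irreducible_variety_P1 partial_morphism_id pair_map_partial_morphism[OF homogeneous_pair_id]])
  show "irreducible_variety (PL :: ('k proj_point, 'k) fspace)" by (rule irreducible_variety_P1)
  then show "points (PL :: ('k proj_point, 'k) fspace) \<noteq> {}" by (rule irreducible_varietyD)
  fix p :: "'k proj_point" assume "p \<in> points PL"
  then obtain a b where p: "p = pt a b" "a \<noteq> 0 \<or> b \<noteq> 0" by (rule P1_pointE)
  show "p = pair_map (\<lambda>x. x 0) (\<lambda>x. x (Suc 0)) p" unfolding p(1) pair_map_pt[OF homogeneous_pair_id p(2)] by simp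
qed simp

text \<open>A root of Q(x, 1) would be a root of P(x, 1) = x Q(x, 1) too, so Q(x, 1) is a nonzero
  constant c by algebraic closedness and P(x, 1) = c x. At infinity Q vanishes, so the coefficient
  of P in degree d must not, which leaves d = 1.\<close>

lemma pair_map_id_degree:
  fixes P Q :: "(nat \<Rightarrow> 'k::{alg_closed_field, field_char_0}) \<Rightarrow> 'k"
  assumes PQ: "homogeneous_pair d P Q" and id: "\<And>p. p \<in> points PL \<Longrightarrow> pair_map P Q p = p"
  shows "d = 1"
proof -
  have hP: "P \<in> homogeneous 2 d" "Q \<in> homogeneous 2 d" using PQ by (auto simp: homogeneous_pair_def)
  have nz: "P (vec2 a b) \<noteq> 0 \<or> Q (vec2 a b) \<noteq> 0" if "a \<noteq> 0 \<or> b \<noteq> 0" for a b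
    using that PQ unfolding homogeneous_pair_def by auto
  have eq: "P (vec2 a b) * b = Q (vec2 a b) * a" if ab: "a \<noteq> 0 \<or> b \<noteq> 0" for a b
    using id[OF pt_mem[OF ab]] pt_eq_iff[OF nz[OF ab] ab] unfolding pair_map_pt[OF PQ ab] by blast
  obtain A where A: "\<And>x. P (vec2 x 1) = poly A x" "P (vec2 1 0) = coeff A d" using homogeneous_dehomogenize[OF hP(1)] by metis
  obtain B where B: "\<And>x. Q (vec2 x 1) = poly B x" "Q (vec2 1 0) = coeff B d" using homogeneous_dehomogenize[OF hP(2)] by metis
  have AB: "poly A x = poly B x * x" for x using eq[of x 1] A B by simp
  have "poly B x \<noteq> 0" for x using AB[of x] nz[of x 1] A B by auto
  then have "degree B = 0" using alg_closed_imp_poly_has_root[of B] by (metis gr0I)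
  then obtain c where c: "B = [:c:]" by (rule degree_eq_zeroE)
  have "poly A x = poly [:0, c:] x" for x using AB[of x] c by simp
  then have A': "A = [:0, c:]" by (simp add: poly_eq_poly_eq_iff[symmetric] fun_eq_iff)
  have "coeff B d = 0" using eq[of 1 0] A B by simp
  then have "coeff A d \<noteq> 0" using nz[of 1 0] A B by simp
  then show "d = 1" unfolding A' by (auto simp: coeff_pCons split: nat.splits)
qed

text \<open>Degrees multiply under composition and the identity has degree 1.\<close>

lemma birational_pair_degree:
  fixes P Q :: "(nat \<Rightarrow> 'k::{alg_closed_field, field_char_0}) \<Rightarrow> 'k"
  assumes PQ: "homogeneous_pair d P Q" and bir: "birational PL PL (pair_class P Q)"
  shows "d = 1"
proof -
  obtain \<psi> where inv: "mutually_inverse PL PL (pair_class P Q) \<psi>" using bir unfolding birational_def by blast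
  then have "\<psi> \<in> rational_maps PL PL" and dom: "dominant PL (pair_class P Q)"
    and id: "rational_comp PL PL \<psi> (pair_class P Q) = rational_id PL"
    unfolding mutually_inverse_def by auto
  then obtain e R S where RS: "homogeneous_pair e R S" and \<psi>: "\<psi> = pair_class R S" using rational_map_P1_pair by blast
  note hc = homogeneous_pair_comp(1)[OF PQ RS]
  have "pair_class (\<lambda>x. R (vec2 (P x) (Q x))) (\<lambda>x. S (vec2 (P x) (Q x))) = pair_class (\<lambda>x. x 0) (\<lambda>x :: nat \<Rightarrow> 'k. x (Suc 0))"
    using id unfolding \<psi> pair_class_comp[OF PQ RS dom] rational_id_pair_class .
  then have eq: "\<forall>p\<in>points PL. pair_map (\<lambda>x. R (vec2 (P x) (Q x))) (\<lambda>x. S (vec2 (P x) (Q x))) p = pair_map (\<lambda>x. x 0) (\<lambda>x. x (Suc 0)) p"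
    unfolding pair_class_eq_iff[OF hc homogeneous_pair_id] .
  have "e * d = 1"
  proof (rule pair_map_id_degree[OF hc])
    fix p :: "'k proj_point" assume p: "p \<in> points PL"
    then obtain a b where ab: "p = pt a b" "a \<noteq> 0 \<or> b \<noteq> 0" by (rule P1_pointE)
    have "pair_map (\<lambda>x. x 0) (\<lambda>x. x (Suc 0)) p = p" unfolding ab(1) pair_map_pt[OF homogeneous_pair_id ab(2)] by simp
    with eq[rule_format, OF p]
    show "pair_map (\<lambda>x. R (vec2 (P x) (Q x))) (\<lambda>x. S (vec2 (P x) (Q x))) p = p" by (rule trans)
  qed
  then show ?thesis by simp
qed

subsection \<open>Moebius transformations\<close>

datatype 'k mat2 = Mat2 (m11: 'k) (m12: 'k) (m21: 'k) (m22: 'k)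

definition det2 :: "'k::field mat2 \<Rightarrow> 'k" where
  "det2 M = m11 M * m22 M - m12 M * m21 M"

definition mult2 :: "'k::field mat2 \<Rightarrow> 'k mat2 \<Rightarrow> 'k mat2" where
  "mult2 M N = Mat2 (m11 M * m11 N + m12 M * m21 N) (m11 M * m12 N + m12 M * m22 N)
                    (m21 M * m11 N + m22 M * m21 N) (m21 M * m12 N + m22 M * m22 N)"

definition smult2 :: "'k::field \<Rightarrow> 'k mat2 \<Rightarrow> 'k mat2" where
  "smult2 c M = Mat2 (c * m11 M) (c * m12 M) (c * m21 M) (c * m22 M)"

definition row1 :: "'k::field mat2 \<Rightarrow> (nat \<Rightarrow> 'k) \<Rightarrow> 'k" where
  "row1 M x = m11 M * x 0 + m12 M * x (Suc 0)"

definition row2 :: "'k::field mat2 \<Rightarrow> (nat \<Rightarrow> 'k) \<Rightarrow> 'k" where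
  "row2 M x = m21 M * x 0 + m22 M * x (Suc 0)"

definition moebius :: "'k::field mat2 \<Rightarrow> 'k proj_point \<Rightarrow> 'k proj_point" where
  "moebius M = pair_map (row1 M) (row2 M)"

definition moebius_class :: "'k::field mat2 \<Rightarrow> ('k proj_point, 'k proj_point) rational_map" where
  "moebius_class M = pair_class (row1 M) (row2 M)"

lemma det_mult2: "det2 (mult2 M N) = det2 M * det2 N"
  by (simp add: det2_def mult2_def algebra_simps)

lemma matrix_nonzero_image:
  assumes "det2 M \<noteq> 0" "a \<noteq> 0 \<or> b \<noteq> 0"
  shows "m11 M * a + m12 M * b \<noteq> 0 \<or> m21 M * a + m22 M * b \<noteq> 0"
proof (rule ccontr)
  assume "\<not> ?thesis"
  then have "m11 M * a + m12 M * b = 0" "m21 M * a + m22 M * b = 0" by auto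
  then have "det2 M * a = 0" "det2 M * b = 0" unfolding det2_def by Groebner_Basis.algebra+
  then show False using assms by simp
qed

lemma moebius_pair:
  assumes "det2 M \<noteq> 0"
  shows "homogeneous_pair 1 (row1 M) (row2 M)"
proof -
  have "row1 M = (\<lambda>x. m11 M * x 0 + m12 M * x (Suc 0))" "row2 M = (\<lambda>x. m21 M * x 0 + m22 M * x (Suc 0))"
    by (auto simp: row1_def row2_def)
  then show ?thesis unfolding homogeneous_pair_def One_nat_def
    using homogeneous_linear[of "m11 M" "m12 M"] homogeneous_linear[of "m21 M" "m22 M"] matrix_nonzero_image[OF assms] by auto
qed

lemma moebius_pt:
  assumes "det2 M \<noteq> 0" "a \<noteq> 0 \<or> b \<noteq> 0"
  shows "moebius M (pt a b) = pt (m11 M * a + m12 M * b) (m21 M * a + m22 M * b)"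
  unfolding moebius_def pair_map_pt[OF moebius_pair[OF assms(1)] assms(2)] by (simp add: row1_def row2_def)

lemma moebius_mem: "det2 M \<noteq> 0 \<Longrightarrow> p \<in> points PL \<Longrightarrow> moebius M p \<in> points PL"
  unfolding moebius_def using morphismD(1)[OF pair_map_morphism[OF moebius_pair]] .

lemma moebius_mult:
  assumes "det2 M \<noteq> 0" "det2 N \<noteq> 0" "p \<in> points PL"
  shows "moebius (mult2 M N) p = moebius M (moebius N p)"
proof -
  obtain a b where p: "p = pt a b" "a \<noteq> 0 \<or> b \<noteq> 0" by (rule P1_pointE[OF assms(3)])
  show ?thesis unfolding p(1) moebius_pt[OF assms(2) p(2)] moebius_pt[OF assms(1) matrix_nonzero_image[OF assms(2) p(2)]]
    using moebius_pt[of "mult2 M N", OF _ p(2)] assms det_mult2[of M N] by (simp add: mult2_def algebra_simps)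
qed

lemma moebius_class_eq_iff:
  fixes M N :: "'k::field_char_0 mat2"
  assumes M: "det2 M \<noteq> 0" and N: "det2 N \<noteq> 0"
  shows "moebius_class M = moebius_class N \<longleftrightarrow> (\<forall>p\<in>points PL. moebius M p = moebius N p)"
  unfolding moebius_class_def moebius_def by (rule pair_class_eq_iff[OF moebius_pair[OF M] moebius_pair[OF N]])

text \<open>A Moebius transformation is determined by its values at [1 : 0], [0 : 1] and [1 : 1];
  the resulting equations force proportional matrices.\<close>

lemma moebius_eq_proportional:
  assumes M: "det2 M \<noteq> 0" and N: "det2 N \<noteq> 0" and eq: "\<And>p. p \<in> points PL \<Longrightarrow> moebius M p = moebius N p"
  shows "\<exists>c. c \<noteq> 0 \<and> N = smult2 c M"
proof -
  have e: "(m11 M * a + m12 M * b) * (m21 N * a + m22 N * b) = (m21 M * a + m22 M * b) * (m11 N * a + m12 N * b)"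
    if ab: "a \<noteq> 0 \<or> b \<noteq> 0" for a b
    using eq[OF pt_mem[OF ab]] unfolding moebius_pt[OF M ab] moebius_pt[OF N ab]
      pt_eq_iff[OF matrix_nonzero_image[OF M ab] matrix_nonzero_image[OF N ab]] .
  obtain a b c d where Mv: "M = Mat2 a b c d" by (cases M)
  obtain a' b' c' d' where Nv: "N = Mat2 a' b' c' d'" by (cases N)
  have 1: "a * c' = c * a'" "b * d' = d * b'" "(a + b) * (c' + d') = (c + d) * (a' + b')"
    using e[of 1 0] e[of 0 1] e[of 1 1] by (simp_all add: Mv Nv)
  define D where "D = a * d - b * c"
  have D: "D \<noteq> 0" and D': "a' * d' - b' * c' \<noteq> 0" using M N by (auto simp: det2_def Mv Nv D_def)
  \<comment> \<open>If N = k M, then N times the adjugate of M is k D times the identity; k is read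
    off from the upper left entry.\<close>
  define k where "k = (a' * d - b' * c) / D"
  have kD: "k * D = a' * d - b' * c" using D by (simp add: k_def)
  have 3: "a * d' + b * c' = c * b' + d * a'" using 1 by (simp add: algebra_simps)
  have "D * (a * b' - a' * b) = 0" "D * (b * c' - b' * c) = 0"
    unfolding D_def using 1(1,2) 3 by Groebner_Basis.algebra+
  then have 4: "a * b' = a' * b" "b * c' = b' * c" using D by simp_all
  have "a' * D = (k * D) * a" "b' * D = (k * D) * b" "c' * D = (k * D) * c" "d' * D = (k * D) * d"
    unfolding kD unfolding D_def using 1(1,2) 3 4 by Groebner_Basis.algebra+
  then have k: "a' = k * a" "b' = k * b" "c' = k * c" "d' = k * d" using D by (simp_all add: mult.assoc mult.left_commute mult.commute[of D])
  then have "k \<noteq> 0" using D' by auto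
  then show ?thesis using k by (intro exI[of _ k]) (simp add: smult2_def Mv Nv)
qed

lemma moebius_smult: "c \<noteq> 0 \<Longrightarrow> det2 M \<noteq> 0 \<Longrightarrow> p \<in> points PL \<Longrightarrow> moebius (smult2 c M) p = moebius M p"
proof -
  assume c: "c \<noteq> 0" and M: "det2 M \<noteq> 0" and "p \<in> points PL"
  then obtain a b where p: "p = pt a b" "a \<noteq> 0 \<or> b \<noteq> 0" using P1_pointE by blast
  have "det2 (smult2 c M) = c * c * det2 M" by (simp add: det2_def smult2_def algebra_simps)
  then have d: "det2 (smult2 c M) \<noteq> 0" using c M by simp
  show ?thesis unfolding p(1) moebius_pt[OF d p(2)] moebius_pt[OF M p(2)]
    using pt_scale[OF c, of "m11 M * a + m12 M * b" "m21 M * a + m22 M * b"] by (simp add: smult2_def algebra_simps)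
qed

lemma moebius_inverse:
  assumes M: "det2 M \<noteq> 0"
  obtains N where "det2 N \<noteq> 0" "\<And>p. p \<in> points PL \<Longrightarrow> moebius N (moebius M p) = p"
    "\<And>p. p \<in> points PL \<Longrightarrow> moebius M (moebius N p) = p"
proof -
  define N where "N = Mat2 (m22 M) (- m12 M) (- m21 M) (m11 M)"
  have N: "det2 N \<noteq> 0" using M by (simp add: N_def det2_def algebra_simps)
  have pr: "mult2 N M = smult2 (det2 M) (Mat2 1 0 0 1)" "mult2 M N = smult2 (det2 M) (Mat2 1 0 0 1)"
    by (simp_all add: mult2_def N_def smult2_def det2_def algebra_simps)
  have i: "moebius (smult2 (det2 M) (Mat2 1 0 0 1)) p = p" if pP: "p \<in> points PL" for p
  proof -
    obtain a b where p: "p = pt a b" "a \<noteq> 0 \<or> b \<noteq> 0" by (rule P1_pointE[OF pP])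
    have "det2 (Mat2 1 0 0 1 :: 'a mat2) \<noteq> 0" by (simp add: det2_def)
    from moebius_smult[OF M this pP] show ?thesis unfolding p(1) moebius_pt[OF \<open>det2 (Mat2 1 0 0 1) \<noteq> 0\<close> p(2)] by simp
  qed
  show thesis using that[OF N] i moebius_mult[OF N M] moebius_mult[OF M N] unfolding pr by simp
qed

lemma moebius_class_dominant:
  fixes M :: "'k::field_char_0 mat2"
  assumes M: "det2 M \<noteq> 0"
  shows "dense_image PL (points PL) (moebius M)" "moebius_class M \<in> dominant_maps PL PL"
proof -
  obtain N where N: "\<And>p. p \<in> points (PL :: ('k proj_point, 'k) fspace) \<Longrightarrow> moebius M (moebius N p) = p" "det2 N \<noteq> 0"
    using moebius_inverse[OF M] by metis
  show *: "dense_image PL (points PL) (moebius M)"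
  proof (rule dense_imageI)
    fix V :: "'k proj_point set" assume V: "openin (top_of PL) V" "V \<noteq> {}"
    then obtain p where "p \<in> V" "p \<in> points PL" using openin_subset by blast
    then show "\<exists>x\<in>points PL. moebius M x \<in> V" using N(1)[of p] moebius_mem[OF N(2), of p] by (intro bexI[of _ "moebius N p"]) auto
  qed
  show "moebius_class M \<in> dominant_maps PL PL"
    unfolding moebius_class_def
    by (rule dominant_mapsI[OF irreducible_variety_P1 irreducible_variety_P1 pair_map_partial_morphism[OF moebius_pair[OF M]] *[unfolded moebius_def]])
qed

lemma moebius_class_comp:
  fixes M N :: "'k::field_char_0 mat2"
  assumes M: "det2 M \<noteq> 0" and N: "det2 N \<noteq> 0"
  shows "rational_comp PL PL (moebius_class M) (moebius_class N) = moebius_class (mult2 M N)"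
proof -
  have "(\<lambda>x. row1 M (vec2 (row1 N x) (row2 N x))) = row1 (mult2 M N)" "(\<lambda>x. row2 M (vec2 (row1 N x) (row2 N x))) = row2 (mult2 M N)"
    by (auto simp: row1_def row2_def mult2_def algebra_simps)
  moreover have "dominant PL (pair_class (row1 N) (row2 N))"
    using moebius_class_dominant(2)[OF N] unfolding dominant_maps_def moebius_class_def by blast
  ultimately show ?thesis
    unfolding moebius_class_def by (subst pair_class_comp[OF moebius_pair[OF N] moebius_pair[OF M]]) simp_all
qed

lemma rational_id_moebius: "rational_id PL = moebius_class (Mat2 1 0 0 (1::'k::field_char_0))"
proof -
  have "row1 (Mat2 1 0 0 (1::'k)) = (\<lambda>x. x 0)" "row2 (Mat2 1 0 0 (1::'k)) = (\<lambda>x. x (Suc 0))"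
    by (auto simp: row1_def row2_def)
  then show ?thesis unfolding rational_id_pair_class moebius_class_def by simp
qed

lemma moebius_class_birational:
  fixes M :: "'k::field_char_0 mat2"
  assumes M: "det2 M \<noteq> 0"
  shows "birational PL PL (moebius_class M)"
proof -
  obtain N where N: "det2 N \<noteq> 0" "\<And>p. p \<in> points (PL :: ('k proj_point, 'k) fspace) \<Longrightarrow> moebius N (moebius M p) = p"
     "\<And>p. p \<in> points (PL :: ('k proj_point, 'k) fspace) \<Longrightarrow> moebius M (moebius N p) = p"
    using moebius_inverse[OF M] by metis
  have I: "det2 (Mat2 1 0 0 (1::'k)) \<noteq> 0" by (simp add: det2_def)
  have id: "moebius (Mat2 1 0 0 1) p = p" if pP: "p \<in> points (PL :: ('k proj_point, 'k) fspace)" for p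
  proof -
    obtain a b where p: "p = pt a b" "a \<noteq> 0 \<or> b \<noteq> 0" by (rule P1_pointE[OF pP])
    show ?thesis unfolding p(1) moebius_pt[OF I p(2)] by simp
  qed
  have MN: "det2 (mult2 M N) \<noteq> 0" "det2 (mult2 N M) \<noteq> 0" using M N(1) by (auto simp: det_mult2)
  have "rational_comp PL PL (moebius_class N) (moebius_class M) = rational_id PL"
    unfolding moebius_class_comp[OF N(1) M] rational_id_moebius moebius_class_eq_iff[OF MN(2) I]
    using moebius_mult[OF N(1) M] N(2) id by simp
  moreover have "rational_comp PL PL (moebius_class M) (moebius_class N) = rational_id PL"
    unfolding moebius_class_comp[OF M N(1)] rational_id_moebius moebius_class_eq_iff[OF MN(1) I]
    using moebius_mult[OF M N(1)] N(3) id by simp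
  ultimately show ?thesis unfolding birational_def mutually_inverse_iff
    using moebius_class_dominant(2)[OF M] moebius_class_dominant(2)[OF N(1)] by blast
qed

text \<open>Birational maps have degree 1, so their coordinate forms are linear, and the absence of
  a common zero is the nonvanishing of the determinant.\<close>

lemma carrier_Cremona_1:
  "carrier (Cremona 1 :: ('k::{alg_closed_field, field_char_0} proj_point, 'k proj_point) rational_map monoid) =
     moebius_class ` {M. det2 M \<noteq> 0}"
proof (intro equalityI subsetI)
  fix \<phi> :: "('k proj_point, 'k proj_point) rational_map" assume "\<phi> \<in> moebius_class ` {M. det2 M \<noteq> 0}"
  then show "\<phi> \<in> carrier (Cremona 1)" unfolding Cremona_def carrier_Bir using moebius_class_birational by blast
next
  fix \<phi> :: "('k proj_point, 'k proj_point) rational_map" assume "\<phi> \<in> carrier (Cremona 1)"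
  then have bir: "birational PL PL \<phi>" unfolding Cremona_def carrier_Bir .
  then have "\<phi> \<in> rational_maps PL PL" using birational_dominant unfolding dominant_maps_def by blast
  then obtain d P Q where PQ: "homogeneous_pair d P Q" and \<phi>: "\<phi> = pair_class P Q" using rational_map_P1_pair by blast
  have d: "d = 1" using birational_pair_degree[OF PQ] bir \<phi> by blast
  have hP: "P \<in> homogeneous 2 d" "Q \<in> homogeneous 2 d" using PQ by (auto simp: homogeneous_pair_def)
  have lin: "\<exists>a b. \<forall>u v. T (vec2 u v) = a * u + b * v" if "T \<in> homogeneous 2 d" for T :: "(nat \<Rightarrow> 'k) \<Rightarrow> 'k"
  proof -
    obtain A where A: "degree A \<le> d" "\<And>u v. v \<noteq> 0 \<Longrightarrow> T (vec2 u v) = v ^ d * poly A (u / v)" "\<And>a. T (vec2 a 0) = a ^ d * coeff A d"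
      using homogeneous_dehomogenize[OF \<open>T \<in> homogeneous 2 d\<close>] by metis
    have "poly A x = coeff A 0 + coeff A 1 * x" for x
    proof -
      have "poly A x = (\<Sum>i\<le>1. coeff A i * x ^ i)"
        unfolding poly_altdef using A(1) d by (intro sum.mono_neutral_left) (auto simp: coeff_eq_0)
      then show ?thesis by (simp add: One_nat_def)
    qed
    then have "T (vec2 u v) = coeff A 1 * u + coeff A 0 * v" for u v
      using A(2)[of v u] A(3)[of u] d by (cases "v = 0") (auto simp: algebra_simps)
    then show ?thesis by blast
  qed
  obtain a b where ab: "\<And>u v. P (vec2 u v) = a * u + b * v" using lin[OF hP(1)] by blast
  obtain c e where ce: "\<And>u v. Q (vec2 u v) = c * u + e * v" using lin[OF hP(2)] by blast
  let ?M = "Mat2 a b c e"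
  have M: "det2 ?M \<noteq> 0"
  proof
    assume 0: "det2 ?M = 0"
    have nz: "a * u + b * v \<noteq> 0 \<or> c * u + e * v \<noteq> 0" if "u \<noteq> 0 \<or> v \<noteq> 0" for u v
      using that PQ ab ce unfolding homogeneous_pair_def by auto
    \<comment> \<open>Both linear forms now vanish at (b, - a) and at (e, - c). A pair without
      common zero allows this only if these vectors are 0, that is, if both forms are 0.\<close>
    have "a * e = b * c" using 0 by (simp add: det2_def)
    then have z: "a * b + b * (- a) = 0" "c * b + e * (- a) = 0" "a * e + b * (- c) = 0" "c * e + e * (- c) = 0"
      by (simp_all add: algebra_simps)
    have "b = 0 \<and> a = 0" using nz[of b "- a"] z(1,2) by (metis neg_equal_0_iff_equal)
    moreover have "e = 0 \<and> c = 0" using nz[of e "- c"] z(3,4) by (metis neg_equal_0_iff_equal)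
    ultimately show False using nz[of 1 1] by simp
  qed
  have "pair_map P Q p = moebius ?M p" if pP: "p \<in> points PL" for p
  proof -
    obtain u v where p: "p = pt u v" "u \<noteq> 0 \<or> v \<noteq> 0" by (rule P1_pointE[OF pP])
    show ?thesis unfolding p(1) pair_map_pt[OF PQ p(2)] moebius_pt[OF M p(2)] ab ce by simp
  qed
  then have "\<phi> = moebius_class ?M" unfolding \<phi> moebius_class_def pair_class_eq_iff[OF PQ moebius_pair[OF M]] moebius_def by blast
  then show "\<phi> \<in> moebius_class ` {M. det2 M \<noteq> 0}" using M by blast
qed

section \<open>Self-compressions\<close>

text \<open>
  In an affine coordinate with \<open>v\<close> at infinity, the polar of a finite set of points at \<open>v\<close> is their
  barycentre; this description is invariant under projective transformations.
\<close>

definition bracket :: "('k::field \<times> 'k) \<Rightarrow> (nat \<Rightarrow> 'k) \<Rightarrow> 'k" where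
  "bracket p x = - snd p * x 0 + fst p * x (Suc 0)"

text \<open>With x at infinity, the point p has the normalized representative r(p) / [r(p), x], and
  the barycentre is the sum of these vectors. The formula is this sum multiplied by the product of
  all brackets; \<open>c\<close> selects one of the two coordinates.\<close>

definition polar :: "('i \<Rightarrow> 'k::field \<times> 'k) \<Rightarrow> 'i set \<Rightarrow> ('k \<times> 'k \<Rightarrow> 'k) \<Rightarrow> (nat \<Rightarrow> 'k) \<Rightarrow> 'k" where
  "polar r S c x = (\<Sum>p\<in>S. c (r p) * (\<Prod>q\<in>S - {p}. bracket (r q) x))"

lemma bracket_homogeneous: "bracket p \<in> homogeneous 2 (Suc 0)"
  unfolding bracket_def[abs_def] by (rule homogeneous_linear)

lemma homogeneous_prod:
  "finite I \<Longrightarrow> (\<And>i. i \<in> I \<Longrightarrow> p i \<in> homogeneous m (Suc 0)) \<Longrightarrow> (\<lambda>x. \<Prod>i\<in>I. p i x) \<in> homogeneous m (card I)"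
proof (induction I rule: finite_induct)
  case empty
  show ?case using homogeneous_const[of 1 m] by simp
next
  case (insert i I)
  then have "(\<lambda>x. p i x * (\<Prod>i\<in>I. p i x)) \<in> homogeneous m (Suc 0 + card I)" by (intro homogeneous_mult) auto
  then show ?case using insert by simp
qed

lemma polar_homogeneous:
  assumes "finite S"
  shows "polar r S c \<in> homogeneous 2 (card S - 1)"
proof -
  have "(\<lambda>x. c (r p) * (\<Prod>q\<in>S - {p}. bracket (r q) x)) \<in> homogeneous 2 (card S - 1)" if "p \<in> S" for p
  proof -
    have "(\<lambda>x. \<Prod>q\<in>S - {p}. bracket (r q) x) \<in> homogeneous 2 (card (S - {p}))"
      by (intro homogeneous_prod bracket_homogeneous) (use assms in auto)
    then show ?thesis using that assms by (intro homogeneous_cmult) simp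
  qed
  then show ?thesis unfolding polar_def[abs_def] by (intro homogeneous_sum assms)
qed

text \<open>At a point of S every summand except its own contains a vanishing bracket.\<close>

lemma polar_at_member:
  assumes S: "finite S" "s \<in> S" and "bracket (r s) x = 0"
  shows "polar r S c x = c (r s) * (\<Prod>q\<in>S - {s}. bracket (r q) x)"
proof -
  have "(\<Sum>p\<in>S - {s}. c (r p) * (\<Prod>q\<in>S - {p}. bracket (r q) x)) = 0"
  proof (rule sum.neutral, rule ballI)
    fix p assume "p \<in> S - {s}"
    then have "(\<Prod>q\<in>S - {p}. bracket (r q) x) = 0" using S assms(3) by (intro prod_zero) auto
    then show "c (r p) * (\<Prod>q\<in>S - {p}. bracket (r q) x) = 0" by simp
  qed
  then show ?thesis unfolding polar_def using sum.remove[OF S, of "\<lambda>p. c (r p) * (\<Prod>q\<in>S - {p}. bracket (r q) x)"] by simp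
qed

text \<open>Pairing the polar with x completes the product in each summand, giving card S equal
  terms. This is Euler's identity in disguise, and in characteristic zero it shows that the two
  coordinates cannot vanish together off S.\<close>

lemma polar_bracket:
  assumes S: "finite S"
  shows "polar r S fst x * x (Suc 0) - polar r S snd x * x 0 = of_nat (card S) * (\<Prod>q\<in>S. bracket (r q) x)"
proof -
  have "polar r S fst x * x (Suc 0) - polar r S snd x * x 0 =
     (\<Sum>p\<in>S. bracket (r p) x * (\<Prod>q\<in>S - {p}. bracket (r q) x))"
    unfolding polar_def bracket_def sum_distrib_right sum_subtractf[symmetric]
    by (intro sum.cong refl) (simp add: algebra_simps)
  also have "\<dots> = (\<Sum>p\<in>S. \<Prod>q\<in>S. bracket (r q) x)"
    by (intro sum.cong refl) (simp add: prod.remove[OF S])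
  finally show ?thesis by simp
qed

lemma bracket_eq_0_iff:
  assumes "fst p \<noteq> 0 \<or> snd p \<noteq> 0" "a \<noteq> 0 \<or> b \<noteq> 0"
  shows "bracket p (vec2 a b) = 0 \<longleftrightarrow> pt (fst p) (snd p) = pt a b"
  using pt_eq_iff[OF assms] by (auto simp: bracket_def)

text \<open>Common zeros are excluded in two ways: off S by \<open>polar_bracket\<close>, and at s
  in S because there the polar is a nonzero multiple of s itself. The latter also shows that the map
  fixes S pointwise.\<close>

lemma polar_pair:
  fixes r :: "'i \<Rightarrow> 'k::field_char_0 \<times> 'k"
  assumes S: "finite S" "S \<noteq> {}" and nz: "\<And>p. p \<in> S \<Longrightarrow> fst (r p) \<noteq> 0 \<or> snd (r p) \<noteq> 0"
    and inj: "\<And>p q. p \<in> S \<Longrightarrow> q \<in> S \<Longrightarrow> pt (fst (r p)) (snd (r p)) = pt (fst (r q)) (snd (r q)) \<Longrightarrow> p = q"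
  shows "homogeneous_pair (card S - 1) (polar r S fst) (polar r S snd)"
    and "s \<in> S \<Longrightarrow> pair_map (polar r S fst) (polar r S snd) (pt (fst (r s)) (snd (r s))) = pt (fst (r s)) (snd (r s))"
proof -
  have member: "\<exists>k. k \<noteq> 0 \<and> (\<forall>c. polar r S c (vec2 a b) = k * c (r s))"
    if s: "s \<in> S" and ab: "a \<noteq> 0 \<or> b \<noteq> 0" and eq: "pt (fst (r s)) (snd (r s)) = pt a b" for s a b
  proof -
    have 0: "bracket (r s) (vec2 a b) = 0" using bracket_eq_0_iff[OF nz[OF s] ab] eq by simp
    have "bracket (r q) (vec2 a b) \<noteq> 0" if "q \<in> S - {s}" for q
      using bracket_eq_0_iff[OF nz ab, of q] inj[OF _ s, of q] that eq by auto
    then have "(\<Prod>q\<in>S - {s}. bracket (r q) (vec2 a b)) \<noteq> 0" using S by simp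
    then show ?thesis using polar_at_member[where r = r, OF S(1) s 0] by (auto simp: mult.commute)
  qed
  show hp: "homogeneous_pair (card S - 1) (polar r S fst) (polar r S snd)"
    unfolding homogeneous_pair_def
  proof (intro conjI polar_homogeneous S allI impI)
    fix a b :: 'k assume ab: "a \<noteq> 0 \<or> b \<noteq> 0"
    show "polar r S fst (vec2 a b) \<noteq> 0 \<or> polar r S snd (vec2 a b) \<noteq> 0"
    proof (cases "\<exists>s\<in>S. pt (fst (r s)) (snd (r s)) = pt a b")
      case True
      then obtain s where s: "s \<in> S" "pt (fst (r s)) (snd (r s)) = pt a b" by blast
      then show ?thesis using member[OF s(1) ab s(2)] nz[OF s(1)] by auto
    next
      case False
      then have "\<forall>q\<in>S. bracket (r q) (vec2 a b) \<noteq> 0" using bracket_eq_0_iff[OF nz ab] by auto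
      then have "of_nat (card S) * (\<Prod>q\<in>S. bracket (r q) (vec2 a b)) \<noteq> 0" using S by simp
      then show ?thesis using polar_bracket[OF S(1), of r "vec2 a b"] by auto
    qed
  qed
  assume s: "s \<in> S"
  obtain k where k: "k \<noteq> 0" "\<And>c. polar r S c (vec2 (fst (r s)) (snd (r s))) = k * c (r s)"
    using member[OF s nz[OF s] refl] by blast
  show "pair_map (polar r S fst) (polar r S snd) (pt (fst (r s)) (snd (r s))) = pt (fst (r s)) (snd (r s))"
    unfolding pair_map_pt[OF hp nz[OF s]] k(2) by (rule pt_scale[OF k(1)])
qed

text \<open>Applying M to both arguments multiplies a bracket by the determinant of M. Since M
  permutes S up to rescaling the chosen representatives, all summands acquire the same factor after
  reindexing.\<close>

lemma polar_equivariant: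
  fixes r :: "'k::field_char_0 proj_point \<Rightarrow> 'k \<times> 'k"
  assumes S: "finite S" and nz: "\<And>p. p \<in> S \<Longrightarrow> fst (r p) \<noteq> 0 \<or> snd (r p) \<noteq> 0"
    and rep: "\<And>p. p \<in> S \<Longrightarrow> pt (fst (r p)) (snd (r p)) = p"
    and M: "det2 M \<noteq> 0" and bij: "bij_betw (moebius M) S S"
  shows "\<exists>k. k \<noteq> 0 \<and> (\<forall>x.
     polar r S fst (vec2 (row1 M x) (row2 M x)) = k * row1 M (vec2 (polar r S fst x) (polar r S snd x)) \<and>
     polar r S snd (vec2 (row1 M x) (row2 M x)) = k * row2 M (vec2 (polar r S fst x) (polar r S snd x)))"
proof -
  let ?\<sigma> = "moebius M"
  define A where "A p = (m11 M * fst p + m12 M * snd p, m21 M * fst p + m22 M * snd p)" for p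
  have "\<exists>c. c \<noteq> 0 \<and> r (?\<sigma> p) = (c * fst (A (r p)), c * snd (A (r p)))" if p: "p \<in> S" for p
  proof -
    have "?\<sigma> p \<in> S" by (rule bij_betw_apply[OF bij p])
    then have "pt (fst (r (?\<sigma> p))) (snd (r (?\<sigma> p))) = ?\<sigma> p" by (rule rep)
    also have "\<dots> = ?\<sigma> (pt (fst (r p)) (snd (r p)))" using rep[OF p] by simp
    also have "\<dots> = pt (fst (A (r p))) (snd (A (r p)))"
      unfolding moebius_pt[OF M nz[OF p]] by (simp add: A_def)
    finally have "proj_class (vec2 (fst (A (r p))) (snd (A (r p)))) = proj_class (vec2 (fst (r (?\<sigma> p))) (snd (r (?\<sigma> p))))" ..
    from proj_class_eqD[OF this] obtain c where "c \<noteq> 0"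
      "vec2 (fst (r (?\<sigma> p))) (snd (r (?\<sigma> p))) = (\<lambda>i. c * vec2 (fst (A (r p))) (snd (A (r p))) i)" by blast
    then show ?thesis unfolding scale_vec2 by (intro exI[of _ c]) (auto simp: prod_eq_iff)
  qed
  then obtain c where c: "\<And>p. p \<in> S \<Longrightarrow> c p \<noteq> 0" "\<And>p. p \<in> S \<Longrightarrow> r (?\<sigma> p) = (c p * fst (A (r p)), c p * snd (A (r p)))"
    by metis
  \<comment> \<open>The summand of p receives c p from its own representative and c q from the
    bracket of each other q; its card S - 1 brackets contribute one determinant each.\<close>
  define k where "k = (\<Prod>p\<in>S. c p) * det2 M ^ (card S - 1)"
  have k: "k \<noteq> 0" using c(1) S M by (simp add: k_def)
  have br: "bracket (r (?\<sigma> q)) (vec2 (row1 M x) (row2 M x)) = c q * det2 M * bracket (r q) x" if "q \<in> S" for q x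
    unfolding c(2)[OF that] by (simp add: bracket_def A_def row1_def row2_def det2_def algebra_simps)
  have main: "polar r S e (vec2 (row1 M x) (row2 M x)) = k * (\<Sum>p\<in>S. f (r p) * (\<Prod>q\<in>S - {p}. bracket (r q) x))"
    if e: "\<And>p. p \<in> S \<Longrightarrow> e (r (?\<sigma> p)) = c p * f (r p)" for e f x
  proof -
    have "polar r S e (vec2 (row1 M x) (row2 M x)) =
       (\<Sum>p\<in>S. e (r (?\<sigma> p)) * (\<Prod>q\<in>S - {?\<sigma> p}. bracket (r q) (vec2 (row1 M x) (row2 M x))))"
      unfolding polar_def by (rule sum.reindex_bij_betw[OF bij, symmetric])
    also have "\<dots> = (\<Sum>p\<in>S. k * (f (r p) * (\<Prod>q\<in>S - {p}. bracket (r q) x)))"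
    proof (rule sum.cong[OF refl])
      fix p assume p: "p \<in> S"
      have "bij_betw ?\<sigma> (S - {p}) (S - {?\<sigma> p})"
        using bij p bij_betw_apply[OF bij p] by (intro bij_betw_DiffI) auto
      then have "(\<Prod>q\<in>S - {?\<sigma> p}. bracket (r q) (vec2 (row1 M x) (row2 M x))) =
         (\<Prod>q\<in>S - {p}. bracket (r (?\<sigma> q)) (vec2 (row1 M x) (row2 M x)))"
        by (rule prod.reindex_bij_betw[symmetric])
      also have "\<dots> = (\<Prod>q\<in>S - {p}. c q * det2 M * bracket (r q) x)"
        by (rule prod.cong[OF refl]) (simp add: br)
      also have "\<dots> = (\<Prod>q\<in>S - {p}. c q) * det2 M ^ (card S - 1) * (\<Prod>q\<in>S - {p}. bracket (r q) x)"
        using S p by (simp add: prod.distrib)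
      finally show "e (r (?\<sigma> p)) * (\<Prod>q\<in>S - {?\<sigma> p}. bracket (r q) (vec2 (row1 M x) (row2 M x))) =
          k * (f (r p) * (\<Prod>q\<in>S - {p}. bracket (r q) x))"
        unfolding e[OF p] k_def prod.remove[OF S p] by simp
    qed
    finally show ?thesis by (simp add: sum_distrib_left)
  qed
  have "polar r S fst (vec2 (row1 M x) (row2 M x)) = k * row1 M (vec2 (polar r S fst x) (polar r S snd x))" for x
  proof -
    have "polar r S fst (vec2 (row1 M x) (row2 M x)) = k * (\<Sum>p\<in>S. fst (A (r p)) * (\<Prod>q\<in>S - {p}. bracket (r q) x))"
      by (rule main) (simp add: c(2))
    then show ?thesis by (simp add: A_def row1_def polar_def sum_distrib_left sum.distrib algebra_simps)
  qed
  moreover have "polar r S snd (vec2 (row1 M x) (row2 M x)) = k * row2 M (vec2 (polar r S fst x) (polar r S snd x))" for x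
  proof -
    have "polar r S snd (vec2 (row1 M x) (row2 M x)) = k * (\<Sum>p\<in>S. snd (A (r p)) * (\<Prod>q\<in>S - {p}. bracket (r q) x))"
      by (rule main) (simp add: c(2))
    then show ?thesis by (simp add: A_def row2_def polar_def sum_distrib_left sum.distrib algebra_simps)
  qed
  ultimately show ?thesis using k by blast
qed

lemma finite_subgroup_invariant_set:
  fixes G :: "('k::{alg_closed_field, field_char_0} proj_point, 'k proj_point) rational_map set"
  assumes G: "subgroup G (Cremona 1)" "finite G"
  obtains S where "finite S" "S \<subseteq> points PL" "card S \<ge> 3"
    "\<And>M. det2 M \<noteq> 0 \<Longrightarrow> moebius_class M \<in> G \<Longrightarrow> bij_betw (moebius M) S S"
proof -
  have "\<exists>M. det2 M \<noteq> 0 \<and> moebius_class M = g" if "g \<in> G" for g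
    using subgroup.subset[OF G(1)] that unfolding carrier_Cremona_1 by blast
  then obtain m where m: "\<And>g. g \<in> G \<Longrightarrow> det2 (m g) \<noteq> 0" "\<And>g. g \<in> G \<Longrightarrow> moebius_class (m g) = g" by metis
  \<comment> \<open>Three points make the degree card S - 1 of the polar map at least 2. The union
    of their translates is invariant because translating a translate is a translate.\<close>
  define T where "T = {pt 0 1, pt 1 0, pt 1 (1::'k)}"
  have T: "card T = 3" unfolding T_def by (simp add: pt_eq_iff)
  have Tp: "T \<subseteq> points PL" unfolding T_def by (simp only: insert_subset empty_subsetI simp_thms) (intro conjI pt_mem; simp)
  define S where "S = (\<Union>g\<in>G. moebius (m g) ` T)"
  have "finite T" unfolding T_def by simp
  then have fin: "finite S" using G(2) unfolding S_def by blast
  have Sp: "S \<subseteq> points PL" unfolding S_def using moebius_mem m(1) Tp by blast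
  have inj: "inj_on (moebius M) (points PL)" if M: "det2 M \<noteq> 0" for M :: "'k mat2"
  proof -
    obtain N where "\<And>p. p \<in> points (PL :: ('k proj_point, 'k) fspace) \<Longrightarrow> moebius N (moebius M p) = p"
      using moebius_inverse[OF M] by metis
    then show ?thesis by (rule inj_on_inverseI)
  qed
  have inv: "bij_betw (moebius M) S S" if M: "det2 M \<noteq> 0" "moebius_class M \<in> G" for M
  proof -
    have "moebius M p \<in> S" if p: "p \<in> S" for p
    proof -
      obtain g q where g: "g \<in> G" "q \<in> T" "p = moebius (m g) q" using p unfolding S_def by blast
      define h where "h = moebius_class M \<otimes>\<^bsub>Cremona 1\<^esub> g"
      have h: "h \<in> G" unfolding h_def using subgroup.m_closed[OF G(1) M(2) g(1)] .
      have "moebius_class (m h) = rational_comp PL PL (moebius_class M) (moebius_class (m g))"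
        using m(2)[OF h] m(2)[OF g(1)] unfolding h_def Cremona_def mult_Bir by simp
      also have "\<dots> = moebius_class (mult2 M (m g))" by (rule moebius_class_comp[OF M(1) m(1)[OF g(1)]])
      finally have "\<forall>p\<in>points PL. moebius (m h) p = moebius (mult2 M (m g)) p"
        using moebius_class_eq_iff[OF m(1)[OF h], of "mult2 M (m g)"] M(1) m(1)[OF g(1)] by (simp add: det_mult2)
      then have "moebius (m h) q = moebius M p"
        using moebius_mult[OF M(1) m(1)[OF g(1)]] g Tp by auto
      then show ?thesis unfolding S_def using h g(2) by (metis UN_I imageI)
    qed
    then have "moebius M ` S \<subseteq> S" by blast
    moreover have "inj_on (moebius M) S" using inj[OF M(1)] Sp by (rule inj_on_subset)
    ultimately show ?thesis using fin by (simp add: bij_betw_def endo_inj_surj)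
  qed
  have "G \<noteq> {}" using subgroup.one_closed[OF G(1)] by blast
  then obtain g where g: "g \<in> G" by blast
  have "card (moebius (m g) ` T) = 3"
    using card_image[OF inj_on_subset[OF inj[OF m(1)[OF g]] Tp]] T by simp
  moreover have "moebius (m g) ` T \<subseteq> S" unfolding S_def using g by blast
  ultimately have "card S \<ge> 3" using card_mono[OF fin] by metis
  then show thesis using that fin Sp inv by blast
qed

lemma finite_subgroup_self_compressible:
  fixes G :: "('k::{alg_closed_field, field_char_0} proj_point, 'k proj_point) rational_map set"
  assumes G: "subgroup G (Cremona 1)" "finite G"
  shows "nontrivially_self_compressible PL G"
proof -
  let ?P = "PL :: ('k proj_point, 'k) fspace"
  note irr = irreducible_variety_P1[where 'k = 'k]
  obtain S where S: "finite S" "S \<subseteq> points ?P" "card S \<ge> 3"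
    and bij: "\<And>M. det2 M \<noteq> 0 \<Longrightarrow> moebius_class M \<in> G \<Longrightarrow> bij_betw (moebius M) S S"
    by (rule finite_subgroup_invariant_set[OF G]) blast
  have "\<exists>r. (fst r \<noteq> 0 \<or> snd r \<noteq> 0) \<and> pt (fst r) (snd r) = p" if "p \<in> S" for p
  proof -
    have "p \<in> points ?P" using that S(2) by blast
    then obtain a b where "p = pt a b" "a \<noteq> 0 \<or> b \<noteq> 0" by (rule P1_pointE)
    then show ?thesis by (intro exI[of _ "(a, b)"]) simp
  qed
  then have "\<exists>r. \<forall>p\<in>S. (fst (r p) \<noteq> 0 \<or> snd (r p) \<noteq> 0) \<and> pt (fst (r p)) (snd (r p)) = p"
    by (intro bchoice) blast
  then obtain r where nz: "\<And>p. p \<in> S \<Longrightarrow> fst (r p) \<noteq> 0 \<or> snd (r p) \<noteq> 0" and rep: "\<And>p. p \<in> S \<Longrightarrow> pt (fst (r p)) (snd (r p)) = p"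
    by blast
  have ne: "S \<noteq> {}" using S(3) by auto
  have inj: "p = q" if "p \<in> S" "q \<in> S" "pt (fst (r p)) (snd (r p)) = pt (fst (r q)) (snd (r q))" for p q
    using rep that by metis
  let ?F = "polar r S fst" and ?E = "polar r S snd"
  have hp: "homogeneous_pair (card S - 1) ?F ?E" by (rule polar_pair(1)[OF S(1) ne nz inj])
  have fix_S: "pair_map ?F ?E s = s" if "s \<in> S" for s
  proof -
    have "pair_map ?F ?E (pt (fst (r s)) (snd (r s))) = pt (fst (r s)) (snd (r s))"
      by (rule polar_pair(2)[OF S(1) ne _ _ that]) (fact nz, fact inj)
    then show ?thesis unfolding rep[OF that] .
  qed
  obtain s t where st: "s \<in> S" "t \<in> S" "s \<noteq> t"
  proof -
    obtain s where s: "s \<in> S" using ne by blast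
    have "card (S - {s}) \<noteq> 0" using S s by simp
    then have "S - {s} \<noteq> {}" by (metis card.empty)
    then show thesis using that s by blast
  qed
  \<comment> \<open>The map fixes two distinct points of S, so it is not constant.\<close>
  have "dense_image PL (points PL) (pair_map ?F ?E)"
    by (rule pair_map_dense_image[OF hp, of s t]) (use st S(2) fix_S in auto)
  then have dom: "pair_class ?F ?E \<in> dominant_maps PL PL"
    by (rule dominant_mapsI[OF irr irr pair_map_partial_morphism[OF hp]])
  have comm: "rational_comp PL PL (pair_class ?F ?E) g = rational_comp PL PL g (pair_class ?F ?E)" if g: "g \<in> G" for g
  proof -
    obtain M where M: "det2 M \<noteq> 0" "g = moebius_class M"
      using g subgroup.subset[OF G(1)] unfolding carrier_Cremona_1 by blast
    note mp = moebius_pair[OF M(1)]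
    have b: "bij_betw (moebius M) S S" using bij M g by blast
    obtain k where k: "k \<noteq> 0" "\<And>x. ?F (vec2 (row1 M x) (row2 M x)) = k * row1 M (vec2 (?F x) (?E x))"
       "\<And>x. ?E (vec2 (row1 M x) (row2 M x)) = k * row2 M (vec2 (?F x) (?E x))"
      using polar_equivariant[OF S(1) nz rep M(1) b] by blast
    have dM: "dominant PL (pair_class (row1 M) (row2 M))"
      using moebius_class_dominant(2)[OF M(1)] unfolding dominant_maps_def moebius_class_def by blast
    have dF: "dominant PL (pair_class ?F ?E)" using dom unfolding dominant_maps_def by blast
    note h1 = homogeneous_pair_comp(1)[OF mp hp] and h2 = homogeneous_pair_comp(1)[OF hp mp]
    show ?thesis unfolding M(2) moebius_class_def pair_class_comp[OF mp hp dM] pair_class_comp[OF hp mp dF]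
      unfolding pair_class_eq_iff[OF h1 h2]
    proof
      fix p :: "'k proj_point" assume "p \<in> points PL"
      then obtain a b where p: "p = pt a b" "a \<noteq> 0 \<or> b \<noteq> 0" by (rule P1_pointE)
      show "pair_map (\<lambda>x. ?F (vec2 (row1 M x) (row2 M x))) (\<lambda>x. ?E (vec2 (row1 M x) (row2 M x))) p =
         pair_map (\<lambda>x. row1 M (vec2 (?F x) (?E x))) (\<lambda>x. row2 M (vec2 (?F x) (?E x))) p"
        unfolding p(1) pair_map_pt[OF h1 p(2)] pair_map_pt[OF h2 p(2)] unfolding k(2,3) by (rule pt_scale[OF k(1)])
    qed
  qed
  have grp: "subgroup G (Bir ?P)" using G(1) unfolding Cremona_def .
  have "group (Bir ?P\<lparr>carrier := G\<rparr>)" by (rule subgroup.subgroup_is_group[OF grp group_Bir[OF irr]])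
  moreover have "(\<lambda>g. g) \<in> mon (Bir ?P\<lparr>carrier := G\<rparr>) (Bir ?P)"
    using subgroup.subset[OF grp] by (auto simp: mon_def hom_def)
  ultimately have "rational_action (Bir ?P\<lparr>carrier := G\<rparr>) ?P (\<lambda>g. g)"
    using G(2) unfolding rational_action_def by simp
  then have "compression (Bir ?P\<lparr>carrier := G\<rparr>) ?P (\<lambda>g. g) ?P (\<lambda>g. g) (pair_class ?F ?E)"
    using dom comm unfolding compression_def dominant_maps_def by simp
  \<comment> \<open>The degree card S - 1 is at least 2, whereas birational maps have degree
    1.\<close>
  moreover have "\<not> birational PL PL (pair_class ?F ?E)"
    using birational_pair_degree[OF hp] S(3) by auto
  ultimately show ?thesis unfolding nontrivially_self_compressible_def by blast
qed

section \<open>Roots of unity and orbit counting\<close>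

text \<open>A double root of x^n - 1 would be a zero of the derivative n x^(n - 1), hence 0 in
  characteristic zero, but 0 is not a root. So the n linear factors are distinct.\<close>

lemma card_roots_of_unity:
  assumes "n > 0"
  shows "card {x :: 'k::{alg_closed_field, field_char_0}. x ^ n = 1} = n"
proof -
  define p where "p = monom 1 n - (1 :: 'k poly)"
  have px: "poly p x = x ^ n - 1" for x by (simp add: p_def poly_monom)
  have "degree p = n"
    using degree_add_eq_left[of "- 1" "monom (1 :: 'k) n"] assms by (simp add: p_def degree_monom_eq)
  have p0: "p \<noteq> 0" using \<open>degree p = n\<close> assms by auto
  obtain A where A: "size A = degree p" "p = smult (lead_coeff p) (\<Prod>x\<in>#A. [:-x, 1:])"
    using alg_closed_imp_factorization[OF p0] by blast
  have "count A x \<le> 1" for x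
  proof (rule ccontr)
    assume "\<not> count A x \<le> 1"
    then have "{#x, x#} \<subseteq># A" by (auto simp: subseteq_mset_def)
    then obtain B where "A = {#x, x#} + B" by (metis subset_mset.le_iff_add)
    then have "A = add_mset x (add_mset x B)" by simp
    moreover have "(\<Prod>y\<in>#add_mset x (add_mset x B). f y) = f x * (f x * (\<Prod>y\<in>#B. f y))" for f :: "'k \<Rightarrow> 'k poly"
      by simp
    ultimately obtain R where R: "p = smult (lead_coeff p) ([:-x, 1:] * ([:-x, 1:] * R))"
      using A(2) by metis
    define L where "L = [:-x, 1:]"
    have L0: "poly L x = 0" by (simp add: L_def)
    have q: "p = L * (L * smult (lead_coeff p) R)" using R unfolding L_def[symmetric] by simp
    have "poly (pderiv p) x = 0" by (subst q) (simp add: pderiv_mult pderiv_smult L0)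
    moreover have "pderiv p = monom (of_nat n) (n - 1)" by (simp add: p_def pderiv_diff pderiv_monom)
    ultimately have "x = 0" using assms by (simp add: poly_monom)
    moreover have "poly p x = 0" by (subst q) (simp add: L0)
    ultimately show False using px[of 0] zero_power[OF assms, where 'a = 'k] by simp
  qed
  then have "size A = card (set_mset A)"
    unfolding size_multiset_overloaded_eq card_eq_sum by (intro sum.cong refl) (metis count_greater_zero_iff le_antisym Suc_leI One_nat_def)
  moreover have "poly p x = 0 \<longleftrightarrow> x \<in># A" for x
  proof -
    have "poly p x = lead_coeff p * (\<Prod>y\<in>#A. x - y)" by (subst A(2)) (simp add: poly_prod_mset)
    then show ?thesis using p0 by (auto simp: prod_mset_zero_iff)
  qed
  then have "set_mset A = {x. x ^ n = 1}" using px by auto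
  ultimately show ?thesis using A(1) \<open>degree p = n\<close> by simp
qed

definition primitive_root_of_unity :: "nat \<Rightarrow> 'k::field \<Rightarrow> bool" where
  "primitive_root_of_unity n x \<longleftrightarrow> n > 0 \<and> x ^ n = 1 \<and> (\<forall>d. 0 < d \<longrightarrow> d < n \<longrightarrow> x ^ d \<noteq> 1)"

lemma primitive_root_dvd:
  assumes "primitive_root_of_unity d x" "x ^ n = 1"
  shows "d dvd n"
proof -
  have "x ^ n = (x ^ d) ^ (n div d) * x ^ (n mod d)"
    by (simp add: power_mult[symmetric] power_add[symmetric])
  then have "x ^ (n mod d) = 1" using assms unfolding primitive_root_of_unity_def by simp
  then have "n mod d = 0" using assms(1) unfolding primitive_root_of_unity_def by (metis mod_less_divisor gr0I)
  then show ?thesis by auto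
qed

text \<open>The numbers of primitive roots satisfy the recursion of Euler's totient function.\<close>

lemma card_primitive_roots:
  "n > 0 \<Longrightarrow> card {x :: 'k::{alg_closed_field, field_char_0}. primitive_root_of_unity n x} = totient n"
proof (induction n rule: less_induct)
  case (less n)
  let ?E = "\<lambda>d. {x :: 'k. primitive_root_of_unity d x}"
  have fin: "finite (?E d)" if "d > 0" for d
  proof (rule finite_subset)
    show "?E d \<subseteq> {x. x ^ d = 1}" by (auto simp: primitive_root_of_unity_def)
    show "finite {x :: 'k. x ^ d = 1}" using card_roots_of_unity[OF that] that by (metis card.infinite less_numeral_extra(3))
  qed
  have D: "finite {d. d dvd n}" "{d. d dvd n} = insert n {d. d dvd n \<and> d < n}" "finite {d. d dvd n \<and> d < n}"
    using less.prems by (auto dest: dvd_imp_le intro: finite_subset[OF _ finite_divisors_nat[OF less.prems]] simp: le_less)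
  have "{x :: 'k. x ^ n = 1} = (\<Union>d\<in>{d. d dvd n}. ?E d)"
  proof (intro equalityI subsetI)
    fix x :: 'k assume x: "x \<in> {x. x ^ n = 1}"
    define d where "d = (LEAST d. 0 < d \<and> x ^ d = 1)"
    have d: "0 < d \<and> x ^ d = 1" unfolding d_def by (rule LeastI[of _ n]) (use x less.prems in simp)
    have "primitive_root_of_unity d x" unfolding primitive_root_of_unity_def
      using d not_less_Least[of _ "\<lambda>d. 0 < d \<and> x ^ d = 1"] unfolding d_def by blast
    then show "x \<in> (\<Union>d\<in>{d. d dvd n}. ?E d)" using primitive_root_dvd[of d x n] x by auto
  next
    fix x :: 'k assume "x \<in> (\<Union>d\<in>{d. d dvd n}. ?E d)"
    then show "x \<in> {x. x ^ n = 1}" unfolding primitive_root_of_unity_def by (auto simp: power_mult elim!: dvdE)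
  qed
  then have "n = card (\<Union>d\<in>{d. d dvd n}. ?E d)" using card_roots_of_unity[OF less.prems, where 'k = 'k] by simp
  also have "\<dots> = (\<Sum>d\<in>{d. d dvd n}. card (?E d))"
  proof (rule card_UN_disjoint[OF D(1)])
    show "\<forall>d\<in>{d. d dvd n}. finite (?E d)" using fin less.prems by (auto intro: dvd_pos_nat)
    have "d = e" if "x \<in> ?E d" "x \<in> ?E e" for d e x
      using that primitive_root_dvd by (metis dvd_antisym mem_Collect_eq primitive_root_of_unity_def)
    then show "\<forall>d\<in>{d. d dvd n}. \<forall>e\<in>{d. d dvd n}. d \<noteq> e \<longrightarrow> ?E d \<inter> ?E e = {}" by blast
  qed
  also have "\<dots> = card (?E n) + (\<Sum>d\<in>{d. d dvd n \<and> d < n}. card (?E d))"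
    unfolding D(2) using D(3) by (subst sum.insert) auto
  also have "(\<Sum>d\<in>{d. d dvd n \<and> d < n}. card (?E d)) = (\<Sum>d\<in>{d. d dvd n \<and> d < n}. totient d)"
    using less.IH less.prems by (intro sum.cong) (auto intro: dvd_pos_nat)
  finally have "n = card (?E n) + (\<Sum>d\<in>{d. d dvd n \<and> d < n}. totient d)" .
  moreover have "n = totient n + (\<Sum>d\<in>{d. d dvd n \<and> d < n}. totient d)"
    using totient_divisor_sum[of n] unfolding D(2) using D(3) by (subst (asm) sum.insert) auto
  ultimately show ?case by linarith
qed

lemma primitive_root_exists:
  assumes "n > 0"
  shows "\<exists>x :: 'k::{alg_closed_field, field_char_0}. primitive_root_of_unity n x"
proof -
  have "card {x :: 'k. primitive_root_of_unity n x} \<noteq> 0" unfolding card_primitive_roots[OF assms] using assms by simp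
  then show ?thesis by (metis (mono_tags, lifting) card.empty Collect_empty_eq)
qed

text \<open>Divided by N, the hypothesis reads 1/e1 + 1/e2 + 1/e3 = 1 + 2/N. The sum exceeds 1 only
  for the triples (2, 2, e3), (2, 3, 3), (2, 3, 4) and (2, 3, 5), and each determines N. The orbit
  sizes n1, n2, n3 keep the argument within the natural numbers.\<close>

lemma three_orbits_arithmetic_sorted:
  fixes N :: nat
  assumes "n1 * e1 = N" "n2 * e2 = N" "n3 * e3 = N" "2 \<le> e1" "e1 \<le> e2" "e2 \<le> e3" "n1 + n2 + n3 = N + 2" "N > 0"
  shows "N = 2 * e3 \<or> (e3 = 3 \<and> N = 12) \<or> (e3 = 4 \<and> N = 24) \<or> (e3 = 5 \<and> N = 60)"
proof -
  have e1: "e1 = 2"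
  proof (rule ccontr)
    assume "e1 \<noteq> 2"
    then have "3 \<le> e1" "3 \<le> e2" "3 \<le> e3" using assms by auto
    then have "n1 * 3 \<le> N" "n2 * 3 \<le> N" "n3 * 3 \<le> N" using assms(1-3) by (metis mult_le_mono2)+
    then show False using assms(7) by linarith
  qed
  have "e2 < 4"
  proof (rule ccontr)
    assume "\<not> e2 < 4"
    then have "4 \<le> e2" "4 \<le> e3" using assms by auto
    then have "n2 * 4 \<le> N" "n3 * 4 \<le> N" using assms(2,3) by (metis mult_le_mono2)+
    then show False using assms(1)[unfolded e1] assms(7) by linarith
  qed
  then consider "e2 = 2" | "e2 = 3" using assms(4,5) by linarith
  then show ?thesis
  proof cases
    case 1
    then have "n3 = 2" using assms(1)[unfolded e1] assms(2)[unfolded 1] assms(7) by linarith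
    then show ?thesis using assms(3) by simp
  next
    case 2
    then have "n1 * 2 = n2 * 3" using assms(1,2) e1 by simp
    then have "even (n2 * 3)" by (metis dvd_triv_right)
    then have "even n2" by simp
    then obtain k where "n2 = 2 * k" by (rule evenE)
    then have k: "n2 = 2 * k" "n1 = 3 * k" using \<open>n1 * 2 = n2 * 3\<close> by auto
    then have n3: "n3 = k + 2" "N = 6 * k" using assms(1,7) e1 by auto
    have eq: "(k + 2) * e3 = 6 * k" using assms(3) n3 by simp
    have "e3 < 6"
    proof (rule ccontr)
      assume "\<not> e3 < 6"
      then have "(k + 2) * 6 \<le> (k + 2) * e3" by (intro mult_le_mono2) simp
      then show False using eq by simp
    qed
    then consider "e3 = 3" | "e3 = 4" | "e3 = 5" using assms(6) 2 by linarith
    then show ?thesis using eq n3(2) by cases auto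
  qed
qed

lemma three_orbits_arithmetic:
  fixes N :: nat
  assumes "n1 * e1 = N" "n2 * e2 = N" "n3 * e3 = N" "2 \<le> e1" "2 \<le> e2" "2 \<le> e3" "n1 + n2 + n3 = N + 2" "N > 0"
  shows "\<exists>r \<in> {e1, e2, e3}. e1 \<le> r \<and> e2 \<le> r \<and> e3 \<le> r \<and>
    (N = 2 * r \<or> (r = 3 \<and> N = 12) \<or> (r = 4 \<and> N = 24) \<or> (r = 5 \<and> N = 60))"
proof -
  note s = three_orbits_arithmetic_sorted
  consider "e1 \<le> e2" "e2 \<le> e3" | "e1 \<le> e3" "e3 \<le> e2" | "e2 \<le> e1" "e1 \<le> e3" | "e2 \<le> e3" "e3 \<le> e1"
    | "e3 \<le> e1" "e1 \<le> e2" | "e3 \<le> e2" "e2 \<le> e1" by linarith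
  then show ?thesis
  proof cases
    case 1 show ?thesis using s[OF assms(1,2,3) assms(4) 1 assms(7,8)] 1 by auto
  next
    case 2 show ?thesis using s[OF assms(1,3,2) assms(4) 2 _ assms(8)] assms(7) 2 by auto
  next
    case 3 show ?thesis using s[OF assms(2,1,3) assms(5) 3 _ assms(8)] assms(7) 3 by auto
  next
    case 4 show ?thesis using s[OF assms(2,3,1) assms(5) 4 _ assms(8)] assms(7) 4 by auto
  next
    case 5 show ?thesis using s[OF assms(3,1,2) assms(6) 5 _ assms(8)] assms(7) 5 by auto
  next
    case 6 show ?thesis using s[OF assms(3,2,1) assms(6) 6 _ assms(8)] assms(7) 6 by auto
  qed
qed

text \<open>The fibres of g \<mapsto> \<open>act g p\<close> are left translates of the stabilizer,
  hence all of its size.\<close>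

lemma orbit_stabilizer:
  fixes G (structure)
  assumes G: "group G" "finite (carrier G)"
    and mult: "\<And>g h p. g \<in> carrier G \<Longrightarrow> h \<in> carrier G \<Longrightarrow> p \<in> P \<Longrightarrow> act (g \<otimes> h) p = act g (act h p)"
    and one: "\<And>p. p \<in> P \<Longrightarrow> act \<one> p = p" and p: "p \<in> P"
  shows "card ((\<lambda>g. act g p) ` carrier G) * card {g \<in> carrier G. act g p = p} = card (carrier G)"
proof -
  interpret group G by fact
  let ?O = "(\<lambda>g. act g p) ` carrier G" and ?F = "\<lambda>q. {g \<in> carrier G. act g p = q}"
  have "carrier G = (\<Union>q\<in>?O. ?F q)" by auto
  then have "card (carrier G) = card (\<Union>q\<in>?O. ?F q)" by simp
  also have "\<dots> = (\<Sum>q\<in>?O. card (?F q))"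
    by (rule card_UN_disjoint) (use G(2) in auto)
  also have "\<dots> = (\<Sum>q\<in>?O. card (?F p))"
  proof (rule sum.cong[OF refl])
    fix q assume "q \<in> ?O"
    then obtain h where h: "h \<in> carrier G" "q = act h p" by blast
    have "bij_betw (\<lambda>g. h \<otimes> g) (?F p) (?F q)"
    proof (rule bij_betw_byWitness[where f' = "\<lambda>g. inv h \<otimes> g"])
      show "\<forall>g\<in>?F p. inv h \<otimes> (h \<otimes> g) = g" "\<forall>g\<in>?F q. h \<otimes> (inv h \<otimes> g) = g"
        using h by (auto simp: m_assoc[symmetric])
      show "(\<lambda>g. h \<otimes> g) ` ?F p \<subseteq> ?F q" using h p mult by auto
      have "act (inv h \<otimes> g) p = p" if g: "g \<in> ?F q" for g
      proof -
        have "act (inv h \<otimes> g) p = act (inv h) (act h p)" using g h p mult by auto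
        also have "\<dots> = act (inv h \<otimes> h) p" using h p mult[of "inv h" h p] by simp
        finally show ?thesis using h p one by simp
      qed
      then show "(\<lambda>g. inv h \<otimes> g) ` ?F q \<subseteq> ?F p" using h by auto
    qed
    from bij_betw_same_card[OF this] show "card (?F q) = card (?F p)" ..
  qed
  finally show ?thesis by simp
qed

text \<open>
  The class equation for the points with nontrivial stabilizer, as in Klein's classification
  of the finite rotation groups.
\<close>

lemma two_fixed_points_classification:
  fixes G (structure)
  assumes G: "group G" "finite (carrier G)" and N: "card (carrier G) \<ge> 2"
    and mem: "\<And>g p. g \<in> carrier G \<Longrightarrow> p \<in> P \<Longrightarrow> act g p \<in> P"
    and mult: "\<And>g h p. g \<in> carrier G \<Longrightarrow> h \<in> carrier G \<Longrightarrow> p \<in> P \<Longrightarrow> act (g \<otimes> h) p = act g (act h p)"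
    and one: "\<And>p. p \<in> P \<Longrightarrow> act \<one> p = p"
    and fix2: "\<And>g. g \<in> carrier G \<Longrightarrow> g \<noteq> \<one> \<Longrightarrow> card {p \<in> P. act g p = p} = 2"
  defines "e \<equiv> \<lambda>p. card {g \<in> carrier G. act g p = p}"
  shows "\<exists>r. (\<exists>p\<in>P. e p = r) \<and> (\<forall>p\<in>P. e p \<le> r) \<and> r \<ge> 2 \<and>
    (card (carrier G) = r \<or> card (carrier G) = 2 * r \<or> (r = 3 \<and> card (carrier G) = 12) \<or>
     (r = 4 \<and> card (carrier G) = 24) \<or> (r = 5 \<and> card (carrier G) = 60))"
proof -
  interpret group G by fact
  define n where "n = card (carrier G)"
  define orb where "orb p = (\<lambda>g. act g p) ` carrier G" for p
  define S where "S = (\<Union>g\<in>carrier G - {\<one>}. {p \<in> P. act g p = p})"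
  have os: "card (orb p) * e p = n" if "p \<in> P" for p
    unfolding orb_def e_def n_def by (rule orbit_stabilizer[OF G mult one that])
  have e1: "e p \<ge> 1" if "p \<in> P" for p using os[OF that] N n_def by (metis mult_0_right not_less_eq_eq One_nat_def le_zero_eq zero_neq_numeral)
  have SP: "S \<subseteq> P" unfolding S_def by blast
  have finS: "finite S" unfolding S_def
  proof (rule finite_UN_I)
    fix g assume "g \<in> carrier G - {\<one>}"
    then have "card {p \<in> P. act g p = p} = 2" using fix2 by simp
    then show "finite {p \<in> P. act g p = p}" by (metis card.infinite zero_neq_numeral)
  qed (use G(2) in simp)
  have eS: "card {g \<in> carrier G - {\<one>}. act g p = p} = e p - 1" if "p \<in> P" for p
  proof -
    have "{g \<in> carrier G - {\<one>}. act g p = p} = {g \<in> carrier G. act g p = p} - {\<one>}" by auto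
    then show ?thesis unfolding e_def using one[OF that] by simp
  qed
  have e2: "e p \<ge> 2" if "p \<in> S" for p
  proof -
    have "{g \<in> carrier G - {\<one>}. act g p = p} \<noteq> {}" using that unfolding S_def by blast
    then have "card {g \<in> carrier G - {\<one>}. act g p = p} \<noteq> 0" using G(2) by simp
    then show ?thesis using eS that SP by auto
  qed
  have e_not_S: "e p = 1" if "p \<in> P" "p \<notin> S" for p
  proof -
    have "{g \<in> carrier G - {\<one>}. act g p = p} = {}" using that unfolding S_def by blast
    then have "e p - 1 = 0" using eS[OF that(1)] by (metis card.empty)
    then show ?thesis using e1[OF that(1)] by simp
  qed
  have self: "p \<in> orb p" if "p \<in> P" for p unfolding orb_def using one[OF that] by force
  have orbP: "orb p \<subseteq> P" if "p \<in> P" for p unfolding orb_def using mem that by blast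
  have orb_eq: "orb q = orb p" if p: "p \<in> P" and q: "q \<in> orb p" for p q
  proof -
    obtain h where h: "h \<in> carrier G" "q = act h p" using q unfolding orb_def by blast
    have "act g q \<in> orb p" if "g \<in> carrier G" for g
      unfolding h(2) mult[OF that h(1) p, symmetric] orb_def using that h(1) by blast
    moreover have "act g p \<in> orb q" if "g \<in> carrier G" for g
    proof -
      have "act (g \<otimes> inv h) q = act g (act (inv h) (act h p))" using mult mem h that p by simp
      also have "act (inv h) (act h p) = p" using mult[of "inv h" h p] h p one by simp
      finally have "act g p = act (g \<otimes> inv h) q" by simp
      moreover have "g \<otimes> inv h \<in> carrier G" using that h by simp
      ultimately show ?thesis unfolding orb_def by blast
    qed
    ultimately show ?thesis unfolding orb_def by blast
  qed
  have e_orb: "e q = e p" if p: "p \<in> P" and q: "q \<in> orb p" for p q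
  proof -
    have "card (orb p) * e q = card (orb p) * e p" using os[OF p] os[of q] orb_eq[OF p q] orbP[OF p] q by auto
    moreover have "card (orb p) \<noteq> 0"
    proof
      assume "card (orb p) = 0"
      then show False using os[OF p] N n_def by simp
    qed
    ultimately show ?thesis by simp
  qed
  have orbS: "orb p \<subseteq> S" if p: "p \<in> S" for p
  proof
    fix q assume q: "q \<in> orb p"
    have "p \<in> P" using p SP by blast
    then show "q \<in> S" using e_orb[OF _ q] e2[OF p] e_not_S[of q] orbP q by fastforce
  qed
  \<comment> \<open>Pairs of a nontrivial element and a point fixed by it, counted once by points
    and once by elements.\<close>
  have count: "(\<Sum>p\<in>S. e p - 1) = 2 * (n - 1)"
  proof -
    have "(\<Sum>g\<in>carrier G - {\<one>}. card {p \<in> S. act g p = p}) = (\<Sum>p\<in>S. e p - 1)"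
      by (rule sum_multicount_gen) (use G(2) finS eS SP in auto)
    moreover have "card {p \<in> S. act g p = p} = 2" if "g \<in> carrier G - {\<one>}" for g
    proof -
      have "{p \<in> S. act g p = p} = {p \<in> P. act g p = p}" using that unfolding S_def by blast
      then show ?thesis using fix2 that by simp
    qed
    ultimately show ?thesis using G(2) by (simp add: n_def)
  qed
  define W where "W = orb ` S"
  have finW: "finite W" unfolding W_def using finS by simp
  have SW: "S = \<Union>W" unfolding W_def using orbS self SP by blast
  have "(\<Sum>p\<in>S. e p - 1) = (\<Sum>O'\<in>W. \<Sum>p\<in>O'. e p - 1)"
    unfolding SW
  proof (rule sum.Union_disjoint[unfolded o_def])
    show "\<forall>A\<in>W. finite A" using finS SW by (metis Union_upper finite_subset)
    show "\<forall>A\<in>W. \<forall>B\<in>W. A \<noteq> B \<longrightarrow> A \<inter> B = {}"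
    proof (intro ballI impI)
      fix A B assume "A \<in> W" "B \<in> W" and ne: "A \<noteq> B"
      then obtain p q where pq: "p \<in> P" "q \<in> P" "A = orb p" "B = orb q" unfolding W_def using SP by blast
      show "A \<inter> B = {}"
      proof (rule ccontr)
        assume "A \<inter> B \<noteq> {}"
        then obtain x where "x \<in> orb p" "x \<in> orb q" using pq by blast
        then have "orb p = orb q" using orb_eq pq by metis
        then show False using ne pq by simp
      qed
    qed
  qed
  also have "\<dots> = (\<Sum>O'\<in>W. n - card O')"
  proof (rule sum.cong[OF refl])
    fix O' assume "O' \<in> W"
    then obtain p where p: "p \<in> P" "O' = orb p" unfolding W_def using SP by blast
    have "(\<Sum>q\<in>O'. e q - 1) = (\<Sum>q\<in>O'. e p - 1)" using e_orb[OF p(1)] p(2) by (intro sum.cong) auto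
    also have "\<dots> = n - card O'" using os[OF p(1)] p(2) by (simp add: diff_mult_distrib2)
    finally show "(\<Sum>q\<in>O'. e q - 1) = n - card O'" .
  qed
  \<comment> \<open>All points of an orbit have stabilizers of the same order, so an orbit O
    contributes card O * (e - 1) = n - card O.\<close>
  finally have main: "(\<Sum>O'\<in>W. n - card O') = 2 * (n - 1)" using count by simp
  have W: "\<exists>p\<in>S. O' = orb p \<and> card O' * e p = n \<and> e p \<ge> 2" if "O' \<in> W" for O'
    using that os e2 SP unfolding W_def by blast
  have eW: "\<exists>O'\<in>W. card O' * e p = n" if "p \<in> S" for p using that os SP unfolding W_def by blast
  have n2: "n \<ge> 2" using N n_def by simp
  have half: "2 * card O' \<le> n" "card O' \<ge> 1" if OW: "O' \<in> W" for O'
  proof -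
    obtain p where p: "card O' * e p = n" "e p \<ge> 2" using W[OF OW] by blast
    have "card O' * 2 \<le> card O' * e p" using p(2) by simp
    then show "2 * card O' \<le> n" using p(1) by simp
    show "card O' \<ge> 1" using p n2 by (cases "card O'") (auto simp: One_nat_def)
  qed
  \<comment> \<open>Orbits of points with nontrivial stabilizer have at most n / 2 elements, so each
    contributes at least n / 2 to a total of 2 n - 2: there are at most three. As each contributes
    at most n - 1, there are at least two.\<close>
  have "card W * n \<le> (\<Sum>O'\<in>W. 2 * (n - card O'))"
  proof -
    have "n \<le> 2 * (n - card O')" if "O' \<in> W" for O' using half[OF that] by linarith
    from sum_bounded_below[of W n "\<lambda>O'. 2 * (n - card O')", OF this] show ?thesis by simp
  qed
  also have "\<dots> = 2 * (2 * (n - 1))" using main by (simp add: sum_distrib_left[symmetric])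
  finally have "card W * n < 4 * n" using n2 by linarith
  then have le3: "card W \<le> 3" by simp
  have "(\<Sum>O'\<in>W. n - card O') \<le> card W * (n - 1)"
    using sum_bounded_above[of W "\<lambda>O'. n - card O'" "n - 1"] half by (auto intro: diff_le_mono2)
  then have "2 * (n - 1) \<le> card W * (n - 1)" using main by simp
  then have ge2: "card W \<ge> 2" using n2 by simp
  have bound: "\<forall>p\<in>P. e p \<le> r" if "\<And>p. p \<in> S \<Longrightarrow> e p \<le> r" "r \<ge> 2" for r
    using that e_not_S by (metis le_trans one_le_numeral)
  from le3 ge2 consider "card W = 2" | "card W = 3" by linarith
  then show ?thesis
  proof cases
    case 1
    then obtain A B where AB: "W = {A, B}" "A \<noteq> B" by (auto simp: card_2_iff)
    then have "n - card A + (n - card B) = 2 * (n - 1)" using main by simp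
    \<comment> \<open>Both contributions reach the maximum n - 1, so the two orbits are single
      points fixed by the whole group.\<close>
    then have c1: "card A = 1" "card B = 1" using half[of A] half[of B] AB n2 by auto
    have eq: "e p = n" if "p \<in> S" for p using eW[OF that] AB c1 by auto
    obtain p where "p \<in> S" using AB unfolding W_def by blast
    then show ?thesis using bound[of n] eq n2 SP unfolding n_def[symmetric] by (intro exI[of _ n]) auto
  next
    case 2
    then obtain A B C where ABC: "W = {A, B, C}" "A \<noteq> B" "A \<noteq> C" "B \<noteq> C" by (auto simp: card_3_iff)
    then have "(n - card A) + ((n - card B) + (n - card C)) = 2 * (n - 1)" using main by simp
    then have sum: "card A + card B + card C = n + 2" using half[of A] half[of B] half[of C] ABC n2 by auto
    obtain a where a: "a \<in> S" "card A * e a = n" "2 \<le> e a" using W[of A] ABC by blast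
    obtain b where b: "b \<in> S" "card B * e b = n" "2 \<le> e b" using W[of B] ABC by blast
    obtain c where c: "c \<in> S" "card C * e c = n" "2 \<le> e c" using W[of C] ABC by blast
    have n0: "n > 0" using n2 by simp
    obtain r where r: "r \<in> {e a, e b, e c}" "e a \<le> r" "e b \<le> r" "e c \<le> r"
      "n = 2 * r \<or> (r = 3 \<and> n = 12) \<or> (r = 4 \<and> n = 24) \<or> (r = 5 \<and> n = 60)"
      using three_orbits_arithmetic[OF a(2) b(2) c(2) a(3) b(3) c(3) sum n0] by blast
    have "e p \<in> {e a, e b, e c}" if p: "p \<in> S" for p
    proof -
      obtain O' where "O' \<in> W" "card O' * e p = n" using eW[OF p] by blast
      then have "card A * e p = card A * e a \<or> card B * e p = card B * e b \<or> card C * e p = card C * e c"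
        using ABC a b c by auto
      moreover have "card A \<noteq> 0" "card B \<noteq> 0" "card C \<noteq> 0"
        using a(2) b(2) c(2) n0 by (metis mult_0 less_irrefl)+
      ultimately show ?thesis by simp
    qed
    then have "e p \<le> r" if "p \<in> S" for p using r that by fastforce
    moreover have "r \<ge> 2" using r(2) a(3) by simp
    moreover have "\<exists>p\<in>P. e p = r" using r(1) a b c SP by blast
    ultimately show ?thesis using bound[of r] r(5) unfolding n_def[symmetric] by blast
  qed
qed

declare topspace_projective [simp del] top_of_projective_space [simp del]

section \<open>Conjugate subgroups\<close>

definition conj_by :: "('g, 'm) monoid_scheme \<Rightarrow> 'g \<Rightarrow> 'g set \<Rightarrow> 'g set" where
  "conj_by G h A = (\<lambda>a. h \<otimes>\<^bsub>G\<^esub> a \<otimes>\<^bsub>G\<^esub> inv\<^bsub>G\<^esub> h) ` A"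

context group
begin

lemma inv_mult_cancel: "h \<in> carrier G \<Longrightarrow> a \<in> carrier G \<Longrightarrow> inv h \<otimes> (h \<otimes> a) = a"
  by (simp add: m_assoc[symmetric])

lemma conj_cancel: "h \<in> carrier G \<Longrightarrow> a \<in> carrier G \<Longrightarrow> inv h \<otimes> (h \<otimes> a \<otimes> inv h) \<otimes> h = a"
  by (simp add: m_assoc inv_mult_cancel)

lemma conj_mult:
  "h \<in> carrier G \<Longrightarrow> a \<in> carrier G \<Longrightarrow> b \<in> carrier G \<Longrightarrow>
     (h \<otimes> a \<otimes> inv h) \<otimes> (h \<otimes> b \<otimes> inv h) = h \<otimes> (a \<otimes> b) \<otimes> inv h"
  by (simp add: m_assoc inv_mult_cancel)

lemma inj_on_conj: "h \<in> carrier G \<Longrightarrow> A \<subseteq> carrier G \<Longrightarrow> inj_on (\<lambda>a. h \<otimes> a \<otimes> inv h) A"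
  by (rule inj_on_inverseI[where g = "\<lambda>b. inv h \<otimes> b \<otimes> h"]) (use conj_cancel in blast)

lemma conj_by_one: "A \<subseteq> carrier G \<Longrightarrow> conj_by G \<one> A = A"
  unfolding conj_by_def by (force simp: image_iff subset_iff)

lemma conj_by_mult:
  assumes "g \<in> carrier G" "h \<in> carrier G" "A \<subseteq> carrier G"
  shows "conj_by G g (conj_by G h A) = conj_by G (g \<otimes> h) A"
  unfolding conj_by_def image_image
  by (rule image_cong[OF refl]) (use assms in \<open>auto simp: m_assoc inv_mult_group subset_iff\<close>)

lemma subgroup_conj_by:
  assumes h: "h \<in> carrier G" and A: "subgroup A G"
  shows "subgroup (conj_by G h A) G"
proof (rule subgroupI)
  have sub: "A \<subseteq> carrier G" using subgroup.subset[OF A] .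
  show "conj_by G h A \<subseteq> carrier G" unfolding conj_by_def using h sub by auto
  show "conj_by G h A \<noteq> {}" unfolding conj_by_def using subgroup.one_closed[OF A] by auto
  fix x assume "x \<in> conj_by G h A"
  then obtain a where a: "a \<in> A" "x = h \<otimes> a \<otimes> inv h" unfolding conj_by_def by blast
  have "inv x = h \<otimes> inv a \<otimes> inv h"
    using a h sub by (auto simp: inv_mult_group m_assoc subset_iff)
  then show "inv x \<in> conj_by G h A" unfolding conj_by_def using subgroup.m_inv_closed[OF A a(1)] by blast
  fix y assume "y \<in> conj_by G h A"
  then obtain b where b: "b \<in> A" "y = h \<otimes> b \<otimes> inv h" unfolding conj_by_def by blast
  have "x \<otimes> y = h \<otimes> (a \<otimes> b) \<otimes> inv h" unfolding a(2) b(2) using a b h sub by (intro conj_mult) auto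
  then show "x \<otimes> y \<in> conj_by G h A" unfolding conj_by_def using subgroup.m_closed[OF A a(1) b(1)] by blast
qed

lemma card_conj_by: "h \<in> carrier G \<Longrightarrow> A \<subseteq> carrier G \<Longrightarrow> card (conj_by G h A) = card A"
  unfolding conj_by_def by (rule card_image[OF inj_on_conj])

lemma conjugate_subgroups_iff: "conjugate_subgroups G A B \<longleftrightarrow> (\<exists>h\<in>carrier G. B = conj_by G h A)"
  unfolding conjugate_subgroups_def conj_by_def ..

text \<open>Conjugacy is always established by moving both groups to one standard group.\<close>

lemma conjugate_subgroups_of_common:
  assumes "A \<subseteq> carrier G" "B \<subseteq> carrier G" "g \<in> carrier G" "h \<in> carrier G" "conj_by G g A = conj_by G h B"
  shows "conjugate_subgroups G A B"
  unfolding conjugate_subgroups_iff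
proof (rule bexI)
  have "conj_by G (inv h \<otimes> g) A = conj_by G (inv h) (conj_by G h B)"
    using assms conj_by_mult[of "inv h" g A] by simp
  also have "\<dots> = B" using assms conj_by_mult[of "inv h" h B] conj_by_one by simp
  finally show "B = conj_by G (inv h \<otimes> g) A" ..
qed (use assms in simp)

lemma subgroup_pow_card:
  assumes K: "subgroup K G" "finite K" and x: "x \<in> K"
  shows "x [^] card K = \<one>"
proof -
  interpret K: group "G\<lparr>carrier := K\<rparr>" by (rule subgroup.subgroup_is_group[OF K(1)]) (rule is_group)
  have "x [^]\<^bsub>G\<lparr>carrier := K\<rparr>\<^esub> order (G\<lparr>carrier := K\<rparr>) = \<one>\<^bsub>G\<lparr>carrier := K\<rparr>\<^esub>"
    using x by (intro K.pow_order_eq_1) auto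
  then show ?thesis by (simp add: order_def nat_pow_consistent[symmetric])
qed

end

section \<open>Finite subgroups of the projective linear group\<close>

abbreviation CrL :: "('k::{alg_closed_field, field_char_0} proj_point, 'k proj_point) rational_map monoid" where
  "CrL \<equiv> Cremona 1"

abbreviation identity2 :: "'k::field mat2" where "identity2 \<equiv> Mat2 1 0 0 1"

abbreviation diag2 :: "'k::field \<Rightarrow> 'k mat2" where "diag2 a \<equiv> Mat2 a 0 0 1"

lemma group_Cr1: "group (CrL :: ('k::{alg_closed_field, field_char_0} proj_point, 'k proj_point) rational_map monoid)"
  unfolding Cremona_def by (rule group_Bir[OF irreducible_variety_P1])

interpretation CrL: group "CrL :: ('k::{alg_closed_field, field_char_0} proj_point, 'k proj_point) rational_map monoid"
  by (rule group_Cr1)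

lemma class_carrier [simp]: "det2 M \<noteq> 0 \<Longrightarrow> moebius_class M \<in> carrier CrL"
  unfolding carrier_Cremona_1 by blast

lemma class_cases:
  assumes "g \<in> carrier CrL" obtains M where "det2 M \<noteq> 0" "g = moebius_class M"
  using assms unfolding carrier_Cremona_1 by blast

lemma class_mult: "det2 M \<noteq> 0 \<Longrightarrow> det2 N \<noteq> 0 \<Longrightarrow>
   moebius_class M \<otimes>\<^bsub>CrL\<^esub> moebius_class N = moebius_class (mult2 M N)"
  unfolding Cremona_def mult_Bir by (rule moebius_class_comp)

lemma class_one: "\<one>\<^bsub>CrL\<^esub> = moebius_class identity2"
  unfolding Cremona_def one_Bir by (rule rational_id_moebius)

lemma class_eq_iff:
  fixes M N :: "'k::{alg_closed_field, field_char_0} mat2"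
  assumes "det2 M \<noteq> 0" "det2 N \<noteq> 0"
  shows "moebius_class M = moebius_class N \<longleftrightarrow> (\<exists>c. c \<noteq> 0 \<and> N = smult2 c M)"
  unfolding moebius_class_eq_iff[OF assms]
  using moebius_eq_proportional[OF assms] moebius_smult assms by metis

lemma class_smult:
  fixes M :: "'k::{alg_closed_field, field_char_0} mat2"
  assumes "c \<noteq> 0" "det2 M \<noteq> 0"
  shows "moebius_class (smult2 c M) = moebius_class M"
proof -
  have "det2 (smult2 c M) = c * c * det2 M" by (simp add: det2_def smult2_def algebra_simps)
  then have "det2 (smult2 c M) \<noteq> 0" using assms by simp
  then show ?thesis using class_eq_iff[of M "smult2 c M"] assms by metis
qed

lemma det_identity: "det2 identity2 \<noteq> 0" by (simp add: det2_def)

lemma class_eq_one_iff: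
  fixes M :: "'k::{alg_closed_field, field_char_0} mat2"
  assumes "det2 M \<noteq> 0"
  shows "moebius_class M = \<one>\<^bsub>CrL\<^esub> \<longleftrightarrow> m12 M = 0 \<and> m21 M = 0 \<and> m11 M = m22 M"
proof
  assume "moebius_class M = \<one>\<^bsub>CrL\<^esub>"
  then have "\<exists>c. c \<noteq> 0 \<and> M = smult2 c identity2"
    unfolding class_one using class_eq_iff[OF det_identity assms] by metis
  then show "m12 M = 0 \<and> m21 M = 0 \<and> m11 M = m22 M" by (auto simp: smult2_def)
next
  assume M: "m12 M = 0 \<and> m21 M = 0 \<and> m11 M = m22 M"
  then have "m11 M \<noteq> 0" using assms by (auto simp: det2_def)
  moreover have "M = smult2 (m11 M) identity2" using M by (cases M) (auto simp: smult2_def)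
  ultimately show "moebius_class M = \<one>\<^bsub>CrL\<^esub>" unfolding class_one using class_smult[of "m11 M" identity2] det_identity by metis
qed

definition adj2 :: "'k::field mat2 \<Rightarrow> 'k mat2" where
  "adj2 M = Mat2 (m22 M) (- m12 M) (- m21 M) (m11 M)"

lemma det_adj2 [simp]: "det2 (adj2 M) = det2 M" by (simp add: adj2_def det2_def algebra_simps)

lemma class_inv:
  fixes M :: "'k::{alg_closed_field, field_char_0} mat2"
  assumes "det2 M \<noteq> 0"
  shows "inv\<^bsub>CrL\<^esub> (moebius_class M) = moebius_class (adj2 M)"
proof (rule CrL.inv_equality)
  have "mult2 (adj2 M) M = smult2 (det2 M) identity2" by (simp add: mult2_def adj2_def smult2_def det2_def algebra_simps)
  then show "moebius_class (adj2 M) \<otimes>\<^bsub>CrL\<^esub> moebius_class M = \<one>\<^bsub>CrL\<^esub>"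
    using class_mult[of "adj2 M" M] assms class_smult[of "det2 M" identity2] det_identity by (simp add: class_one)
qed (use assms in simp_all)

primrec pow2 :: "'k::field mat2 \<Rightarrow> nat \<Rightarrow> 'k mat2" where
  "pow2 M 0 = identity2" |
  "pow2 M (Suc n) = mult2 (pow2 M n) M"

lemma det_pow2: "det2 M \<noteq> 0 \<Longrightarrow> det2 (pow2 M n) \<noteq> 0"
  by (induction n) (simp_all add: det_mult2, simp add: det2_def)

lemma class_pow:
  fixes M :: "'k::{alg_closed_field, field_char_0} mat2"
  assumes "det2 M \<noteq> 0"
  shows "moebius_class M [^]\<^bsub>CrL\<^esub> n = moebius_class (pow2 M n)"
  by (induction n) (use assms in \<open>simp_all add: class_one class_mult det_pow2\<close>)

lemma pow2_diag: "pow2 (diag2 a) n = diag2 (a ^ n)"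
  by (induction n) (simp_all add: mult2_def mult.commute)

lemma pow2_translation: "pow2 (Mat2 1 b 0 1) n = Mat2 1 (of_nat n * b) 0 1"
  by (induction n) (simp_all add: mult2_def algebra_simps)

text \<open>Elements of the Cremona group are classes of partial maps, so their action on points
  goes through a chosen matrix; by \<open>act_class\<close> the choice has no influence on points of
  the line.\<close>

definition act :: "('k::field proj_point, 'k proj_point) rational_map \<Rightarrow> 'k proj_point \<Rightarrow> 'k proj_point" where
  "act g = moebius (SOME M. det2 M \<noteq> 0 \<and> moebius_class M = g)"

lemma act_class:
  fixes M :: "'k::{alg_closed_field, field_char_0} mat2"
  assumes "det2 M \<noteq> 0" "p \<in> points PL"
  shows "act (moebius_class M) p = moebius M p"
proof -
  define N where "N = (SOME N. det2 N \<noteq> 0 \<and> moebius_class N = moebius_class M)"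
  have N: "det2 N \<noteq> 0 \<and> moebius_class N = moebius_class M" unfolding N_def by (rule someI[of _ M]) (use assms in simp)
  then have "moebius N p = moebius M p" using moebius_class_eq_iff[of N M] assms by blast
  then show ?thesis unfolding act_def N_def .
qed

lemma act_pt:
  fixes M :: "'k::{alg_closed_field, field_char_0} mat2"
  assumes "det2 M \<noteq> 0" "a \<noteq> 0 \<or> b \<noteq> 0"
  shows "act (moebius_class M) (pt a b) = pt (m11 M * a + m12 M * b) (m21 M * a + m22 M * b)"
  unfolding act_class[OF assms(1) pt_mem[OF assms(2)]] by (rule moebius_pt[OF assms])

lemma act_mem:
  assumes "g \<in> carrier CrL" "p \<in> points PL"
  shows "act g p \<in> points PL"
proof -
  obtain M where M: "det2 M \<noteq> 0" "g = moebius_class M" using assms(1) by (rule class_cases)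
  show ?thesis unfolding M(2) act_class[OF M(1) assms(2)] by (rule moebius_mem[OF M(1) assms(2)])
qed

lemma act_mult:
  assumes "g \<in> carrier CrL" "h \<in> carrier CrL" "p \<in> points PL"
  shows "act (g \<otimes>\<^bsub>CrL\<^esub> h) p = act g (act h p)"
proof -
  obtain M where M: "det2 M \<noteq> 0" "g = moebius_class M" using assms(1) by (rule class_cases)
  obtain N where N: "det2 N \<noteq> 0" "h = moebius_class N" using assms(2) by (rule class_cases)
  have MN: "det2 (mult2 M N) \<noteq> 0" using M N by (simp add: det_mult2)
  show ?thesis unfolding M(2) N(2) class_mult[OF M(1) N(1)] act_class[OF MN assms(3)] act_class[OF N(1) assms(3)]
    act_class[OF M(1) moebius_mem[OF N(1) assms(3)]] by (rule moebius_mult[OF M(1) N(1) assms(3)])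
qed

lemma act_one: "p \<in> points PL \<Longrightarrow> act \<one>\<^bsub>CrL\<^esub> p = p"
  by (erule P1_pointE) (simp add: class_one act_pt det_identity)

lemma infinity_mem [simp]: "pt 1 0 \<in> points PL" by (rule pt_mem) simp

lemma origin_mem [simp]: "pt 0 1 \<in> points PL" by (rule pt_mem) simp

lemma act_inv:
  assumes "g \<in> carrier CrL" "p \<in> points PL"
  shows "act (inv\<^bsub>CrL\<^esub> g) (act g p) = p" "act g (act (inv\<^bsub>CrL\<^esub> g) p) = p"
  using act_mult[of "inv\<^bsub>CrL\<^esub> g" g p] act_mult[of g "inv\<^bsub>CrL\<^esub> g" p] assms act_one by auto

abbreviation infinity :: "'k::field proj_point" where "infinity \<equiv> pt 1 0"
abbreviation origin :: "'k::field proj_point" where "origin \<equiv> pt 0 1"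

section \<open>Stabilizers and fixed points\<close>

definition stab :: "('k::field proj_point, 'k proj_point) rational_map set \<Rightarrow> 'k proj_point \<Rightarrow> ('k proj_point, 'k proj_point) rational_map set" where
  "stab G p = {g \<in> G. act g p = p}"

lemma subgroup_stab:
  assumes G: "subgroup G CrL" and p: "p \<in> points PL"
  shows "subgroup (stab G p) CrL"
proof (rule CrL.subgroupI)
  have sub: "G \<subseteq> carrier CrL" using subgroup.subset[OF G] .
  then show "stab G p \<subseteq> carrier CrL" unfolding stab_def by blast
  show "stab G p \<noteq> {}" unfolding stab_def using subgroup.one_closed[OF G] act_one[OF p] by blast
  fix g assume g: "g \<in> stab G p"
  then have gc: "g \<in> carrier CrL" "act g p = p" "g \<in> G" using sub unfolding stab_def by auto
  have "act (inv\<^bsub>CrL\<^esub> g) p = p" using act_inv(1)[OF gc(1) p] gc(2) by simp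
  then show "inv\<^bsub>CrL\<^esub> g \<in> stab G p" unfolding stab_def using subgroup.m_inv_closed[OF G gc(3)] by simp
  fix h assume "h \<in> stab G p"
  then have hc: "h \<in> carrier CrL" "act h p = p" "h \<in> G" using sub unfolding stab_def by auto
  show "g \<otimes>\<^bsub>CrL\<^esub> h \<in> stab G p" unfolding stab_def
    using subgroup.m_closed[OF G gc(3) hc(3)] act_mult[OF gc(1) hc(1) p] gc hc by simp
qed

lemma stab_conj:
  assumes G: "subgroup G CrL" and h: "h \<in> carrier CrL" and p: "p \<in> points PL"
  shows "stab (conj_by CrL h G) (act h p) = conj_by CrL h (stab G p)"
proof -
  have "act (h \<otimes>\<^bsub>CrL\<^esub> g \<otimes>\<^bsub>CrL\<^esub> inv\<^bsub>CrL\<^esub> h) (act h p) = act h p \<longleftrightarrow> act g p = p" if "g \<in> G" for g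
  proof -
    have g: "g \<in> carrier CrL" using subgroup.subset[OF G] that by blast
    have "act (h \<otimes>\<^bsub>CrL\<^esub> g \<otimes>\<^bsub>CrL\<^esub> inv\<^bsub>CrL\<^esub> h) (act h p) = act h (act g (act (inv\<^bsub>CrL\<^esub> h) (act h p)))"
      using g h p by (simp add: act_mult act_mem)
    also have "\<dots> = act h (act g p)" using act_inv(1)[OF h p] by simp
    finally show ?thesis using act_inv(1)[OF h p] act_inv(1)[OF h act_mem[OF g p]] by metis
  qed
  then show ?thesis unfolding stab_def conj_by_def by auto
qed

lemma card_stab_conj:
  assumes G: "subgroup G CrL" and h: "h \<in> carrier CrL" and p: "p \<in> points PL"
  shows "card (stab (conj_by CrL h G) (act h p)) = card (stab G p)"
  unfolding stab_conj[OF assms] using CrL.card_conj_by[OF h] subgroup.subset[OF subgroup_stab[OF G p]] by blast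

lemma transitive_Cr1:
  assumes "p \<in> points PL"
  obtains h :: "('k::{alg_closed_field, field_char_0} proj_point, 'k proj_point) rational_map"
  where "h \<in> carrier CrL" "act h p = infinity"
proof -
  obtain a b where p: "p = pt a b" "a \<noteq> 0 \<or> b \<noteq> 0" using assms by (rule P1_pointE)
  obtain N where N: "det2 N \<noteq> 0" "act (moebius_class N) infinity = p"
  proof (cases "a = 0")
    case True
    then have "det2 (Mat2 0 1 b 0) \<noteq> 0" using p(2) by (simp add: det2_def)
    then show ?thesis using that[of "Mat2 0 1 b 0"] act_pt[of "Mat2 0 1 b 0" 1 0] p True by simp
  next
    case False
    then have "det2 (Mat2 a 0 b 1) \<noteq> 0" by (simp add: det2_def)
    then show ?thesis using that[of "Mat2 a 0 b 1"] act_pt[of "Mat2 a 0 b 1" 1 0] p by simp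
  qed
  have "act (inv\<^bsub>CrL\<^esub> (moebius_class N)) p = infinity"
    using act_inv(1)[of "moebius_class N" infinity] N by simp
  then show thesis using that[of "inv\<^bsub>CrL\<^esub> (moebius_class N)"] N by simp
qed

lemma stabilizer_of_infinity:
  fixes g :: "('k::{alg_closed_field, field_char_0} proj_point, 'k proj_point) rational_map"
  assumes "g \<in> carrier CrL" "act g infinity = infinity"
  obtains a b where "a \<noteq> 0" "g = moebius_class (Mat2 a b 0 1)"
proof -
  obtain M where M: "det2 M \<noteq> 0" "g = moebius_class M" using assms(1) by (rule class_cases)
  have "pt (m11 M) (m21 M) = pt 1 0" using assms(2) unfolding M(2) act_pt[OF M(1), of 1 0, simplified] .
  moreover have "m11 M \<noteq> 0 \<or> m21 M \<noteq> 0" using matrix_nonzero_image[OF M(1), of 1 0] by simp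
  ultimately have c: "m21 M = 0" using pt_eq_iff[of "m11 M" "m21 M" 1 0] by simp
  then have d: "m11 M \<noteq> 0" "m22 M \<noteq> 0" using M(1) by (auto simp: det2_def)
  have "smult2 (inverse (m22 M)) M = Mat2 (m11 M / m22 M) (m12 M / m22 M) 0 1"
    using c d by (simp add: smult2_def field_simps)
  then have "g = moebius_class (Mat2 (m11 M / m22 M) (m12 M / m22 M) 0 1)"
    using class_smult[of "inverse (m22 M)" M] M d by simp
  then show thesis using that[of "m11 M / m22 M"] d by simp
qed

text \<open>Nonzero translations have infinite order in characteristic zero.\<close>

lemma translation_in_finite_subgroup:
  fixes b :: "'k::{alg_closed_field, field_char_0}"
  assumes G: "subgroup G CrL" "finite G" and g: "moebius_class (Mat2 1 b 0 1) \<in> G"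
  shows "b = 0"
proof -
  have d: "det2 (Mat2 1 b 0 1) \<noteq> 0" by (simp add: det2_def)
  have "moebius_class (Mat2 1 (of_nat (card G) * b) 0 1) = \<one>\<^bsub>CrL\<^esub>"
    using CrL.subgroup_pow_card[OF G g] unfolding class_pow[OF d] pow2_translation .
  then have "of_nat (card G) * b = 0" by (subst (asm) class_eq_one_iff) (auto simp: det2_def)
  moreover have "card G \<noteq> 0" using G(2) g by auto
  ultimately show ?thesis by simp
qed

text \<open>One fixed point exists as a root of a quadratic and is moved to infinity, which turns g
  into an affine map x \<mapsto> a x + b. Here a = 1 would give a translation, excluded in a finite
  group unless it is trivial; so a is not 1 and b / (1 - a) is the only other fixed point.\<close>

lemma fixed_points_card:
  fixes g :: "('k::{alg_closed_field, field_char_0} proj_point, 'k proj_point) rational_map"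
  assumes G: "subgroup G CrL" "finite G" and g: "g \<in> G" "g \<noteq> \<one>\<^bsub>CrL\<^esub>"
  shows "card {p \<in> points PL. act g p = p} = 2"
proof -
  have gc: "g \<in> carrier CrL" using subgroup.subset[OF G(1)] g by blast
  obtain M where M: "det2 M \<noteq> 0" "g = moebius_class M" using gc by (rule class_cases)
  \<comment> \<open>The equation says that (u, v) and its image under M are parallel. If
    \<open>m21 M\<close> is 0, infinity is fixed; otherwise v = 1 leaves a quadratic polynomial in
    u.\<close>
  obtain u v where uv: "u \<noteq> 0 \<or> v \<noteq> 0" and e: "m21 M * u * u + (m22 M - m11 M) * u * v - m12 M * v * v = 0"
  proof (cases "m21 M = 0")
    case True then show ?thesis using that[of 1 0] by simp
  next
    case False
    then have "degree [:- m12 M, m22 M - m11 M, m21 M:] > 0" by simp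
    then obtain x where "poly [:- m12 M, m22 M - m11 M, m21 M:] x = 0" using alg_closed_imp_poly_has_root by blast
    then show ?thesis using that[of x 1] by (simp add: algebra_simps)
  qed
  let ?p = "pt u v"
  have p: "?p \<in> points PL" by (rule pt_mem[OF uv])
  have gp: "act g ?p = ?p" unfolding M(2) act_pt[OF M(1) uv] pt_eq_iff[OF matrix_nonzero_image[OF M(1) uv] uv]
    using e by (simp add: algebra_simps)
  obtain h where h: "h \<in> carrier CrL" "act h ?p = infinity" using p by (rule transitive_Cr1)
  define k where "k = h \<otimes>\<^bsub>CrL\<^esub> g \<otimes>\<^bsub>CrL\<^esub> inv\<^bsub>CrL\<^esub> h"
  have kc: "k \<in> carrier CrL" unfolding k_def using h gc by simp
  have kact: "act k (act h q) = act h (act g q)" if "q \<in> points PL" for q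
    unfolding k_def using that h gc act_inv(1)[OF h(1)] by (simp add: act_mult act_mem)
  have kinf: "act k infinity = infinity" using kact[OF p] h(2) gp by simp
  note G' = CrL.subgroup_conj_by[OF h(1) G(1)]
  have finG': "finite (conj_by CrL h G)" unfolding conj_by_def using G(2) by simp
  have kG: "k \<in> conj_by CrL h G" unfolding conj_by_def k_def using g by blast
  have k1: "k \<noteq> \<one>\<^bsub>CrL\<^esub>"
  proof
    assume "k = \<one>\<^bsub>CrL\<^esub>"
    then have "g = \<one>\<^bsub>CrL\<^esub>" using CrL.conj_cancel[OF h(1) gc] h(1) unfolding k_def by simp
    then show False using g by simp
  qed
  obtain a b where ab: "a \<noteq> 0" "k = moebius_class (Mat2 a b 0 1)" using kc kinf by (rule stabilizer_of_infinity)
  have d: "det2 (Mat2 a b 0 1) \<noteq> 0" using ab(1) by (simp add: det2_def)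
  have a1: "a \<noteq> 1"
  proof
    assume "a = 1"
    then have "b = 0" using translation_in_finite_subgroup[OF G' finG'] kG ab by simp
    then show False using k1 ab \<open>a = 1\<close> by (simp add: class_one)
  qed
  have "act k q = q \<longleftrightarrow> q \<in> {infinity, pt (b / (1 - a)) 1}" if qP: "q \<in> points PL" for q
  proof -
    obtain x y where q: "q = pt x y" "x \<noteq> 0 \<or> y \<noteq> 0" using qP by (rule P1_pointE)
    have nz: "a * x + b * y \<noteq> 0 \<or> y \<noteq> 0" using matrix_nonzero_image[OF d q(2)] by simp
    have "act k q = q \<longleftrightarrow> (a * x + b * y) * y = y * x"
      unfolding q(1) ab(2) act_pt[OF d q(2)] using pt_eq_iff[OF nz q(2)] by simp
    also have "\<dots> \<longleftrightarrow> y * (b * y - x * (1 - a)) = 0"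
      by (subst eq_iff_diff_eq_0) (simp add: algebra_simps)
    also have "\<dots> \<longleftrightarrow> y = 0 \<or> x * (1 - a) = b * y" by auto
    also have "\<dots> \<longleftrightarrow> q \<in> {infinity, pt (b / (1 - a)) 1}"
      using a1 q pt_eq_iff[of x y 1 0] pt_eq_iff[of x y "b / (1 - a)" 1] by (auto simp: field_simps)
    finally show ?thesis .
  qed
  then have "{q \<in> points PL. act k q = q} = {infinity, pt (b / (1 - a)) 1}"
    using infinity_mem[where 'a = 'k] pt_mem[of "b / (1 - a)" "1 :: 'k", OF disjI2[OF one_neq_zero]] by blast
  then have two: "card {q \<in> points PL. act k q = q} = 2" by (simp add: pt_eq_iff)
  have bij: "bij_betw (act h) {q \<in> points PL. act g q = q} {q \<in> points PL. act k q = q}"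
  proof (rule bij_betw_byWitness[where f' = "act (inv\<^bsub>CrL\<^esub> h)"])
    show "\<forall>q\<in>{q \<in> points PL. act g q = q}. act (inv\<^bsub>CrL\<^esub> h) (act h q) = q"
      "\<forall>q\<in>{q \<in> points PL. act k q = q}. act h (act (inv\<^bsub>CrL\<^esub> h) q) = q"
      using act_inv[OF h(1)] by blast+
    show "act h ` {q \<in> points PL. act g q = q} \<subseteq> {q \<in> points PL. act k q = q}"
      using kact act_mem[OF h(1)] by auto
    show "act (inv\<^bsub>CrL\<^esub> h) ` {q \<in> points PL. act k q = q} \<subseteq> {q \<in> points PL. act g q = q}"
    proof (rule image_subsetI)
      fix q assume "q \<in> {q \<in> points PL. act k q = q}"
      then have q: "q \<in> points PL" "act k q = q" by auto
      define q' where "q' = act (inv\<^bsub>CrL\<^esub> h) q"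
      have q': "q' \<in> points PL" "act h q' = q" unfolding q'_def using q act_mem[of "inv\<^bsub>CrL\<^esub> h"] act_inv(2)[OF h(1)] h(1) by auto
      have "act h (act g q') = act h q'" using kact[OF q'(1)] q' q by simp
      then have "act g q' = q'" using act_inv(1)[OF h(1) q'(1)] act_inv(1)[OF h(1) act_mem[OF gc q'(1)]] by metis
      then show "act (inv\<^bsub>CrL\<^esub> h) q \<in> {q \<in> points PL. act g q = q}" using q' unfolding q'_def by simp
    qed
  qed
  from bij_betw_same_card[OF bij] show ?thesis unfolding two .
qed

text \<open>The geometric invariant of the classification; by \<open>max_stab_ord\<close> it is the
  largest order of an element and hence preserved by isomorphisms. The bound 2 excludes the trivial
  group, where no point has a nontrivial stabilizer to start from.\<close>

definition max_stab :: "('k::field proj_point, 'k proj_point) rational_map set \<Rightarrow> nat \<Rightarrow> bool" where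
  "max_stab G r \<longleftrightarrow> r \<ge> 2 \<and> (\<exists>p\<in>points PL. card (stab G p) = r) \<and> (\<forall>p\<in>points PL. card (stab G p) \<le> r)"

lemma max_stab_unique: "max_stab G r \<Longrightarrow> max_stab G s \<Longrightarrow> r = s"
  unfolding max_stab_def by (metis le_antisym)

text \<open>Klein's list: the alternatives are the cyclic, dihedral, tetrahedral, octahedral and
  icosahedral cases, in this order.\<close>

lemma finite_subgroup_orders:
  fixes G :: "('k::{alg_closed_field, field_char_0} proj_point, 'k proj_point) rational_map set"
  assumes G: "subgroup G CrL" "finite G" "card G \<ge> 2"
  shows "\<exists>r. max_stab G r \<and> (card G = r \<or> card G = 2 * r \<or> (r = 3 \<and> card G = 12) \<or>
     (r = 4 \<and> card G = 24) \<or> (r = 5 \<and> card G = 60))"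
proof -
  let ?H = "CrL\<lparr>carrier := G\<rparr>"
  have sub: "g \<in> carrier CrL" if "g \<in> G" for g using subgroup.subset[OF G(1)] that by blast
  have grp: "group ?H" by (rule subgroup.subgroup_is_group[OF G(1) group_Cr1])
  have "\<exists>r. (\<exists>p\<in>points PL. card {g \<in> carrier ?H. act g p = p} = r) \<and> (\<forall>p\<in>points PL. card {g \<in> carrier ?H. act g p = p} \<le> r) \<and> r \<ge> 2 \<and>
    (card (carrier ?H) = r \<or> card (carrier ?H) = 2 * r \<or> (r = 3 \<and> card (carrier ?H) = 12) \<or>
     (r = 4 \<and> card (carrier ?H) = 24) \<or> (r = 5 \<and> card (carrier ?H) = 60))"
    by (rule two_fixed_points_classification[OF grp])
       (use G sub fixed_points_card[OF G(1,2)] in \<open>simp_all add: act_mem act_mult act_one\<close>)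
  then obtain r where "\<exists>p\<in>points PL. card (stab G p) = r" "\<forall>p\<in>points PL. card (stab G p) \<le> r" "r \<ge> 2"
    "card G = r \<or> card G = 2 * r \<or> (r = 3 \<and> card G = 12) \<or> (r = 4 \<and> card G = 24) \<or> (r = 5 \<and> card G = 60)"
    unfolding stab_def by auto
  then show ?thesis unfolding max_stab_def by blast
qed

lemma orbit_stab:
  fixes G :: "('k::{alg_closed_field, field_char_0} proj_point, 'k proj_point) rational_map set"
  assumes G: "subgroup G CrL" "finite G" and p: "p \<in> points PL"
  shows "card ((\<lambda>g. act g p) ` G) * card (stab G p) = card G"
proof -
  let ?H = "CrL\<lparr>carrier := G\<rparr>"
  have sub: "g \<in> carrier CrL" if "g \<in> G" for g using subgroup.subset[OF G(1)] that by blast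
  have grp: "group ?H" by (rule subgroup.subgroup_is_group[OF G(1) group_Cr1])
  have "card ((\<lambda>g. act g p) ` carrier ?H) * card {g \<in> carrier ?H. act g p = p} = card (carrier ?H)"
    by (rule orbit_stabilizer[OF grp, where P = "points PL"]) (use G sub p in \<open>simp_all add: act_mult act_one\<close>)
  then show ?thesis by (simp add: stab_def)
qed

section \<open>Standard cyclic groups and stabilizers in normal form\<close>

definition cyclic_group :: "nat \<Rightarrow> ('k::field proj_point, 'k proj_point) rational_map set" where
  "cyclic_group r = {moebius_class (diag2 a) | a. a ^ r = 1}"

lemma diag_class_inj:
  fixes a b :: "'k::{alg_closed_field, field_char_0}"
  assumes "a \<noteq> 0" "b \<noteq> 0" "moebius_class (diag2 a) = moebius_class (diag2 b)"
  shows "a = b"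
  using assms class_eq_iff[of "diag2 a" "diag2 b"] by (auto simp: det2_def smult2_def)

lemma card_cyclic_group:
  assumes "r > 0"
  shows "card (cyclic_group r :: ('k::{alg_closed_field, field_char_0} proj_point, 'k proj_point) rational_map set) = r"
proof -
  have "cyclic_group r = (\<lambda>a :: 'k. moebius_class (diag2 a)) ` {a. a ^ r = 1}" unfolding cyclic_group_def by blast
  moreover have "inj_on (\<lambda>a :: 'k. moebius_class (diag2 a)) {a. a ^ r = 1}"
  proof (rule inj_onI)
    fix a b :: 'k assume "a \<in> {a. a ^ r = 1}" "b \<in> {a. a ^ r = 1}" and eq: "moebius_class (diag2 a) = moebius_class (diag2 b)"
    then have "a \<noteq> 0" "b \<noteq> 0" using assms by (auto simp: power_0_left)
    then show "a = b" using eq by (rule diag_class_inj)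
  qed
  ultimately show ?thesis using card_image card_roots_of_unity[OF assms, where 'k = 'k] by metis
qed

lemma act_diag: "a \<noteq> 0 \<Longrightarrow> u \<noteq> 0 \<or> v \<noteq> 0 \<Longrightarrow> act (moebius_class (diag2 (a::'k::{alg_closed_field, field_char_0}))) (pt u v) = pt (a * u) v"
  by (subst act_pt) (auto simp: det2_def)

lemma fixed_by_diag:
  fixes a :: "'k::{alg_closed_field, field_char_0}"
  assumes "a \<noteq> 0" "a \<noteq> 1" "p \<in> points PL" "act (moebius_class (diag2 a)) p = p"
  shows "p = infinity \<or> p = origin"
proof -
  obtain u v where p: "p = pt u v" "u \<noteq> 0 \<or> v \<noteq> 0" using assms(3) by (rule P1_pointE)
  have "a * u * v = v * u" using assms(4) pt_eq_iff[of "a * u" v u v] p assms(1) unfolding p(1) act_diag[OF assms(1) p(2)] by auto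
  then have "u = 0 \<or> v = 0" using assms(2) by (auto simp: algebra_simps)
  then show ?thesis using p pt_eq_iff[of u v 1 0] pt_eq_iff[of u v 0 1] by auto
qed

text \<open>A point with nontrivial stabilizer is moved to infinity, and its companion fixed point to the origin.\<close>

lemma stabilizer_normal_form:
  fixes G :: "('k::{alg_closed_field, field_char_0} proj_point, 'k proj_point) rational_map set"
  assumes G: "subgroup G CrL" "finite G" and p: "p \<in> points PL" and r: "card (stab G p) = r" "r \<ge> 2"
  obtains h where "h \<in> carrier CrL" "stab (conj_by CrL h G) infinity = cyclic_group r"
proof -
  obtain h1 where h1: "h1 \<in> carrier CrL" "act h1 p = infinity" using p by (rule transitive_Cr1)
  define G1 where "G1 = conj_by CrL h1 G"
  have G1: "subgroup G1 CrL" "finite G1" unfolding G1_def using CrL.subgroup_conj_by[OF h1(1) G(1)] G(2) by (auto simp: conj_by_def)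
  have sub1: "G1 \<subseteq> carrier CrL" using subgroup.subset[OF G1(1)] .
  have inf: "infinity \<in> points (PL :: ('k proj_point, 'k) fspace)" by (rule pt_mem) simp
  have c1: "card (stab G1 infinity) = r" using card_stab_conj[OF G(1) h1(1) p] h1(2) r unfolding G1_def by simp
  have "\<not> stab G1 infinity \<subseteq> {\<one>\<^bsub>CrL\<^esub>}"
  proof
    assume "stab G1 infinity \<subseteq> {\<one>\<^bsub>CrL\<^esub>}"
    then have "card (stab G1 infinity) \<le> card {\<one>\<^bsub>CrL :: ('k proj_point, 'k proj_point) rational_map monoid\<^esub>}" by (intro card_mono) auto
    then show False using c1 r(2) by simp
  qed
  then obtain g0 where g0: "g0 \<in> G1" "act g0 infinity = infinity" "g0 \<noteq> \<one>\<^bsub>CrL\<^esub>" unfolding stab_def by blast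
  have g0c: "g0 \<in> carrier CrL" using sub1 g0 by blast
  obtain a0 b0 where ab0: "a0 \<noteq> 0" "g0 = moebius_class (Mat2 a0 b0 0 1)" using g0c g0(2) by (rule stabilizer_of_infinity)
  have a01: "a0 \<noteq> 1"
  proof
    assume "a0 = 1"
    then have "b0 = 0" using translation_in_finite_subgroup[OF G1] g0 ab0 by simp
    then show False using g0 ab0 \<open>a0 = 1\<close> by (simp add: class_one)
  qed
  \<comment> \<open>The second fixed point of g0; the translation by - x moves it to the origin and
    makes g0 diagonal.\<close>
  define x where "x = b0 / (1 - a0)"
  define h2 where "h2 = moebius_class (Mat2 1 (- x) 0 1)"
  have dx: "det2 (Mat2 1 (- x) 0 1) \<noteq> 0" by (simp add: det2_def)
  have h2: "h2 \<in> carrier CrL" unfolding h2_def using dx by simp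
  define G2 where "G2 = conj_by CrL h2 G1"
  have G2: "subgroup G2 CrL" "finite G2" unfolding G2_def using CrL.subgroup_conj_by[OF h2 G1(1)] G1(2) by (auto simp: conj_by_def)
  have sub2: "G2 \<subseteq> carrier CrL" using subgroup.subset[OF G2(1)] .
  have h2inf: "act h2 infinity = infinity" unfolding h2_def using act_pt[OF dx, of 1 0] by simp
  have c2: "card (stab G2 infinity) = r" using card_stab_conj[OF G1(1) h2 inf] h2inf c1 unfolding G2_def by simp
  have d0: "det2 (Mat2 a0 b0 0 1) \<noteq> 0" "det2 (diag2 a0) \<noteq> 0" using ab0 by (auto simp: det2_def)
  have g0': "moebius_class (diag2 a0) \<in> G2"
  proof -
    have "h2 \<otimes>\<^bsub>CrL\<^esub> g0 \<otimes>\<^bsub>CrL\<^esub> inv\<^bsub>CrL\<^esub> h2 = moebius_class (mult2 (mult2 (Mat2 1 (- x) 0 1) (Mat2 a0 b0 0 1)) (adj2 (Mat2 1 (- x) 0 1)))"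
      unfolding h2_def ab0(2) using dx d0 by (simp add: class_inv class_mult det_mult2)
    also have "mult2 (mult2 (Mat2 1 (- x) 0 1) (Mat2 a0 b0 0 1)) (adj2 (Mat2 1 (- x) 0 1)) = diag2 a0"
      using a01 by (simp add: mult2_def adj2_def x_def field_simps)
    finally have "h2 \<otimes>\<^bsub>CrL\<^esub> g0 \<otimes>\<^bsub>CrL\<^esub> inv\<^bsub>CrL\<^esub> h2 = moebius_class (diag2 a0)" .
    moreover have "h2 \<otimes>\<^bsub>CrL\<^esub> g0 \<otimes>\<^bsub>CrL\<^esub> inv\<^bsub>CrL\<^esub> h2 \<in> G2" unfolding G2_def conj_by_def using g0(1) by blast
    ultimately show ?thesis by simp
  qed
  \<comment> \<open>The commutator of two affine maps is a translation, so it is trivial in a finite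
    group. An affine map commuting with a nontrivial diagonal one fixes the origin and is diagonal
    itself.\<close>
  have diag: "\<exists>a. a \<noteq> 0 \<and> f = moebius_class (diag2 a)" if f: "f \<in> stab G2 infinity" for f
  proof -
    have f': "f \<in> G2" "act f infinity = infinity" "f \<in> carrier CrL" using f sub2 unfolding stab_def by auto
    obtain a b where ab: "a \<noteq> 0" "f = moebius_class (Mat2 a b 0 1)" using f'(3,2) by (rule stabilizer_of_infinity)
    have d: "det2 (Mat2 a b 0 1) \<noteq> 0" using ab by (simp add: det2_def)
    let ?g = "moebius_class (diag2 a0)"
    have in1: "(f \<otimes>\<^bsub>CrL\<^esub> ?g) \<otimes>\<^bsub>CrL\<^esub> inv\<^bsub>CrL\<^esub> (?g \<otimes>\<^bsub>CrL\<^esub> f) \<in> G2"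
      using f'(1) g0' G2(1) by (intro subgroup.m_closed subgroup.m_inv_closed)
    have "(f \<otimes>\<^bsub>CrL\<^esub> ?g) \<otimes>\<^bsub>CrL\<^esub> inv\<^bsub>CrL\<^esub> (?g \<otimes>\<^bsub>CrL\<^esub> f) =
       moebius_class (mult2 (mult2 (Mat2 a b 0 1) (diag2 a0)) (adj2 (mult2 (diag2 a0) (Mat2 a b 0 1))))"
      unfolding ab(2) using d d0 by (simp add: class_inv class_mult det_mult2)
    also have "mult2 (mult2 (Mat2 a b 0 1) (diag2 a0)) (adj2 (mult2 (diag2 a0) (Mat2 a b 0 1))) = smult2 (a * a0) (Mat2 1 (b - a0 * b) 0 1)"
      by (simp add: mult2_def adj2_def smult2_def algebra_simps)
    also have "moebius_class \<dots> = moebius_class (Mat2 1 (b - a0 * b) 0 1)"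
      using ab ab0 by (intro class_smult) (auto simp: det2_def)
    finally have "moebius_class (Mat2 1 (b - a0 * b) 0 1) \<in> G2" using in1 by simp
    then have "b - a0 * b = 0" by (rule translation_in_finite_subgroup[OF G2])
    then have "b = 0" using a01 by (simp add: algebra_simps)
    then show ?thesis using ab by blast
  qed
  have "stab G2 infinity \<subseteq> cyclic_group r"
  proof
    fix f assume f: "f \<in> stab G2 infinity"
    then obtain a where a: "a \<noteq> 0" "f = moebius_class (diag2 a)" using diag by blast
    have d: "det2 (diag2 a) \<noteq> 0" using a by (simp add: det2_def)
    have "finite (stab G2 infinity)" unfolding stab_def using G2(2) by simp
    from CrL.subgroup_pow_card[OF subgroup_stab[OF G2(1) inf] this f]
    have "moebius_class (diag2 (a ^ r)) = \<one>\<^bsub>CrL\<^esub>" unfolding c2 a(2) class_pow[OF d] pow2_diag .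
    then have "a ^ r = 1" using a(1) by (subst (asm) class_eq_one_iff) (auto simp: det2_def)
    then show "f \<in> cyclic_group r" unfolding cyclic_group_def using a(2) by blast
  qed
  moreover have fc: "card (cyclic_group r :: ('k proj_point, 'k proj_point) rational_map set) = r"
    by (rule card_cyclic_group) (use r(2) in simp)
  moreover have "finite (cyclic_group r :: ('k proj_point, 'k proj_point) rational_map set)" using fc r(2) by (metis card.infinite not_numeral_le_zero)
  ultimately have "stab G2 infinity = cyclic_group r" using c2 by (intro card_subset_eq) auto
  moreover have "G2 = conj_by CrL (h2 \<otimes>\<^bsub>CrL\<^esub> h1) G" unfolding G2_def G1_def
    using CrL.conj_by_mult[OF h2 h1(1)] subgroup.subset[OF G(1)] by blast
  ultimately show thesis using that[of "h2 \<otimes>\<^bsub>CrL\<^esub> h1"] h1 h2 by simp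
qed

subsection \<open>Cyclic and dihedral groups\<close>

lemma max_stab_conj:
  fixes G :: "('k::{alg_closed_field, field_char_0} proj_point, 'k proj_point) rational_map set"
  assumes G: "subgroup G CrL" and h: "h \<in> carrier CrL" and r: "max_stab G r"
  shows "max_stab (conj_by CrL h G) r"
proof -
  have eq: "card (stab (conj_by CrL h G) p) = card (stab G (act (inv\<^bsub>CrL\<^esub> h) p))" "act (inv\<^bsub>CrL\<^esub> h) p \<in> points PL"
    if "p \<in> points PL" for p
    using card_stab_conj[OF G h, of "act (inv\<^bsub>CrL\<^esub> h) p"] act_inv(2)[OF h that] act_mem[of "inv\<^bsub>CrL\<^esub> h" p] h that by auto
  obtain p where p: "p \<in> points PL" "card (stab G p) = r" using r unfolding max_stab_def by blast
  have "card (stab (conj_by CrL h G) (act h p)) = r" using card_stab_conj[OF G h p(1)] p(2) by simp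
  then show ?thesis using r eq act_mem[OF h p(1)] unfolding max_stab_def by auto
qed

lemma max_stab_normal_form:
  fixes G :: "('k::{alg_closed_field, field_char_0} proj_point, 'k proj_point) rational_map set"
  assumes G: "subgroup G CrL" "finite G" and r: "max_stab G r"
  obtains h where "h \<in> carrier CrL" "stab (conj_by CrL h G) infinity = cyclic_group r"
    "subgroup (conj_by CrL h G) CrL" "finite (conj_by CrL h G)" "max_stab (conj_by CrL h G) r"
    "card (conj_by CrL h G) = card G"
proof -
  obtain p where p: "p \<in> points PL" "card (stab G p) = r" using r unfolding max_stab_def by blast
  have r2: "r \<ge> 2" using r unfolding max_stab_def by blast
  obtain h where h: "h \<in> carrier CrL" "stab (conj_by CrL h G) infinity = cyclic_group r"
    using stabilizer_normal_form[OF G p r2] by blast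
  then show thesis using that CrL.subgroup_conj_by[OF h(1) G(1)] G(2) max_stab_conj[OF G(1) h(1) r]
      CrL.card_conj_by[OF h(1) subgroup.subset[OF G(1)]] by (simp add: conj_by_def)
qed

definition inversion :: "('k::field proj_point, 'k proj_point) rational_map" where
  "inversion = moebius_class (Mat2 0 1 1 0)"

definition dihedral_group :: "nat \<Rightarrow> ('k::{alg_closed_field, field_char_0} proj_point, 'k proj_point) rational_map set" where
  "dihedral_group r = cyclic_group r \<union> (\<lambda>g. g \<otimes>\<^bsub>CrL\<^esub> inversion) ` cyclic_group r"

lemma cyclic_groupE:
  assumes "f \<in> cyclic_group r" "r > 0"
  obtains a where "a \<noteq> 0" "a ^ r = 1" "f = moebius_class (diag2 a)" "det2 (diag2 a) \<noteq> 0"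
proof -
  obtain a where a: "a ^ r = 1" "f = moebius_class (diag2 a)" using assms(1) unfolding cyclic_group_def by blast
  then have "a \<noteq> 0" using assms(2) by (auto simp: power_0_left)
  then show thesis using that[of a] a by (simp add: det2_def)
qed

lemma finite_cyclic_group:
  "r > 0 \<Longrightarrow> finite (cyclic_group r :: ('k::{alg_closed_field, field_char_0} proj_point, 'k proj_point) rational_map set)"
  using card_cyclic_group[of r] by (metis card.infinite less_irrefl)

lemma conj_diag_cyclic_group:
  fixes c :: "'k::{alg_closed_field, field_char_0}"
  assumes c: "c \<noteq> 0" and r: "r > 0"
  shows "conj_by CrL (moebius_class (diag2 c)) (cyclic_group r) = cyclic_group r"
proof -
  have d: "det2 (diag2 c) \<noteq> 0" using c by (simp add: det2_def)
  have "moebius_class (diag2 c) \<otimes>\<^bsub>CrL\<^esub> f \<otimes>\<^bsub>CrL\<^esub> inv\<^bsub>CrL\<^esub> (moebius_class (diag2 c)) = f" if f: "f \<in> cyclic_group r" for f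
  proof -
    obtain a where a: "a \<noteq> 0" "f = moebius_class (diag2 a)" "det2 (diag2 a) \<noteq> 0" using f r by (rule cyclic_groupE)
    have "moebius_class (diag2 c) \<otimes>\<^bsub>CrL\<^esub> f = f \<otimes>\<^bsub>CrL\<^esub> moebius_class (diag2 c)"
      unfolding a(2) using d a(3) by (simp add: class_mult mult2_def mult.commute)
    then show ?thesis using d a by (simp add: CrL.m_assoc)
  qed
  then show ?thesis unfolding conj_by_def by simp
qed

lemma conj_to_cyclic:
  fixes G :: "('k::{alg_closed_field, field_char_0} proj_point, 'k proj_point) rational_map set"
  assumes G: "subgroup G CrL" "finite G" and r: "max_stab G r" and c: "card G = r"
  obtains h where "h \<in> carrier CrL" "conj_by CrL h G = cyclic_group r"
proof -
  obtain h where h: "h \<in> carrier CrL" "stab (conj_by CrL h G) infinity = cyclic_group r"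
    "finite (conj_by CrL h G)" "card (conj_by CrL h G) = card G"
    using max_stab_normal_form[OF G r] by metis
  have r0: "r > 0" using r unfolding max_stab_def by auto
  have "cyclic_group r \<subseteq> conj_by CrL h G" using h(2) unfolding stab_def by blast
  then have "cyclic_group r = conj_by CrL h G"
    using h c card_cyclic_group[OF r0] by (intro card_subset_eq) auto
  then show thesis using that h by metis
qed

text \<open>The orbit of infinity has two points. A generating rotation fixes infinity and therefore
  the other point as well, which must be the origin. An element outside the stabilizer exchanges the
  two, so it has the form x \<mapsto> b / x, and a rescaling reduces b to 1.\<close>

lemma conj_to_dihedral:
  fixes G :: "('k::{alg_closed_field, field_char_0} proj_point, 'k proj_point) rational_map set"
  assumes G: "subgroup G CrL" "finite G" and r: "max_stab G r" and c: "card G = 2 * r"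
  obtains h where "h \<in> carrier CrL" "conj_by CrL h G = dihedral_group r"
proof -
  obtain h where h: "h \<in> carrier CrL" and inf: "stab (conj_by CrL h G) infinity = cyclic_group r"
    and G1: "subgroup (conj_by CrL h G) CrL" "finite (conj_by CrL h G)" and r1: "max_stab (conj_by CrL h G) r"
    and c1: "card (conj_by CrL h G) = card G"
    using max_stab_normal_form[OF G r] by metis
  define G1 where "G1 = conj_by CrL h G"
  note inf = inf[folded G1_def] and G1 = G1[folded G1_def] and r1 = r1[folded G1_def] and c1 = c1[folded G1_def]
  have r2: "r \<ge> 2" and r0: "r > 0" using r unfolding max_stab_def by auto
  have sub: "g \<in> carrier CrL" if "g \<in> G1" for g using subgroup.subset[OF G1(1)] that by blast
  have C: "cyclic_group r \<subseteq> G1" using inf unfolding stab_def by blast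
  define O1 where "O1 = (\<lambda>g. act g infinity) ` G1"
  have O1: "card O1 = 2" using orbit_stab[OF G1 infinity_mem] c1 c card_cyclic_group[OF r0, where 'k = 'k] r0 unfolding inf O1_def by simp
  have "card (cyclic_group r :: ('k proj_point, 'k proj_point) rational_map set) < card G1" using c1 c card_cyclic_group[OF r0, where 'k = 'k] r0 by simp
  then obtain t where t: "t \<in> G1" "t \<notin> cyclic_group r" using C by (metis subsetI subset_antisym less_irrefl)
  have tinf: "act t infinity \<noteq> infinity" using t inf unfolding stab_def by blast
  have infO: "infinity \<in> O1" unfolding O1_def using subgroup.one_closed[OF G1(1)] act_one[OF infinity_mem] by force
  have tO: "act t infinity \<in> O1" unfolding O1_def using t by blast
  have O1_eq: "O1 = {infinity, act t infinity}"
  proof -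
    have "finite O1" using O1 by (metis card.infinite zero_neq_numeral)
    moreover have "card {infinity, act t infinity} = 2" using tinf by auto
    ultimately show ?thesis using O1 infO tO by (intro card_subset_eq[symmetric]) auto
  qed
  obtain z :: 'k where z: "primitive_root_of_unity r z" using primitive_root_exists[OF r0] by blast
  have z1: "z ^ r = 1" "z \<noteq> 1" "z \<noteq> 0"
  proof -
    show "z ^ r = 1" using z unfolding primitive_root_of_unity_def by blast
    then show "z \<noteq> 0" using r0 by (auto simp: power_0_left)
    have "z ^ 1 \<noteq> 1" using z r2 unfolding primitive_root_of_unity_def by (metis One_nat_def Suc_le_lessD Suc_1 zero_less_one)
    then show "z \<noteq> 1" by simp
  qed
  let ?c = "moebius_class (diag2 z)"
  have cC: "?c \<in> cyclic_group r" unfolding cyclic_group_def using z1 by blast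
  then have cG: "?c \<in> G1" "act ?c infinity = infinity" using inf unfolding stab_def by auto
  have tP: "act t infinity \<in> points PL" using act_mem[OF sub[OF t(1)]] by simp
  have "act ?c (act t infinity) \<in> O1"
  proof -
    have "act ?c (act t infinity) = act (?c \<otimes>\<^bsub>CrL\<^esub> t) infinity" using act_mult[OF sub[OF cG(1)] sub[OF t(1)], of infinity] by simp
    then show ?thesis unfolding O1_def using subgroup.m_closed[OF G1(1) cG(1) t(1)] by blast
  qed
  moreover have "act ?c (act t infinity) \<noteq> infinity"
    using act_inv(1)[OF sub[OF cG(1)] tP] act_inv(1)[OF sub[OF cG(1)] infinity_mem] cG(2) tinf by metis
  ultimately have "act ?c (act t infinity) = act t infinity" using O1_eq by blast
  then have t0: "act t infinity = origin" using fixed_by_diag[OF z1(3,2) tP] tinf by blast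
  have tor: "act t origin = infinity"
  proof -
    have "act t origin = act (t \<otimes>\<^bsub>CrL\<^esub> t) infinity" using act_mult[OF sub[OF t(1)] sub[OF t(1)], of infinity] t0 by simp
    then have "act t origin \<in> {infinity, origin}" using subgroup.m_closed[OF G1(1) t(1) t(1)] O1_eq t0 unfolding O1_def by blast
    moreover have "act t origin \<noteq> origin"
      using act_inv(1)[OF sub[OF t(1)] origin_mem] act_inv(1)[OF sub[OF t(1)] infinity_mem] t0 tinf by metis
    ultimately show ?thesis by blast
  qed
  obtain M where M: "det2 M \<noteq> 0" "t = moebius_class M" using sub[OF t(1)] by (rule class_cases)
  have nz: "m11 M \<noteq> 0 \<or> m21 M \<noteq> 0" "m12 M \<noteq> 0 \<or> m22 M \<noteq> 0"
    using matrix_nonzero_image[OF M(1), of 1 0] matrix_nonzero_image[OF M(1), of 0 1] by auto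
  have "pt (m11 M) (m21 M) = pt 0 1" using t0 act_pt[OF M(1), of 1 0] M(2) by simp
  then have m11: "m11 M = 0" using pt_eq_iff[OF nz(1), of 0 1] by simp
  have "pt (m12 M) (m22 M) = pt 1 0" using tor act_pt[OF M(1), of 0 1] M(2) by simp
  then have m22: "m22 M = 0" using pt_eq_iff[OF nz(2), of 1 0] by simp
  define b where "b = m12 M / m21 M"
  have b: "b \<noteq> 0" "m21 M \<noteq> 0" using nz m11 m22 by (auto simp: b_def)
  have "smult2 (inverse (m21 M)) M = Mat2 0 b 1 0" using m11 m22 b by (cases M) (simp add: smult2_def b_def field_simps)
  then have tb: "t = moebius_class (Mat2 0 b 1 0)" using class_smult[of "inverse (m21 M)" M] M b by simp
  \<comment> \<open>Conjugation by x \<mapsto> s x turns x \<mapsto> b / x into x \<mapsto> s^2 b /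
    x.\<close>
  obtain s where s: "s ^ 2 = 1 / b" using nth_root_exists[of 2 "1 / b"] by auto
  then have s0: "s \<noteq> 0" using b by auto
  have ds: "det2 (diag2 s) \<noteq> 0" "det2 (Mat2 0 b 1 0) \<noteq> 0" "det2 (Mat2 0 1 1 (0::'k)) \<noteq> 0" using s0 b by (auto simp: det2_def)
  define k where "k = moebius_class (diag2 s)"
  have k: "k \<in> carrier CrL" unfolding k_def using ds by simp
  define G2 where "G2 = conj_by CrL k G1"
  have kt: "k \<otimes>\<^bsub>CrL\<^esub> t \<otimes>\<^bsub>CrL\<^esub> inv\<^bsub>CrL\<^esub> k = inversion"
  proof -
    have "k \<otimes>\<^bsub>CrL\<^esub> t \<otimes>\<^bsub>CrL\<^esub> inv\<^bsub>CrL\<^esub> k = moebius_class (mult2 (mult2 (diag2 s) (Mat2 0 b 1 0)) (adj2 (diag2 s)))"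
      unfolding k_def tb using ds by (simp add: class_mult class_inv det_mult2)
    also have "mult2 (mult2 (diag2 s) (Mat2 0 b 1 0)) (adj2 (diag2 s)) = smult2 1 (Mat2 0 (s ^ 2 * b) 1 0)"
      by (simp add: mult2_def adj2_def smult2_def power2_eq_square algebra_simps)
    also have "s ^ 2 * b = 1" using s b by simp
    finally show ?thesis unfolding inversion_def using class_smult[of 1 "Mat2 0 1 1 (0::'k)"] ds by simp
  qed
  have G2: "subgroup G2 CrL" "finite G2" unfolding G2_def using CrL.subgroup_conj_by[OF k G1(1)] G1(2) by (auto simp: conj_by_def)
  have CG2: "cyclic_group r \<subseteq> G2"
  proof -
    have "conj_by CrL k (cyclic_group r) \<subseteq> G2" unfolding G2_def conj_by_def using C by blast
    then show ?thesis unfolding k_def conj_diag_cyclic_group[OF s0 r0] .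
  qed
  have wG2: "inversion \<in> G2" using t(1) unfolding kt[symmetric] G2_def conj_by_def by blast
  have D: "dihedral_group r \<subseteq> G2" unfolding dihedral_group_def using CG2 wG2 subgroup.m_closed[OF G2(1)] by blast
  have wc: "inversion \<in> carrier (CrL :: ('k proj_point, 'k proj_point) rational_map monoid)" unfolding inversion_def using ds by simp
  have winf: "act inversion (infinity :: 'k proj_point) = origin" unfolding inversion_def using act_pt[OF ds(3), of 1 0] by simp
  have Cc: "cyclic_group r \<subseteq> carrier (CrL :: ('k proj_point, 'k proj_point) rational_map monoid)" using CG2 subgroup.subset[OF G2(1)] by blast
  let ?D2 = "(\<lambda>g. g \<otimes>\<^bsub>CrL\<^esub> inversion) ` (cyclic_group r :: ('k proj_point, 'k proj_point) rational_map set)"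
  have "inj_on (\<lambda>g. g \<otimes>\<^bsub>CrL\<^esub> inversion) (cyclic_group r :: ('k proj_point, 'k proj_point) rational_map set)"
  proof (rule inj_onI)
    fix x y :: "('k proj_point, 'k proj_point) rational_map" assume "x \<in> cyclic_group r" "y \<in> cyclic_group r" "x \<otimes>\<^bsub>CrL\<^esub> inversion = y \<otimes>\<^bsub>CrL\<^esub> inversion"
    then show "x = y" using CrL.right_cancel[OF wc] Cc by blast
  qed
  then have "card ?D2 = r" using card_image card_cyclic_group[OF r0, where 'k = 'k] by metis
  moreover have "cyclic_group r \<inter> ?D2 = {}"
  proof -
    have False if f: "f \<in> cyclic_group r" and g: "g \<in> cyclic_group r" "f = g \<otimes>\<^bsub>CrL\<^esub> inversion" for f g :: "('k proj_point, 'k proj_point) rational_map"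
    proof -
      obtain a where a: "a \<noteq> 0" "f = moebius_class (diag2 a)" using f r0 by (rule cyclic_groupE)
      obtain a' where a': "a' \<noteq> 0" "g = moebius_class (diag2 a')" using g(1) r0 by (rule cyclic_groupE)
      have "act f infinity = infinity" unfolding a(2) using act_diag[OF a(1), of 1 0] pt_eq_iff[of a 0 1 0] a(1) by simp
      moreover have "act f infinity = act g origin" unfolding g(2) using act_mult[OF _ wc infinity_mem, of g] g(1) Cc winf by auto
      moreover have "act g origin = origin" unfolding a'(2) using act_diag[OF a'(1), of 0 1] by simp
      ultimately show False using pt_eq_iff[of 1 0 0 "1::'k"] by simp
    qed
    then show ?thesis by blast
  qed
  ultimately have "card (dihedral_group r :: ('k proj_point, 'k proj_point) rational_map set) = 2 * r"
    unfolding dihedral_group_def using card_cyclic_group[OF r0, where 'k = 'k] finite_cyclic_group[OF r0, where 'k = 'k]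
    by (subst card_Un_disjoint) auto
  moreover have "card G2 = 2 * r" unfolding G2_def using CrL.card_conj_by[OF k subgroup.subset[OF G1(1)]] c1 c by simp
  ultimately have "dihedral_group r = G2" using D G2(2) by (intro card_subset_eq) auto
  moreover have "G2 = conj_by CrL (k \<otimes>\<^bsub>CrL\<^esub> h) G" unfolding G2_def G1_def
    using CrL.conj_by_mult[OF k h] subgroup.subset[OF G(1)] by blast
  ultimately show thesis using that[of "k \<otimes>\<^bsub>CrL\<^esub> h"] h k by simp
qed

text \<open>A nontrivial element lies in the stabilizer of one of its fixed points, and Lagrange's
  theorem in this stabilizer bounds its order.\<close>

lemma order_of_element:
  fixes G :: "('k::{alg_closed_field, field_char_0} proj_point, 'k proj_point) rational_map set"
  assumes G: "subgroup G CrL" "finite G" and r: "max_stab G r" and g: "g \<in> G"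
  shows "\<exists>n. 0 < n \<and> n \<le> r \<and> g [^]\<^bsub>CrL\<^esub> n = \<one>\<^bsub>CrL\<^esub>"
proof (cases "g = \<one>\<^bsub>CrL\<^esub>")
  case True
  then show ?thesis using r unfolding max_stab_def by (intro exI[of _ 1]) auto
next
  case False
  have "{p \<in> points PL. act g p = p} \<noteq> {}" using fixed_points_card[OF G g False] by (metis card.empty zero_neq_numeral)
  then obtain p where p: "p \<in> points PL" "act g p = p" by blast
  have gs: "g \<in> stab G p" using g p unfolding stab_def by blast
  have fin: "finite (stab G p)" unfolding stab_def using G(2) by simp
  have "card (stab G p) > 0" using gs fin by (auto simp: card_gt_0_iff)
  moreover have "card (stab G p) \<le> r" using r p unfolding max_stab_def by blast
  moreover have "g [^]\<^bsub>CrL\<^esub> card (stab G p) = \<one>\<^bsub>CrL\<^esub>" by (rule CrL.subgroup_pow_card[OF subgroup_stab[OF G(1) p(1)] fin gs])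
  ultimately show ?thesis by blast
qed

text \<open>This makes \<open>max_stab\<close> independent of the embedding: a largest stabilizer is
  conjugate to the group of r-th roots of unity, and a primitive root gives an element of order
  exactly r.\<close>

lemma max_stab_ord:
  fixes G :: "('k::{alg_closed_field, field_char_0} proj_point, 'k proj_point) rational_map set"
  assumes G: "subgroup G CrL" "finite G" and r: "max_stab G r"
  shows "\<exists>g\<in>G. CrL.ord g = r" "\<And>g. g \<in> G \<Longrightarrow> CrL.ord g \<le> r"
proof -
  have sub: "g \<in> carrier CrL" if "g \<in> G" for g using subgroup.subset[OF G(1)] that by blast
  show "CrL.ord g \<le> r" if g: "g \<in> G" for g
  proof -
    obtain n where n: "0 < n" "n \<le> r" "g [^]\<^bsub>CrL\<^esub> n = \<one>\<^bsub>CrL\<^esub>" using order_of_element[OF G r g] by blast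
    then have "CrL.ord g dvd n" using CrL.pow_eq_id[OF sub[OF g]] by blast
    then show ?thesis using n by (meson dvd_imp_le le_trans)
  qed
  obtain h where h: "h \<in> carrier CrL" and inf: "stab (conj_by CrL h G) infinity = cyclic_group r"
    using max_stab_normal_form[OF G r] by metis
  have r0: "r > 0" using r unfolding max_stab_def by auto
  obtain z :: 'k where z: "primitive_root_of_unity r z" using primitive_root_exists[OF r0] by blast
  have z0: "z ^ r = 1" "z \<noteq> 0" using z r0 unfolding primitive_root_of_unity_def by (auto simp: power_0_left)
  let ?c = "moebius_class (diag2 z)"
  have dz: "det2 (diag2 z) \<noteq> 0" using z0 by (simp add: det2_def)
  have "?c \<in> cyclic_group r" unfolding cyclic_group_def using z0 by blast
  then have "?c \<in> conj_by CrL h G" using inf unfolding stab_def by blast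
  then obtain g where g: "g \<in> G" "?c = h \<otimes>\<^bsub>CrL\<^esub> g \<otimes>\<^bsub>CrL\<^esub> inv\<^bsub>CrL\<^esub> h" unfolding conj_by_def by blast
  have pw: "(h \<otimes>\<^bsub>CrL\<^esub> g \<otimes>\<^bsub>CrL\<^esub> inv\<^bsub>CrL\<^esub> h) [^]\<^bsub>CrL\<^esub> n = h \<otimes>\<^bsub>CrL\<^esub> (g [^]\<^bsub>CrL\<^esub> n) \<otimes>\<^bsub>CrL\<^esub> inv\<^bsub>CrL\<^esub> h" for n :: nat
    by (induction n) (use h sub[OF g(1)] in \<open>simp_all add: CrL.conj_mult\<close>)
  have "g [^]\<^bsub>CrL\<^esub> n = \<one>\<^bsub>CrL\<^esub> \<longleftrightarrow> r dvd n" for n :: nat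
  proof -
    have "g [^]\<^bsub>CrL\<^esub> n = \<one>\<^bsub>CrL\<^esub> \<longleftrightarrow> ?c [^]\<^bsub>CrL\<^esub> n = \<one>\<^bsub>CrL\<^esub>"
    proof
      assume "g [^]\<^bsub>CrL\<^esub> n = \<one>\<^bsub>CrL\<^esub>"
      then show "?c [^]\<^bsub>CrL\<^esub> n = \<one>\<^bsub>CrL\<^esub>" unfolding g(2) pw using h by simp
    next
      assume "?c [^]\<^bsub>CrL\<^esub> n = \<one>\<^bsub>CrL\<^esub>"
      then have "h \<otimes>\<^bsub>CrL\<^esub> (g [^]\<^bsub>CrL\<^esub> n) \<otimes>\<^bsub>CrL\<^esub> inv\<^bsub>CrL\<^esub> h = \<one>\<^bsub>CrL\<^esub>" unfolding g(2) pw .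
      then show "g [^]\<^bsub>CrL\<^esub> n = \<one>\<^bsub>CrL\<^esub>" using CrL.conj_cancel[OF h, of "g [^]\<^bsub>CrL\<^esub> n"] h sub[OF g(1)] by simp
    qed
    also have "\<dots> \<longleftrightarrow> z ^ n = 1" unfolding class_pow[OF dz] pow2_diag using z0
      by (subst class_eq_one_iff) (auto simp: det2_def)
    also have "\<dots> \<longleftrightarrow> r dvd n" using primitive_root_dvd[OF z] z0(1) by (auto simp: power_mult elim!: dvdE)
    finally show ?thesis .
  qed
  then have "CrL.ord g = r" using CrL.ord_unique[OF sub[OF g(1)]] by blast
  then show "\<exists>g\<in>G. CrL.ord g = r" using g by blast
qed

subsection \<open>Polyhedral groups\<close>

text \<open>Cauchy's theorem at the prime 2, obtained from Sylow's theorem with exponent 1, where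
  the cofactor m may still be even.\<close>

lemma involution_exists:
  fixes G :: "('k::{alg_closed_field, field_char_0} proj_point, 'k proj_point) rational_map set"
  assumes G: "subgroup G CrL" "finite G" and ev: "even (card G)"
  shows "\<exists>u\<in>G. u \<noteq> \<one>\<^bsub>CrL\<^esub> \<and> u \<otimes>\<^bsub>CrL\<^esub> u = \<one>\<^bsub>CrL\<^esub>"
proof -
  let ?H = "CrL\<lparr>carrier := G\<rparr>"
  have grp: "group ?H" by (rule subgroup.subgroup_is_group[OF G(1) group_Cr1])
  obtain m where "card G = 2 * m" using ev by (rule evenE)
  then have "order ?H = 2 ^ 1 * m" by (simp add: order_def)
  moreover have "finite (carrier ?H)" using G(2) by simp
  ultimately have "\<exists>K. subgroup K ?H \<and> card K = 2 ^ 1" by (rule sylow_thm[OF two_is_prime_nat grp])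
  then obtain K where K: "subgroup K ?H" "card K = 2" by auto
  have KG: "K \<subseteq> G" using subgroup.subset[OF K(1)] by simp
  then have KC: "subgroup K CrL" using CrL.incl_subgroup[OF G(1) K(1)] by simp
  have fK: "finite K" using K(2) by (metis card.infinite zero_neq_numeral)
  have "\<not> K \<subseteq> {\<one>\<^bsub>CrL\<^esub>}" using K(2) card_mono[of "{\<one>\<^bsub>CrL :: ('k proj_point, 'k proj_point) rational_map monoid\<^esub>}" K] by auto
  then obtain u where u: "u \<in> K" "u \<noteq> \<one>\<^bsub>CrL\<^esub>" by blast
  have "u [^]\<^bsub>CrL\<^esub> (2::nat) = \<one>\<^bsub>CrL\<^esub>" using CrL.subgroup_pow_card[OF KC fK u(1)] K(2) by simp
  moreover have "u \<in> carrier CrL" using u KC subgroup.subset by blast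
  ultimately have "u \<otimes>\<^bsub>CrL\<^esub> u = \<one>\<^bsub>CrL\<^esub>" by (simp add: numeral_2_eq_2)
  then show ?thesis using u KG by blast
qed

text \<open>
  Otherwise all involutions would preserve every translate of the pair of fixed points of the
  largest stabilizer; two such pairs are disjoint, and the rotations of order at least 3 around
  the first pair do not preserve the second.
\<close>

lemma moving_involution_exists:
  fixes G :: "('k::{alg_closed_field, field_char_0} proj_point, 'k proj_point) rational_map set"
  assumes G: "subgroup G CrL" "finite G" and ev: "even (card G)" and inf: "stab G infinity = cyclic_group r"
    and r: "max_stab G r" "r \<ge> 3" and big: "card G > 2 * r"
  shows "\<exists>t\<in>G. t \<otimes>\<^bsub>CrL\<^esub> t = \<one>\<^bsub>CrL\<^esub> \<and> act t infinity \<noteq> infinity \<and> act t infinity \<noteq> origin"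
proof (rule ccontr)
  assume "\<not> ?thesis"
  then have no: "act t infinity = infinity \<or> act t infinity = origin" if "t \<in> G" "t \<otimes>\<^bsub>CrL\<^esub> t = \<one>\<^bsub>CrL\<^esub>" for t
    using that by blast
  have r0: "r > 0" using r(2) by simp
  have sub: "g \<in> carrier CrL" if "g \<in> G" for g using subgroup.subset[OF G(1)] that by blast
  \<comment> \<open>The orbit of infinity has card G / r > 2 points, so it does not fit into the
    pair of infinity and origin.\<close>
  have "\<exists>g\<in>G. act g infinity \<noteq> infinity \<and> act g infinity \<noteq> origin"
  proof (rule ccontr)
    assume "\<not> ?thesis"
    then have "(\<lambda>g. act g infinity) ` G \<subseteq> {infinity, origin}" by blast
    then have "card ((\<lambda>g. act g infinity) ` G) \<le> card {infinity, origin :: 'k proj_point}" by (intro card_mono) auto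
    also have "\<dots> \<le> 2" by (simp add: card_insert_if)
    finally have "card ((\<lambda>g. act g infinity) ` G) * r \<le> 2 * r" by (rule mult_le_mono1)
    moreover have "card ((\<lambda>g. act g infinity) ` G) * r = card G"
      using orbit_stab[OF G infinity_mem] unfolding inf card_cyclic_group[OF r0] .
    ultimately show False using big by linarith
  qed
  then obtain g where g: "g \<in> G" "act g infinity \<noteq> infinity" "act g infinity \<noteq> origin" by blast
  note gc = sub[OF g(1)]
  define a b where "a = act g infinity" and "b = act g origin"
  have abP: "a \<in> points PL" "b \<in> points PL" unfolding a_def b_def using act_mem[OF gc] by simp_all
  have invol: "act t (act t p) = p" if "t \<in> G" "t \<otimes>\<^bsub>CrL\<^esub> t = \<one>\<^bsub>CrL\<^esub>" "p \<in> points PL" for t p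
    using act_mult[OF sub[OF that(1)] sub[OF that(1)] that(3)] act_one[OF that(3)] that(2) by simp
  have orig: "act t origin = origin \<or> act t origin = infinity"
    and fix_both: "act t infinity = infinity \<Longrightarrow> act t origin = origin"
    if t: "t \<in> G" "t \<otimes>\<^bsub>CrL\<^esub> t = \<one>\<^bsub>CrL\<^esub>" for t
  proof -
    show fb: "act t origin = origin" if ti: "act t infinity = infinity"
    proof -
      have "t \<in> cyclic_group r" using t ti inf unfolding stab_def by blast
      then obtain x where x: "x \<noteq> 0" "t = moebius_class (diag2 x)" using r0 by (rule cyclic_groupE)
      show ?thesis unfolding x(2) using act_diag[OF x(1), of 0 1] by simp
    qed
    show "act t origin = origin \<or> act t origin = infinity"
      using no[OF t] fb invol[OF t infinity_mem] by metis
  qed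
  \<comment> \<open>Conjugates of involutions are involutions, so what holds for the pair infinity,
    origin is transported by g to the pair a, b.\<close>
  have conj: "inv\<^bsub>CrL\<^esub> g \<otimes>\<^bsub>CrL\<^esub> t \<otimes>\<^bsub>CrL\<^esub> g \<in> G \<and>
      (inv\<^bsub>CrL\<^esub> g \<otimes>\<^bsub>CrL\<^esub> t \<otimes>\<^bsub>CrL\<^esub> g) \<otimes>\<^bsub>CrL\<^esub> (inv\<^bsub>CrL\<^esub> g \<otimes>\<^bsub>CrL\<^esub> t \<otimes>\<^bsub>CrL\<^esub> g) = \<one>\<^bsub>CrL\<^esub>"
    if t: "t \<in> G" "t \<otimes>\<^bsub>CrL\<^esub> t = \<one>\<^bsub>CrL\<^esub>" for t
  proof
    show "inv\<^bsub>CrL\<^esub> g \<otimes>\<^bsub>CrL\<^esub> t \<otimes>\<^bsub>CrL\<^esub> g \<in> G"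
      using g(1) t(1) G(1) by (intro subgroup.m_closed[OF G(1)] subgroup.m_inv_closed[OF G(1)])
    have "(inv\<^bsub>CrL\<^esub> g \<otimes>\<^bsub>CrL\<^esub> t \<otimes>\<^bsub>CrL\<^esub> g) \<otimes>\<^bsub>CrL\<^esub> (inv\<^bsub>CrL\<^esub> g \<otimes>\<^bsub>CrL\<^esub> t \<otimes>\<^bsub>CrL\<^esub> g) =
      inv\<^bsub>CrL\<^esub> g \<otimes>\<^bsub>CrL\<^esub> (t \<otimes>\<^bsub>CrL\<^esub> t) \<otimes>\<^bsub>CrL\<^esub> g"
      using CrL.conj_mult[of "inv\<^bsub>CrL\<^esub> g" t t] gc sub[OF t(1)] by simp
    then show "(inv\<^bsub>CrL\<^esub> g \<otimes>\<^bsub>CrL\<^esub> t \<otimes>\<^bsub>CrL\<^esub> g) \<otimes>\<^bsub>CrL\<^esub> (inv\<^bsub>CrL\<^esub> g \<otimes>\<^bsub>CrL\<^esub> t \<otimes>\<^bsub>CrL\<^esub> g) = \<one>\<^bsub>CrL\<^esub>"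
      using t(2) gc by simp
  qed
  have conj_act: "act t (act g p) = act g (act (inv\<^bsub>CrL\<^esub> g \<otimes>\<^bsub>CrL\<^esub> t \<otimes>\<^bsub>CrL\<^esub> g) p)" if t: "t \<in> G" and p: "p \<in> points PL" for t p
  proof -
    have "act (inv\<^bsub>CrL\<^esub> g \<otimes>\<^bsub>CrL\<^esub> t \<otimes>\<^bsub>CrL\<^esub> g) p = act (inv\<^bsub>CrL\<^esub> g) (act t (act g p))"
      using gc sub[OF t] p by (simp add: act_mult act_mem)
    then show ?thesis using act_inv(2)[OF gc act_mem[OF sub[OF t] act_mem[OF gc p]]] by simp
  qed
  have ab: "act t a \<in> {a, b}" "act t b \<in> {a, b}" if t: "t \<in> G" "t \<otimes>\<^bsub>CrL\<^esub> t = \<one>\<^bsub>CrL\<^esub>" for t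
    unfolding a_def b_def conj_act[OF t(1) infinity_mem] conj_act[OF t(1) origin_mem]
    using no[of "inv\<^bsub>CrL\<^esub> g \<otimes>\<^bsub>CrL\<^esub> t \<otimes>\<^bsub>CrL\<^esub> g"] orig[of "inv\<^bsub>CrL\<^esub> g \<otimes>\<^bsub>CrL\<^esub> t \<otimes>\<^bsub>CrL\<^esub> g"] conj[OF t] by auto
  show False
  proof (cases "\<exists>t\<in>G. t \<otimes>\<^bsub>CrL\<^esub> t = \<one>\<^bsub>CrL\<^esub> \<and> act t infinity = origin")
    case True
    then obtain t where t: "t \<in> G" "t \<otimes>\<^bsub>CrL\<^esub> t = \<one>\<^bsub>CrL\<^esub>" "act t infinity = origin" by blast
    have tor: "act t origin = infinity" using invol[OF t(1,2) infinity_mem] t(3) by simp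
    obtain z :: 'k where z: "primitive_root_of_unity r z" using primitive_root_exists[OF r0] by blast
    have z0: "z ^ r = 1" "z \<noteq> 0" "z ^ 2 \<noteq> 1"
    proof -
      show "z ^ r = 1" using z unfolding primitive_root_of_unity_def by blast
      then show "z \<noteq> 0" using r0 by (auto simp: power_0_left)
      show "z ^ 2 \<noteq> 1" using z r(2) unfolding primitive_root_of_unity_def by auto
    qed
    let ?c = "moebius_class (diag2 z)"
    have dz: "det2 (diag2 z) \<noteq> 0" using z0 by (simp add: det2_def)
    have cG: "?c \<in> G" using inf z0(1) unfolding stab_def cyclic_group_def by blast
    obtain M where M: "det2 M \<noteq> 0" "t = moebius_class M" using sub[OF t(1)] by (rule class_cases)
    have nz: "m11 M \<noteq> 0 \<or> m21 M \<noteq> 0" "m12 M \<noteq> 0 \<or> m22 M \<noteq> 0"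
      using matrix_nonzero_image[OF M(1), of 1 0] matrix_nonzero_image[OF M(1), of 0 1] by auto
    have "pt (m11 M) (m21 M) = pt 0 1" using t(3) act_pt[OF M(1), of 1 0] M(2) by simp
    then have m11: "m11 M = 0" using pt_eq_iff[OF nz(1), of 0 1] by simp
    have "pt (m12 M) (m22 M) = pt 1 0" using tor act_pt[OF M(1), of 0 1] M(2) by simp
    then have m22: "m22 M = 0" using pt_eq_iff[OF nz(2), of 1 0] by simp
    have ct: "?c \<otimes>\<^bsub>CrL\<^esub> t \<in> G" using subgroup.m_closed[OF G(1) cG t(1)] .
    \<comment> \<open>Antidiagonal matrices have scalar squares, so rotation times t is an
      involution. The rotation is then a product of two involutions and preserves the pair a,
      b.\<close>
    have ct2: "(?c \<otimes>\<^bsub>CrL\<^esub> t) \<otimes>\<^bsub>CrL\<^esub> (?c \<otimes>\<^bsub>CrL\<^esub> t) = \<one>\<^bsub>CrL\<^esub>"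
    proof -
      have "(?c \<otimes>\<^bsub>CrL\<^esub> t) \<otimes>\<^bsub>CrL\<^esub> (?c \<otimes>\<^bsub>CrL\<^esub> t) = moebius_class (mult2 (mult2 (diag2 z) M) (mult2 (diag2 z) M))"
        unfolding M(2) using dz M(1) by (simp add: class_mult det_mult2)
      also have "\<dots> = \<one>\<^bsub>CrL\<^esub>"
      proof -
        have dd: "det2 (mult2 (mult2 (diag2 z) M) (mult2 (diag2 z) M)) \<noteq> 0" using dz M(1) by (simp add: det_mult2)
        show ?thesis unfolding class_eq_one_iff[OF dd] using m11 m22 by (simp add: mult2_def)
      qed
      finally show ?thesis .
    qed
    have cab: "act ?c p \<in> {a, b}" if p: "p \<in> {a, b}" for p
    proof -
      have pP: "p \<in> points PL" using p abP by blast
      have tp: "act t p \<in> {a, b}" using ab[OF t(1,2)] p by blast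
      have "act ?c p = act ?c (act t (act t p))" using invol[OF t(1,2) pP] by simp
      also have "\<dots> = act (?c \<otimes>\<^bsub>CrL\<^esub> t) (act t p)" using act_mult[OF sub[OF cG] sub[OF t(1)] act_mem[OF sub[OF t(1)] pP]] by simp
      finally show ?thesis using ab[OF ct ct2] tp by auto
    qed
    have cinj: "p = q" if "act ?c p = act ?c q" "p \<in> points PL" "q \<in> points PL" for p q
      using act_inv(1)[OF sub[OF cG]] that by metis
    \<comment> \<open>A permutation of at most two points squares to the identity. But z^2 is not 1,
      so the squared rotation fixes only infinity and origin, and a is neither.\<close>
    have "act ?c (act ?c a) = a"
    proof (cases "act ?c a = a")
      case False
      then have "act ?c a = b" using cab[of a] by blast
      moreover have "act ?c b \<noteq> b" using cinj[of a b] False \<open>act ?c a = b\<close> abP by auto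
      ultimately show ?thesis using cab[of b] by auto
    qed simp
    then have "act (?c \<otimes>\<^bsub>CrL\<^esub> ?c) a = a" using act_mult[OF sub[OF cG] sub[OF cG] abP(1)] by simp
    moreover have "?c \<otimes>\<^bsub>CrL\<^esub> ?c = moebius_class (diag2 (z ^ 2))"
      using dz by (simp add: class_mult mult2_def power2_eq_square)
    ultimately have "act (moebius_class (diag2 (z ^ 2))) a = a" by simp
    from fixed_by_diag[OF _ z0(3) abP(1) this] z0(2) show False using g(2,3) unfolding a_def by auto
  next
    case False
    \<comment> \<open>Here every involution fixes infinity and is therefore diagonal. The conjugate
      of u under g fixes infinity too, so u fixes a, which is impossible for a nontrivial diagonal
      element.\<close>
    obtain u where u: "u \<in> G" "u \<noteq> \<one>\<^bsub>CrL\<^esub>" "u \<otimes>\<^bsub>CrL\<^esub> u = \<one>\<^bsub>CrL\<^esub>" using involution_exists[OF G ev] by blast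
    have all_inf: "act t infinity = infinity" if "t \<in> G" "t \<otimes>\<^bsub>CrL\<^esub> t = \<one>\<^bsub>CrL\<^esub>" for t using no[OF that] False that by blast
    have "u \<in> cyclic_group r" using all_inf[OF u(1,3)] u(1) inf unfolding stab_def by blast
    then obtain x where x: "x \<noteq> 0" "u = moebius_class (diag2 x)" using r0 by (rule cyclic_groupE)
    have "x \<noteq> 1" using u(2) x by (auto simp: class_one)
    moreover have "act u a = a" unfolding a_def conj_act[OF u(1) infinity_mem] using all_inf conj[OF u(1,3)] by simp
    ultimately show False using fixed_by_diag[OF x(1) _ abP(1)] g(2,3) unfolding x(2) a_def by blast
  qed
qed

text \<open>The lower left entry of the square is m21 times the trace, so an involution moving
  infinity has trace 0. As infinity does not go to the origin either, the upper left entry can be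
  scaled to 1. Conjugation by diagonal matrices changes q and s but not q * s, which is the
  parameter studied below.\<close>

lemma moving_involution_matrix:
  fixes t :: "('k::{alg_closed_field, field_char_0} proj_point, 'k proj_point) rational_map"
  assumes t: "t \<in> carrier CrL" "t \<otimes>\<^bsub>CrL\<^esub> t = \<one>\<^bsub>CrL\<^esub>" "act t infinity \<noteq> infinity" "act t infinity \<noteq> origin"
  obtains q s where "t = moebius_class (Mat2 1 q s (-1))" "s \<noteq> 0" "1 + q * s \<noteq> 0"
proof -
  obtain M where M: "det2 M \<noteq> 0" "t = moebius_class M" using t(1) by (rule class_cases)
  have nz: "m11 M \<noteq> 0 \<or> m21 M \<noteq> 0" using matrix_nonzero_image[OF M(1), of 1 0] by simp
  have ti: "act t infinity = pt (m11 M) (m21 M)" using act_pt[OF M(1), of 1 0] M(2) by simp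
  have s: "m21 M \<noteq> 0" and p: "m11 M \<noteq> 0"
    using t(3,4) unfolding ti pt_eq_iff[OF nz, of 1 0, simplified] pt_eq_iff[OF nz, of 0 1, simplified] by auto
  have "moebius_class (mult2 M M) = \<one>\<^bsub>CrL\<^esub>" using t(2) M by (simp add: class_mult)
  then have "m21 (mult2 M M) = 0" using class_eq_one_iff[of "mult2 M M"] M(1) by (simp add: det_mult2)
  then have "m21 M * (m11 M + m22 M) = 0" by (simp add: mult2_def algebra_simps)
  then have tr: "m22 M = - m11 M" using s by (simp add: add_eq_0_iff)
  have "smult2 (inverse (m11 M)) M = Mat2 1 (m12 M / m11 M) (m21 M / m11 M) (-1)"
    using p tr by (simp add: smult2_def field_simps)
  then have teq: "t = moebius_class (Mat2 1 (m12 M / m11 M) (m21 M / m11 M) (-1))"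
    using class_smult[of "inverse (m11 M)" M] M p by simp
  have "- (m11 M * m11 M) - m12 M * m21 M \<noteq> 0" using M(1) tr by (simp add: det2_def)
  then have "1 + m12 M / m11 M * (m21 M / m11 M) \<noteq> 0" using p by (auto simp: field_simps add_eq_0_iff)
  then show thesis using that[OF teq] s p by simp
qed

text \<open>The lower left entries of the powers of a matrix are Chebyshev polynomials in trace and determinant.\<close>

lemma pow2_lower_left_rec:
  "m21 (pow2 M (Suc (Suc n))) = (m11 M + m22 M) * m21 (pow2 M (Suc n)) - det2 M * m21 (pow2 M n)"
  by (simp add: mult2_def det2_def algebra_simps)

lemma pow2_lower_left:
  fixes M :: "'k::field mat2"
  defines "t \<equiv> m11 M + m22 M" and "d \<equiv> det2 M"
  shows "m21 (pow2 M 2) = m21 M * t"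
    "m21 (pow2 M 3) = m21 M * (t ^ 2 - d)"
    "m21 (pow2 M 4) = m21 M * (t * (t ^ 2 - 2 * d))"
    "m21 (pow2 M 5) = m21 M * (t ^ 4 - 3 * t ^ 2 * d + d ^ 2)"
proof -
  define u where "u n = m21 (pow2 M n)" for n
  have rec: "u (Suc (Suc n)) = t * u (Suc n) - d * u n" for n
    unfolding u_def t_def d_def by (rule pow2_lower_left_rec)
  have u: "u 0 = 0" "u 1 = m21 M" by (simp_all add: u_def mult2_def One_nat_def)
  show u2: "m21 (pow2 M 2) = m21 M * t" using rec[of 0] u unfolding u_def[symmetric] by (simp add: numeral_2_eq_2 One_nat_def)
  show u3: "m21 (pow2 M 3) = m21 M * (t ^ 2 - d)"
    using rec[of 1] u u2 unfolding u_def[symmetric]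
    by (simp add: numeral_3_eq_3 numeral_2_eq_2 One_nat_def algebra_simps)
  show u4: "m21 (pow2 M 4) = m21 M * (t * (t ^ 2 - 2 * d))"
    using rec[of 2] u2 u3 unfolding u_def[symmetric] by (simp add: power2_eq_square algebra_simps)
  show "m21 (pow2 M 5) = m21 M * (t ^ 4 - 3 * t ^ 2 * d + d ^ 2)"
    using rec[of 3] u3 u4 unfolding u_def[symmetric] by (simp add: power2_eq_square power4_eq_xxxx algebra_simps)
qed

text \<open>Some power with exponent n \<le> 5 is scalar, so its lower left entry vanishes; since
  \<open>m21 M\<close> is nonzero, what remains is a polynomial relation between trace and
  determinant for n = 2, 3, 4 or 5.\<close>

lemma order_conditions:
  fixes M :: "'k::{alg_closed_field, field_char_0} mat2"
  assumes G: "subgroup G CrL" "finite G" and r: "max_stab G r" "r \<le> 5"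
    and M: "det2 M \<noteq> 0" "m21 M \<noteq> 0" "moebius_class M \<in> G"
  defines "t \<equiv> m11 M + m22 M" and "d \<equiv> det2 M"
  shows "t = 0 \<or> t ^ 2 = d \<or> (r \<ge> 4 \<and> t ^ 2 = 2 * d) \<or> (r \<ge> 5 \<and> t ^ 4 - 3 * t ^ 2 * d + d ^ 2 = 0)"
proof -
  obtain n where n: "0 < n" "n \<le> r" "moebius_class M [^]\<^bsub>CrL\<^esub> n = \<one>\<^bsub>CrL\<^esub>" using order_of_element[OF G r(1) M(3)] by blast
  have z: "m21 (pow2 M n) = 0" using n(3) unfolding class_pow[OF M(1)] class_eq_one_iff[OF det_pow2[OF M(1)]] by blast
  have "n \<noteq> 1" using z M(2) by (auto simp: One_nat_def mult2_def)
  then consider "n = 2" | "n = 3" | "n = 4" | "n = 5" using n r(2) by linarith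
  then show ?thesis
  proof cases
    case 1 then show ?thesis using z M(2) unfolding t_def d_def by (simp add: pow2_lower_left)
  next
    case 2 then show ?thesis using z M(2) unfolding t_def d_def by (simp add: pow2_lower_left)
  next
    case 3 then show ?thesis using z M(2) n(2) unfolding t_def d_def by (auto simp: pow2_lower_left)
  next
    case 4 then show ?thesis using z M(2) n(2) unfolding t_def d_def by (simp add: pow2_lower_left)
  qed
qed

text \<open>Rotation by w times the involution has trace w - 1 and determinant - w e, so
  \<open>order_conditions\<close> becomes an equation for e. Order 2 would need w = 1.\<close>

lemma rotation_times_involution:
  fixes w :: "'k::{alg_closed_field, field_char_0}"
  assumes G: "subgroup G CrL" "finite G" and r: "max_stab G r" "r \<le> 5" and inf: "stab G infinity = cyclic_group r"
    and t: "moebius_class (Mat2 1 q s (-1)) \<in> G" "s \<noteq> 0" and e: "e = 1 + q * s" "e \<noteq> 0"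
    and w: "w ^ r = 1" "w \<noteq> 1"
  shows "(w - 1) ^ 2 = - w * e \<or> (r \<ge> 4 \<and> (w - 1) ^ 2 = - 2 * w * e) \<or>
     (r \<ge> 5 \<and> (w - 1) ^ 4 + 3 * (w - 1) ^ 2 * (w * e) + (w * e) ^ 2 = 0)"
proof -
  have r0: "r > 0" using r unfolding max_stab_def by auto
  have w0: "w \<noteq> 0" using w(1) r0 by (auto simp: power_0_left)
  have d: "det2 (diag2 w) \<noteq> 0" "det2 (Mat2 1 q s (-1)) \<noteq> 0" using w0 e by (auto simp: det2_def algebra_simps add_eq_0_iff)
  have "moebius_class (diag2 w) \<in> G" using inf w(1) unfolding stab_def cyclic_group_def by blast
  from subgroup.m_closed[OF G(1) this t(1)]
  have wt: "moebius_class (mult2 (diag2 w) (Mat2 1 q s (-1))) \<in> G" using d by (simp add: class_mult)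
  have eq: "mult2 (diag2 w) (Mat2 1 q s (-1)) = Mat2 w (w * q) s (-1)" by (simp add: mult2_def)
  have det: "det2 (Mat2 w (w * q) s (-1)) = - (w * e)" by (simp add: det2_def e algebra_simps)
  then have "det2 (Mat2 w (w * q) s (-1)) \<noteq> 0" using w0 e by simp
  from order_conditions[OF G r this _ wt[unfolded eq]] show ?thesis
    using t(2) w(2) unfolding det by auto
qed

text \<open>Here s1 and s2 are the values of (w - 1)^2 / w for w = z and w = z^2, with z a primitive
  fifth root of unity; they are the two roots of X^2 + 5 X + 5. The rotations by z and z^2 give the
  conditions A and B on the same e. If neither product has order 3, every remaining combination
  contradicts characteristic zero.\<close>

lemma five_fold_cases:
  fixes e s1 s2 :: "'k::field_char_0"
  assumes s: "s1 + s2 = - 5" "s1 ^ 2 + 5 * s1 + 5 = 0"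
    and A: "s1 = - e \<or> s1 = - 2 * e \<or> s1 ^ 2 + 3 * s1 * e + e ^ 2 = 0"
    and B: "s2 = - e \<or> s2 = - 2 * e \<or> s2 ^ 2 + 3 * s2 * e + e ^ 2 = 0"
  shows "s1 = - e \<or> s2 = - e"
proof (rule ccontr)
  assume "\<not> ?thesis"
  then have A: "s1 = - 2 * e \<or> s1 ^ 2 + 3 * s1 * e + e ^ 2 = 0" and B: "s2 = - 2 * e \<or> s2 ^ 2 + 3 * s2 * e + e ^ 2 = 0"
    using A B by auto
  have s2: "s2 = - 5 - s1" using s(1) by (simp add: algebra_simps eq_neg_iff_add_eq_0)
  \<comment> \<open>The conditions on e when one of the two values is - 2 e: the first is the
    equation of that value, the second the quadratic relation for the other one. Eliminating e^2
    gives e = 3/2, which is no solution.\<close>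
  have mixed: False if "4 * e ^ 2 - 10 * e + 5 = 0" "11 * e ^ 2 - 35 * e + 25 = 0"
  proof -
    have "10 * e = 15" using that by Groebner_Basis.algebra
    then have e: "e = 15 / 10" by (simp add: eq_divide_eq mult.commute)
    show False using that(1) unfolding e by (simp add: power2_eq_square)
  qed
  have ne: "2 * s1 + 5 \<noteq> 0"
  proof
    assume "2 * s1 + 5 = 0"
    then have "(5::'k) = 0" using s(2) by Groebner_Basis.algebra
    then show False by simp
  qed
  from A B show False
  proof (elim disjE)
    assume "s1 = - 2 * e" "s2 = - 2 * e"
    then have "2 * s1 + 5 = 0" using s2 by Groebner_Basis.algebra
    then show False using ne by simp
  next
    assume h: "s1 = - 2 * e" "s2 ^ 2 + 3 * s2 * e + e ^ 2 = 0"
    show False by (rule mixed) (use h s(2) s2 in Groebner_Basis.algebra)+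
  next
    assume h: "s1 ^ 2 + 3 * s1 * e + e ^ 2 = 0" "s2 = - 2 * e"
    show False by (rule mixed) (use h s(2) s2 in Groebner_Basis.algebra)+
  next
    assume h: "s1 ^ 2 + 3 * s1 * e + e ^ 2 = 0" "s2 ^ 2 + 3 * s2 * e + e ^ 2 = 0"
    \<comment> \<open>The difference of the two relations, with s1 - s2 = 2 s1 + 5 and s1 + s2 = -
      5.\<close>
    have "(2 * s1 + 5) * (3 * e - 5) = 0" using h s2 by Groebner_Basis.algebra
    then have "3 * e = 5" using ne by simp
    then have e: "e = 5 / 3" by (simp add: eq_divide_eq mult.commute)
    have "s1 ^ 2 + 5 * s1 = - (25 / 9)" using h(1) unfolding e by (simp add: power2_eq_square add_eq_0_iff2)
    moreover have "s1 ^ 2 + 5 * s1 = - 5" using s(2) by (simp add: add_eq_0_iff2)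
    ultimately show False by simp
  qed
qed

text \<open>The hypothesis \<open>qs\<close> is the case where the product with the rotation by z^2,
  not by z, satisfies the order 3 relation. With c the rotation by z, the word t (c^2 t c^(-2)) t is
  a conjugate of t, hence again an involution, and its parameter is the one that fits z.\<close>

lemma icosahedral_word:
  fixes z :: "'k::{alg_closed_field, field_char_0}"
  assumes G: "subgroup G CrL" and z: "z ^ 4 + z ^ 3 + z ^ 2 + z + 1 = 0"
    and c: "\<And>w. w ^ 5 = 1 \<Longrightarrow> moebius_class (diag2 w) \<in> G"
    and t: "moebius_class (Mat2 1 q s (-1)) \<in> G" and qs: "q * s = 1 - z ^ 2 - z ^ 3"
  obtains q' s' where "moebius_class (Mat2 1 q' s' (-1)) \<in> G" "z * (1 + q' * s') = - ((z - 1) ^ 2)" "s' \<noteq> 0" "1 + q' * s' \<noteq> 0"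
proof -
  have z5: "z ^ 5 = 1" using z by Groebner_Basis.algebra
  then have z0: "z \<noteq> 0" by auto
  have z2: "(z ^ 2) ^ 5 = 1" "(z ^ 3) ^ 5 = 1" using z5 by (metis power_mult mult.commute power_one)+
  let ?T = "Mat2 1 q s (-1)"
  \<comment> \<open>Entries of the matrix of the word, computed with the cyclotomic relation for z
    and the given value of q * s; z^3 stands for z^(-2).\<close>
  define p where "p = 3 * (z ^ 2 + z ^ 3) - 1"
  define q1 s1 where "q1 = q * (2 - z ^ 2 + (1 - z ^ 2 - z ^ 3) * z ^ 3)" and "s1 = s * (2 - z ^ 3 + (1 - z ^ 2 - z ^ 3) * z ^ 2)"
  have e: "1 + q * s = 2 - z ^ 2 - z ^ 3" using qs by Groebner_Basis.algebra
  have e0: "1 + q * s \<noteq> 0"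
  proof
    assume "1 + q * s = 0"
    then have w: "z ^ 2 + z ^ 3 = 2" using e by Groebner_Basis.algebra
    have "z ^ 2 + 3 * z + 1 = (z ^ 4 + z ^ 3 + z ^ 2 + z + 1) - z * (z ^ 2 + z ^ 3 - 2)"
      by Groebner_Basis.algebra
    then have a: "z ^ 2 + 3 * z + 1 = 0" using w z by simp
    have "5 * z = (z ^ 2 + z ^ 3 - 2) - z * (z ^ 2 + 3 * z + 1) + 2 * (z ^ 2 + 3 * z + 1)"
      by Groebner_Basis.algebra
    then have "5 * z = 0" unfolding a using w by simp
    then show False using z0 by simp
  qed
  have d: "det2 ?T \<noteq> 0" "det2 (diag2 (z ^ 2)) \<noteq> 0" "det2 (diag2 (z ^ 3)) \<noteq> 0"
    using e0 z0 by (auto simp: det2_def algebra_simps add_eq_0_iff)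
  have in_G: "moebius_class (mult2 (mult2 ?T (mult2 (mult2 (diag2 (z ^ 2)) ?T) (diag2 (z ^ 3)))) ?T) \<in> G"
    using subgroup.m_closed[OF G subgroup.m_closed[OF G t subgroup.m_closed[OF G subgroup.m_closed[OF G c[OF z2(1)] t] c[OF z2(2)]]] t] d
    by (simp add: class_mult det_mult2)
  have "mult2 (mult2 ?T (mult2 (mult2 (diag2 (z ^ 2)) ?T) (diag2 (z ^ 3)))) ?T = Mat2 p q1 s1 (- p)"
    unfolding mult2_def p_def q1_def s1_def mat2.sel mat2.inject using qs z by (intro conjI; Groebner_Basis.algebra)
  then have in_G': "moebius_class (Mat2 p q1 s1 (- p)) \<in> G" using in_G by simp
  have p0: "p \<noteq> 0"
  proof
    assume "p = 0"
    then have "3 * (z ^ 2 + z ^ 3) - 1 = 0" unfolding p_def .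
    then have "(5::'k) = 0" using z by Groebner_Basis.algebra
    then show False by simp
  qed
  \<comment> \<open>The sum p^2 + q1 * s1 is minus the determinant of the word. Scaling the upper
    left entry p to 1 turns this identity into the required equation.\<close>
  have key: "z * (p ^ 2 + q1 * s1) = - ((z - 1) ^ 2 * p ^ 2)"
    unfolding p_def q1_def s1_def using qs z by Groebner_Basis.algebra
  have z1: "z - 1 \<noteq> 0"
  proof
    assume "z - 1 = 0"
    then have "(5::'k) = 0" using z by Groebner_Basis.algebra
    then show False by simp
  qed
  have dd: "p ^ 2 + q1 * s1 \<noteq> 0"
  proof
    assume "p ^ 2 + q1 * s1 = 0"
    then have "(z - 1) ^ 2 * p ^ 2 = 0" using key by simp
    then show False using z1 p0 by simp
  qed
  have "det2 (Mat2 p q1 s1 (- p)) \<noteq> 0" using dd by (simp add: det2_def power2_eq_square algebra_simps add_eq_0_iff)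
  from class_smult[OF _ this, of "inverse p"] p0
  have "moebius_class (Mat2 1 (q1 / p) (s1 / p) (-1)) \<in> G"
    using in_G' by (simp add: smult2_def divide_inverse mult.commute)
  moreover have k: "1 + q1 / p * (s1 / p) = (p ^ 2 + q1 * s1) / p ^ 2" using p0 by (simp add: field_simps power2_eq_square)
  moreover have "z * (1 + q1 / p * (s1 / p)) = - ((z - 1) ^ 2)" unfolding k using key p0 by (simp add: field_simps)
  moreover have "s1 / p \<noteq> 0"
  proof
    assume "s1 / p = 0"
    then have "s1 = 0" using p0 by simp
    then have "(z + (z - 1) ^ 2) * p ^ 2 = 0" using key by (simp add: algebra_simps)
    then have "z + (z - 1) ^ 2 = 0" using p0 by simp
    then have "(1::'k) = 0" using z by Groebner_Basis.algebra
    then show False by simp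
  qed
  moreover have "1 + q1 / p * (s1 / p) \<noteq> 0" unfolding k using dd p0 by simp
  ultimately show thesis using that by blast
qed

text \<open>The value of q * s for which rotation by z times the involution has squared trace equal
  to its determinant, the condition for order 3.\<close>

definition involution_parameter :: "'k::field \<Rightarrow> 'k" where
  "involution_parameter z = - ((z - 1) ^ 2) / z - 1"

text \<open>Generators of order r and 2 with product of order 3, as in the triangle groups (2, 3,
  r). The upper right entry 1 is a normalization by diagonal conjugation. Since the group is written
  in terms of z, both groups to be compared must use the same z.\<close>

definition polyhedral_group :: "'k::{alg_closed_field, field_char_0} \<Rightarrow> ('k proj_point, 'k proj_point) rational_map set" where
  "polyhedral_group z = generate CrL {moebius_class (diag2 z), moebius_class (Mat2 1 1 (involution_parameter z) (-1))}"

text \<open>The moving involution must satisfy the order 3 relation with the prescribed rotation.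
  For r = 3 there is no alternative; for r = 4 the half turn z^2 excludes the other solution; for r
  = 5 the rotation by z^2 leaves two parameters, and the wrong one is repaired by
  \<open>icosahedral_word\<close>.\<close>

lemma polyhedral_involution:
  fixes G :: "('k::{alg_closed_field, field_char_0} proj_point, 'k proj_point) rational_map set"
  assumes G: "subgroup G CrL" "finite G" and ev: "even (card G)" and inf: "stab G infinity = cyclic_group r"
    and r: "max_stab G r" "r = 3 \<or> r = 4 \<or> r = 5" and big: "card G > 2 * r" and z: "primitive_root_of_unity r z"
  obtains q s where "moebius_class (Mat2 1 q s (-1)) \<in> G" "s \<noteq> 0" "1 + q * s \<noteq> 0" "z * (1 + q * s) = - ((z - 1) ^ 2)"
proof -
  have r3: "r \<ge> 3" "r \<le> 5" using r(2) by auto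
  obtain t where t: "t \<in> G" "t \<otimes>\<^bsub>CrL\<^esub> t = \<one>\<^bsub>CrL\<^esub>" "act t infinity \<noteq> infinity" "act t infinity \<noteq> origin"
    using moving_involution_exists[OF G ev inf r(1) r3(1) big] by blast
  have "t \<in> carrier CrL" using t(1) subgroup.subset[OF G(1)] by blast
  from moving_involution_matrix[OF this t(2-4)]
  obtain q s where qs: "t = moebius_class (Mat2 1 q s (-1))" "s \<noteq> 0" "1 + q * s \<noteq> 0" by blast
  have tG: "moebius_class (Mat2 1 q s (-1)) \<in> G" using t(1) qs(1) by simp
  define e where "e = 1 + q * s"
  have e: "e \<noteq> 0" using qs(3) e_def by simp
  have zr: "z ^ r = 1" and zd: "z ^ d \<noteq> 1" if "0 < d" "d < r" for d
    using z that unfolding primitive_root_of_unity_def by auto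
  have zr: "z ^ r = 1" using z unfolding primitive_root_of_unity_def by blast
  note cond = rotation_times_involution[OF G r(1) r3(2) inf tG qs(2) e_def e]
  have z1: "z \<noteq> 1" using zd[of 1] r3(1) by auto
  from r(2) show thesis
  proof (elim disjE)
    assume "r = 3"
    then have "(z - 1) ^ 2 = - z * e" using cond[OF zr z1] by auto
    then show thesis using that[OF tG qs(2,3)] unfolding e_def by simp
  next
    assume r4: "r = 4"
    have "z ^ 4 = 1" using zr r4 by simp
    then have "(z ^ 2 - 1) * (z ^ 2 + 1) = 0" by Groebner_Basis.algebra
    then have z2: "z ^ 2 = - 1" using zd[of 2] r4 by (auto simp: add_eq_0_iff2)
    have "(z ^ 2) ^ 4 = 1" unfolding z2 by simp
    then have c2: "(z ^ 2) ^ r = 1" "z ^ 2 \<noteq> 1" using zd[of 2] r4 by auto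
    \<comment> \<open>For the half turn w = - 1 the equation reads 4 = e or 4 = 2 e; this
      contradicts e = 1, the order 4 alternative for z itself.\<close>
    have e4: "e = 4 \<or> e = 2" using cond[OF c2] r4 unfolding z2 by auto
    have sq: "(z - 1) ^ 2 = - 2 * z" using z2 by (simp add: power2_eq_square algebra_simps)
    have z0: "z \<noteq> 0" using z2 by auto
    have "(z - 1) ^ 2 = - z * e"
    proof (rule ccontr)
      assume "(z - 1) ^ 2 \<noteq> - z * e"
      then have "(z - 1) ^ 2 = - 2 * z * e" using cond[OF zr z1] r4 by auto
      then have "e = 1" using sq z0 by simp
      then show False using e4 by auto
    qed
    then show thesis using that[OF tG qs(2,3)] unfolding e_def by simp
  next
    assume r5: "r = 5"
    have z5: "z ^ 5 = 1" using zr r5 by simp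
    then have "(z - 1) * (z ^ 4 + z ^ 3 + z ^ 2 + z + 1) = 0" by Groebner_Basis.algebra
    then have phi: "z ^ 4 + z ^ 3 + z ^ 2 + z + 1 = 0" using z1 by simp
    have z0: "z \<noteq> 0" using z5 by auto
    \<comment> \<open>The quotients (w - 1)^2 / w for w = z and w = z^2, simplified with z^5 =
      1.\<close>
    define s1 s2 where "s1 = z + z ^ 4 - 2" and "s2 = z ^ 2 + z ^ 3 - 2"
    have sum: "s1 + s2 = - 5" unfolding s1_def s2_def using phi by Groebner_Basis.algebra
    have sq: "s1 ^ 2 + 5 * s1 + 5 = 0" unfolding s1_def using phi by Groebner_Basis.algebra
    have "(z ^ 2) ^ 5 = 1" using z5 by (metis power_mult mult.commute power_one)
    then have w2: "(z ^ 2) ^ r = 1" "z ^ 2 \<noteq> 1" using r5 zd[of 2] by auto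
    have a1: "(z - 1) ^ 2 = z * s1" unfolding s1_def using phi by Groebner_Basis.algebra
    have a2: "(z ^ 2 - 1) ^ 2 = z ^ 2 * s2" unfolding s2_def using phi by Groebner_Basis.algebra
    have gen: "s = - e \<or> s = - 2 * e \<or> s ^ 2 + 3 * s * e + e ^ 2 = 0"
      if c: "(w - 1) ^ 2 = - w * e \<or> (r \<ge> 4 \<and> (w - 1) ^ 2 = - 2 * w * e) \<or>
         (r \<ge> 5 \<and> (w - 1) ^ 4 + 3 * (w - 1) ^ 2 * (w * e) + (w * e) ^ 2 = 0)"
      and w: "(w - 1) ^ 2 = w * s" "w \<noteq> 0" for w s
    proof -
      have "(w - 1) ^ 4 = (w * s) ^ 2" using w(1) by (metis power_mult mult_2 numeral_Bit0)
      then have "w * s = - w * e \<or> w * s = - 2 * w * e \<or> (w * s) ^ 2 + 3 * (w * s) * (w * e) + (w * e) ^ 2 = 0"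
        using c unfolding w(1) by auto
      moreover have "(w * s) ^ 2 + 3 * (w * s) * (w * e) + (w * e) ^ 2 = w ^ 2 * (s ^ 2 + 3 * s * e + e ^ 2)"
        by (simp add: algebra_simps power2_eq_square)
      moreover have "- w * e = w * (- e)" "- 2 * w * e = w * (- 2 * e)" by simp_all
      then have "w * s = - w * e \<longleftrightarrow> s = - e" "w * s = - 2 * w * e \<longleftrightarrow> s = - 2 * e"
        using mult_left_cancel[OF w(2)] by metis+
      ultimately show ?thesis using w(2) by auto
    qed
    from five_fold_cases[OF sum sq gen[OF cond[OF zr z1] a1 z0] gen[OF cond[OF w2] a2]] z0
    have "s1 = - e \<or> s2 = - e" by simp
    then show thesis
    proof
      assume "s1 = - e"
      then have s1: "s1 = - (1 + q * s)" unfolding e_def .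
      have "z * (1 + q * s) = - ((z - 1) ^ 2)" unfolding a1 s1 by (simp add: algebra_simps)
      then show thesis by (rule that[OF tG qs(2,3)])
    next
      assume "s2 = - e"
      then have qs': "q * s = 1 - z ^ 2 - z ^ 3" unfolding s2_def e_def by (simp add: algebra_simps)
      have c: "moebius_class (diag2 w) \<in> G" if "w ^ 5 = 1" for w
        using inf that r5 unfolding stab_def cyclic_group_def by blast
      show thesis using icosahedral_word[OF G(1) phi c tG qs'] that by metis
    qed
  qed
qed

text \<open>A zero parameter would mean z^2 - z + 1 = 0 and hence z^3 = - 1, so z would be a sixth
  root of unity of the wrong order. Nonvanishing gives the orbit of infinity more than two
  points.\<close>

lemma involution_parameter_nonzero:
  fixes z :: "'k::field_char_0"
  assumes z: "primitive_root_of_unity r z" "r = 3 \<or> r = 4 \<or> r = 5"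
  shows "involution_parameter z \<noteq> 0"
proof
  have zr: "z ^ r = 1" using z(1) unfolding primitive_root_of_unity_def by blast
  have zd: "z ^ d \<noteq> 1" if "0 < d" "d < r" for d using z(1) that unfolding primitive_root_of_unity_def by auto
  have z0: "z \<noteq> 0" using zr z(2) by (auto simp: power_0_left)
  assume "involution_parameter z = 0"
  then have "- ((z - 1) ^ 2) = z" using z0 unfolding involution_parameter_def by (simp add: field_simps)
  moreover have "z ^ 2 - (z - 1) = z - (- ((z - 1) ^ 2))" by (simp add: power2_eq_square algebra_simps)
  ultimately have q: "z ^ 2 = z - 1" by simp
  have "z ^ 3 = z * z ^ 2" by (simp add: power2_eq_square power3_eq_cube)
  also have "\<dots> = z * (z - 1)" unfolding q ..
  also have "\<dots> = z ^ 2 - z" by (simp add: power2_eq_square algebra_simps)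
  also have "\<dots> = - 1" using q by simp
  finally have z3: "z ^ 3 = - 1" .
  from z(2) show False
  proof (elim disjE)
    assume "r = 3" then show False using zr z3 by simp
  next
    assume r: "r = 4"
    have "z ^ 4 = z ^ 3 * z" by Groebner_Basis.algebra
    then have "z = - 1" using zr r z3 by (simp add: minus_equation_iff)
    then show False using zd[of 2] r by simp
  next
    assume r: "r = 5"
    have "z ^ 5 = z ^ 3 * z ^ 2" by Groebner_Basis.algebra
    then have "z ^ 2 = - 1" using zr r z3 by (simp add: minus_equation_iff)
    then have "(z ^ 2) ^ 2 = 1" by simp
    then have "z ^ 4 = 1" by (simp add: power_mult[symmetric])
    then show False using zd[of 4] r by simp
  qed
qed

text \<open>The group generated by the two standard elements is never enumerated. It contains a
  rotation of order r and moves infinity to at least three points, so its order is at least 3 r; in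
  Klein's list this leaves only the order of the whole group.\<close>

lemma conj_to_polyhedral:
  fixes G :: "('k::{alg_closed_field, field_char_0} proj_point, 'k proj_point) rational_map set"
  assumes G: "subgroup G CrL" "finite G" and r: "max_stab G r"
    and N: "(r = 3 \<and> card G = 12) \<or> (r = 4 \<and> card G = 24) \<or> (r = 5 \<and> card G = 60)"
    and z: "primitive_root_of_unity r z"
  obtains h where "h \<in> carrier CrL" "conj_by CrL h G = polyhedral_group z"
proof -
  obtain h where h: "h \<in> carrier CrL" and inf: "stab (conj_by CrL h G) infinity = cyclic_group r"
    and G1: "subgroup (conj_by CrL h G) CrL" "finite (conj_by CrL h G)" and r1: "max_stab (conj_by CrL h G) r"
    and c1: "card (conj_by CrL h G) = card G"
    using max_stab_normal_form[OF G r] by metis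
  define G1 where "G1 = conj_by CrL h G"
  note inf = inf[folded G1_def] and G1 = G1[folded G1_def] and r1 = r1[folded G1_def] and c1 = c1[folded G1_def]
  have r345: "r = 3 \<or> r = 4 \<or> r = 5" and big: "card G1 > 2 * r" and ev: "even (card G1)" using N c1 by auto
  have r0: "r > 0" "r \<ge> 2" using r345 by auto
  have z0: "z ^ r = 1" "z \<noteq> 0" using z r0 unfolding primitive_root_of_unity_def by (auto simp: power_0_left)
  obtain q s where t: "moebius_class (Mat2 1 q s (-1)) \<in> G1" "s \<noteq> 0" "1 + q * s \<noteq> 0" and zq: "z * (1 + q * s) = - ((z - 1) ^ 2)"
    using polyhedral_involution[OF G1 ev inf r1 r345 big z] by metis
  have par: "q * s = involution_parameter z" unfolding involution_parameter_def using zq z0 by (simp add: field_simps)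
  have par0: "involution_parameter z \<noteq> 0" by (rule involution_parameter_nonzero[OF z r345])
  then have q0: "q \<noteq> 0" using par by auto
  let ?T = "Mat2 1 1 (involution_parameter z) (-1)"
  \<comment> \<open>Scaling by 1 / q makes the upper right entry 1 and keeps the product q *
    s.\<close>
  define k where "k = moebius_class (diag2 (1 / q))"
  have d: "det2 (diag2 (1 / q)) \<noteq> 0" "det2 (Mat2 1 q s (-1)) \<noteq> 0" "det2 ?T \<noteq> 0" "det2 (diag2 z) \<noteq> 0"
    using q0 t(3) z0 par by (auto simp: det2_def add_eq_0_iff)
  have k: "k \<in> carrier CrL" unfolding k_def using d by simp
  define G2 where "G2 = conj_by CrL k G1"
  have G2: "subgroup G2 CrL" "finite G2" unfolding G2_def using CrL.subgroup_conj_by[OF k G1(1)] G1(2) by (auto simp: conj_by_def)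
  have c2: "card G2 = card G" unfolding G2_def using CrL.card_conj_by[OF k subgroup.subset[OF G1(1)]] c1 by simp
  have r2: "max_stab G2 r" unfolding G2_def by (rule max_stab_conj[OF G1(1) k r1])
  have tG2: "moebius_class ?T \<in> G2"
  proof -
    have "k \<otimes>\<^bsub>CrL\<^esub> moebius_class (Mat2 1 q s (-1)) \<otimes>\<^bsub>CrL\<^esub> inv\<^bsub>CrL\<^esub> k =
        moebius_class (mult2 (mult2 (diag2 (1 / q)) (Mat2 1 q s (-1))) (adj2 (diag2 (1 / q))))"
      unfolding k_def using d by (simp add: class_mult class_inv det_mult2)
    also have "mult2 (mult2 (diag2 (1 / q)) (Mat2 1 q s (-1))) (adj2 (diag2 (1 / q))) = smult2 (1 / q) ?T"
      using q0 by (simp add: mult2_def adj2_def smult2_def par[symmetric])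
    also have "moebius_class \<dots> = moebius_class ?T" using q0 d by (intro class_smult) auto
    finally have "k \<otimes>\<^bsub>CrL\<^esub> moebius_class (Mat2 1 q s (-1)) \<otimes>\<^bsub>CrL\<^esub> inv\<^bsub>CrL\<^esub> k = moebius_class ?T" .
    moreover have "k \<otimes>\<^bsub>CrL\<^esub> moebius_class (Mat2 1 q s (-1)) \<otimes>\<^bsub>CrL\<^esub> inv\<^bsub>CrL\<^esub> k \<in> G2"
      unfolding G2_def conj_by_def using t(1) by blast
    ultimately show ?thesis by simp
  qed
  have CG2: "cyclic_group r \<subseteq> G2"
  proof -
    have "cyclic_group r \<subseteq> G1" using inf unfolding stab_def by blast
    then have "conj_by CrL k (cyclic_group r) \<subseteq> G2" unfolding G2_def conj_by_def by blast
    moreover have "conj_by CrL k (cyclic_group r) = cyclic_group r"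
      unfolding k_def using q0 r0 by (intro conj_diag_cyclic_group) auto
    ultimately show ?thesis by simp
  qed
  let ?c = "moebius_class (diag2 z)"
  have cG2: "?c \<in> G2" using CG2 z0 unfolding cyclic_group_def by blast
  define K where "K = polyhedral_group z"
  have gens: "{?c, moebius_class ?T} \<subseteq> G2" using cG2 tG2 by blast
  then have KG: "K \<subseteq> G2" unfolding K_def polyhedral_group_def by (rule CrL.generate_subgroup_incl[OF _ G2(1)])
  have K: "subgroup K CrL" unfolding K_def polyhedral_group_def
    by (rule CrL.generate_is_subgroup) (use gens subgroup.subset[OF G2(1)] in blast)
  have fK: "finite K" using KG G2(2) by (rule finite_subset)
  have inK: "?c \<in> K" "moebius_class ?T \<in> K" unfolding K_def polyhedral_group_def by (auto intro: generate.incl)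
  have sub: "g \<in> carrier CrL" if "g \<in> K" for g using subgroup.subset[OF K] that by blast
  have stabK: "card (stab K p) \<le> r" if "p \<in> points PL" for p
  proof -
    have "card (stab K p) \<le> card (stab G2 p)" using KG G2(2) unfolding stab_def by (intro card_mono) auto
    then show ?thesis using r2 that unfolding max_stab_def by (meson le_trans)
  qed
  have ge: "r \<le> card (stab K infinity)"
  proof -
    have cs: "?c \<in> stab K infinity" unfolding stab_def using inK act_diag[OF z0(2), of 1 0] z0(2) by (simp add: pt_eq_iff)
    have fs: "finite (stab K infinity)" unfolding stab_def using fK by simp
    have "?c [^]\<^bsub>CrL\<^esub> card (stab K infinity) = \<one>\<^bsub>CrL\<^esub>"
      by (rule CrL.subgroup_pow_card[OF subgroup_stab[OF K infinity_mem] fs cs])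
    then have "z ^ card (stab K infinity) = 1" unfolding class_pow[OF d(4)] pow2_diag using z0
      by (subst (asm) class_eq_one_iff) (auto simp: det2_def)
    then have "r dvd card (stab K infinity)" by (rule primitive_root_dvd[OF z])
    moreover have "card (stab K infinity) > 0" using cs fs by (auto simp: card_gt_0_iff)
    ultimately show ?thesis by (rule dvd_imp_le)
  qed
  have eqr: "card (stab K infinity) = r" using ge stabK[OF infinity_mem] by simp
  have rK: "max_stab K r" unfolding max_stab_def using eqr stabK r0 infinity_mem by blast
  have z1: "z \<noteq> 1"
  proof -
    have "z ^ 1 \<noteq> 1" using z r0(2) unfolding primitive_root_of_unity_def by (metis One_nat_def Suc_le_lessD Suc_1 zero_less_one)
    then show ?thesis by simp
  qed
  \<comment> \<open>Infinity, its image under the involution, and the rotated image; they differ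
    because the parameter is nonzero and z is not 1.\<close>
  have three: "3 \<le> card ((\<lambda>g. act g infinity) ` K)"
  proof -
    let ?p = "involution_parameter z"
    have a: "act (moebius_class ?T) infinity = pt 1 ?p" using act_pt[OF d(3), of 1 0] by simp
    have b: "act (?c \<otimes>\<^bsub>CrL\<^esub> moebius_class ?T) infinity = pt z ?p"
      using act_mult[OF sub[OF inK(1)] sub[OF inK(2)] infinity_mem] a act_diag[OF z0(2), of 1 ?p] by simp
    have "infinity \<in> (\<lambda>g. act g infinity) ` K" using act_one[OF infinity_mem] subgroup.one_closed[OF K] by force
    moreover have "pt 1 ?p \<in> (\<lambda>g. act g infinity) ` K" using a inK(2) by force
    moreover have "pt z ?p \<in> (\<lambda>g. act g infinity) ` K" using b subgroup.m_closed[OF K inK] by force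
    ultimately have "{infinity, pt 1 ?p, pt z ?p} \<subseteq> (\<lambda>g. act g infinity) ` K" by blast
    moreover have "card {infinity, pt 1 ?p, pt z ?p} = 3"
      using par0 z1 z0 by (simp add: pt_eq_iff card_insert_if)
    ultimately show ?thesis using card_mono[of "(\<lambda>g. act g infinity) ` K"] fK by (metis finite_imageI)
  qed
  have "3 * r \<le> card K"
    using mult_le_mono1[OF three, of r] orbit_stab[OF K fK infinity_mem] unfolding eqr by simp
  moreover have "card K \<ge> 2" using calculation r0 by linarith
  then obtain r' where r': "max_stab K r'" "card K = r' \<or> card K = 2 * r' \<or> (r' = 3 \<and> card K = 12) \<or>
     (r' = 4 \<and> card K = 24) \<or> (r' = 5 \<and> card K = 60)"
    using finite_subgroup_orders[OF K fK] by blast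
  moreover have "r' = r" using max_stab_unique[OF r'(1) rK] .
  \<comment> \<open>The orders r and 2 r are too small, and r selects one of the three exceptional
    orders.\<close>
  ultimately have "card K = card G2" using N r0 unfolding c2 by auto
  then have "K = G2" using KG G2(2) by (intro card_subset_eq) auto
  moreover have "G2 = conj_by CrL (k \<otimes>\<^bsub>CrL\<^esub> h) G" unfolding G2_def G1_def
    using CrL.conj_by_mult[OF k h] subgroup.subset[OF G(1)] by blast
  ultimately show thesis using that[of "k \<otimes>\<^bsub>CrL\<^esub> h"] h k unfolding K_def by simp
qed

lemma conjugate_of_same_order:
  fixes A B :: "('k::{alg_closed_field, field_char_0} proj_point, 'k proj_point) rational_map set"
  assumes A: "subgroup A CrL" "finite A" and B: "subgroup B CrL" "finite B" and card: "card A = card B"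
    and r: "max_stab A r" "max_stab B r"
  shows "conjugate_subgroups CrL A B"
proof -
  have r2: "r \<ge> 2" using r unfolding max_stab_def by blast
  have "card A \<ge> 2"
  proof -
    obtain p where "card (stab A p) = r" using r(1) unfolding max_stab_def by blast
    moreover have "card (stab A p) \<le> card A" using A(2) unfolding stab_def by (intro card_mono) auto
    ultimately show ?thesis using r2 by simp
  qed
  then obtain r' where r': "max_stab A r'" "card A = r' \<or> card A = 2 * r' \<or> (r' = 3 \<and> card A = 12) \<or>
     (r' = 4 \<and> card A = 24) \<or> (r' = 5 \<and> card A = 60)"
    using finite_subgroup_orders[OF A] by blast
  have "r' = r" using max_stab_unique[OF r'(1) r(1)] .
  then consider "card A = r" | "card A = 2 * r" | "(r = 3 \<and> card A = 12) \<or> (r = 4 \<and> card A = 24) \<or> (r = 5 \<and> card A = 60)"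
    using r'(2) by blast
  then have "\<exists>g h. g \<in> carrier CrL \<and> h \<in> carrier CrL \<and> conj_by CrL g A = conj_by CrL h B"
  proof cases
    case 1
    obtain g where "g \<in> carrier CrL" "conj_by CrL g A = cyclic_group r" using conj_to_cyclic[OF A r(1) 1] by blast
    moreover obtain h where "h \<in> carrier CrL" "conj_by CrL h B = cyclic_group r" using conj_to_cyclic[OF B r(2)] 1 card by metis
    ultimately show ?thesis by metis
  next
    case 2
    obtain g where "g \<in> carrier CrL" "conj_by CrL g A = dihedral_group r" using conj_to_dihedral[OF A r(1) 2] by blast
    moreover obtain h where "h \<in> carrier CrL" "conj_by CrL h B = dihedral_group r" using conj_to_dihedral[OF B r(2)] 2 card by metis
    ultimately show ?thesis by metis
  next
    case 3
    have r0: "r > 0" using r2 by simp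
    obtain z :: 'k where z: "primitive_root_of_unity r z" using primitive_root_exists[OF r0] by blast
    obtain g where "g \<in> carrier CrL" "conj_by CrL g A = polyhedral_group z" using conj_to_polyhedral[OF A r(1) 3 z] by blast
    moreover obtain h where "h \<in> carrier CrL" "conj_by CrL h B = polyhedral_group z"
      using conj_to_polyhedral[OF B r(2) 3[unfolded card] z] by blast
    ultimately show ?thesis by metis
  qed
  then show ?thesis using CrL.conjugate_subgroups_of_common[OF subgroup.subset[OF A(1)] subgroup.subset[OF B(1)]] by blast
qed

text \<open>Both images have the order of H and, by injectivity, the same element orders, hence the
  same maximal stabilizer order. The trivial group is treated apart since it has no
  \<open>max_stab\<close>.\<close>

lemma isomorphic_finite_subgroups_conjugate:
  fixes H :: "('h, 'm) monoid_scheme" and \<rho>\<^sub>1 \<rho>\<^sub>2 :: "'h \<Rightarrow> ('k::{alg_closed_field, field_char_0} proj_point, 'k proj_point) rational_map"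
  assumes H: "group H" "finite (carrier H)" and \<rho>: "\<rho>\<^sub>1 \<in> mon H CrL" "\<rho>\<^sub>2 \<in> mon H CrL"
  shows "conjugate_subgroups CrL (\<rho>\<^sub>1 ` carrier H) (\<rho>\<^sub>2 ` carrier H)"
proof -
  have hom: "\<rho> \<in> hom H CrL" and inj: "inj_on \<rho> (carrier H)" if "\<rho> \<in> mon H CrL" for \<rho> :: "'h \<Rightarrow> ('k proj_point, 'k proj_point) rational_map"
    using that by (auto simp: mon_def)
  have sub: "subgroup (\<rho> ` carrier H) CrL" if "\<rho> \<in> mon H CrL" for \<rho> :: "'h \<Rightarrow> ('k proj_point, 'k proj_point) rational_map"
    using group_hom.img_is_subgroup[of H CrL \<rho>] H(1) group_Cr1 hom[OF that] by (simp add: group_hom_def group_hom_axioms_def)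
  have fin: "finite (\<rho> ` carrier H)" for \<rho> :: "'h \<Rightarrow> ('k proj_point, 'k proj_point) rational_map" using H(2) by simp
  have card: "card (\<rho> ` carrier H) = card (carrier H)" if "\<rho> \<in> mon H CrL" for \<rho> :: "'h \<Rightarrow> ('k proj_point, 'k proj_point) rational_map"
    by (rule card_image[OF inj[OF that]])
  show ?thesis
  proof (cases "card (carrier H) \<ge> 2")
    case False
    have "card (carrier H) > 0" using H group.subgroup_self subgroup.one_closed by (metis card_gt_0_iff empty_iff)
    then have "card (carrier H) = 1" using False by linarith
    then have one: "\<rho> ` carrier H = {\<one>\<^bsub>CrL\<^esub>}" if "\<rho> \<in> mon H CrL" for \<rho> :: "'h \<Rightarrow> ('k proj_point, 'k proj_point) rational_map"
      using card[OF that] subgroup.one_closed[OF sub[OF that]] by (metis card_1_singletonE singletonD)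
    show ?thesis unfolding one[OF \<rho>(1)] one[OF \<rho>(2)]
      by (rule CrL.conjugate_subgroups_of_common[of _ _ "\<one>\<^bsub>CrL\<^esub>" "\<one>\<^bsub>CrL\<^esub>"]) auto
  next
    case True
    obtain r where r: "max_stab (\<rho>\<^sub>1 ` carrier H) r" using finite_subgroup_orders[OF sub[OF \<rho>(1)] fin] card[OF \<rho>(1)] True by auto
    obtain s where s: "max_stab (\<rho>\<^sub>2 ` carrier H) s" using finite_subgroup_orders[OF sub[OF \<rho>(2)] fin] card[OF \<rho>(2)] True by auto
    have ord: "CrL.ord (\<rho> h) = group.ord H h" if \<rho>: "\<rho> \<in> mon H CrL" and h: "h \<in> carrier H" for \<rho> :: "'h \<Rightarrow> ('k proj_point, 'k proj_point) rational_map" and h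
    proof -
      interpret H: group H by (rule H(1))
      interpret gh: group_hom H CrL \<rho> using H(1) group_Cr1 hom[OF \<rho>] by (simp add: group_hom_def group_hom_axioms_def)
      have "\<rho> h [^]\<^bsub>CrL\<^esub> n = \<one>\<^bsub>CrL\<^esub> \<longleftrightarrow> h [^]\<^bsub>H\<^esub> n = \<one>\<^bsub>H\<^esub>" for n :: nat
      proof -
        have "\<rho> h [^]\<^bsub>CrL\<^esub> n = \<rho> (h [^]\<^bsub>H\<^esub> n)" using gh.hom_nat_pow[OF h] by simp
        moreover have "\<one>\<^bsub>CrL\<^esub> = \<rho> \<one>\<^bsub>H\<^esub>" by simp
        moreover have "\<rho> (h [^]\<^bsub>H\<^esub> n) = \<rho> \<one>\<^bsub>H\<^esub> \<longleftrightarrow> h [^]\<^bsub>H\<^esub> n = \<one>\<^bsub>H\<^esub>"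
          by (rule inj_on_eq_iff[OF inj[OF \<rho>] H.nat_pow_closed[OF h] H.one_closed])
        ultimately show ?thesis by metis
      qed
      moreover have "\<rho> h \<in> carrier CrL" using gh.hom_closed[OF h] .
      ultimately show ?thesis using CrL.ord_unique H.pow_eq_id[OF h] by metis
    qed
    have le: "a \<le> b" if a: "max_stab (\<rho> ` carrier H) a" and b: "max_stab (\<sigma> ` carrier H) b" and m: "\<rho> \<in> mon H CrL" "\<sigma> \<in> mon H CrL"
      for a b and \<rho> \<sigma> :: "'h \<Rightarrow> ('k proj_point, 'k proj_point) rational_map"
    proof -
      obtain h where h: "h \<in> carrier H" "CrL.ord (\<rho> h) = a" using max_stab_ord(1)[OF sub[OF m(1)] fin a] by blast
      then have "CrL.ord (\<sigma> h) = a" using ord[OF m(1) h(1)] ord[OF m(2) h(1)] by simp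
      then show ?thesis using max_stab_ord(2)[OF sub[OF m(2)] fin b] h(1) by blast
    qed
    have "r = s" using le[OF r s \<rho>] le[OF s r \<rho>(2,1)] by simp
    then show ?thesis
      using conjugate_of_same_order[OF sub[OF \<rho>(1)] fin sub[OF \<rho>(2)] fin _ r] s card[OF \<rho>(1)] card[OF \<rho>(2)] by simp
  qed
qed

section \<open>Lueroth's theorem\<close>

definition is_ring_hom :: "('a::comm_ring_1 \<Rightarrow> 'b::comm_ring_1) \<Rightarrow> bool" where
  "is_ring_hom h \<longleftrightarrow> h 0 = 0 \<and> h 1 = 1 \<and> (\<forall>a b. h (a + b) = h a + h b) \<and> (\<forall>a b. h (a * b) = h a * h b)"

lemma is_ring_homD:
  assumes "is_ring_hom h"
  shows "h 0 = 0" "h 1 = 1" "h (a + b) = h a + h b" "h (a * b) = h a * h b" "h (- a) = - h a" "h (a - b) = h a - h b"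
proof -
  show h: "h 0 = 0" "h 1 = 1" "h (a + b) = h a + h b" "h (a * b) = h a * h b" for a b using assms unfolding is_ring_hom_def by auto
  show m: "h (- a) = - h a" for a using h(3)[of a "- a"] h(1) by (simp add: eq_neg_iff_add_eq_0 add.commute)
  show "h (a - b) = h a - h b" using h(3)[of a "- b"] m[of b] by simp
qed

lemma is_ring_hom_sum: "is_ring_hom h \<Longrightarrow> h (sum f A) = (\<Sum>x\<in>A. h (f x))"
  by (induction A rule: infinite_finite_induct) (simp_all add: is_ring_homD)

lemma map_poly_hom:
  assumes h: "is_ring_hom h"
  shows "map_poly h (p + q) = map_poly h p + map_poly h q"
    "map_poly h (p - q) = map_poly h p - map_poly h q"
    "map_poly h (p * q) = map_poly h p * map_poly h q"
    "map_poly h (smult c p) = smult (h c) (map_poly h p)"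
    "poly (map_poly h p) (h x) = h (poly p x)"
proof -
  note h' = is_ring_homD[OF h]
  show "map_poly h (p + q) = map_poly h p + map_poly h q" "map_poly h (p - q) = map_poly h p - map_poly h q"
    "map_poly h (smult c p) = smult (h c) (map_poly h p)"
    by (auto intro!: poly_eqI simp: coeff_map_poly h')
  show "map_poly h (p * q) = map_poly h p * map_poly h q"
    by (auto intro!: poly_eqI simp: coeff_map_poly h' coeff_mult is_ring_hom_sum[OF h])
  show "poly (map_poly h p) (h x) = h (poly p x)"
    by (induction p) (simp_all add: map_poly_pCons h')
qed

abbreviation emb :: "'k::field poly \<Rightarrow> 'k poly fract" where "emb p \<equiv> Fract p 1"

abbreviation con :: "'k::field \<Rightarrow> 'k poly fract" where "con c \<equiv> emb [:c:]"

abbreviation var :: "'k::field poly fract" where "var \<equiv> emb [:0, 1:]"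

abbreviation lift_poly :: "'k::field poly \<Rightarrow> 'k poly poly" where "lift_poly p \<equiv> map_poly (\<lambda>c. [:c:]) p"

abbreviation eval_fract :: "'k::field poly \<Rightarrow> 'k poly fract \<Rightarrow> 'k poly fract" where
  "eval_fract p t \<equiv> poly (map_poly con p) t"

lemma emb_hom: "is_ring_hom (emb :: 'k::field poly \<Rightarrow> _)"
  unfolding is_ring_hom_def by (simp add: Zero_fract_def One_fract_def)

lemma pCons_hom: "is_ring_hom (\<lambda>c::'k::field. [:c:])"
  unfolding is_ring_hom_def by (simp add: one_pCons)

lemma con_hom: "is_ring_hom (con :: 'k::field \<Rightarrow> _)"
  unfolding is_ring_hom_def by (simp add: Zero_fract_def One_fract_def pCons_one mult.commute)

lemma emb_eq_iff [simp]: "emb p = emb q \<longleftrightarrow> p = q"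
  by (simp add: eq_fract)

lemma emb_0 [simp]: "emb p = 0 \<longleftrightarrow> p = 0"
  by (simp add: Zero_fract_def eq_fract)

lemma emb_zero [simp]: "emb 0 = 0" and con_zero [simp]: "con 0 = 0"
  by simp_all

lemma Fract_emb: "q \<noteq> 0 \<Longrightarrow> Fract p q = emb p / emb q"
  by (simp add: divide_fract)

declare add_fract [simp del] minus_fract [simp del] mult_fract [simp del] diff_fract [simp del]
  divide_fract [simp del] inverse_fract [simp del]

lemma fract_cases_emb:
  obtains p q where "q \<noteq> 0" "u = emb p / emb q"
  by (cases u) (metis Fract_emb)

lemma eval_fract_var: "eval_fract p var = emb p"
proof (induction p)
  case (pCons a p)
  have "emb (pCons a p) = emb ([:a:] + [:0, 1:] * p)" by simp
  also have "\<dots> = con a + var * emb p" by (simp only: is_ring_homD[OF emb_hom])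
  finally show ?case using pCons by (simp add: map_poly_pCons)
qed simp

section \<open>Subfields of the rational function field and division with remainder\<close>

definition subfield_over :: "'k::field poly fract set \<Rightarrow> bool" where
  "subfield_over S \<longleftrightarrow> range con \<subseteq> S \<and> (\<forall>a\<in>S. \<forall>b\<in>S. a - b \<in> S \<and> a * b \<in> S) \<and> (\<forall>a\<in>S. inverse a \<in> S)"

lemma subfield_overD:
  assumes "subfield_over S"
  shows "con c \<in> S" "0 \<in> S" "1 \<in> S" "a \<in> S \<Longrightarrow> b \<in> S \<Longrightarrow> a - b \<in> S" "a \<in> S \<Longrightarrow> b \<in> S \<Longrightarrow> a * b \<in> S"
    "a \<in> S \<Longrightarrow> b \<in> S \<Longrightarrow> a + b \<in> S" "a \<in> S \<Longrightarrow> b \<in> S \<Longrightarrow> a / b \<in> S"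
proof -
  show c: "con c \<in> S" for c using assms unfolding subfield_over_def by blast
  show z: "0 \<in> S" using c[of 0] by simp
  have "con 1 = 1" using is_ring_homD(2)[OF con_hom] .
  then show "1 \<in> S" using c[of 1] by metis
  show d: "a - b \<in> S" if "a \<in> S" "b \<in> S" for a b using that assms unfolding subfield_over_def by blast
  show m: "a * b \<in> S" if "a \<in> S" "b \<in> S" for a b using that assms unfolding subfield_over_def by blast
  show "a + b \<in> S" if "a \<in> S" "b \<in> S" using d[OF that(1) d[OF z that(2)]] by simp
  show "a / b \<in> S" if "a \<in> S" "b \<in> S" using m[OF that(1), of "inverse b"] that(2) assms unfolding subfield_over_def by (simp add: divide_inverse)
qed

lemma subfield_over_sum: "subfield_over S \<Longrightarrow> (\<And>i. i \<in> A \<Longrightarrow> f i \<in> S) \<Longrightarrow> sum f A \<in> S"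
  by (induction A rule: infinite_finite_induct) (simp_all add: subfield_overD)

lemma subfield_over_poly:
  assumes S: "subfield_over S" and "\<And>i. coeff P i \<in> S" "x \<in> S"
  shows "poly P x \<in> S"
proof -
  have "x ^ n \<in> S" for n by (induction n) (simp_all add: subfield_overD[OF S] assms)
  then show ?thesis unfolding poly_altdef by (intro subfield_over_sum[OF S] subfield_overD(5)[OF S] assms)
qed

text \<open>The intermediate field is a set and not a type, so long division is carried out again in
  order to see that only the leading coefficient of Q is inverted and the remainder stays over
  S.\<close>

lemma subfield_over_division:
  assumes S: "subfield_over S" and Q: "\<And>i. coeff Q i \<in> S" "Q \<noteq> 0" and P: "\<And>i. coeff P i \<in> S"
  shows "\<exists>s r. (\<forall>i. coeff r i \<in> S) \<and> P = s * Q + r \<and> (r = 0 \<or> degree r < degree Q)"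
proof -
  have "\<exists>s r. (\<forall>i. coeff r i \<in> S) \<and> P = s * Q + r \<and> (r = 0 \<or> degree r < degree Q)"
    if "\<And>i. coeff P i \<in> S" "P = 0 \<or> degree P < n" for n P
    using that
  proof (induction n arbitrary: P)
    case 0
    then show ?case by (intro exI[of _ 0]) simp
  next
    case (Suc n)
    show ?case
    proof (cases "P = 0 \<or> degree P < degree Q")
      case True
      then show ?thesis using Suc.prems(1) by (intro exI[of _ 0] exI[of _ P]) auto
    next
      case False
      then have PQ: "P \<noteq> 0" "degree Q \<le> degree P" by auto
      define m where "m = monom (lead_coeff P / lead_coeff Q) (degree P - degree Q)"
      define P' where "P' = P - m * Q"
      have m0: "m \<noteq> 0" unfolding m_def using PQ Q(2) by simp
      have dm: "degree (m * Q) = degree P"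
        unfolding degree_mult_eq[OF m0 Q(2)] using PQ Q(2) by (simp add: m_def degree_monom_eq)
      have "coeff (m * Q) (degree P) = lead_coeff P"
        using lead_coeff_mult[of m Q] Q(2) PQ unfolding dm by (simp add: m_def degree_monom_eq)
      then have c0: "coeff P' (degree P) = 0" unfolding P'_def by simp
      have "degree P' \<le> degree P" unfolding P'_def using degree_diff_le[of P "degree P" "m * Q"] dm by simp
      then have "P' = 0 \<or> degree P' < degree P" using c0 by (metis le_neq_implies_less leading_coeff_0_iff)
      then have lt: "P' = 0 \<or> degree P' < n" using Suc.prems(2) PQ by auto
      have coeff: "coeff P' i \<in> S" for i
        unfolding P'_def m_def using Suc.prems(1) Q(1) S
        by (auto simp: coeff_monom_mult intro!: subfield_overD[OF S])
      obtain s r where "\<forall>i. coeff r i \<in> S" "P' = s * Q + r" "r = 0 \<or> degree r < degree Q"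
        using Suc.IH[OF coeff lt] by blast
      then show ?thesis unfolding P'_def by (intro exI[of _ "s + m"] exI[of _ r]) (auto simp: algebra_simps)
    qed
  qed
  from this[OF P, of "Suc (degree P)"] show ?thesis by simp
qed

lemma clear_denominators:
  obtains D g where "D \<noteq> 0" "map_poly emb g = smult (emb D) (P :: 'k::field poly fract poly)"
proof -
  have "\<exists>D g. D \<noteq> 0 \<and> map_poly emb g = smult (emb D) P"
  proof (induction P)
    case 0
    show ?case by (intro exI[of _ 1] exI[of _ 0]) simp
  next
    case (pCons a P)
    then obtain D g where D: "D \<noteq> 0" "map_poly emb g = smult (emb D) P" by blast
    obtain p q where q: "q \<noteq> 0" "a = emb p / emb q" by (rule fract_cases_emb)
    have "map_poly emb (pCons (D * p) (smult q g)) = smult (emb (D * q)) (pCons a P)"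
      using D q by (simp add: map_poly_pCons map_poly_hom[OF emb_hom] is_ring_homD(4)[OF emb_hom] mult.commute)
    then show ?case using D(1) q(1) by (intro exI[of _ "D * q"]) auto
  qed
  then show thesis using that by blast
qed

section \<open>Primitive polynomials and Gauss's lemma\<close>

lemma map_poly_emb_inj: "inj (map_poly (emb :: 'k::field poly \<Rightarrow> _))"
proof (rule injI, rule poly_eqI)
  fix P Q :: "'k poly poly" and i assume "map_poly emb P = map_poly emb Q"
  from arg_cong[OF this, of "\<lambda>R. coeff R i"] show "coeff P i = coeff Q i" by (simp add: coeff_map_poly)
qed

text \<open>No linear factor divides all coefficients; over an algebraically closed field this says
  that the content is constant.\<close>

definition primitive_poly :: "'k::field poly poly \<Rightarrow> bool" where
  "primitive_poly g \<longleftrightarrow> (\<forall>y. map_poly (\<lambda>c. poly c y) g \<noteq> 0)"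

lemma poly_eval_hom: "is_ring_hom (\<lambda>c. poly c (y :: 'k::field))"
  unfolding is_ring_hom_def by simp

lemma smult_linear_of_specialization_zero:
  assumes "map_poly (\<lambda>c. poly c y) (g :: 'k::field poly poly) = 0"
  obtains g' where "g = smult [:- y, 1:] g'"
proof -
  have "poly (coeff g i) y = 0" for i using assms by (metis coeff_0 coeff_map_poly poly_0)
  then have dvd: "[:- y, 1:] dvd coeff g i" for i by (simp add: poly_eq_0_iff_dvd)
  have "g = smult [:- y, 1:] (map_poly (\<lambda>c. c div [:- y, 1:]) g)"
    by (rule poly_eqI) (simp add: coeff_map_poly dvd_mult_div_cancel[OF dvd] del: mult_pCons_left)
  then show thesis using that by blast
qed

text \<open>Common linear factors are divided out one at a time; each lowers the degree of the
  leading coefficient.\<close>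

lemma primitive_part:
  fixes g :: "'k::field poly poly"
  assumes "g \<noteq> 0"
  shows "\<exists>c g'. c \<noteq> 0 \<and> g = smult c g' \<and> primitive_poly g'"
  using assms
proof (induction "degree (lead_coeff g)" arbitrary: g rule: less_induct)
  case less
  show ?case
  proof (cases "primitive_poly g")
    case True
    then show ?thesis by (intro exI[of _ 1] exI[of _ g]) simp
  next
    case False
    then obtain y where "map_poly (\<lambda>c. poly c y) g = 0" unfolding primitive_poly_def by blast
    then obtain g1 where g1: "g = smult [:- y, 1:] g1" by (rule smult_linear_of_specialization_zero)
    have L: "[:- y, 1:] \<noteq> 0" by simp
    have g10: "g1 \<noteq> 0" using less.prems g1 by auto
    have "lead_coeff g = [:- y, 1:] * lead_coeff g1" unfolding g1 by (rule lead_coeff_smult)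
    then have "degree (lead_coeff g) = degree [:- y, 1:] + degree (lead_coeff g1)"
      using degree_mult_eq[OF L, of "lead_coeff g1"] g10 by simp
    then have "degree (lead_coeff g1) < degree (lead_coeff g)" by simp
    then obtain c g' where "c \<noteq> 0" "g1 = smult c g'" "primitive_poly g'" using less.hyps g10 by blast
    then show ?thesis using g1 L by (intro exI[of _ "[:- y, 1:] * c"] exI[of _ g']) (auto simp del: mult_pCons_left)
  qed
qed

text \<open>Gauss's lemma: over an algebraically closed field, primitivity can be tested by specialization.\<close>

lemma primitive_poly_dvd:
  fixes g H l :: "'k::alg_closed_field poly poly"
  assumes g: "primitive_poly g" and "c \<noteq> 0" "smult c H = g * l"
  shows "g dvd H"
  using assms(2,3)
proof (induction "degree c" arbitrary: c l rule: less_induct)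
  case less
  show ?case
  proof (cases "degree c = 0")
    case True
    then obtain a where a: "c = [:a:]" by (rule degree_eq_zeroE)
    then have a0: "a \<noteq> 0" using less.prems by auto
    have "H = smult [:inverse a:] (smult c H)" using a a0 by (simp add: one_pCons[symmetric])
    also have "\<dots> = g * smult [:inverse a:] l" unfolding less.prems(2) by simp
    finally show ?thesis by (rule dvdI)
  next
    case False
    then obtain y where "poly c y = 0" using alg_closed_imp_poly_has_root[of c] by blast
    then obtain c' where c': "c = [:- y, 1:] * c'" by (metis dvdE poly_eq_0_iff_dvd)
    have c'0: "c' \<noteq> 0" using less.prems(1) c' by auto
    note hom = map_poly_hom[OF poly_eval_hom[of y]]
    \<comment> \<open>At a root y of c the left-hand side of the equation vanishes while g survives,
      so l is divisible by the linear factor, which cancels.\<close>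
    have "map_poly (\<lambda>c. poly c y) g * map_poly (\<lambda>c. poly c y) l = smult (poly c y) (map_poly (\<lambda>c. poly c y) H)"
      unfolding hom(3)[symmetric] hom(4)[symmetric] less.prems(2) ..
    then have "map_poly (\<lambda>c. poly c y) l = 0" using g \<open>poly c y = 0\<close> unfolding primitive_poly_def by simp
    then obtain l' where l': "l = smult [:- y, 1:] l'" by (rule smult_linear_of_specialization_zero)
    have "smult [:- y, 1:] (smult c' H) = smult [:- y, 1:] (g * l')"
      using less.prems(2) unfolding c' l' by (simp only: smult_smult mult_smult_right)
    then have "smult c' H = g * l'" by (metis smult_cancel pCons_eq_0_iff zero_neq_one)
    moreover have "degree c' < degree c"
      unfolding c' using degree_mult_eq[of "[:- y, 1:]" c'] c'0 by simp
    ultimately show ?thesis using less.hyps c'0 by blast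
  qed
qed

lemma poly_at_constant_coeff:
  "coeff (poly g [:x:]) e = poly (map_poly (\<lambda>c. coeff c e) g) (x :: 'k::field)"
  by (induction g) (simp_all add: map_poly_pCons)

lemma poly_lift_at_constant: "poly (lift_poly p) [:x:] = [:poly p (x :: 'k::field):]"
  using map_poly_hom(5)[OF pCons_hom, of p x] .

lemma map_emb_lift: "map_poly emb (lift_poly p) = map_poly con p"
  by (rule poly_eqI) (simp add: coeff_map_poly)

text \<open>The generator t = p / q is a nonconstant element of S of least degree d. The polynomial
  p(Y) - t q(Y) over S vanishes at x; the point is that it is a minimal polynomial of x over S. To
  see this, clear denominators in the minimal polynomial M: the result g has degree at least d in x,
  while H = q(x) p(Y) - p(x) q(Y), a multiple of g, has degree at most d in x. The cofactor is
  therefore free of x, and then constant. Equal degrees over S and over k(t) give S = k(t).\<close>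

theorem lueroth:
  fixes S :: "'k::{alg_closed_field, field_char_0} poly fract set"
  assumes S: "subfield_over S" and nc: "\<not> S \<subseteq> range con"
  shows "\<exists>t\<in>S. t \<notin> range con \<and> (\<forall>u\<in>S. \<exists>a b. eval_fract b t \<noteq> 0 \<and> u = eval_fract a t / eval_fract b t)"
proof -
  note S' = subfield_overD[OF S]
  \<comment> \<open>Pairs rather than field elements, so that the degree of a representation can be
    minimized; minimality also makes the chosen p and q coprime.\<close>
  define good where "good p q \<longleftrightarrow> q \<noteq> 0 \<and> emb p / emb q \<in> S \<and> emb p / emb q \<notin> range con" for p q :: "'k poly"
  obtain u where "u \<in> S" "u \<notin> range con" using nc by blast
  then obtain p1 q1 where "good p1 q1" unfolding good_def using fract_cases_emb[of u] by metis
  then have ex: "\<exists>d p q. good p q \<and> max (degree p) (degree q) = d" by blast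
  then obtain d where "\<exists>p q. good p q \<and> max (degree p) (degree q) = d" and
    min0: "\<And>d'. d' < d \<Longrightarrow> \<not> (\<exists>p q. good p q \<and> max (degree p) (degree q) = d')"
    using exists_least_iff[of "\<lambda>d. \<exists>p q. good p q \<and> max (degree p) (degree q) = d"] by auto
  then obtain p q where pq: "good p q" and d: "max (degree p) (degree q) = d" by blast
  have min: "d \<le> max (degree p') (degree q')" if "good p' q'" for p' q'
    using min0[of "max (degree p') (degree q')"] that by (metis not_le)
  define t where "t = emb p / emb q"
  have q0: "q \<noteq> 0" and tS: "t \<in> S" and tc: "t \<notin> range con" using pq unfolding good_def t_def by auto
  have p0: "p \<noteq> 0"
  proof
    assume "p = 0"
    then have "t = con 0" unfolding t_def by simp
    then show False using tc by blast
  qed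
  have tq: "t * emb q = emb p" unfolding t_def using q0 by simp
  have no_root: "poly p x \<noteq> 0 \<or> poly q x \<noteq> 0" for x
  proof (rule ccontr)
    assume "\<not> (poly p x \<noteq> 0 \<or> poly q x \<noteq> 0)"
    then obtain p' q' where pq': "p = [:- x, 1:] * p'" "q = [:- x, 1:] * q'" by (metis dvdE poly_eq_0_iff_dvd)
    have nz: "p' \<noteq> 0" "q' \<noteq> 0" "emb [:- x, 1:] \<noteq> 0" using p0 q0 pq' by auto
    have "emb p' / emb q' = t" unfolding t_def pq' is_ring_homD(4)[OF emb_hom] using nz by simp
    then have "good p' q'" unfolding good_def using nz tS tc by simp
    then have "d \<le> max (degree p') (degree q')" by (rule min)
    moreover have "degree p = Suc (degree p')" "degree q = Suc (degree q')"
      unfolding pq' using degree_mult_eq[of "[:- x, 1:]"] nz by simp_all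
    ultimately show False using d by simp
  qed
  \<comment> \<open>Otherwise p / q would be constant. In terms of H this says that no substitution
    of a constant for Y makes it vanish.\<close>
  have nonprop: "smult (poly q x) p \<noteq> smult (poly p x) q" for x
  proof
    assume eq: "smult (poly q x) p = smult (poly p x) q"
    show False
    proof (cases "poly q x = 0")
      case True
      then show False using eq no_root[of x] q0 by simp
    next
      case False
      have "p = smult (poly p x / poly q x) q" using False eq by (metis div_smult_left nonzero_mult_div_cancel_left smult_smult smult_1_left divide_inverse mult.commute right_inverse)
      then have "p = [:poly p x / poly q x:] * q" by simp
      then have "emb p = con (poly p x / poly q x) * emb q" using is_ring_homD(4)[OF emb_hom] by metis
      then have "t = con (poly p x / poly q x)" unfolding t_def using q0 by (simp add: field_simps)
      then show False using tc by blast
    qed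
  qed
  define Pt where "Pt = map_poly con p - smult t (map_poly con q)"
  have PtS: "coeff Pt i \<in> S" for i unfolding Pt_def by (simp add: coeff_map_poly S' tS)
  have PtY: "poly Pt var = 0" unfolding Pt_def using tq by (simp add: eval_fract_var)
  have Pt0: "Pt \<noteq> 0"
  proof
    assume "Pt = 0"
    then have "coeff Pt (degree q) = 0" by simp
    then have "con (coeff p (degree q)) = t * con (lead_coeff q)" unfolding Pt_def by (simp add: coeff_map_poly)
    then have "t = con (coeff p (degree q)) / con (lead_coeff q)" using q0 by (simp add: field_simps)
    also have "\<dots> = con (coeff p (degree q) / lead_coeff q)"
    proof -
      have "con (coeff p (degree q) / lead_coeff q) * con (lead_coeff q) = con (coeff p (degree q))"
        unfolding is_ring_homD(4)[OF con_hom, symmetric] using q0 by simp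
      then show ?thesis using q0 by (simp add: field_simps)
    qed
    finally show False using tc by blast
  qed
  \<comment> \<open>A member of least degree is a minimal polynomial of the variable over S.\<close>
  define vanish where "vanish N \<longleftrightarrow> N \<noteq> 0 \<and> (\<forall>i. coeff N i \<in> S) \<and> poly N var = 0" for N
  have "\<exists>n N. vanish N \<and> degree N = n" using Pt0 PtS PtY unfolding vanish_def by blast
  then obtain n where "\<exists>N. vanish N \<and> degree N = n" and minM0: "\<And>n'. n' < n \<Longrightarrow> \<not> (\<exists>N. vanish N \<and> degree N = n')"
    using exists_least_iff[of "\<lambda>n. \<exists>N. vanish N \<and> degree N = n"] by auto
  then obtain M where M: "vanish M" and Mn: "degree M = n" by blast
  have M0: "M \<noteq> 0" and MS: "\<And>i. coeff M i \<in> S" and MY: "poly M var = 0" using M unfolding vanish_def by auto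
  have small: "N = 0" if "\<And>i. coeff N i \<in> S" "poly N var = 0" "N = 0 \<or> degree N < degree M" for N
    using that minM0[of "degree N"] Mn unfolding vanish_def by blast
  obtain s r where sr: "\<forall>i. coeff r i \<in> S" "Pt = s * M + r" "r = 0 \<or> degree r < degree M"
    using subfield_over_division[OF S MS M0 PtS] by blast
  have "poly r var = 0" using PtY MY sr(2) by simp
  then have "r = 0" using small sr by blast
  then have Pts: "Pt = M * s" using sr(2) by (simp add: mult.commute)
  obtain D0 g0 where D0: "D0 \<noteq> 0" "map_poly emb g0 = smult (emb D0) M" by (rule clear_denominators)
  have g00: "g0 \<noteq> 0" using D0 M0 by auto
  obtain c g where c: "c \<noteq> 0" "g0 = smult c g" and prim: "primitive_poly g" using primitive_part[OF g00] by blast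
  define \<kappa> where "\<kappa> = emb D0 / emb c"
  have \<kappa>0: "\<kappa> \<noteq> 0" unfolding \<kappa>_def using D0 c by simp
  have gM: "map_poly emb g = smult \<kappa> M"
  proof -
    have "smult (emb c) (map_poly emb g) = smult (emb D0) M" using D0(2) unfolding c(2) map_poly_hom(4)[OF emb_hom] .
    then have "smult (inverse (emb c)) (smult (emb c) (map_poly emb g)) = smult (inverse (emb c)) (smult (emb D0) M)" by simp
    then show ?thesis unfolding smult_smult \<kappa>_def using c(1) by (simp add: divide_inverse mult.commute)
  qed
  \<comment> \<open>With only constant ratios of coefficients, the variable would be algebraic over
    k. A nonconstant ratio is an element of S, so its numerator or denominator has degree at least
    d.\<close>
  have "\<exists>j. coeff M j / lead_coeff M \<notin> range con"
  proof (rule ccontr)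
    assume "\<not> ?thesis"
    then have "\<forall>j. \<exists>a. coeff M j / lead_coeff M = con a" by blast
    then obtain f where f: "\<And>j. coeff M j / lead_coeff M = con (f j)" by metis
    define a where "a = (\<Sum>j\<le>degree M. monom (f j) j)"
    have ca: "coeff a j = (if j \<le> degree M then f j else 0)" for j
      unfolding a_def by (simp add: coeff_sum if_distrib cong: if_cong)
    have "map_poly con a = smult (inverse (lead_coeff M)) M"
    proof (rule poly_eqI)
      fix j
      show "coeff (map_poly con a) j = coeff (smult (inverse (lead_coeff M)) M) j"
        using f[of j] by (cases "j \<le> degree M") (auto simp: coeff_map_poly ca coeff_eq_0 divide_inverse mult.commute)
    qed
    then have "eval_fract a var = 0" using MY by simp
    then have "a = 0" by (simp add: eval_fract_var)
    then have "f (degree M) = 0" using ca[of "degree M"] by simp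
    then have "con (f (degree M)) = 0" by simp
    then show False using f[of "degree M"] M0 by simp
  qed
  then obtain j where j: "coeff M j / lead_coeff M \<notin> range con" by blast
  have gc: "emb (coeff g i) = \<kappa> * coeff M i" for i using arg_cong[OF gM, of "\<lambda>P. coeff P i"] by (simp add: coeff_map_poly)
  have "good (coeff g j) (coeff g (degree M))"
  proof -
    have eq: "emb (coeff g j) / emb (coeff g (degree M)) = coeff M j / lead_coeff M" unfolding gc using \<kappa>0 by simp
    have "emb (coeff g (degree M)) \<noteq> 0" unfolding gc using \<kappa>0 M0 by simp
    then have "coeff g (degree M) \<noteq> 0" by simp
    then show ?thesis unfolding good_def eq using j MS S' by simp
  qed
  then have "d \<le> max (degree (coeff g j)) (degree (coeff g (degree M)))" by (rule min)
  then obtain i where i: "d \<le> degree (coeff g i)" by (metis max_def)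
  have d0: "d > 0"
  proof (rule ccontr)
    assume "\<not> d > 0"
    then have "degree p = 0" "degree q = 0" using d by auto
    then have "smult (poly q 0) p = smult (poly p 0) q" by (auto elim!: degree_eq_zeroE)
    then show False using nonprop by blast
  qed
  define e where "e = degree (coeff g i)"
  have de: "d \<le> e" using i e_def by simp
  \<comment> \<open>The relation p(Y) - t q(Y) multiplied by q(x). Its degree is at most d in x, and
    it changes only its sign when x and Y are exchanged.\<close>
  define H where "H = smult q (lift_poly p) - smult p (lift_poly q)"
  have HPt: "map_poly emb H = smult (emb q) Pt"
    unfolding H_def Pt_def map_poly_hom[OF emb_hom] map_emb_lift smult_diff_right smult_smult
    using tq by (simp add: mult.commute)
  have "g dvd H"
  proof -
    obtain D l where D: "D \<noteq> 0" "map_poly emb l = smult (emb D) s" by (rule clear_denominators)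
    have "map_poly emb (smult (D0 * D) H) = map_poly emb (smult (c * q) (g * l))"
    proof -
      have \<kappa>c: "\<kappa> * emb c = emb D0" unfolding \<kappa>_def using c(1) by simp
      have "map_poly emb (smult (c * q) (g * l)) = smult (emb c * emb q) (smult \<kappa> M * smult (emb D) s)"
        unfolding map_poly_hom[OF emb_hom] gM D(2) is_ring_homD(4)[OF emb_hom] ..
      also have "\<dots> = smult ((\<kappa> * emb c) * emb D) (smult (emb q) (M * s))"
        by (simp add: mult_ac)
      also have "\<dots> = smult (emb D0 * emb D) (map_poly emb H)" unfolding \<kappa>c HPt Pts ..
      also have "\<dots> = map_poly emb (smult (D0 * D) H)"
        unfolding map_poly_hom[OF emb_hom] is_ring_homD(4)[OF emb_hom] ..
      finally show ?thesis ..
    qed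
    then have "smult (D0 * D) H = smult (c * q) (g * l)"
      using injD[OF map_poly_emb_inj] by blast
    then have "smult (D0 * D) H = g * smult (c * q) l" by simp
    then show ?thesis using primitive_poly_dvd[OF prim, of "D0 * D"] D0(1) D(1) by (metis mult_eq_0_iff)
  qed
  then obtain l where l: "H = g * l" by blast
  have Hx: "poly H [:x:] = smult (poly p x) q - smult (poly q x) p" for x
    unfolding H_def by (simp add: poly_lift_at_constant)
  have Hx0: "poly H [:x:] \<noteq> 0" for x unfolding Hx using nonprop[of x] by (metis eq_iff_diff_eq_0)
  have Hxd: "degree (poly H [:x:]) \<le> d" for x
    unfolding Hx using d by (intro degree_diff_le) (auto intro: order_trans[OF degree_smult_le])
  \<comment> \<open>The coefficient of x^e in g, as a polynomial in Y. Where it does not vanish,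
    specializing Y keeps the degree of g in x at least e, and comparison with H makes the
    specialized cofactor constant.\<close>
  define A where "A = map_poly (\<lambda>c. coeff c e) g"
  have "coeff A i \<noteq> 0" unfolding A_def e_def using i d0 by (subst coeff_map_poly) (auto simp: leading_coeff_0_iff)
  then have A0: "A \<noteq> 0" by auto
  have lx: "degree (poly l [:x:]) = 0" if "poly A x \<noteq> 0" for x
  proof -
    have "coeff (poly g [:x:]) e \<noteq> 0" using that unfolding poly_at_constant_coeff A_def .
    then have ge: "e \<le> degree (poly g [:x:])" by (rule le_degree)
    have prod: "poly H [:x:] = poly g [:x:] * poly l [:x:]" unfolding l by simp
    have "poly g [:x:] \<noteq> 0" "poly l [:x:] \<noteq> 0" using Hx0[of x] unfolding prod by auto
    then have "degree (poly H [:x:]) = degree (poly g [:x:]) + degree (poly l [:x:])"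
      unfolding prod by (rule degree_mult_eq)
    then show ?thesis using ge de Hxd[of x] by linarith
  qed
  have lc: "coeff (coeff l k) m = 0" if "m > 0" for k m
  proof -
    define B where "B = map_poly (\<lambda>c. coeff c m) l"
    have "poly B x = 0" if "poly A x \<noteq> 0" for x
      unfolding B_def poly_at_constant_coeff[symmetric] using lx[OF that] \<open>m > 0\<close> by (simp add: coeff_eq_0)
    then have "{x. poly B x \<noteq> 0} \<subseteq> {x. poly A x = 0}" by blast
    then have "B = 0" using poly_roots_finite[OF A0] by (intro poly_eq_0_of_cofinite) (rule finite_subset)
    then have "coeff B k = 0" by simp
    then show ?thesis unfolding B_def by (simp add: coeff_map_poly)
  qed
  define l0 where "l0 = map_poly (\<lambda>c. coeff c 0) l"
  have ll0: "l = lift_poly l0"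
  proof (rule poly_eqI, rule poly_eqI)
    fix k m
    show "coeff (coeff l k) m = coeff (coeff (lift_poly l0) k) m"
      using lc[of m k] by (cases m) (auto simp: l0_def coeff_map_poly)
  qed
  \<comment> \<open>A root of the cofactor would be a constant value of Y at which H vanishes,
    contrary to \<open>nonprop\<close>.\<close>
  have "degree l0 = 0"
  proof (rule ccontr)
    assume "degree l0 \<noteq> 0"
    then obtain x where "poly l0 x = 0" using alg_closed_imp_poly_has_root[of l0] by blast
    then have "poly l [:x:] = 0" unfolding ll0 by (simp add: poly_lift_at_constant)
    then have "poly H [:x:] = 0" unfolding l by simp
    then show False using Hx0 by blast
  qed
  then obtain b where "l0 = [:b:]" by (rule degree_eq_zeroE)
  then have lb: "l = [:[:b:]:]" unfolding ll0 by (simp add: map_poly_pCons)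
  have b0: "b \<noteq> 0" using Hx0[of 0] unfolding l lb by auto
  have degM: "degree Pt = degree M"
  proof -
    have "smult (emb q) Pt = smult (con b * \<kappa>) M"
      using HPt unfolding l lb map_poly_hom(3)[OF emb_hom] gM by (simp add: map_poly_pCons mult.commute)
    then have "degree (smult (emb q) Pt) = degree (smult (con b * \<kappa>) M)" by simp
    moreover have "emb q \<noteq> 0" "con b * \<kappa> \<noteq> 0" using q0 b0 \<kappa>0 by auto
    ultimately show ?thesis by simp
  qed
  \<comment> \<open>The field k(t).\<close>
  define T where "T = {eval_fract a t / eval_fract b t | a b. eval_fract b t \<noteq> 0}"
  have ev_add: "eval_fract (a + b) t = eval_fract a t + eval_fract b t"
    and ev_diff: "eval_fract (a - b) t = eval_fract a t - eval_fract b t"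
    and ev_mult: "eval_fract (a * b) t = eval_fract a t * eval_fract b t" for a b
    by (simp_all add: map_poly_hom[OF con_hom])
  have con1: "con 1 = 1" using is_ring_homD(2)[OF con_hom] .
  have ev1: "eval_fract 1 t = 1"
  proof -
    have "eval_fract [:1:] t = 1" by (simp add: map_poly_pCons con1)
    then show ?thesis by (metis one_pCons)
  qed
  have T: "subfield_over T" unfolding subfield_over_def
  proof (intro conjI ballI)
    show "range con \<subseteq> T"
    proof
      fix x assume "x \<in> range (con :: 'k \<Rightarrow> _)"
      then obtain a where "x = con a" by blast
      then have "x = eval_fract [:a:] t / eval_fract 1 t" by (simp add: ev1 map_poly_pCons)
      then show "x \<in> T" unfolding T_def using ev1 by (metis (mono_tags, lifting) mem_Collect_eq zero_neq_one)
    qed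
    fix x y assume "x \<in> T" "y \<in> T"
    then obtain a b a' b' where xy: "x = eval_fract a t / eval_fract b t" "y = eval_fract a' t / eval_fract b' t"
      "eval_fract b t \<noteq> 0" "eval_fract b' t \<noteq> 0" unfolding T_def by blast
    have "x - y = eval_fract (a * b' - a' * b) t / eval_fract (b * b') t" "x * y = eval_fract (a * a') t / eval_fract (b * b') t"
      unfolding ev_diff ev_mult xy(1,2) using xy(3,4) by (simp_all add: field_simps)
    moreover have "eval_fract (b * b') t \<noteq> 0" unfolding ev_mult using xy by simp
    ultimately show "x - y \<in> T" "x * y \<in> T" unfolding T_def by blast+
  next
    fix x assume "x \<in> T"
    then obtain a b where x: "x = eval_fract a t / eval_fract b t" "eval_fract b t \<noteq> 0" unfolding T_def by blast
    show "inverse x \<in> T"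
    proof (cases "eval_fract a t = 0")
      case True
      then have "inverse x = x" using x by simp
      then show ?thesis using \<open>x \<in> T\<close> by simp
    next
      case False
      then have "inverse x = eval_fract b t / eval_fract a t" unfolding x(1) by simp
      then show ?thesis unfolding T_def using False by blast
    qed
  qed
  have tT: "t \<in> T"
  proof -
    have "t = eval_fract [:0, 1:] t / eval_fract 1 t"
      unfolding ev1 by (simp add: map_poly_pCons con1)
    then show ?thesis unfolding T_def using ev1 by (metis (mono_tags, lifting) mem_Collect_eq zero_neq_one)
  qed
  have TS: "T \<subseteq> S"
  proof -
    have "eval_fract a t \<in> S" for a by (rule subfield_over_poly[OF S _ tS]) (simp add: coeff_map_poly S')
    then show ?thesis unfolding T_def using S'(7) by auto
  qed
  have PtT: "coeff Pt k \<in> T" for k unfolding Pt_def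
    by (simp add: coeff_map_poly subfield_overD[OF T] tT)
  have "u \<in> T" if u: "u \<in> S" for u
  proof -
    obtain a b where b: "b \<noteq> 0" "u = emb a / emb b" by (rule fract_cases_emb)
    have cT: "coeff (map_poly con f) k \<in> T" for f k by (simp add: coeff_map_poly subfield_overD[OF T])
    obtain sa ra where ra: "\<forall>i. coeff ra i \<in> T" "map_poly con a = sa * Pt + ra" "ra = 0 \<or> degree ra < degree Pt"
      using subfield_over_division[OF T PtT Pt0 cT] by blast
    obtain sb rb where rb: "\<forall>i. coeff rb i \<in> T" "map_poly con b = sb * Pt + rb" "rb = 0 \<or> degree rb < degree Pt"
      using subfield_over_division[OF T PtT Pt0 cT] by blast
    have raY: "poly ra var = emb a" using arg_cong[OF ra(2), of "\<lambda>P. poly P var"] PtY by (simp add: eval_fract_var)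
    have rbY: "poly rb var = emb b" using arg_cong[OF rb(2), of "\<lambda>P. poly P var"] PtY by (simp add: eval_fract_var)
    \<comment> \<open>Numerator and denominator of u are reduced modulo the minimal polynomial with
      remainders over k(t). This combination vanishes at x and has too small a degree, so it is
      zero, and u is a quotient of coefficients in k(t).\<close>
    define R where "R = ra - smult u rb"
    have "R = 0"
    proof (rule small)
      show "coeff R k \<in> S" for k unfolding R_def using ra(1) rb(1) TS u by (auto intro!: S')
      show "poly R var = 0" unfolding R_def using raY rbY b by simp
      have "degree (smult u rb) \<le> degree rb" by (rule degree_smult_le)
      moreover have "degree (ra - smult u rb) \<le> max (degree ra) (degree (smult u rb))" by (rule degree_diff_le_max)
      ultimately show "R = 0 \<or> degree R < degree M" unfolding R_def degM[symmetric] using ra(3) rb(3)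
        by (cases "ra = 0"; cases "rb = 0") auto
    qed
    then have eq: "coeff ra k = u * coeff rb k" for k unfolding R_def by (metis coeff_0 coeff_diff coeff_smult eq_iff_diff_eq_0)
    have "rb \<noteq> 0" using rbY b(1) by auto
    then have lc: "lead_coeff rb \<noteq> 0" by simp
    then have "u = coeff ra (degree rb) / lead_coeff rb" using eq[of "degree rb"] by simp
    then show ?thesis using subfield_overD(7)[OF T] ra(1) rb(1) by metis
  qed
  then have "\<forall>u\<in>S. \<exists>a b. eval_fract b t \<noteq> 0 \<and> u = eval_fract a t / eval_fract b t" unfolding T_def by blast
  then show ?thesis using tS tc by blast
qed

section \<open>Curves dominated by the projective line\<close>

text \<open>Connects an element of k(x) with a function on k that is given by it off a finite set.
  Functions restricted from open subsets of the line are controlled only there, hence the cofinite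
  filter.\<close>

definition represents :: "'k::field_char_0 poly fract \<Rightarrow> ('k \<Rightarrow> 'k) \<Rightarrow> bool" where
  "represents u g \<longleftrightarrow> (\<exists>p q. q \<noteq> 0 \<and> u = emb p / emb q \<and>
     (\<forall>\<^sub>F x in cofinite. poly q x \<noteq> 0 \<and> g x = poly p x / poly q x))"

lemma representsE:
  assumes "represents u g"
  obtains p q where "q \<noteq> 0" "u = emb p / emb q" "\<forall>\<^sub>F x in cofinite. poly q x \<noteq> 0 \<and> g x = poly p x / poly q x"
  using assms unfolding represents_def by blast

lemma eventually_cofinite_ex:
  assumes "\<forall>\<^sub>F x::'k::field_char_0 in cofinite. P x"
  shows "\<exists>x. P x"
proof (rule ccontr)
  assume "\<not> ?thesis"
  then show False using assms infinite_UNIV_char_0[where 'a = 'k] by (simp add: eventually_cofinite)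
qed

lemma poly_nonzero_cofinite: "q \<noteq> 0 \<Longrightarrow> \<forall>\<^sub>F x in cofinite. poly q x \<noteq> (0::'k::field)"
  using poly_roots_finite[of q] by (simp add: eventually_cofinite)

lemma represents_fraction: "q \<noteq> 0 \<Longrightarrow> represents (emb p / emb q) (\<lambda>x. poly p x / poly q x)"
  unfolding represents_def using poly_nonzero_cofinite[of q] by (intro exI[of _ p] exI[of _ q]) simp

lemma represents_ex: "\<exists>g. represents u g"
proof -
  obtain p q where "q \<noteq> 0" "u = emb p / emb q" by (rule fract_cases_emb)
  then show ?thesis using represents_fraction by blast
qed

lemma represents_con: "represents (con c) (\<lambda>x. c)"
  using represents_fraction[of 1 "[:c:]"] by (simp add: is_ring_homD(2)[OF emb_hom])

lemma represents_add:
  assumes "represents u g" "represents v h"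
  shows "represents (u + v) (\<lambda>x. g x + h x)"
proof -
  obtain p q where p: "q \<noteq> 0" "u = emb p / emb q" "\<forall>\<^sub>F x in cofinite. poly q x \<noteq> 0 \<and> g x = poly p x / poly q x"
    using assms(1) by (rule representsE)
  obtain p' q' where p': "q' \<noteq> 0" "v = emb p' / emb q'" "\<forall>\<^sub>F x in cofinite. poly q' x \<noteq> 0 \<and> h x = poly p' x / poly q' x"
    using assms(2) by (rule representsE)
  have "u + v = emb (p * q' + p' * q) / emb (q * q')"
    unfolding p(2) p'(2) is_ring_homD[OF emb_hom] using p(1) p'(1) by (simp add: field_simps)
  moreover have "\<forall>\<^sub>F x in cofinite. poly (q * q') x \<noteq> 0 \<and> g x + h x = poly (p * q' + p' * q) x / poly (q * q') x"
    using p(3) p'(3) by eventually_elim (simp add: field_simps)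
  ultimately show ?thesis unfolding represents_def using p(1) p'(1)
    by (intro exI[of _ "p * q' + p' * q"] exI[of _ "q * q'"]) simp
qed

lemma represents_mult:
  assumes "represents u g" "represents v h"
  shows "represents (u * v) (\<lambda>x. g x * h x)"
proof -
  obtain p q where p: "q \<noteq> 0" "u = emb p / emb q" "\<forall>\<^sub>F x in cofinite. poly q x \<noteq> 0 \<and> g x = poly p x / poly q x"
    using assms(1) by (rule representsE)
  obtain p' q' where p': "q' \<noteq> 0" "v = emb p' / emb q'" "\<forall>\<^sub>F x in cofinite. poly q' x \<noteq> 0 \<and> h x = poly p' x / poly q' x"
    using assms(2) by (rule representsE)
  have "u * v = emb (p * p') / emb (q * q')" unfolding p(2) p'(2) is_ring_homD[OF emb_hom] by simp
  moreover have "\<forall>\<^sub>F x in cofinite. poly (q * q') x \<noteq> 0 \<and> g x * h x = poly (p * p') x / poly (q * q') x"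
    using p(3) p'(3) by eventually_elim simp
  ultimately show ?thesis unfolding represents_def using p(1) p'(1)
    by (intro exI[of _ "p * p'"] exI[of _ "q * q'"]) simp
qed

lemma represents_diff:
  fixes u v :: "'k::field_char_0 poly fract"
  assumes "represents u g" "represents v h"
  shows "represents (u - v) (\<lambda>x. g x - h x)"
proof -
  have "con (- 1 :: 'k) = - 1" using is_ring_homD(2,5)[OF con_hom] by metis
  then show ?thesis using represents_add[OF assms(1) represents_mult[OF represents_con[of "- 1"] assms(2)]] by simp
qed

lemma represents_zero:
  assumes "represents 0 g"
  shows "\<forall>\<^sub>F x in cofinite. g x = 0"
proof -
  obtain p q where p: "q \<noteq> 0" "0 = emb p / emb q" "\<forall>\<^sub>F x in cofinite. poly q x \<noteq> 0 \<and> g x = poly p x / poly q x"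
    using assms by (rule representsE)
  then have "p = 0" by simp
  show ?thesis using p(3) by eventually_elim (simp add: \<open>p = 0\<close>)
qed

lemma represents_nonzero:
  assumes "represents u g" "u \<noteq> 0"
  shows "\<forall>\<^sub>F x in cofinite. g x \<noteq> 0"
proof -
  obtain p q where p: "q \<noteq> 0" "u = emb p / emb q" "\<forall>\<^sub>F x in cofinite. poly q x \<noteq> 0 \<and> g x = poly p x / poly q x"
    using assms(1) by (rule representsE)
  then have "p \<noteq> 0" using assms(2) by auto
  from p(3) poly_nonzero_cofinite[OF this] show ?thesis by eventually_elim simp
qed

lemma represents_agree:
  assumes "represents u g" "represents u h"
  shows "\<forall>\<^sub>F x in cofinite. g x = h x"
proof -
  have "represents 0 (\<lambda>x. g x - h x)" using represents_diff[OF assms] by simp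
  from represents_zero[OF this] show ?thesis by simp
qed

lemma represents_divide:
  assumes "represents u g" "represents v h" "v \<noteq> 0" "represents w k" "w = u / v"
  shows "\<forall>\<^sub>F x in cofinite. h x \<noteq> 0 \<and> k x = g x / h x"
proof -
  have "u = w * v" using assms(3,5) by simp
  then have "represents u (\<lambda>x. k x * h x)" using represents_mult[OF assms(4,2)] by simp
  from represents_agree[OF this assms(1)] represents_nonzero[OF assms(2,3)]
  show ?thesis by eventually_elim (simp add: nonzero_eq_divide_eq)
qed

lemma represents_eval:
  assumes "represents t s"
  shows "represents (eval_fract p t) (\<lambda>x. poly p (s x))"
proof (induction p)
  case 0
  show ?case using represents_con[of 0] by simp
next
  case (pCons a p)
  show ?case using represents_add[OF represents_con represents_mult[OF assms pCons.IH], of a]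
    by (simp add: map_poly_pCons)
qed

lemma coprime_fraction:
  fixes p q :: "'k::field poly"
  assumes "q \<noteq> 0"
  shows "\<exists>p' q'. q' \<noteq> 0 \<and> emb p / emb q = emb p' / emb q' \<and> (\<forall>x. poly p' x \<noteq> 0 \<or> poly q' x \<noteq> 0)"
  using assms
proof (induction "degree q" arbitrary: p q rule: less_induct)
  case less
  show ?case
  proof (cases "\<forall>x. poly p x \<noteq> 0 \<or> poly q x \<noteq> 0")
    case False
    then obtain x where x: "poly p x = 0" "poly q x = 0" by blast
    then obtain p' q' where pq': "p = [:- x, 1:] * p'" "q = [:- x, 1:] * q'" by (metis dvdE poly_eq_0_iff_dvd)
    have nz: "q' \<noteq> 0" "emb [:- x, 1:] \<noteq> 0" using less.prems pq' by auto
    have "emb p / emb q = emb p' / emb q'" unfolding pq' is_ring_homD(4)[OF emb_hom] using nz by simp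
    moreover have "degree q' < degree q" unfolding pq' using degree_mult_eq[of "[:- x, 1:]" q'] nz by simp
    ultimately show ?thesis using less.hyps[of q' p'] nz(1) by simp
  qed (use less.prems in blast)
qed

lemma con_divide: "c \<noteq> 0 \<Longrightarrow> con a / con c = con (a / c)"
  using is_ring_homD(4)[OF con_hom, of "a / c" c] by (simp add: field_simps)

text \<open>For coprime p and q the value y is attained by p / q as soon as p - y q has a root, that
  is, unless it is constant. This fails for at most one y; the finitely many x to be avoided spoil
  only finitely many further values.\<close>

lemma represents_image_cofinite:
  fixes t :: "'k::{alg_closed_field, field_char_0} poly fract"
  assumes t: "represents t s" and nc: "t \<notin> range con" and P: "\<forall>\<^sub>F x in cofinite. P x"
  shows "\<forall>\<^sub>F y in cofinite. \<exists>x. P x \<and> s x = y"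
proof -
  obtain p0 q0 where "q0 \<noteq> 0" "t = emb p0 / emb q0" by (rule fract_cases_emb)
  then obtain p q where q0: "q \<noteq> 0" and tpq: "t = emb p / emb q" and root: "\<And>x. poly p x \<noteq> 0 \<or> poly q x \<noteq> 0"
    using coprime_fraction by metis
  have "represents t (\<lambda>x. poly p x / poly q x)" unfolding tpq by (rule represents_fraction[OF q0])
  from represents_agree[OF t this] P
  have "\<forall>\<^sub>F x in cofinite. P x \<and> s x = poly p x / poly q x" by (rule eventually_elim2) simp
  then have fin: "finite {x. \<not> (P x \<and> s x = poly p x / poly q x)}" (is "finite ?N") by (simp add: eventually_cofinite)
  \<comment> \<open>Two distinct elements would make both p and q constant, contradicting
    \<open>nc\<close>.\<close>
  let ?D = "{y. degree (p - smult y q) = 0}"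
  have one: "y = z" if yz: "y \<in> ?D" "z \<in> ?D" for y z
  proof (rule ccontr)
    assume ne: "y \<noteq> z"
    obtain a b where ab: "p - smult y q = [:a:]" "p - smult z q = [:b:]" using yz by (auto elim!: degree_eq_zeroE)
    define c where "c = (a - b) / (z - y)"
    have "smult (z - y) q = [:a - b:]"
      using arg_cong2[OF ab, of "(-)"] by (simp add: smult_diff_left)
    then have "smult (inverse (z - y)) (smult (z - y) q) = [:c:]" by (simp add: c_def divide_inverse mult.commute)
    then have q: "q = [:c:]" using ne by simp
    then have p: "p = [:a + y * c:]" using ab(1) by (simp add: diff_eq_eq)
    show False using nc con_divide[of c "a + y * c"] q0 unfolding tpq p q by auto
  qed
  have "finite ?D"
  proof (cases "?D = {}")
    case False
    then obtain y where "y \<in> ?D" by blast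
    then have "?D \<subseteq> {y}" using one by blast
    then show ?thesis by (rule finite_subset) simp
  next
    case True
    then show ?thesis by (metis finite.emptyI)
  qed
  then have "finite (?D \<union> (\<lambda>x. poly p x / poly q x) ` ?N)" using fin by blast
  moreover have "{y. \<not> (\<exists>x. P x \<and> s x = y)} \<subseteq> ?D \<union> (\<lambda>x. poly p x / poly q x) ` ?N"
  proof (rule subsetI, rule ccontr)
    fix y assume no: "y \<in> {y. \<not> (\<exists>x. P x \<and> s x = y)}" and y: "y \<notin> ?D \<union> (\<lambda>x. poly p x / poly q x) ` ?N"
    then obtain x where "poly (p - smult y q) x = 0" using alg_closed_imp_poly_has_root[of "p - smult y q"] by blast
    then have e: "poly p x = y * poly q x" by simp
    then have "poly q x \<noteq> 0" using root[of x] by auto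
    then have "y = poly p x / poly q x" using e by simp
    moreover have "x \<notin> ?N" using y calculation by blast
    ultimately show False using no by blast
  qed
  ultimately show ?thesis unfolding eventually_cofinite by (rule rev_finite_subset)
qed

lemma regular_P1_represents:
  fixes h :: "'k::field_char_0 proj_point \<Rightarrow> 'k"
  assumes "openin (top_of PL) U" "U \<noteq> {}" "h \<in> regular PL U"
  shows "\<exists>u. represents u (\<lambda>x. h (pt x 1))"
proof -
  obtain u where u: "u \<in> U" using assms(2) by blast
  obtain V d p q where V: "openin (top_of PL) V" "u \<in> V"
    and pq: "p \<in> homogeneous 2 d" "q \<in> homogeneous 2 d"
    and eq: "\<And>x. x \<in> homogeneous_coords 1 \<Longrightarrow> proj_class x \<in> V \<Longrightarrow> q x \<noteq> 0 \<and> h (proj_class x) = p x / q x"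
    using assms(3) u unfolding regular_projective_space top_of_projective_space by (auto simp: Suc_1)
  obtain A where A: "\<And>x. p (vec2 x 1) = poly A x" using homogeneous_dehomogenize[OF pq(1)] by metis
  obtain B where B: "\<And>x. q (vec2 x 1) = poly B x" using homogeneous_dehomogenize[OF pq(2)] by metis
  have "\<forall>\<^sub>F x in cofinite. pt x 1 \<in> V" using finite_not_in_open_P1[OF V(1)] V(2) by (auto simp: eventually_cofinite)
  then have ev: "\<forall>\<^sub>F x in cofinite. poly B x \<noteq> 0 \<and> h (pt x 1) = poly A x / poly B x"
  proof (rule eventually_mono)
    fix x assume "pt x 1 \<in> V"
    then show "poly B x \<noteq> 0 \<and> h (pt x 1) = poly A x / poly B x" using eq[OF vec2_coords, of x 1] A B by simp
  qed
  then have "B \<noteq> 0" using eventually_cofinite_ex by fastforce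
  then show ?thesis unfolding represents_def using ev by blast
qed

text \<open>Lueroth's theorem is applied to the field generated by the coordinates of the curve.\<close>

lemma curve_parameter:
  fixes g :: "'k::{alg_closed_field, field_char_0} \<Rightarrow> nat \<Rightarrow> 'k"
  assumes c: "\<And>i. i < n \<Longrightarrow> represents (c i) (\<lambda>x. g x i)" and j: "j < n" "c j \<notin> range con"
  shows "\<exists>t s A B \<alpha> \<beta>. represents t s \<and> t \<notin> range con \<and> A \<in> poly_functions n \<and> B \<in> poly_functions n \<and>
    (\<forall>\<^sub>F x in cofinite. B (g x) \<noteq> 0 \<and> s x = A (g x) / B (g x) \<and>
       (\<forall>i<n. poly (\<beta> i) (s x) \<noteq> 0 \<and> g x i = poly (\<alpha> i) (s x) / poly (\<beta> i) (s x)))"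
proof -
  \<comment> \<open>Not only the field is recorded but also a presentation of each element by
    polynomials in the coordinates: the parameter t must be expressed through the curve to define
    the map back to the line.\<close>
  define gen where "gen u A B v w \<longleftrightarrow> A \<in> poly_functions n \<and> B \<in> poly_functions n \<and> represents v (\<lambda>x. A (g x)) \<and>
    represents w (\<lambda>x. B (g x)) \<and> w \<noteq> 0 \<and> u = v / w" for u A B v w
  define S where "S = {u. \<exists>A B v w. gen u A B v w}"
  have con1: "con 1 = 1" using is_ring_homD(2)[OF con_hom] .
  have base: "v \<in> S" if A: "A \<in> poly_functions n" "represents v (\<lambda>x. A (g x))" for A v
  proof -
    have "represents 1 (\<lambda>x. 1 :: 'k)" using represents_con[of "1 :: 'k"] unfolding con1 .
    then have "gen v A (\<lambda>x. 1) v 1" unfolding gen_def using A poly_functions.const by simp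
    then show ?thesis unfolding S_def by blast
  qed
  have S: "subfield_over S" unfolding subfield_over_def
  proof (intro conjI ballI)
    show "range con \<subseteq> S"
    proof
      fix u assume "u \<in> range (con :: 'k \<Rightarrow> _)"
      then obtain a where "u = con a" by blast
      then show "u \<in> S" using base[OF poly_functions.const represents_con] by blast
    qed
    fix u u' assume "u \<in> S" "u' \<in> S"
    then obtain A B v w A' B' v' w' where g: "gen u A B v w" and g': "gen u' A' B' v' w'" unfolding S_def by blast
    have pm: "A \<in> poly_functions n" "B \<in> poly_functions n" "A' \<in> poly_functions n" "B' \<in> poly_functions n"
      using g g' by (auto simp: gen_def)
    have w: "w \<noteq> 0" "w' \<noteq> 0" "u = v / w" "u' = v' / w'" using g g' by (auto simp: gen_def)
    have rep: "represents v (\<lambda>x. A (g x))" "represents w (\<lambda>x. B (g x))"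
      "represents v' (\<lambda>x. A' (g x))" "represents w' (\<lambda>x. B' (g x))" using g g' by (auto simp: gen_def)
    have d: "(\<lambda>x. A x * B' x + (- 1) * (A' x * B x)) \<in> poly_functions n"
      by (intro poly_functions.add poly_functions.mult poly_functions.const pm)
    have "represents (v * w' - v' * w) (\<lambda>x. A (g x) * B' (g x) + (- 1) * (A' (g x) * B (g x)))"
      using represents_diff[OF represents_mult[OF rep(1,4)] represents_mult[OF rep(3,2)]] by simp
    then have "gen (u - u') (\<lambda>x. A x * B' x + (- 1) * (A' x * B x)) (\<lambda>x. B x * B' x) (v * w' - v' * w) (w * w')"
      unfolding gen_def using d poly_functions.mult[OF pm(2,4)] represents_mult[OF rep(2,4)] w
      by (simp add: diff_frac_eq)
    then show "u - u' \<in> S" unfolding S_def by blast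
    have "gen (u * u') (\<lambda>x. A x * A' x) (\<lambda>x. B x * B' x) (v * v') (w * w')"
      unfolding gen_def using poly_functions.mult[OF pm(1,3)] poly_functions.mult[OF pm(2,4)]
        represents_mult[OF rep(1,3)] represents_mult[OF rep(2,4)] w by simp
    then show "u * u' \<in> S" unfolding S_def by blast
  next
    fix u assume u: "u \<in> S"
    then obtain A B v w where g: "gen u A B v w" unfolding S_def by blast
    show "inverse u \<in> S"
    proof (cases "v = 0")
      case True
      then have "inverse u = u" using g unfolding gen_def by simp
      then show ?thesis using u by simp
    next
      case False
      then have "gen (inverse u) B A w v" using g unfolding gen_def by simp
      then show ?thesis unfolding S_def by blast
    qed
  qed
  have cS: "c i \<in> S" if "i < n" for i by (rule base[OF poly_functions.coord c]) fact+
  have "\<not> S \<subseteq> range con" using j cS by blast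
  from lueroth[OF S this] obtain t where tS: "t \<in> S" and tc: "t \<notin> range con"
    and gen_t: "\<And>u. u \<in> S \<Longrightarrow> \<exists>a b. eval_fract b t \<noteq> 0 \<and> u = eval_fract a t / eval_fract b t" by blast
  obtain A B v w where g: "gen t A B v w" using tS unfolding S_def by blast
  obtain s where s: "represents t s" using represents_ex by blast
  have "\<forall>i\<in>{..<n}. \<exists>a b. eval_fract b t \<noteq> 0 \<and> c i = eval_fract a t / eval_fract b t" using gen_t cS by blast
  then obtain \<alpha> \<beta> where ab: "\<And>i. i < n \<Longrightarrow> eval_fract (\<beta> i) t \<noteq> 0 \<and> c i = eval_fract (\<alpha> i) t / eval_fract (\<beta> i) t"
    by (metis lessThan_iff)
  have "\<forall>\<^sub>F x in cofinite. poly (\<beta> i) (s x) \<noteq> 0 \<and> g x i = poly (\<alpha> i) (s x) / poly (\<beta> i) (s x)" if i: "i < n" for i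
    using represents_divide[OF represents_eval[OF s] represents_eval[OF s] _ c[OF i]] ab[OF i] by blast
  then have "\<forall>\<^sub>F x in cofinite. \<forall>i\<in>{..<n}. poly (\<beta> i) (s x) \<noteq> 0 \<and> g x i = poly (\<alpha> i) (s x) / poly (\<beta> i) (s x)"
    by (intro eventually_ball_finite) auto
  moreover have "\<forall>\<^sub>F x in cofinite. B (g x) \<noteq> 0 \<and> s x = A (g x) / B (g x)"
    using represents_divide[OF _ _ _ s] g unfolding gen_def by blast
  ultimately have "\<forall>\<^sub>F x in cofinite. B (g x) \<noteq> 0 \<and> s x = A (g x) / B (g x) \<and>
       (\<forall>i<n. poly (\<beta> i) (s x) \<noteq> 0 \<and> g x i = poly (\<alpha> i) (s x) / poly (\<beta> i) (s x))"
    by eventually_elim auto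
  then show ?thesis using s tc g unfolding gen_def by blast
qed

section \<open>From the parameter to a birational map\<close>

lemma morphism_const:
  assumes X: "function_space X" and y: "y \<in> points Y"
  shows "morphism X Y (\<lambda>x. y)"
proof (rule morphismI)
  have o: "openin (top_of X) {x \<in> points X. y \<in> V}" for V by (cases "y \<in> V") auto
  then show "openin (top_of X) {x \<in> points X. y \<in> V}" for V .
  show "(\<lambda>x. h y) \<in> regular X {x \<in> points X. y \<in> V}" for V h by (rule function_spaceD(2)[OF X o])
qed (rule y)

text \<open>Points are closed: separatedness is applied to the identity and a constant map.\<close>

lemma point_complement_open:
  assumes X: "irreducible_variety X" and x: "x \<in> points X"
  shows "openin (top_of X) (points X - {x})"
proof -
  note X' = irreducible_varietyD[OF X]
  have o: "openin (top_of X) (points X)" by simp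
  have "openin (top_of X) {y \<in> points X. y \<noteq> x}"
    by (rule neq_locus_open[OF X'(1,2) o morphism_restrict[OF X'(4) o morphism_id[OF X'(4)]]
        morphism_restrict[OF X'(4) o morphism_const[OF X'(5) x]]])
  moreover have "{y \<in> points X. y \<noteq> x} = points X - {x}" by blast
  ultimately show ?thesis by simp
qed

lemma dense_image_restrict:
  assumes X: "irreducible_variety X" and f: "(U, f) \<in> partial_morphisms X Y" "dense_image Y U f"
    and V: "openin (top_of X) V" "V \<noteq> {}"
  shows "dense_image Y (U \<inter> V) f"
proof (rule dense_imageI)
  fix W assume W: "openin (top_of Y) W" "W \<noteq> {}"
  then have "{x \<in> U. f x \<in> W} \<noteq> {}" using dense_imageD[OF f(2)] by blast
  from irreducible_space_Int[OF irreducible_varietyD(3)[OF X] partial_morphism_preimage[OF f(1) W(1)] this V]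
  show "\<exists>x\<in>U \<inter> V. f x \<in> W" by blast
qed

lemma dense_image_P1_cofinite:
  fixes f :: "'k::field_char_0 proj_point \<Rightarrow> 'b"
  assumes f: "(U, f) \<in> partial_morphisms PL X" "dense_image X U f" and P: "\<forall>\<^sub>F x in cofinite. P x"
    and W: "openin (top_of X) W" "W \<noteq> {}"
  shows "\<exists>x. P x \<and> f (pt x 1) \<in> W"
proof -
  have "finite (- {x. P x})" using P by (simp add: eventually_cofinite Collect_neg_eq)
  from dense_image_restrict[OF irreducible_variety_P1 f cofinite_affine_open[OF this]]
  show ?thesis using dense_imageD W by blast
qed

lemma function_space_poly:
  assumes X: "function_space X" and U: "openin (top_of X) U" and h: "h \<in> regular X U"
  shows "(\<lambda>x. poly p (h x)) \<in> regular X U"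
proof (induction p)
  case 0
  show ?case using function_spaceD(2)[OF X U] by simp
next
  case (pCons a p)
  show ?case using function_spaceD(3)[OF X U function_spaceD(2)[OF X U] function_spaceD(4)[OF X U h pCons.IH]] by simp
qed

text \<open>In an affine chart of X the coordinates of the given map are elements of k(x), and
  Lueroth's theorem provides a parameter t of the field they generate. Expressing t by the
  coordinates gives \<tau> from X to the line, and expressing the coordinates by t gives \<delta>
  back; they are inverse to each other on dense sets.\<close>

theorem curve_dominated_by_P1:
  fixes X :: "('b, 'k::{alg_closed_field, field_char_0}) fspace"
  assumes X: "irreducible_variety X" and ns: "\<not> is_singleton (points X)" and \<phi>: "\<phi> \<in> dominant_maps PL X"
  shows "\<exists>\<psi>. birational X PL \<psi>"
proof -
  let ?P = "PL :: ('k proj_point, 'k) fspace"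
  note P1v = irreducible_variety_P1[where 'k = 'k]
  note X' = irreducible_varietyD[OF X]
  obtain U f where f: "(U, f) \<in> partial_morphisms ?P X" and fd: "dense_image X U f"
    by (rule dominant_mapsE[OF P1v X \<phi>])
  obtain x0 where x0: "x0 \<in> points X" using X'(6) by blast
  obtain W n Z where W: "openin (top_of X) W" "x0 \<in> W" and Z: "algebraic_set n Z"
    and iso: "isomorphic (open_subspace X W) (affine_variety n Z)"
    using prevarietyD(2)[OF X'(1) x0] by blast
  let ?A = "affine_variety n Z" and ?W = "open_subspace X W"
  obtain a b where a: "morphism ?W ?A a" and b: "morphism ?A ?W b"
    and ba: "\<And>w. w \<in> points ?W \<Longrightarrow> b (a w) = w" using iso unfolding isomorphic_def by blast
  have ptsW: "points ?W = W" using openin_subset[OF W(1)] by auto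
  have aZ: "a w \<in> affine_points n \<and> a w \<in> Z" if "w \<in> W" for w using morphismD(1)[OF a, of w] that unfolding ptsW by simp
  have reg: "(\<lambda>w. A (a w)) \<in> regular X W" if A: "A \<in> poly_functions n" for A
  proof -
    have o: "openin (top_of ?A) (points ?A)" by (rule openin_topspace)
    have "{w \<in> points ?W. a w \<in> points ?A} = W" unfolding ptsW using morphismD(1)[OF a] ptsW by blast
    then show ?thesis using morphismD(3)[OF a o poly_function_regular[OF A o]] by simp
  qed
  define U' where "U' = {x \<in> U. f x \<in> W}"
  have U': "openin (top_of ?P) U'" unfolding U'_def by (rule partial_morphism_preimage[OF f W(1)])
  have U'0: "U' \<noteq> {}" using dense_imageD[OF fd W(1)] W(2) unfolding U'_def by blast
  have U'ev: "\<forall>\<^sub>F x in cofinite. pt x 1 \<in> U'" using finite_not_in_open_P1[OF U' U'0] by (simp add: eventually_cofinite)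
  define g where "g x = a (f (pt x 1))" for x
  have "\<exists>u. represents u (\<lambda>x. g x i)" if i: "i < n" for i
  proof -
    have "{x \<in> points (open_subspace ?P U). f x \<in> W} = U'"
      unfolding U'_def using openin_subset[OF partial_morphismsD(1)[OF f]] by auto
    then have "(\<lambda>x. a (f x) i) \<in> regular ?P U'"
      using morphismD(3)[OF partial_morphismsD(3)[OF f] W(1) reg[OF poly_functions.coord[OF i]]] by simp
    from regular_P1_represents[OF U' U'0 this] show ?thesis unfolding g_def .
  qed
  then obtain c where c: "\<And>i. i < n \<Longrightarrow> represents (c i) (\<lambda>x. g x i)" by metis
  \<comment> \<open>If all coordinates were constant, the image of a cofinite set would be one
    point; since X has another point, the complement of the first is a nonempty open set missed by a
    dense image.\<close>
  have "\<exists>j<n. c j \<notin> range con"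
  proof (rule ccontr)
    assume "\<not> ?thesis"
    then have "\<forall>i. \<exists>y. i < n \<longrightarrow> c i = con y" by blast
    then obtain k where k: "\<And>i. i < n \<Longrightarrow> c i = con (k i)" by metis
    have "\<forall>\<^sub>F x in cofinite. g x i = k i" if i: "i < n" for i
      by (rule represents_agree[OF c[OF i]]) (simp add: k[OF i] represents_con)
    then have "\<forall>\<^sub>F x in cofinite. \<forall>i\<in>{..<n}. g x i = k i" by (intro eventually_ball_finite) auto
    from this U'ev have ev: "\<forall>\<^sub>F x in cofinite. pt x 1 \<in> U' \<and> (\<forall>i<n. g x i = k i)" by eventually_elim auto
    have "f (pt x 1) = f (pt y 1)" if x: "pt x 1 \<in> U' \<and> (\<forall>i<n. g x i = k i)" and y: "pt y 1 \<in> U' \<and> (\<forall>i<n. g y i = k i)" for x y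
    proof -
      have m: "f (pt x 1) \<in> W" "f (pt y 1) \<in> W" using x y unfolding U'_def by auto
      have "g x = g y"
      proof
        fix i
        show "g x i = g y i"
        proof (cases "i < n")
          case False
          then show ?thesis using aZ[OF m(1)] aZ[OF m(2)] unfolding g_def affine_points_def by simp
        qed (use x y in simp)
      qed
      then have "b (a (f (pt x 1))) = b (a (f (pt y 1)))" unfolding g_def by simp
      then show ?thesis using ba[of "f (pt x 1)"] ba[of "f (pt y 1)"] m unfolding ptsW by simp
    qed
    note const = this
    obtain x1 where x1: "pt x1 1 \<in> U' \<and> (\<forall>i<n. g x1 i = k i)" using eventually_cofinite_ex[OF ev] by blast
    have m1: "f (pt x1 1) \<in> points X" using x1 openin_subset[OF W(1)] unfolding U'_def by blast
    have "points X - {f (pt x1 1)} \<noteq> {}" using ns m1 unfolding is_singleton_def by blast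
    from dense_image_P1_cofinite[OF f fd ev point_complement_open[OF X m1] this]
    show False using const[OF _ x1] by blast
  qed
  then obtain j where j: "j < n" "c j \<notin> range con" by blast
  obtain t s A B \<alpha> \<beta> where ts: "represents t s" "t \<notin> range con" and AB: "A \<in> poly_functions n" "B \<in> poly_functions n"
    and ev0: "\<forall>\<^sub>F x in cofinite. B (g x) \<noteq> 0 \<and> s x = A (g x) / B (g x) \<and>
       (\<forall>i<n. poly (\<beta> i) (s x) \<noteq> 0 \<and> g x i = poly (\<alpha> i) (s x) / poly (\<beta> i) (s x))"
    using curve_parameter[where c = c and g = g and n = n, OF c j] by blast
  \<comment> \<open>All conditions that hold for cofinitely many x, collected. The points
    \<open>f (pt x 1)\<close> with x good are dense in X, and the corresponding values
    \<open>s x\<close> are cofinite in k.\<close>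
  define good where "good x \<longleftrightarrow> pt x 1 \<in> U' \<and> B (g x) \<noteq> 0 \<and> s x = A (g x) / B (g x) \<and>
       (\<forall>i<n. poly (\<beta> i) (s x) \<noteq> 0 \<and> g x i = poly (\<alpha> i) (s x) / poly (\<beta> i) (s x))" for x
  have ev: "\<forall>\<^sub>F x in cofinite. good x" unfolding good_def using U'ev ev0 by eventually_elim blast
  have gW: "f (pt x 1) \<in> W" if "good x" for x using that unfolding good_def U'_def by simp
  have dense: "\<exists>x. good x \<and> f (pt x 1) \<in> V" if "openin (top_of X) V" "V \<noteq> {}" for V
    by (rule dense_image_P1_cofinite[OF f fd ev that])
  define W1 where "W1 = {w \<in> W. B (a w) \<noteq> 0}"
  define \<tau> where "\<tau> w = pt (A (a w)) (B (a w))" for w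
  have W1: "openin (top_of X) W1" unfolding W1_def by (rule function_spaceD(5)[OF X'(5) W(1) reg[OF AB(2)]])
  have ptsW1: "points (open_subspace X W1) = W1" using openin_subset[OF W1] by auto
  have gW1: "f (pt x 1) \<in> W1" if "good x" for x using that gW[OF that] unfolding W1_def good_def g_def by simp
  have regW1: "(\<lambda>w. C (a w)) \<in> regular X W1" if "C \<in> poly_functions n" for C
    by (rule sheaf_restrict[OF X'(4) W(1) W1 _ reg[OF that]]) (auto simp: W1_def)
  have \<tau>: "(W1, \<tau>) \<in> partial_morphisms X ?P"
  proof (rule partial_morphismsI[OF W1])
    show "W1 \<noteq> {}" using eventually_cofinite_ex[OF ev] gW1 by blast
    show "morphism (open_subspace X W1) ?P \<tau>" unfolding \<tau>_def
    proof (rule morphism_to_projective[OF function_space_open_subspace[OF X'(5) W1]])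
      fix i :: nat assume "i < Suc 1"
      then have "i = 0 \<or> i = 1" by auto
      then show "(\<lambda>w. vec2 (A (a w)) (B (a w)) i) \<in> regular (open_subspace X W1) (points (open_subspace X W1))"
        unfolding ptsW1 using regW1 AB by auto
    qed (auto simp: W1_def intro: vec2_coords)
  qed
  have \<tau>f: "\<tau> (f (pt x 1)) = pt (s x) 1" if "good x" for x
    using that unfolding \<tau>_def good_def g_def by (simp add: pt_eq_iff)
  define Y where "Y = {y. \<exists>x. good x \<and> s x = y}"
  define V1 where "V1 = (\<lambda>y. pt y 1) ` Y"
  have "finite (- Y)" using represents_image_cofinite[OF ts ev] unfolding Y_def eventually_cofinite Collect_neg_eq .
  then have V1: "openin (top_of ?P) V1" "V1 \<noteq> {}" unfolding V1_def by (rule cofinite_affine_open)+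
  have ptsV1: "points (open_subspace ?P V1) = V1" using openin_subset[OF V1(1)] by auto
  have V1E: "\<exists>x. good x \<and> P = pt (s x) 1" if "P \<in> V1" for P using that unfolding V1_def Y_def by blast
  obtain h :: "'k proj_point \<Rightarrow> 'k" where h: "h \<in> regular ?P (chart_domain True)" and hpt: "\<And>y. h (pt y 1) = y"
    using chart_coordinate[of True] unfolding chart_coords_def by (metis (full_types))
  have dom: "openin (top_of ?P) (chart_domain True)" using openin_chart_domain unfolding top_of_projective_space .
  have "V1 \<subseteq> chart_domain True" unfolding V1_def using chart_coords_domain[of True] by (auto simp: chart_coords_def)
  then have hV1: "h \<in> regular ?P V1"
    using sheaf_restrict[OF function_spaceD(1)[OF function_space_projective] dom V1(1)] h by blast
  define d where "d P = (\<lambda>i. if i < n then poly (\<alpha> i) (h P) / poly (\<beta> i) (h P) else 0)" for P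
  have dg: "d (pt (s x) 1) = g x" if x: "good x" for x
  proof
    fix i
    show "d (pt (s x) 1) i = g x i"
    proof (cases "i < n")
      case False
      then show ?thesis using aZ[OF gW[OF x]] unfolding d_def g_def affine_points_def by simp
    qed (use x in \<open>simp add: d_def hpt good_def\<close>)
  qed
  have d: "morphism (open_subspace ?P V1) ?A d"
  proof (rule morphism_to_affine[OF function_space_open_subspace[OF function_space_projective V1(1)]])
    show "(\<lambda>P. d P i) \<in> regular (open_subspace ?P V1) (points (open_subspace ?P V1))" if i: "i < n" for i
    proof -
      have "poly (\<beta> i) (h P) \<noteq> 0" if "P \<in> V1" for P using V1E[OF that] i hpt unfolding good_def by auto
      then have "(\<lambda>P. poly (\<alpha> i) (h P) / poly (\<beta> i) (h P)) \<in> regular ?P V1"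
        by (intro function_space_divide[OF function_space_projective V1(1)] function_space_poly[OF function_space_projective V1(1) hV1])
      then show ?thesis unfolding ptsV1 using i by (simp add: d_def)
    qed
    show "d P \<in> affine_points n \<and> d P \<in> Z" if P: "P \<in> points (open_subspace ?P V1)" for P
    proof -
      obtain x where "good x" "P = pt (s x) 1" using V1E P unfolding ptsV1 by blast
      then show ?thesis using dg aZ[OF gW] unfolding g_def by metis
    qed
  qed
  define \<delta> where "\<delta> = b \<circ> d"
  have \<delta>: "(V1, \<delta>) \<in> partial_morphisms ?P X" unfolding \<delta>_def
    by (rule partial_morphismsI[OF V1 morphism_from_open_subspace_target[OF X'(4) morphism_comp[OF d b] W(1)]])
  have \<delta>s: "\<delta> (pt (s x) 1) = f (pt x 1)" if x: "good x" for x
    unfolding \<delta>_def using dg[OF x] ba[of "f (pt x 1)"] gW[OF x] unfolding g_def ptsW by simp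
  have \<tau>\<delta>: "\<tau> (\<delta> P) = P" if P: "P \<in> V1" for P using V1E[OF P] \<delta>s \<tau>f by auto
  have \<delta>W1: "\<delta> P \<in> W1" if P: "P \<in> V1" for P using V1E[OF P] \<delta>s gW1 by auto
  have \<delta>d: "dense_image X V1 \<delta>"
  proof (rule dense_imageI)
    fix V assume "openin (top_of X) V" "V \<noteq> {}"
    then obtain x where x: "good x" "f (pt x 1) \<in> V" using dense by blast
    moreover have "pt (s x) 1 \<in> V1" unfolding V1_def Y_def using x(1) by blast
    ultimately show "\<exists>P\<in>V1. \<delta> P \<in> V" using \<delta>s by metis
  qed
  have \<tau>d: "dense_image ?P W1 \<tau>"
  proof (rule dense_imageI)
    fix V :: "'k proj_point set" assume "openin (top_of PL) V" "V \<noteq> {}"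
    then have "V \<inter> V1 \<noteq> {}" using irreducible_space_Int[OF irreducible_varietyD(3)[OF P1v]] V1 by blast
    then show "\<exists>w\<in>W1. \<tau> w \<in> V" using \<tau>\<delta> \<delta>W1 by (metis IntE ex_in_conv)
  qed
  have id1: "rational_comp X X (rational_class ?P X V1 \<delta>) (rational_class X ?P W1 \<tau>) = rational_id X"
  proof -
    note comp = rational_comp_class[OF X P1v X \<tau> \<tau>d \<delta>]
    \<comment> \<open>Every nonempty open set contains some \<open>f (pt x 1)\<close> with x good,
      where the two maps agree; the identity theorem does the rest.\<close>
    have "(\<delta> \<circ> \<tau>) w = w" if w: "w \<in> {w \<in> W1. \<tau> w \<in> V1} \<inter> points X" for w
    proof (rule partial_morphisms_agree[OF X X comp(1) partial_morphism_id[OF X] _ w])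
      fix W' assume "openin (top_of X) W'" "W' \<noteq> {}"
      then obtain x where "good x" "f (pt x 1) \<in> W'" using dense by blast
      then show "\<exists>w\<in>W'. (\<delta> \<circ> \<tau>) w = w" using \<tau>f \<delta>s by (metis comp_apply)
    qed
    then show ?thesis unfolding comp(2) rational_id_class
      using rational_class_eq_iff[OF X X comp(1) partial_morphism_id[OF X]] by blast
  qed
  have id2: "rational_comp ?P ?P (rational_class X ?P W1 \<tau>) (rational_class ?P X V1 \<delta>) = rational_id ?P"
  proof -
    note comp = rational_comp_class[OF P1v X P1v \<delta> \<delta>d \<tau>]
    show ?thesis unfolding comp(2) rational_id_class
      using rational_class_eq_iff[OF P1v P1v comp(1) partial_morphism_id[OF P1v]] \<tau>\<delta> by auto
  qed
  have "mutually_inverse X ?P (rational_class X ?P W1 \<tau>) (rational_class ?P X V1 \<delta>)"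
    unfolding mutually_inverse_iff using id1 id2 dominant_mapsI[OF X P1v \<tau> \<tau>d] dominant_mapsI[OF P1v X \<delta> \<delta>d] by blast
  then show ?thesis unfolding birational_def by blast
qed

lemma rational_map_P1_everywhere_defined:
  fixes \<phi> :: "('k::field_char_0 proj_point, 'k proj_point) rational_map"
  assumes "\<phi> \<in> rational_maps PL (PL :: ('k proj_point, 'k) fspace)"
  shows "everywhere_defined (PL :: ('k proj_point, 'k) fspace) \<phi>"
proof -
  obtain d P Q where PQ: "homogeneous_pair d P Q" "\<phi> = pair_class P Q"
    using rational_map_P1_pair[OF assms] by blast
  show ?thesis unfolding everywhere_defined_def PQ(2)
    using rational_class_self[OF pair_map_partial_morphism[OF PQ(1)]] by blast
qed

text \<open>Conjugacy is deduced from both actions on the line being faithful actions of the same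
  finite group; the transported map supplies the compression itself.\<close>

lemma compression_from_P1_conjugate:
  fixes H :: "'h monoid" and X :: "('b, 'k::{alg_closed_field, field_char_0}) fspace"
  assumes X: "irreducible_variety X" and comp: "compression H PL \<rho>\<^sub>1 X \<rho>\<^sub>2 \<phi>"
    and inv: "mutually_inverse X PL \<psi> \<psi>'"
  defines "\<rho> \<equiv> \<lambda>h. rational_comp PL PL \<psi> (rational_comp PL X (\<rho>\<^sub>2 h) \<psi>')"
    and "\<phi>' \<equiv> rational_comp PL PL \<psi> \<phi>"
  shows "compression H PL \<rho>\<^sub>1 PL \<rho> \<phi>' \<and> everywhere_defined (PL :: ('k proj_point, 'k) fspace) \<phi>' \<and>
    conjugate_subgroups (Cremona 1) (\<rho>\<^sub>1 ` carrier H) (\<rho> ` carrier H)"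
proof -
  note P1v = irreducible_variety_P1[where 'k = 'k]
  have c: "compression H PL \<rho>\<^sub>1 PL \<rho> \<phi>'" unfolding \<rho>_def \<phi>'_def
    by (rule transport_compression[OF P1v X P1v inv comp])
  then have "\<phi>' \<in> rational_maps PL PL" "rational_action H PL \<rho>\<^sub>1" "rational_action H PL \<rho>"
    unfolding compression_def by blast+
  then show ?thesis
    using c rational_map_P1_everywhere_defined isomorphic_finite_subgroups_conjugate[of H \<rho>\<^sub>1 \<rho>]
    unfolding rational_action_def Cremona_def by blast
qed

text \<open>A target consisting of one point is excluded because the trivial group compresses into
  it by the constant map. Any other target is identified with the line only up to a birational map,
  so the second part speaks of every such identification.\<close>

theorem theorem2p2:
  fixes P1 :: "('k::{alg_closed_field, field_char_0} proj_point, 'k) fspace"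
    and Cr1 :: "('k proj_point, 'k proj_point) rational_map monoid"
  assumes P1: "P1 = projective_space 1"
    and Cr1: "Cr1 = Cremona 1"
  shows
    "(\<forall>G. subgroup G Cr1 \<and> finite G \<longrightarrow> nontrivially_self_compressible P1 G)
     \<and>
     (\<forall>(H :: 'h monoid) (X :: ('b, 'k) fspace) \<rho>\<^sub>1 \<rho>\<^sub>2 \<phi> G\<^sub>1 G\<^sub>2.
        subgroup G\<^sub>1 Cr1 \<and> finite G\<^sub>1 \<and> G\<^sub>1 = \<rho>\<^sub>1 ` carrier H \<and>
        irreducible_variety X \<and> \<not> is_singleton (points X) \<and>
        subgroup G\<^sub>2 (Bir X) \<and> finite G\<^sub>2 \<and> G\<^sub>2 = \<rho>\<^sub>2 ` carrier H \<and>
        compression H P1 \<rho>\<^sub>1 X \<rho>\<^sub>2 \<phi> \<longrightarrow>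
        (\<exists>\<psi>. birational X P1 \<psi>) \<and>
        (\<forall>\<psi> \<psi>'. mutually_inverse X P1 \<psi> \<psi>' \<longrightarrow>
           (let \<rho> = (\<lambda>h. rational_comp P1 P1 \<psi> (rational_comp P1 X (\<rho>\<^sub>2 h) \<psi>'));
                \<phi>' = rational_comp P1 P1 \<psi> \<phi>
            in compression H P1 \<rho>\<^sub>1 P1 \<rho> \<phi>' \<and> everywhere_defined P1 \<phi>' \<and>
               conjugate_subgroups Cr1 G\<^sub>1 (\<rho> ` carrier H))))"
proof (intro conjI allI impI; (elim conjE)?)
  fix G assume "subgroup G Cr1" "finite G"
  then show "nontrivially_self_compressible P1 G"
    unfolding P1 Cr1 by (rule finite_subgroup_self_compressible)
next
  fix H :: "'h monoid" and X :: "('b, 'k) fspace" and \<rho>\<^sub>1 \<rho>\<^sub>2 \<phi>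
  assume "irreducible_variety X" "\<not> is_singleton (points X)" "compression H P1 \<rho>\<^sub>1 X \<rho>\<^sub>2 \<phi>"
  then show "\<exists>\<psi>. birational X P1 \<psi>"
    using curve_dominated_by_P1 unfolding P1 compression_def dominant_maps_def by blast
next
  fix H :: "'h monoid" and X :: "('b, 'k) fspace" and \<rho>\<^sub>1 \<rho>\<^sub>2 \<phi> G\<^sub>1 \<psi> \<psi>'
  assume "irreducible_variety X" "compression H P1 \<rho>\<^sub>1 X \<rho>\<^sub>2 \<phi>" "mutually_inverse X P1 \<psi> \<psi>'"
    and G: "G\<^sub>1 = \<rho>\<^sub>1 ` carrier H"
  then show "let \<rho> = (\<lambda>h. rational_comp P1 P1 \<psi> (rational_comp P1 X (\<rho>\<^sub>2 h) \<psi>'));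
      \<phi>' = rational_comp P1 P1 \<psi> \<phi>
    in compression H P1 \<rho>\<^sub>1 P1 \<rho> \<phi>' \<and> everywhere_defined P1 \<phi>' \<and>
      conjugate_subgroups Cr1 G\<^sub>1 (\<rho> ` carrier H)"
    unfolding P1 Cr1 Let_def G by (intro compression_from_P1_conjugate)
qed

end
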